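(* Let $(G,P)$ be a quasi-lattice ordered group such that $(G^o,P^o)$ is also quasi-lattice ordered, and let $\omega$ be a multiplier of $P$. Then the canonical map $i_P:P\to\mathcal T_{\mathrm{cov}}(B_P\rtimes_{\tau,\omega}P)$ is a bicovariant partial isometric $\omega$-representation of $P$ whose range generates $\mathcal T_{\mathrm{cov}}(B_P\rtimes_{\tau,\omega}P)$ as a $C^*$-algebra. Moreover, for every bicovariant partial isometric $\omega$-representation $V$ of $P$, there is a representation $V_*$ of $\mathcal T_{\mathrm{cov}}(B_P\rtimes_{\tau,\omega}P)$ such that $V_*\circ i_P=V$.
   Context: Standing assumption: $P$ is a countable semigroup with identity $e$, a subsemigroup of the group $G$ with $P\cap P^{-1}=\{e\}$. Orders. The left-invariant order on $G$ is $s\le_l t\iff s^{-1}t\in P$; the right-invariant order is $s\le_r t\iff ts^{-1}\in P$. $(G,P)$ (respectively $(G^o,P^o)$, the opposite pair) is quasi-lattice ordered if every finite subset of $G$ with an upper bound in $P$ for $\le_l$ (respectively $\le_r$) has a least upper bound in $P$ for that order. Write $s\vee_l t$, $s\vee_r t$ for the least upper bounds of $s,t\in P$ in these orders, with value $\infty$ when there is no common upper bound. A multiplier is $\omega:P\times P\to\mathbb T$ with $\omega(e,e)=1$ and $\omega(r,s)\omega(rs,t)=\omega(r,st)\omega(s,t)$. A partial isometric $\omega$-representation of $P$ is a map $V$ of $P$ into the partial isometries of a $C^*$-algebra with $V_sV_t=\omega(s,t)V_{st}$. It is bicovariant if for all $s,t\in P$: $V_sV_s^*V_tV_t^*=V_{s\vee_l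 t}V_{s\vee_l t}^*$ if $s\vee_l t<\infty$ and $0$ otherwise; and $V_s^*V_sV_t^*V_t=V_{s\vee_r t}^*V_{s\vee_r t}$ if $s\vee_r t<\infty$ and $0$ otherwise. For $t\in P$, $1_t\in\ell^\infty(P)$ is the characteristic function of $tP$; $B_P=\overline{\mathrm{span}}\{1_t:t\in P\}$ is a unital $C^*$-subalgebra of $\ell^\infty(P)$, and $\tau_s(1_t)=1_{st}$ defines an action $\tau$ of $P$ by endomorphisms of $B_P$. A Nica-Toeplitz covariant representation of $(B_P,P,\tau,\omega)$ on $\mathcal H$ is a pair $(\pi,V)$ where $\pi:B_P\to B(\mathcal H)$ is a nondegenerate representation, $V:P\to B(\mathcal H)$ is a partial isometric $\omega$-representation, and for all $s,t\in P$, $a\in B_P$: $\pi(\tau_s(a))=V_s\pi(a)V_s^*$; $V_s^*V_s\pi(a)=\pi(a)V_s^*V_s$; and $V_s^*V_sV_t^*V_t=V_{s\vee_r t}^*V_{s\vee_r t}$ if $s\vee_r t<\infty$, $=0$ otherwise. The Nica-Toeplitz crossed product $\mathcal T_{\mathrm{cov}}(B_P\rtimes_{\tau,\omega}P)$ is the (existing, unique up to canonical isomorphism) $C^*$-algebra $B$ carrying a nondegenerate homomorphism $i_{B_P}:B_P\to B$ and a map $i_P:P\to M(B)$ such that (a) if $\sigma$ is a nondegenerate representation of $B$, then $(\sigma\circ i_{B_P},\overline\sigma\circ i_P)$ is a Nica-Toeplitz covariant representation; (b) for every Nica-Toeplitz covariant representation $(\pi,V)$ there is a representation $\pi\times V$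 of $B$ with $(\pi\times V)\circ i_{B_P}=\pi$ and $\overline{\pi\times V}\circ i_P=V$; (c) $B$ is generated as a $C^*$-algebra by $\{i_{B_P}(a)i_P(s)\}$. Since $B_P$ is unital, $B$ is unital and $M(B)=B$. *)

theory Defs
  imports "HOL-Analysis.Analysis" "HOL-Algebra.Module" "HOL-Algebra.Coset"
begin

section \<open>Closed subspaces of normed complex vector spaces\<close>

definition complex_ring :: "complex ring" where
  "complex_ring = \<lparr>carrier = UNIV, monoid.mult = (*), one = 1, ring.zero = 0, add = (+)\<rparr>"

lemma complex_ring_simps [simp]:
  "carrier complex_ring = UNIV" "x \<otimes>\<^bsub>complex_ring\<^esub> y = x * y" "\<one>\<^bsub>complex_ring\<^esub> = 1"
  "\<zero>\<^bsub>complex_ring\<^esub> = 0" "x \<oplus>\<^bsub>complex_ring\<^esub> y = x + y"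
  by (simp_all add: complex_ring_def)

lemma cring_complex_ring: "cring complex_ring"
proof (intro cringI abelian_groupI comm_monoidI)
  fix x :: complex
  show "\<exists>y\<in>carrier complex_ring. y \<oplus>\<^bsub>complex_ring\<^esub> x = \<zero>\<^bsub>complex_ring\<^esub>"
    by (rule bexI[of _ "- x"]) simp_all
qed (simp_all add: algebra_simps)

text \<open>
  Complex vector spaces are the library's modules over \<open>complex_ring\<close>. The fields \<open>mult\<close> and \<open>one\<close>
  of the record type \<open>module\<close> carry no meaning for a bare vector space, and \<open>one\<close> carries none
  for a \<open>C*\<close>-algebra, which need not be unital.
\<close>

text \<open>
  The value off the carrier is irrelevant, but the library's locale \<open>Metric_space\<close> requires
  nonnegativity and symmetry on the whole type.
\<close>

definition norm_dist :: "(complex, 'a, 'm) module_scheme \<Rightarrow> ('a \<Rightarrow> real) \<Rightarrow> 'a \<Rightarrow> 'a \<Rightarrow> real" where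
  "norm_dist M N x y = (if x \<in> carrier M \<and> y \<in> carrier M then N (x \<ominus>\<^bsub>M\<^esub> y) else 0)"

definition norm_topology :: "(complex, 'a, 'm) module_scheme \<Rightarrow> ('a \<Rightarrow> real) \<Rightarrow> 'a topology" where
  "norm_topology M N = Metric_space.mtopology (carrier M) (norm_dist M N)"

definition norm_complete :: "(complex, 'a, 'm) module_scheme \<Rightarrow> ('a \<Rightarrow> real) \<Rightarrow> bool" where
  "norm_complete M N \<longleftrightarrow> Metric_space.mcomplete (carrier M) (norm_dist M N)"

definition lin_span :: "(complex, 'a, 'm) module_scheme \<Rightarrow> 'a set \<Rightarrow> 'a set" where
  "lin_span M S = \<Inter>{L. submodule L complex_ring M \<and> S \<subseteq> L}"

definition closed_span ::
    "(complex, 'a, 'm) module_scheme \<Rightarrow> ('a \<Rightarrow> real) \<Rightarrow> 'a set \<Rightarrow> 'a set" where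
  "closed_span M N S = norm_topology M N closure_of lin_span M S"


section \<open>\<open>C*\<close>-algebras\<close>

record 'a cstar = "(complex, 'a) module" +
  star :: "'a \<Rightarrow> 'a"
  cnorm :: "'a \<Rightarrow> real"

locale cstar_algebra = module complex_ring A for A :: "('a, 'm) cstar_scheme" (structure) +
  assumes mult_closed: "\<lbrakk>x \<in> carrier A; y \<in> carrier A\<rbrakk> \<Longrightarrow> x \<otimes> y \<in> carrier A"
    and mult_assoc: "\<lbrakk>x \<in> carrier A; y \<in> carrier A; z \<in> carrier A\<rbrakk> \<Longrightarrow> (x \<otimes> y) \<otimes> z = x \<otimes> (y \<otimes> z)"
    and mult_distr_l: "\<lbrakk>x \<in> carrier A; y \<in> carrier A; z \<in> carrier A\<rbrakk>
          \<Longrightarrow> (x \<oplus> y) \<otimes> z = x \<otimes> z \<oplus> y \<otimes> z"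
    and mult_distr_r: "\<lbrakk>x \<in> carrier A; y \<in> carrier A; z \<in> carrier A\<rbrakk>
          \<Longrightarrow> z \<otimes> (x \<oplus> y) = z \<otimes> x \<oplus> z \<otimes> y"
    and smult_mult_l: "\<lbrakk>x \<in> carrier A; y \<in> carrier A\<rbrakk> \<Longrightarrow> (c \<odot> x) \<otimes> y = c \<odot> (x \<otimes> y)"
    and smult_mult_r: "\<lbrakk>x \<in> carrier A; y \<in> carrier A\<rbrakk> \<Longrightarrow> x \<otimes> (c \<odot> y) = c \<odot> (x \<otimes> y)"
    and star_closed: "x \<in> carrier A \<Longrightarrow> star A x \<in> carrier A"
    and star_star: "x \<in> carrier A \<Longrightarrow> star A (star A x) = x"
    and star_add: "\<lbrakk>x \<in> carrier A; y \<in> carrier A\<rbrakk> \<Longrightarrow> star A (x \<oplus> y) = star A x \<oplus> star A y"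
    and star_smult: "x \<in> carrier A \<Longrightarrow> star A (c \<odot> x) = cnj c \<odot> star A x"
    and star_mult: "\<lbrakk>x \<in> carrier A; y \<in> carrier A\<rbrakk> \<Longrightarrow> star A (x \<otimes> y) = star A y \<otimes> star A x"
    and cnorm_nonneg: "x \<in> carrier A \<Longrightarrow> 0 \<le> cnorm A x"
    and cnorm_eq_0: "x \<in> carrier A \<Longrightarrow> cnorm A x = 0 \<Longrightarrow> x = \<zero>"
    and cnorm_triangle: "\<lbrakk>x \<in> carrier A; y \<in> carrier A\<rbrakk> \<Longrightarrow> cnorm A (x \<oplus> y) \<le> cnorm A x + cnorm A y"
    and cnorm_smult: "x \<in> carrier A \<Longrightarrow> cnorm A (c \<odot> x) = cmod c * cnorm A x"
    and cnorm_mult: "\<lbrakk>x \<in> carrier A; y \<in> carrier A\<rbrakk> \<Longrightarrow> cnorm A (x \<otimes> y) \<le> cnorm A x * cnorm A y"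
    and cstar_identity: "x \<in> carrier A \<Longrightarrow> cnorm A (star A x \<otimes> x) = (cnorm A x)\<^sup>2"
    and complete: "norm_complete A (cnorm A)"

definition cstar_hom :: "('a, 'm) cstar_scheme \<Rightarrow> ('b, 'n) cstar_scheme \<Rightarrow> ('a \<Rightarrow> 'b) \<Rightarrow> bool" where
  "cstar_hom A B \<phi> \<longleftrightarrow>
     \<phi> \<in> carrier A \<rightarrow> carrier B \<and>
     (\<forall>x\<in>carrier A. \<forall>y\<in>carrier A. \<phi> (x \<oplus>\<^bsub>A\<^esub> y) = \<phi> x \<oplus>\<^bsub>B\<^esub> \<phi> y) \<and>
     (\<forall>c. \<forall>x\<in>carrier A. \<phi> (c \<odot>\<^bsub>A\<^esub> x) = c \<odot>\<^bsub>B\<^esub> \<phi> x) \<and>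
     (\<forall>x\<in>carrier A. \<forall>y\<in>carrier A. \<phi> (x \<otimes>\<^bsub>A\<^esub> y) = \<phi> x \<otimes>\<^bsub>B\<^esub> \<phi> y) \<and>
     (\<forall>x\<in>carrier A. \<phi> (star A x) = star B (\<phi> x))"

definition nondegenerate_hom ::
    "('a, 'm) cstar_scheme \<Rightarrow> ('b, 'n) cstar_scheme \<Rightarrow> ('a \<Rightarrow> 'b) \<Rightarrow> bool" where
  "nondegenerate_hom A B \<phi> \<longleftrightarrow>
     cstar_hom A B \<phi> \<and>
     closed_span B (cnorm B) {\<phi> a \<otimes>\<^bsub>B\<^esub> b |a b. a \<in> carrier A \<and> b \<in> carrier B} = carrier B"

definition cstar_subalgebra :: "'a set \<Rightarrow> ('a, 'm) cstar_scheme \<Rightarrow> bool" where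
  "cstar_subalgebra D A \<longleftrightarrow>
     submodule D complex_ring A \<and>
     (\<forall>x\<in>D. \<forall>y\<in>D. x \<otimes>\<^bsub>A\<^esub> y \<in> D) \<and>
     (\<forall>x\<in>D. star A x \<in> D) \<and>
     closedin (norm_topology A (cnorm A)) D"

definition cstar_generated :: "('a, 'm) cstar_scheme \<Rightarrow> 'a set \<Rightarrow> 'a set" where
  "cstar_generated A S = \<Inter>{D. cstar_subalgebra D A \<and> S \<subseteq> D}"


section \<open>Hilbert spaces and representations\<close>

record 'h inner_space = "(complex, 'h) module" +
  cinner :: "'h \<Rightarrow> 'h \<Rightarrow> complex"

definition hnorm :: "('h, 'm) inner_space_scheme \<Rightarrow> 'h \<Rightarrow> real" where
  "hnorm H x = sqrt (Re (cinner H x x))"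

locale hilbert_space = module complex_ring H for H :: "('h, 'm) inner_space_scheme" (structure) +
  assumes cinner_add: "\<lbrakk>x \<in> carrier H; y \<in> carrier H; z \<in> carrier H\<rbrakk>
          \<Longrightarrow> cinner H (x \<oplus> y) z = cinner H x z + cinner H y z"
    and cinner_smult: "\<lbrakk>x \<in> carrier H; y \<in> carrier H\<rbrakk> \<Longrightarrow> cinner H (c \<odot> x) y = c * cinner H x y"
    and cinner_cnj: "\<lbrakk>x \<in> carrier H; y \<in> carrier H\<rbrakk> \<Longrightarrow> cinner H y x = cnj (cinner H x y)"
    and cinner_nonneg: "x \<in> carrier H \<Longrightarrow> 0 \<le> Re (cinner H x x)"
    and cinner_eq_0: "x \<in> carrier H \<Longrightarrow> cinner H x x = 0 \<Longrightarrow> x = \<zero>"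
    and complete: "norm_complete H (hnorm H)"

definition bounded_op :: "('h, 'm) inner_space_scheme \<Rightarrow> ('h \<Rightarrow> 'h) \<Rightarrow> bool" where
  "bounded_op H T \<longleftrightarrow>
     T \<in> carrier H \<rightarrow>\<^sub>E carrier H \<and>
     (\<forall>x\<in>carrier H. \<forall>y\<in>carrier H. T (x \<oplus>\<^bsub>H\<^esub> y) = T x \<oplus>\<^bsub>H\<^esub> T y) \<and>
     (\<forall>c. \<forall>x\<in>carrier H. T (c \<odot>\<^bsub>H\<^esub> x) = c \<odot>\<^bsub>H\<^esub> T x) \<and>
     (\<exists>K. \<forall>x\<in>carrier H. hnorm H (T x) \<le> K * hnorm H x)"

definition adjoint_op :: "('h, 'm) inner_space_scheme \<Rightarrow> ('h \<Rightarrow> 'h) \<Rightarrow> 'h \<Rightarrow> 'h" where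
  "adjoint_op H T = (THE S. bounded_op H S \<and>
     (\<forall>x\<in>carrier H. \<forall>y\<in>carrier H. cinner H (T x) y = cinner H x (S y)))"

definition bounded_ops :: "('h, 'm) inner_space_scheme \<Rightarrow> ('h \<Rightarrow> 'h) cstar" where
  "bounded_ops H =
     \<lparr>carrier = Collect (bounded_op H),
      monoid.mult = (\<lambda>S T. compose (carrier H) S T),
      one = (\<lambda>x\<in>carrier H. x),
      ring.zero = (\<lambda>x\<in>carrier H. \<zero>\<^bsub>H\<^esub>),
      add = (\<lambda>S T. \<lambda>x\<in>carrier H. S x \<oplus>\<^bsub>H\<^esub> T x),
      smult = (\<lambda>c T. \<lambda>x\<in>carrier H. c \<odot>\<^bsub>H\<^esub> T x),
      star = adjoint_op H,
      cnorm = (\<lambda>T. SUP x\<in>{x \<in> carrier H. hnorm H x \<le> 1}. hnorm H (T x))\<rparr>"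

definition nondegenerate_rep ::
    "('a, 'm) cstar_scheme \<Rightarrow> ('h, 'n) inner_space_scheme \<Rightarrow> ('a \<Rightarrow> 'h \<Rightarrow> 'h) \<Rightarrow> bool" where
  "nondegenerate_rep A H \<pi> \<longleftrightarrow>
     cstar_hom A (bounded_ops H) \<pi> \<and>
     closed_span H (hnorm H) {\<pi> a h |a h. a \<in> carrier A \<and> h \<in> carrier H} = carrier H"


section \<open>Quasi-lattice ordered groups\<close>

definition left_le :: "('g, 'm) monoid_scheme \<Rightarrow> 'g set \<Rightarrow> 'g \<Rightarrow> 'g \<Rightarrow> bool" where
  "left_le G P s t \<longleftrightarrow> inv\<^bsub>G\<^esub> s \<otimes>\<^bsub>G\<^esub> t \<in> P"

definition right_le :: "('g, 'm) monoid_scheme \<Rightarrow> 'g set \<Rightarrow> 'g \<Rightarrow> 'g \<Rightarrow> bool" where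
  "right_le G P s t \<longleftrightarrow> t \<otimes>\<^bsub>G\<^esub> inv\<^bsub>G\<^esub> s \<in> P"

definition upper_bound_in :: "('g \<Rightarrow> 'g \<Rightarrow> bool) \<Rightarrow> 'g set \<Rightarrow> 'g set \<Rightarrow> 'g \<Rightarrow> bool" where
  "upper_bound_in R P F u \<longleftrightarrow> u \<in> P \<and> (\<forall>x\<in>F. R x u)"

definition lub_in :: "('g \<Rightarrow> 'g \<Rightarrow> bool) \<Rightarrow> 'g set \<Rightarrow> 'g set \<Rightarrow> 'g \<Rightarrow> bool" where
  "lub_in R P F u \<longleftrightarrow> upper_bound_in R P F u \<and> (\<forall>v. upper_bound_in R P F v \<longrightarrow> R u v)"

text \<open>\<open>None\<close> plays the role of the value \<open>\<infinity>\<close>.\<close>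

definition join_in :: "('g \<Rightarrow> 'g \<Rightarrow> bool) \<Rightarrow> 'g set \<Rightarrow> 'g \<Rightarrow> 'g \<Rightarrow> 'g option" where
  "join_in R P s t =
     (if \<exists>u. upper_bound_in R P {s, t} u then Some (THE u. lub_in R P {s, t} u) else None)"

locale ordered_pair = group G + submonoid P G for G :: "('g, 'm) monoid_scheme" (structure) and P +
  assumes countable_cone: "countable P"
    and cone_proper: "P \<inter> m_inv G ` P = {\<one>}"

definition quasi_lattice :: "('g, 'm) monoid_scheme \<Rightarrow> 'g set \<Rightarrow> ('g \<Rightarrow> 'g \<Rightarrow> bool) \<Rightarrow> bool" where
  "quasi_lattice G P R \<longleftrightarrow>
     (\<forall>F. finite F \<and> F \<subseteq> carrier G \<and> (\<exists>u. upper_bound_in R P F u) \<longrightarrow> (\<exists>u. lub_in R P F u))"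

definition quasi_lattice_ordered :: "('g, 'm) monoid_scheme \<Rightarrow> 'g set \<Rightarrow> bool" where
  "quasi_lattice_ordered G P \<longleftrightarrow> ordered_pair G P \<and> quasi_lattice G P (left_le G P)"

text \<open>The opposite pair, phrased through the right-invariant order on \<open>G\<close>.\<close>

definition opp_quasi_lattice_ordered :: "('g, 'm) monoid_scheme \<Rightarrow> 'g set \<Rightarrow> bool" where
  "opp_quasi_lattice_ordered G P \<longleftrightarrow> ordered_pair G P \<and> quasi_lattice G P (right_le G P)"


section \<open>Bicovariant partial isometric representations\<close>

definition multiplier ::
    "('g, 'm) monoid_scheme \<Rightarrow> 'g set \<Rightarrow> ('g \<Rightarrow> 'g \<Rightarrow> complex) \<Rightarrow> bool" where
  "multiplier G P \<omega> \<longleftrightarrow>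
     (\<forall>s\<in>P. \<forall>t\<in>P. cmod (\<omega> s t) = 1) \<and>
     \<omega> \<one>\<^bsub>G\<^esub> \<one>\<^bsub>G\<^esub> = 1 \<and>
     (\<forall>r\<in>P. \<forall>s\<in>P. \<forall>t\<in>P. \<omega> r s * \<omega> (r \<otimes>\<^bsub>G\<^esub> s) t = \<omega> r (s \<otimes>\<^bsub>G\<^esub> t) * \<omega> s t)"

definition partial_isometry :: "('a, 'm) cstar_scheme \<Rightarrow> 'a \<Rightarrow> bool" where
  "partial_isometry A v \<longleftrightarrow> v \<in> carrier A \<and> v \<otimes>\<^bsub>A\<^esub> star A v \<otimes>\<^bsub>A\<^esub> v = v"

definition partial_isometric_rep ::
    "('g, 'm) monoid_scheme \<Rightarrow> 'g set \<Rightarrow> ('g \<Rightarrow> 'g \<Rightarrow> complex) \<Rightarrow> ('a, 'n) cstar_scheme \<Rightarrow>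
     ('g \<Rightarrow> 'a) \<Rightarrow> bool" where
  "partial_isometric_rep G P \<omega> A V \<longleftrightarrow>
     (\<forall>s\<in>P. partial_isometry A (V s)) \<and>
     (\<forall>s\<in>P. \<forall>t\<in>P. V s \<otimes>\<^bsub>A\<^esub> V t = \<omega> s t \<odot>\<^bsub>A\<^esub> V (s \<otimes>\<^bsub>G\<^esub> t))"

definition left_covariant ::
    "('g, 'm) monoid_scheme \<Rightarrow> 'g set \<Rightarrow> ('a, 'n) cstar_scheme \<Rightarrow> ('g \<Rightarrow> 'a) \<Rightarrow> bool" where
  "left_covariant G P A V \<longleftrightarrow>
     (\<forall>s\<in>P. \<forall>t\<in>P. V s \<otimes>\<^bsub>A\<^esub> star A (V s) \<otimes>\<^bsub>A\<^esub> V t \<otimes>\<^bsub>A\<^esub> star A (V t) =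
        (case join_in (left_le G P) P s t of
           Some u \<Rightarrow> V u \<otimes>\<^bsub>A\<^esub> star A (V u) | None \<Rightarrow> \<zero>\<^bsub>A\<^esub>))"

definition right_covariant ::
    "('g, 'm) monoid_scheme \<Rightarrow> 'g set \<Rightarrow> ('a, 'n) cstar_scheme \<Rightarrow> ('g \<Rightarrow> 'a) \<Rightarrow> bool" where
  "right_covariant G P A V \<longleftrightarrow>
     (\<forall>s\<in>P. \<forall>t\<in>P. star A (V s) \<otimes>\<^bsub>A\<^esub> V s \<otimes>\<^bsub>A\<^esub> star A (V t) \<otimes>\<^bsub>A\<^esub> V t =
        (case join_in (right_le G P) P s t of
           Some u \<Rightarrow> star A (V u) \<otimes>\<^bsub>A\<^esub> V u | None \<Rightarrow> \<zero>\<^bsub>A\<^esub>))"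

definition bicovariant_rep ::
    "('g, 'm) monoid_scheme \<Rightarrow> 'g set \<Rightarrow> ('g \<Rightarrow> 'g \<Rightarrow> complex) \<Rightarrow> ('a, 'n) cstar_scheme \<Rightarrow>
     ('g \<Rightarrow> 'a) \<Rightarrow> bool" where
  "bicovariant_rep G P \<omega> A V \<longleftrightarrow>
     partial_isometric_rep G P \<omega> A V \<and> left_covariant G P A V \<and> right_covariant G P A V"


section \<open>The algebra \<open>B\<^sub>P\<close> and its endomorphisms\<close>

text \<open>Functions on \<open>P\<close> are represented by functions on the ambient type that vanish off \<open>P\<close>.\<close>

definition linf :: "'g set \<Rightarrow> ('g \<Rightarrow> complex) cstar" where
  "linf P =
     \<lparr>carrier = {f. (\<forall>x. x \<notin> P \<longrightarrow> f x = 0) \<and> bounded (f ` P)},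
      monoid.mult = (\<lambda>f g x. f x * g x),
      one = indicator P,
      ring.zero = (\<lambda>x. 0),
      add = (\<lambda>f g x. f x + g x),
      smult = (\<lambda>c f x. c * f x),
      star = (\<lambda>f x. cnj (f x)),
      cnorm = (\<lambda>f. SUP x\<in>P. cmod (f x))\<rparr>"

definition chi :: "('g, 'm) monoid_scheme \<Rightarrow> 'g set \<Rightarrow> 'g \<Rightarrow> 'g \<Rightarrow> complex" where
  "chi G P t = indicator (t <#\<^bsub>G\<^esub> P)"

definition BP :: "('g, 'm) monoid_scheme \<Rightarrow> 'g set \<Rightarrow> ('g \<Rightarrow> complex) cstar" where
  "BP G P = (linf P)\<lparr>carrier := closed_span (linf P) (cnorm (linf P)) (chi G P ` P)\<rparr>"

text \<open>
  Translation by \<open>s\<close> is an isometric *-homomorphism of \<open>linf P\<close>; its restriction to \<open>BP G P\<close> is the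
  endomorphism determined by \<open>chi G P t \<mapsto> chi G P (s t)\<close>, see \<open>tau_chi\<close>, \<open>cstar_hom_tau\<close> and \<open>cnorm_tau\<close>.
\<close>

definition tau ::
    "('g, 'm) monoid_scheme \<Rightarrow> 'g set \<Rightarrow> 'g \<Rightarrow> ('g \<Rightarrow> complex) \<Rightarrow> 'g \<Rightarrow> complex" where
  "tau G P s f = (\<lambda>x. if x \<in> s <#\<^bsub>G\<^esub> P then f (inv\<^bsub>G\<^esub> s \<otimes>\<^bsub>G\<^esub> x) else 0)"

context ordered_pair
begin

lemma cone_carrier: "p \<in> P \<Longrightarrow> p \<in> carrier G"
  using submonoid.subset[OF submonoid_axioms] by blast

lemma mem_coset_cone_iff:
  assumes "s \<in> P" shows "x \<in> s <# P \<longleftrightarrow> x \<in> carrier G \<and> inv s \<otimes> x \<in> P"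
proof
  assume "x \<in> s <# P"
  then obtain p where "p \<in> P" "x = s \<otimes> p" by (auto simp: l_coset_def)
  then show "x \<in> carrier G \<and> inv s \<otimes> x \<in> P"
    using assms by (simp add: cone_carrier m_assoc [symmetric])
next
  assume x: "x \<in> carrier G \<and> inv s \<otimes> x \<in> P"
  then have "x = s \<otimes> (inv s \<otimes> x)"
    using assms by (simp add: cone_carrier m_assoc [symmetric])
  then show "x \<in> s <# P" using x by (auto simp: l_coset_def)
qed

lemma tau_chi:
  assumes "s \<in> P" "t \<in> P" shows "tau G P s (chi G P t) = chi G P (s \<otimes> t)"
proof
  fix x
  have "inv (s \<otimes> t) \<otimes> x = inv t \<otimes> (inv s \<otimes> x)" if "x \<in> carrier G"
    using assms that by (simp add: cone_carrier inv_mult_group m_assoc)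
  moreover have "inv s \<otimes> x \<in> P" if "x \<in> carrier G" "inv t \<otimes> (inv s \<otimes> x) \<in> P"
  proof -
    have "t \<otimes> (inv t \<otimes> (inv s \<otimes> x)) \<in> P" using assms(2) that(2) by simp
    then show ?thesis using assms that(1) by (simp add: cone_carrier m_assoc [symmetric])
  qed
  ultimately show "tau G P s (chi G P t) x = chi G P (s \<otimes> t) x"
    using assms by (auto simp: tau_def chi_def mem_coset_cone_iff indicator_def)
qed

lemma cnorm_tau:
  assumes "s \<in> P" "f \<in> carrier (linf P)" shows "cnorm (linf P) (tau G P s f) = cnorm (linf P) f"
proof (unfold linf_def, simp, rule antisym)
  have f: "bounded (f ` P)" using assms by (simp add: linf_def)
  then have bf: "bdd_above ((\<lambda>x. cmod (f x)) ` P)"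
    by (force simp: bounded_iff bdd_above_def)
  have pt: "tau G P s f (s \<otimes> p) = f p" if "p \<in> P" for p
    using assms that
    by (auto simp: tau_def mem_coset_cone_iff cone_carrier m_assoc [symmetric])
  have le: "cmod (tau G P s f x) \<le> (SUP x\<in>P. cmod (f x))" for x
  proof (cases "x \<in> s <# P")
    case True
    then show ?thesis using bf assms by (auto simp: tau_def mem_coset_cone_iff intro!: cSUP_upper)
  next
    case False
    have "0 \<le> cmod (f \<one>)" by simp
    also have "\<dots> \<le> (SUP x\<in>P. cmod (f x))" using bf by (intro cSUP_upper) auto
    finally show ?thesis using False by (simp add: tau_def)
  qed
  have ne: "P \<noteq> {}" using one_closed by blast
  show "(SUP x\<in>P. cmod (tau G P s f x)) \<le> (SUP x\<in>P. cmod (f x))"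
    using ne le by (rule cSUP_least)
  have bt: "bdd_above ((\<lambda>x. cmod (tau G P s f x)) ` P)" using le by (auto simp: bdd_above_def)
  show "(SUP x\<in>P. cmod (f x)) \<le> (SUP x\<in>P. cmod (tau G P s f x))"
  proof (rule cSUP_least[OF ne])
    fix p assume "p \<in> P"
    then have "cmod (tau G P s f (s \<otimes> p)) \<le> (SUP x\<in>P. cmod (tau G P s f x))"
      using assms by (intro cSUP_upper[OF _ bt]) simp
    then show "cmod (f p) \<le> (SUP x\<in>P. cmod (tau G P s f x))" using pt[OF \<open>p \<in> P\<close>] by simp
  qed
qed

lemma cstar_hom_tau:
  assumes s: "s \<in> P" shows "cstar_hom (linf P) (linf P) (tau G P s)"
proof -
  have sub: "s <# P \<subseteq> P" using s by (auto simp: l_coset_def)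
  have "tau G P s f \<in> carrier (linf P)" if f: "f \<in> carrier (linf P)" for f
  proof -
    have "tau G P s f ` P \<subseteq> insert 0 (f ` P)" using s by (auto simp: tau_def mem_coset_cone_iff)
    moreover have "bounded (insert 0 (f ` P))" using f by (simp add: linf_def)
    ultimately have "bounded (tau G P s f ` P)" using bounded_subset by blast
    then show ?thesis using sub by (auto simp: linf_def tau_def)
  qed
  then show ?thesis by (auto simp: cstar_hom_def tau_def linf_def fun_eq_iff)
qed

end


section \<open>The Nica-Toeplitz crossed product\<close>

definition nica_toeplitz_covariant ::
    "('g, 'm) monoid_scheme \<Rightarrow> 'g set \<Rightarrow> ('g \<Rightarrow> 'g \<Rightarrow> complex) \<Rightarrow> ('h, 'n) inner_space_scheme \<Rightarrow>
     (('g \<Rightarrow> complex) \<Rightarrow> 'h \<Rightarrow> 'h) \<Rightarrow> ('g \<Rightarrow> 'h \<Rightarrow> 'h) \<Rightarrow> bool" where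
  "nica_toeplitz_covariant G P \<omega> H \<pi> V \<longleftrightarrow>
     (let L = bounded_ops H in
      nondegenerate_rep (BP G P) H \<pi> \<and>
      partial_isometric_rep G P \<omega> L V \<and>
      (\<forall>s\<in>P. \<forall>a\<in>carrier (BP G P). \<pi> (tau G P s a) = V s \<otimes>\<^bsub>L\<^esub> \<pi> a \<otimes>\<^bsub>L\<^esub> star L (V s)) \<and>
      (\<forall>s\<in>P. \<forall>a\<in>carrier (BP G P).
         star L (V s) \<otimes>\<^bsub>L\<^esub> V s \<otimes>\<^bsub>L\<^esub> \<pi> a = \<pi> a \<otimes>\<^bsub>L\<^esub> star L (V s) \<otimes>\<^bsub>L\<^esub> V s) \<and>
      right_covariant G P L V)"

text \<open>
  HOL cannot quantify over types inside a formula, so the Hilbert spaces in the universal property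
  range over all Hilbert spaces whose carrier is a subset of a type \<open>'h\<close>, passed as a parameter.
  Since the underlying algebras are separable, this determines the crossed product as soon as \<open>'h\<close>
  has at least the cardinality of the continuum.

  As \<open>B\<^sub>P\<close> is unital and \<open>i\<^sub>B\<close> nondegenerate, \<open>B\<close> is unital and equals its multiplier algebra. Hence
  \<open>i\<^sub>P\<close> takes values in \<open>B\<close>, and the extension of a nondegenerate representation to multipliers
  is the representation itself.
\<close>

definition nica_toeplitz_crossed_product ::
    "'h itself \<Rightarrow> ('g, 'm) monoid_scheme \<Rightarrow> 'g set \<Rightarrow> ('g \<Rightarrow> 'g \<Rightarrow> complex) \<Rightarrow> 'b cstar \<Rightarrow>
     (('g \<Rightarrow> complex) \<Rightarrow> 'b) \<Rightarrow> ('g \<Rightarrow> 'b) \<Rightarrow> bool" where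
  "nica_toeplitz_crossed_product (U :: 'h itself) G P \<omega> B i\<^sub>B i\<^sub>P \<longleftrightarrow>
     cstar_algebra B \<and>
     nondegenerate_hom (BP G P) B i\<^sub>B \<and>
     i\<^sub>P \<in> P \<rightarrow> carrier B \<and>
     (\<forall>(H :: 'h inner_space) \<sigma>. hilbert_space H \<and> nondegenerate_rep B H \<sigma> \<longrightarrow>
        nica_toeplitz_covariant G P \<omega> H (\<sigma> \<circ> i\<^sub>B) (\<sigma> \<circ> i\<^sub>P)) \<and>
     (\<forall>(H :: 'h inner_space) \<pi> V. hilbert_space H \<and> nica_toeplitz_covariant G P \<omega> H \<pi> V \<longrightarrow>
        (\<exists>\<rho>. cstar_hom B (bounded_ops H) \<rho> \<and>
           (\<forall>a\<in>carrier (BP G P). \<rho> (i\<^sub>B a) = \<pi> a) \<and> (\<forall>s\<in>P. \<rho> (i\<^sub>P s) = V s))) \<and>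
     cstar_generated B {i\<^sub>B a \<otimes>\<^bsub>B\<^esub> i\<^sub>P s |a s. a \<in> carrier (BP G P) \<and> s \<in> P} = carrier B"

end

theory Submission
  imports Defs
begin

text \<open>
  The relations of a bicovariant representation, and the identity \<open>i\<^sub>B(1\<^sub>t) = i\<^sub>P(t) i\<^sub>P(t)\<^sup>*\<close>, hold in
  every representation of \<open>B\<close> on a Hilbert space, hence in \<open>B\<close>, because the representations
  on the given universe separate the points of a separable unital algebra (Gelfand, Naimark, Segal).
  Left covariance is the multiplication rule of the \<open>1\<^sub>t\<close>.

  Conversely, let \<open>V\<close> be a bicovariant representation generating \<open>A\<close>, with unit \<open>V\<^sub>e\<close>. The assignment
  \<open>1\<^sub>t \<mapsto> V\<^sub>t V\<^sub>t\<^sup>*\<close> is contractive on the span of the \<open>1\<^sub>t\<close>: a subprojection of the unit is split along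
  finitely many of the commuting projections \<open>V\<^sub>t V\<^sub>t\<^sup>*\<close> into pieces on which an element of the span acts
  by one of its values. So every representation of \<open>A\<close> yields a covariant pair, which integrates to
  a representation of \<open>B\<close>. The pairs \<open>(b, a)\<close> whose images agree in all of these form a contractive
  graph, and it contains every \<open>(i\<^sub>P(s), V\<^sub>s)\<close>.

  Positivity and states are developed for a type class of unital C*-algebras; all unital C*-algebras
  with elements in a given type embed into a single instance of this class.
\<close>

text \<open>A bicovariant representation lives in an arbitrary C*-algebra \<open>A\<close>, whereas
  the universal property only yields homomorphisms into operators on spaces carried by
  \<open>'h\<close>. No single faithful representation of \<open>A\<close> on such a space is
  formed: GNS norms one element at a time, and agreement under all compatible pairs of
  representations takes the place of a direct sum. Contractivity makes that relation single-valued.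
  GNS spaces fit into \<open>'h\<close> because a vector is determined by its inner products with a
  countable dense set, hence by a sequence of complex numbers. The supporting theory is free of
  spectra: positivity is tested by \<open>norm (t - x) \<le> t\<close>, square roots come from an
  iteration, and a root \<open>c\<close> with \<open>a^2 + c^2 = 1\<close> is what makes
  homomorphisms and representations contractive. The recurring obstacle is units. An algebra embeds
  in the product of all algebras as a corner, so its unit becomes a projection different from 1; and
  the units that turn up in the argument need not be the ones stored in the field
  \<open>one\<close>.\<close>

section \<open>Positive elements of C*-algebras\<close>

text \<open>
  The element \<open>iu\<close> is the imaginary unit; the complex structure is recovered from it by \<open>csc\<close>.
\<close>

class cstar_ring = real_normed_algebra_1 + banach +
  fixes adj :: "'a \<Rightarrow> 'a" and iu :: 'a
  assumes adj_adj [simp]: "adj (adj x) = x"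
    and adj_add: "adj (x + y) = adj x + adj y"
    and adj_scaleR: "adj (r *\<^sub>R x) = r *\<^sub>R adj x"
    and adj_mult: "adj (x * y) = adj y * adj x"
    and norm_adj_mult: "norm (adj x * x) = (norm x)\<^sup>2"
    and iu_iu: "iu * iu = - 1"
    and iu_commute: "iu * x = x * iu"
    and adj_iu: "adj iu = - iu"

lemma adj_zero [simp]: "adj (0::'a::cstar_ring) = 0"
  using adj_scaleR[of 0 "0::'a"] by simp

lemma adj_minus: "adj (- x) = - adj (x::'a::cstar_ring)"
  using adj_scaleR[of "-1" x] by simp

lemma adj_diff: "adj (x - y) = adj x - adj (y::'a::cstar_ring)"
  using adj_add[of x "- y"] by (simp add: adj_minus)

lemma adj_one [simp]: "adj (1::'a::cstar_ring) = 1"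
proof -
  have "adj (adj 1 * 1) = adj 1 * adj (adj (1::'a))" by (rule adj_mult)
  then show ?thesis by simp
qed

lemma adj_of_real [simp]: "adj (of_real r) = (of_real r :: 'a::cstar_ring)"
  by (simp add: of_real_def adj_scaleR)

lemmas adj_simps = adj_add adj_diff adj_minus adj_scaleR adj_mult

text \<open>The C*-identity and submultiplicativity give \<open>norm y \<le> norm (adj y)\<close>;
  using this for \<open>x\<close> and for \<open>adj x\<close> gives equality.\<close>

lemma norm_adj [simp]: "norm (adj x) = norm (x::'a::cstar_ring)"
proof -
  have le: "norm y \<le> norm (adj y)" for y :: 'a
  proof (cases "y = 0")
    case False
    have "norm y * norm y \<le> norm (adj y) * norm y"
      using norm_mult_ineq[of "adj y" y] by (simp add: norm_adj_mult power2_eq_square)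
    then show ?thesis using False by simp
  qed simp
  show ?thesis using le[of x] le[of "adj x"] by simp
qed

lemma bounded_linear_adj: "bounded_linear (adj :: 'a \<Rightarrow> 'a::cstar_ring)"
  by (rule bounded_linear_intro[of _ 1]) (simp_all add: adj_simps)

lemmas continuous_on_adj [continuous_intros] = bounded_linear.continuous_on[OF bounded_linear_adj]

definition csc :: "complex \<Rightarrow> 'a \<Rightarrow> 'a::cstar_ring" where
  "csc c x = Re c *\<^sub>R x + Im c *\<^sub>R (iu * x)"

lemma iu_mult_iu [simp]: "iu * (iu * x) = - (x::'a::cstar_ring)"
  by (simp add: mult.assoc[symmetric] iu_iu)

lemma iu_left_commute: "x * (iu * y) = iu * (x * y)" for x :: "'a::cstar_ring"
  by (metis iu_commute mult.assoc)

lemma csc_add_left: "csc (c + d) x = csc c x + csc d x"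
  and csc_add_right: "csc c (x + y) = csc c x + csc c y"
  and csc_diff_left: "csc (c - d) x = csc c x - csc d x"
  and csc_diff_right: "csc c (x - y) = csc c x - csc c y"
  and csc_minus_right: "csc c (- x) = - csc c x"
  and csc_assoc: "csc c (csc d x) = csc (c * d) x"
  and csc_one [simp]: "csc 1 x = x"
  and csc_zero [simp]: "csc 0 x = 0" "csc c 0 = 0"
  and csc_of_real: "csc (of_real r) x = r *\<^sub>R x"
  and csc_scaleR: "csc c (r *\<^sub>R x) = r *\<^sub>R csc c x"
  and csc_mult_left: "csc c x * y = csc c (x * y)"
  by (simp_all add: csc_def algebra_simps)

lemma csc_mult_right: "x * csc c y = csc c (x * y)"
  unfolding csc_def using iu_left_commute[of x y] by (simp add: distrib_left)

lemma adj_csc: "adj (csc c x) = csc (cnj c) (adj x)"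
  using iu_commute[of "adj x"] by (simp add: csc_def adj_simps adj_iu)

text \<open>The class only provides real homogeneity. The C*-identity extends it to complex scalars,
  since \<open>adj (csc c x) * csc c x\<close> is \<open>adj x * x\<close> times the real number
  \<open>|c|^2\<close>.\<close>

lemma norm_csc [simp]: "norm (csc c x) = cmod c * norm (x::'a::cstar_ring)"
proof -
  have "(norm (csc c x))\<^sup>2 = norm (adj (csc c x) * csc c x)" by (simp add: norm_adj_mult)
  also have "adj (csc c x) * csc c x = csc (of_real ((cmod c)\<^sup>2)) (adj x * x)"
    by (simp only: adj_csc csc_mult_left csc_mult_right csc_assoc)
      (simp add: complex_norm_square[symmetric] mult.commute)
  also have "norm \<dots> = (cmod c * norm x)\<^sup>2"
    by (simp only: csc_of_real norm_scaleR norm_adj_mult) (simp add: power_mult_distrib)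
  finally show ?thesis by simp
qed

lemma bounded_linear_csc: "bounded_linear (csc c :: 'a \<Rightarrow> 'a::cstar_ring)"
  by (rule bounded_linear_intro[of _ "cmod c"]) (simp_all add: csc_add_right csc_scaleR mult.commute)

lemmas continuous_on_csc [continuous_intros] = bounded_linear.continuous_on[OF bounded_linear_csc]

section \<open>Square roots of \<open>1 - x\<close>, from the fixed-point iteration for
  \<open>1 - sqrt (1 - x)\<close>\<close>

primrec root_seq :: "'a \<Rightarrow> nat \<Rightarrow> 'a::real_normed_algebra_1" where
  "root_seq x 0 = 0"
| "root_seq x (Suc n) = (1/2) *\<^sub>R (x + root_seq x n * root_seq x n)"

lemma root_seq_real: "0 \<le> root_seq (1::real) n \<and> root_seq (1::real) n \<le> 1"
proof (induction n)
  case (Suc n)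
  then have "root_seq (1::real) n * root_seq 1 n \<le> 1 * 1" by (intro mult_mono) auto
  then show ?case using Suc by simp
qed simp

lemma root_seq_norm:
  assumes "norm x \<le> 1" shows "norm (root_seq x n) \<le> root_seq (1::real) n"
proof (induction n)
  case (Suc n)
  have "norm (x + root_seq x n * root_seq x n) \<le> norm x + norm (root_seq x n) * norm (root_seq x n)"
    by (meson norm_triangle_le add_left_mono norm_mult_ineq)
  also have "\<dots> \<le> 1 + root_seq (1::real) n * root_seq (1::real) n"
    using Suc assms root_seq_real[of n] by (intro add_mono mult_mono) auto
  finally show ?case by simp
qed simp

text \<open>The recursion has nonnegative coefficients, so the scalar sequence for 1 majorises it
  step by step: with \<open>d\<close> the previous difference, the next one is half of
  \<open>y (Suc n) * d + d * y n\<close>, an identity that holds without commutativity. Summability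
  is then a matter of an increasing bounded real sequence.\<close>

lemma root_seq_diff:
  assumes "norm x \<le> 1"
  shows "norm (root_seq x (Suc n) - root_seq x n) \<le> root_seq (1::real) (Suc n) - root_seq 1 n"
proof (induction n)
  case 0 then show ?case using assms by simp
next
  case (Suc n)
  let ?y = "root_seq x" and ?t = "root_seq (1::real)"
  have "?y (Suc (Suc n)) - ?y (Suc n)
      = (1/2) *\<^sub>R (?y (Suc n) * (?y (Suc n) - ?y n) + (?y (Suc n) - ?y n) * ?y n)"
    unfolding root_seq.simps(2)[of x "Suc n"]
    by (subst (3) root_seq.simps(2)) (simp add: algebra_simps)
  also have "norm \<dots> \<le> (1/2) * (norm (?y (Suc n)) * norm (?y (Suc n) - ?y n)
       + norm (?y (Suc n) - ?y n) * norm (?y n))"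
    by (simp del: root_seq.simps) (meson norm_triangle_le add_mono norm_mult_ineq)
  also have "\<dots> \<le> (1/2) * (?t (Suc n) * (?t (Suc n) - ?t n) + (?t (Suc n) - ?t n) * ?t n)"
    using Suc root_seq_norm[OF assms, of n] root_seq_norm[OF assms, of "Suc n"]
      root_seq_real[of n] root_seq_real[of "Suc n"] order_trans[OF norm_ge_zero Suc]
    by (intro mult_left_mono add_mono mult_mono) (auto simp del: root_seq.simps)
  also have "\<dots> = ?t (Suc (Suc n)) - ?t (Suc n)"
    unfolding root_seq.simps(2)[of "1::real" "Suc n"]
    by (subst (5) root_seq.simps(2)) (simp add: algebra_simps)
  finally show ?case .
qed

text \<open>The equation says \<open>(1 - y)^2 = 1 - x\<close>. The last clause locates the limit.
  It asks for closure under squares and not under products because \<open>S\<close> will be the set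
  of self-adjoint elements, a commutant, or the range of an embedding, and the first of these is not
  closed under products.\<close>

lemma root_exists:
  fixes x :: "'a::cstar_ring"
  assumes x: "norm x \<le> 1"
  obtains y where "y + y = x + y * y" "norm y \<le> 1"
    "\<And>S. \<lbrakk>closed S; 0 \<in> S; x \<in> S; \<And>a b. a \<in> S \<Longrightarrow> b \<in> S \<Longrightarrow> a + b \<in> S; \<And>r a. a \<in> S \<Longrightarrow> r *\<^sub>R a \<in> S;
       \<And>a. a \<in> S \<Longrightarrow> a * a \<in> S\<rbrakk> \<Longrightarrow> y \<in> S"
proof -
  let ?y = "root_seq x" and ?t = "root_seq (1::real)"
  have "?t n \<le> ?t (Suc n)" for n
    using order_trans[OF norm_ge_zero root_seq_diff[OF x, of n]] by (simp del: root_seq.simps)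
  then have inc: "incseq ?t" by (rule incseq_SucI)
  obtain L where "?t \<longlonglongrightarrow> L"
    by (rule incseq_convergent[OF inc, of 1]) (use root_seq_real in auto)
  then have "summable (\<lambda>n. ?t (Suc n) - ?t n)" by (rule telescope_summable)
  then have "summable (\<lambda>n. ?y (Suc n) - ?y n)"
    by (rule summable_comparison_test') (rule root_seq_diff[OF x])
  then have "(\<lambda>n. \<Sum>k<n. ?y (Suc k) - ?y k) \<longlonglongrightarrow> (\<Sum>n. ?y (Suc n) - ?y n)"
    by (rule summable_LIMSEQ)
  moreover have "(\<Sum>k<n. ?y (Suc k) - ?y k) = ?y n" for n
    unfolding sum_lessThan_telescope by simp
  ultimately obtain y where y: "?y \<longlonglongrightarrow> y" by (simp del: root_seq.simps)
  have "(\<lambda>n. ?y (Suc n)) \<longlonglongrightarrow> y" by (rule LIMSEQ_Suc[OF y])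
  moreover have "(\<lambda>n. ?y (Suc n)) \<longlonglongrightarrow> (1/2) *\<^sub>R (x + y * y)"
    unfolding root_seq.simps by (intro tendsto_scaleR tendsto_add tendsto_mult tendsto_const y)
  ultimately have "y = (1/2) *\<^sub>R (x + y * y)" by (rule LIMSEQ_unique)
  then have "2 *\<^sub>R y = 2 *\<^sub>R ((1/2) *\<^sub>R (x + y * y))" by (rule arg_cong)
  then have 1: "y + y = x + y * y" unfolding scaleR_scaleR scaleR_2 by simp
  have "norm (?y n) \<le> 1" for n using root_seq_norm[OF x, of n] root_seq_real[of n] by simp
  then have 2: "norm y \<le> 1" by (intro LIMSEQ_le_const2[OF tendsto_norm[OF y]]) blast
  have 3: "y \<in> S" if S: "closed S" "0 \<in> S" "x \<in> S" "\<And>a b. a \<in> S \<Longrightarrow> b \<in> S \<Longrightarrow> a + b \<in> S"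
    "\<And>r a. a \<in> S \<Longrightarrow> r *\<^sub>R a \<in> S" "\<And>a. a \<in> S \<Longrightarrow> a * a \<in> S" for S
  proof -
    have "?y n \<in> S" for n by (induction n) (use S in auto)
    then show ?thesis using S(1) y closed_sequentially by blast
  qed
  show thesis using that 1 2 3 by blast
qed

text \<open>Commutation cancels the cross terms in \<open>adj u * u\<close> for
  \<open>u = h + i c\<close>, and \<open>h\<close> is the real part of \<open>u\<close>. The
  inequality stands in for monotonicity of the norm on positive elements, before positivity is
  available.\<close>

lemma norm_le_sum_squares:
  fixes h c :: "'a::cstar_ring"
  assumes "adj h = h" "adj c = c" "h * c = c * h"
  shows "(norm h)\<^sup>2 \<le> norm (h * h + c * c)"
proof -
  define u where "u = h + iu * c"
  have u': "adj u = h - iu * c" using assms iu_commute[of c] by (simp add: u_def adj_simps adj_iu)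
  have "adj u * u = h * h + c * c"
  proof -
    have "h * (iu * c) = iu * (c * h)" by (simp add: iu_left_commute assms(3))
    moreover have "(iu * c) * (iu * c) = - (c * c)" by (metis iu_left_commute iu_mult_iu mult.assoc)
    ultimately show ?thesis unfolding u' unfolding u_def by (simp add: algebra_simps)
  qed
  then have n: "(norm u)\<^sup>2 = norm (h * h + c * c)" using norm_adj_mult[of u] by simp
  have "h + h = u + adj u" unfolding u' unfolding u_def by simp
  then have "norm (h + h) \<le> norm u + norm u" by (metis norm_adj norm_triangle_ineq)
  then have "norm h \<le> norm u" by (simp add: scaleR_2[symmetric])
  then show ?thesis unfolding n[symmetric] by simp
qed

lemma norm_sa_square: "adj h = h \<Longrightarrow> norm (h * h) = (norm (h::'a::cstar_ring))\<^sup>2"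
  using norm_adj_mult[of h] by simp

lemma closed_commutant: "closed {y. z * y = y * (z::'a::cstar_ring)}"
  by (intro closed_Collect_eq continuous_intros)

lemma closed_sa: "closed {y. adj y = (y::'a::cstar_ring)}"
  by (intro closed_Collect_eq continuous_intros)

lemma sa_root_exists:
  fixes x :: "'a::cstar_ring"
  assumes x: "norm x \<le> 1" and sa: "adj x = x"
  obtains y where "(1 - y) * (1 - y) = 1 - x" "norm y \<le> 1" "adj y = y"
    "\<And>z. z * x = x * z \<Longrightarrow> z * y = y * z"
    "\<And>S. \<lbrakk>closed S; 0 \<in> S; x \<in> S; \<And>a b. a \<in> S \<Longrightarrow> b \<in> S \<Longrightarrow> a + b \<in> S; \<And>r a. a \<in> S \<Longrightarrow> r *\<^sub>R a \<in> S;
       \<And>a b. a \<in> S \<Longrightarrow> a * a \<in> S\<rbrakk> \<Longrightarrow> y \<in> S"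
proof -
  obtain y where y: "y + y = x + y * y" "norm y \<le> 1"
    "\<And>S. \<lbrakk>closed S; 0 \<in> S; x \<in> S; \<And>a b. a \<in> S \<Longrightarrow> b \<in> S \<Longrightarrow> a + b \<in> S; \<And>r a. a \<in> S \<Longrightarrow> r *\<^sub>R a \<in> S;
       \<And>a. a \<in> S \<Longrightarrow> a * a \<in> S\<rbrakk> \<Longrightarrow> y \<in> S"
    using root_exists[OF x] by metis
  have 1: "(1 - y) * (1 - y) = 1 - x"
    using y(1) by (simp add: algebra_simps)
  have 2: "y \<in> {y. adj y = y}"
    by (rule y(3)[OF closed_sa]) (auto simp: sa adj_simps)
  have 3: "y \<in> {y. z * y = y * z}" if "z * x = x * z" for z
  proof (rule y(3)[OF closed_commutant])
    show "a * a \<in> {y. z * y = y * z}" if "a \<in> {y. z * y = y * z}" for a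
      using that by simp (metis mult.assoc)
  qed (use that in \<open>auto simp: algebra_simps\<close>)
  show thesis using that[OF 1 y(2) _ _ y(3)] 2 3 by blast
qed

text \<open>Let \<open>1 - y\<close> be the root of \<open>1 - h * h\<close>. It commutes with
  \<open>h\<close>, and the squares of both add up to 1, so \<open>norm_le_sum_squares\<close> gives
  \<open>norm (1 - y) \<le> 1\<close>.\<close>

lemma norm_one_minus_square:
  fixes h :: "'a::cstar_ring"
  assumes h: "adj h = h" "norm h \<le> 1"
  shows "norm (1 - h * h) \<le> 1"
proof -
  have "norm (h * h) \<le> 1" using h by (simp add: norm_sa_square power_le_one)
  then obtain y where y: "(1 - y) * (1 - y) = 1 - h * h" "adj y = y" "\<And>z. z * (h * h) = (h * h) * z \<Longrightarrow> z * y = y * z"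
    using sa_root_exists[of "h * h"] h(1) by (metis adj_mult)
  have "h * y = y * h" by (rule y(3)) (simp add: mult.assoc)
  then have "(norm (1 - y))\<^sup>2 \<le> norm ((1 - y) * (1 - y) + h * h)"
    by (intro norm_le_sum_squares) (simp_all add: adj_simps h y algebra_simps)
  also have "\<dots> = 1" by (simp add: y)
  finally show ?thesis unfolding y(1)[symmetric] using norm_sa_square[of "1 - y"] y by (simp add: adj_simps)
qed

section \<open>The cone of positive elements, described by squares and by a norm test\<close>

definition pos :: "'a::cstar_ring \<Rightarrow> bool" where
  "pos x \<longleftrightarrow> (\<exists>h. adj h = h \<and> x = h * h)"

lemma pos_square: "adj h = h \<Longrightarrow> pos (h * h)"
  unfolding pos_def by blast

lemma pos_sa: "pos x \<Longrightarrow> adj x = x"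
  by (auto simp: pos_def adj_simps)

text \<open>Dividing \<open>h\<close> by \<open>sqrt t\<close> reduces this to
  \<open>norm_one_minus_square\<close>. With its converse \<open>pos_of_norm_le\<close> it forms the
  order test used from here on: a self-adjoint element within distance \<open>t\<close> of
  \<open>t\<close> is positive.\<close>

lemma pos_norm_le:
  assumes "pos x" "norm x \<le> t" shows "norm (of_real t - x) \<le> t"
proof -
  obtain h where h: "adj h = h" "x = h * h" using assms unfolding pos_def by blast
  have t: "(norm h)\<^sup>2 \<le> t" using assms h norm_sa_square by metis
  show ?thesis
  proof (cases "t = 0")
    case False
    then have t0: "t > 0" using order_trans[OF zero_le_power2 t] by simp
    define k where "k = (1 / sqrt t) *\<^sub>R h"
    have k: "adj k = k" using h by (simp add: k_def adj_simps)
    have "norm h \<le> sqrt t" using t by (simp add: real_le_rsqrt)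
    then have "norm k \<le> 1" using t0 by (simp add: k_def field_simps)
    then have "norm (1 - k * k) \<le> 1" using k norm_one_minus_square by blast
    moreover have "of_real t - x = t *\<^sub>R (1 - k * k)"
      using t0 by (simp add: k_def h of_real_def scaleR_right_diff_distrib)
    ultimately show ?thesis using t0 by simp
  qed (use t assms in simp)
qed

text \<open>Write \<open>x = t (1 - z)\<close> with \<open>norm z \<le> 1\<close> and put
  \<open>h = sqrt t (1 - y)\<close>, where \<open>1 - y\<close> is the root of \<open>1 - z\<close>.
  The last clause is the same norm test for \<open>h\<close> at level \<open>sqrt t\<close>; through
  it \<open>pos_root\<close> obtains a root that is itself positive.\<close>

lemma pos_of_norm_le_aux:
  assumes sa: "adj x = x" and t: "norm (of_real t - x) \<le> t"
  obtains h where "adj h = h" "x = h * h" "\<And>z. z * x = x * z \<Longrightarrow> z * h = h * z"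
    "norm (of_real (sqrt t) - h) \<le> sqrt t"
proof (cases "t = 0")
  case True
  then have "x = 0" using t by simp
  then show thesis using that[of 0] True by simp
next
  case False
  then have t0: "t > 0" using order_trans[OF norm_ge_zero t] by simp
  define z where "z = (1 / t) *\<^sub>R (of_real t - x)"
  have nz: "norm z \<le> 1" using t t0 unfolding z_def norm_scaleR by simp
  have z: "adj z = z" using sa by (simp add: z_def adj_simps)
  have zx: "1 - z = (1 / t) *\<^sub>R x" using t0 by (simp add: z_def of_real_def scaleR_right_diff_distrib)
  obtain y where y: "(1 - y) * (1 - y) = 1 - z" "norm y \<le> 1" "adj y = y"
    "\<And>w. w * z = z * w \<Longrightarrow> w * y = y * w"
    using sa_root_exists[OF nz z] by metis
  define h where "h = sqrt t *\<^sub>R (1 - y)"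
  have "h * h = x" using t0 y(1) zx by (simp add: h_def)
  moreover have "adj h = h" using y by (simp add: h_def adj_simps)
  moreover have "w * h = h * w" if "w * x = x * w" for w
  proof -
    have "w * z = z * w" using that by (simp add: z_def of_real_def algebra_simps)
    then show ?thesis using y(4) by (simp add: h_def algebra_simps)
  qed
  moreover have "of_real (sqrt t) - h = sqrt t *\<^sub>R y" by (simp add: h_def of_real_def algebra_simps)
  then have "norm (of_real (sqrt t) - h) \<le> sqrt t" using y t0 by (simp add: mult_left_le)
  ultimately show thesis using that by metis
qed

lemma pos_of_norm_le:
  assumes "adj x = x" "norm (of_real t - x) \<le> t" shows "pos x"
  using pos_of_norm_le_aux[OF assms] unfolding pos_def by metis

lemma pos_root:
  assumes "pos x"
  obtains h where "adj h = h" "x = h * h" "\<And>z. z * x = x * z \<Longrightarrow> z * h = h * z" "pos h"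
  using pos_of_norm_le_aux[OF pos_sa[OF assms] pos_norm_le[OF assms order_refl]] pos_of_norm_le by metis

lemma pos_scaleR: assumes "pos x" "r \<ge> 0" shows "pos (r *\<^sub>R x)"
proof -
  obtain h where h: "adj h = h" "x = h * h" using assms unfolding pos_def by blast
  then have "r *\<^sub>R x = (sqrt r *\<^sub>R h) * (sqrt r *\<^sub>R h)" using assms by simp
  then show ?thesis using pos_square[of "sqrt r *\<^sub>R h"] h(1) by (simp only: adj_scaleR)
qed

lemma pos_zero [simp]: "pos 0"
  using pos_square[of 0] by simp

lemma pos_of_real: "r \<ge> 0 \<Longrightarrow> pos (of_real r)"
  using pos_scaleR[OF pos_square[of 1], of r] by (simp add: of_real_def)

text \<open>This is where the norm test pays off: with squares alone the sum is not visibly a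
  square, but the test at \<open>norm x + norm y\<close> follows from the triangle
  inequality.\<close>

lemma pos_add: assumes "pos x" "pos y" shows "pos (x + y)"
proof (rule pos_of_norm_le)
  show "adj (x + y) = x + y" using assms by (simp add: adj_simps pos_sa)
  have "of_real (norm x + norm y) - (x + y) = (of_real (norm x) - x) + (of_real (norm y) - y)" by simp
  also have "norm \<dots> \<le> norm x + norm y"
    by (rule norm_triangle_mono) (use assms pos_norm_le in auto)
  finally show "norm (of_real (norm x + norm y) - (x + y)) \<le> norm x + norm y" .
qed

text \<open>The roots inherit commutation: first \<open>h\<close> commutes with \<open>y\<close>,
  hence \<open>k\<close> commutes with \<open>h\<close>. So \<open>h * k\<close> is self-adjoint and
  its square is \<open>x * y\<close>.\<close>

lemma pos_mult_commute: assumes "pos x" "pos y" "x * y = y * x" shows "pos (x * y)"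
proof -
  obtain h where h: "adj h = h" "x = h * h" "\<And>z. z * x = x * z \<Longrightarrow> z * h = h * z"
    using pos_root[OF assms(1)] by metis
  obtain k where k: "adj k = k" "y = k * k" "\<And>z. z * y = y * z \<Longrightarrow> z * k = k * z"
    using pos_root[OF assms(2)] by metis
  have "h * y = y * h" using h(3)[of y] assms(3) by simp
  then have hk: "h * k = k * h" by (rule k(3))
  then have "x * y = (h * k) * (h * k)" by (metis h(2) k(2) mult.assoc)
  moreover have "adj (h * k) = h * k" by (simp add: adj_mult h(1) k(1) hk)
  ultimately show ?thesis using pos_square by metis
qed

lemma pos_diff_of_norm_le:
  assumes "adj x = x" "norm x \<le> m" shows "pos (of_real m - x)"
  by (rule pos_of_norm_le[of _ m]) (use assms in \<open>simp_all add: adj_simps\<close>)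

text \<open>The factors \<open>m - x\<close> and \<open>m + x\<close> commute, so their product
  \<open>m^2 - x^2\<close> is a square \<open>d^2\<close> with \<open>d\<close> commuting with
  \<open>x\<close>. Then \<open>x^2 + d^2 = m^2\<close> bounds \<open>norm x\<close>.\<close>

lemma norm_le_of_pos:
  assumes sa: "adj x = x" and p: "pos (of_real m - x)" "pos (of_real m + x)" and m: "m \<ge> 0"
  shows "norm x \<le> m"
proof -
  have c: "of_real m * x = x * of_real m" by (simp add: of_real_def)
  have "pos ((of_real m - x) * (of_real m + x))"
    by (rule pos_mult_commute[OF p]) (simp add: algebra_simps c)
  moreover have e: "(of_real m - x) * (of_real m + x) = of_real (m * m) - x * x"
    by (simp add: algebra_simps c)
  ultimately obtain d where d: "adj d = d" "of_real (m * m) - x * x = d * d"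
      "\<And>z. z * (of_real (m * m) - x * x) = (of_real (m * m) - x * x) * z \<Longrightarrow> z * d = d * z"
    using pos_root by metis
  have "x * d = d * x" by (rule d(3)) (simp add: algebra_simps of_real_def)
  then have "(norm x)\<^sup>2 \<le> norm (x * x + d * d)" using norm_le_sum_squares sa d(1) by blast
  also have "x * x + d * d = of_real (m * m)" by (simp add: d(2)[symmetric])
  finally have "(norm x)\<^sup>2 \<le> m * m" using m by (simp del: of_real_mult)
  then show ?thesis using m by (simp add: power2_eq_square[symmetric])
qed

lemma pos_antisym: assumes "pos x" "pos (- x)" shows "x = 0"
  using norm_le_of_pos[of x 0] assms pos_sa by auto

lemma neumann_inverse:
  fixes z :: "'a::{real_normed_algebra_1,banach}"
  assumes "norm z < 1"
  obtains g where "(1 - z) * g = 1" "g * (1 - z) = 1"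
proof -
  define g where "g = (\<Sum>n. z ^ n)"
  have s: "summable (\<lambda>n. z ^ n)" by (rule complete_algebra_summable_geometric[OF assms])
  have "(\<Sum>n. z ^ Suc n) = g - 1" using suminf_split_head[OF s] by (simp add: g_def)
  then have "z * g = g - 1" "g * z = g - 1"
    unfolding g_def suminf_mult[OF s, symmetric] suminf_mult2[OF s]
    by (simp_all add: power_commutes)
  then show thesis using that[of g] by (simp add: algebra_simps)
qed

text \<open>With \<open>t = norm r\<close> the element is \<open>(m + t) (1 - z)\<close>, and
  \<open>norm z \<le> t / (m + t) < 1\<close> by \<open>pos_norm_le\<close>; the Neumann series
  inverts \<open>1 - z\<close>.\<close>

lemma pos_add_invertible:
  fixes r :: "'a::cstar_ring"
  assumes r: "pos r" and m: "m > 0"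
  obtains g where "(of_real m + r) * g = 1" "g * (of_real m + r) = 1"
proof -
  define t where "t = norm r"
  have t: "t \<ge> 0" by (simp add: t_def)
  define z where "z = (1 / (m + t)) *\<^sub>R (of_real t - r)"
  have "norm (of_real t - r) \<le> t" unfolding t_def using r by (rule pos_norm_le) simp
  then have "norm z < 1" unfolding z_def norm_scaleR using m t by (simp add: field_simps)
  then obtain g where g: "(1 - z) * g = 1" "g * (1 - z) = 1" using neumann_inverse by metis
  have e: "of_real m + r = (m + t) *\<^sub>R (1 - z)"
    using m t by (simp add: z_def of_real_def scaleR_right_diff_distrib scaleR_left_distrib)
  show thesis by (rule that[of "(1 / (m + t)) *\<^sub>R g"]) (use m t g in \<open>simp_all add: e\<close>)
qed

text \<open>Invertibility passes from \<open>m + b * adj b\<close> to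
  \<open>m + adj b * b = m - p\<close>, as the two products have the same nonzero spectrum. But for
  \<open>m = norm p\<close> and positive \<open>p\<close> the element \<open>m - p\<close> is not
  invertible unless \<open>p = 0\<close>.\<close>

lemma neg_adj_mult_eq_0:
  fixes b :: "'a::cstar_ring"
  assumes p: "adj b * b = - p" "pos p" and r: "pos (b * adj b)"
  shows "p = 0"
proof (rule ccontr)
  assume "p \<noteq> 0"
  define m where "m = norm p"
  have m: "m > 0" using \<open>p \<noteq> 0\<close> by (simp add: m_def)
  obtain g where g: "(of_real m + b * adj b) * g = 1" "g * (of_real m + b * adj b) = 1"
    using pos_add_invertible[OF r m] by metis
  define q where "q = of_real m - p"
  have q: "q = of_real m + adj b * b" by (simp add: q_def p)
  \<comment> \<open>The algebraic identity behind equality of the spectra: this expresses the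
    inverse of \<open>m + adj b * b\<close> through the inverse \<open>g\<close> of
    \<open>m + b * adj b\<close>.\<close>
  define y where "y = (1 / m) *\<^sub>R (1 - adj b * g * b)"
  have "q * (1 - adj b * g * b) = of_real m + adj b * b - adj b * ((of_real m + b * adj b) * g) * b"
    by (simp add: q algebra_simps of_real_def)
  then have "q * (1 - adj b * g * b) = of_real m" by (simp add: g)
  then have qy: "q * y = 1" using m by (simp add: y_def of_real_def)
  have "(1 - adj b * g * b) * q = of_real m + adj b * b - adj b * (g * (of_real m + b * adj b)) * b"
    by (simp add: q algebra_simps of_real_def)
  then have "(1 - adj b * g * b) * q = of_real m" by (simp add: g)
  then have yq: "y * q = 1" using m by (simp add: y_def of_real_def)
  have qp: "pos q" unfolding q_def by (rule pos_diff_of_norm_le) (use p pos_sa in \<open>auto simp: m_def\<close>)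
  have sq: "adj q = q" using qp by (rule pos_sa)
  have "adj y * q = 1" using arg_cong[OF qy, of adj] by (simp add: adj_mult sq)
  then have sy: "adj y = y" by (metis mult.assoc mult_1_left mult_1_right qy)
  have "y \<noteq> 0" using qy by auto
  define N where "N = norm y"
  have N: "N > 0" using \<open>y \<noteq> 0\<close> by (simp add: N_def)
  have "pos (of_real N - y)" using sy by (rule pos_diff_of_norm_le) (simp add: N_def)
  then have "pos (q * (of_real N - y))"
    by (rule pos_mult_commute[OF qp]) (simp add: algebra_simps qy yq of_real_def)
  then have "pos ((1 / N) *\<^sub>R (q * (of_real N - y)))" using N by (intro pos_scaleR) auto
  moreover have "(1 / N) *\<^sub>R (q * (of_real N - y)) = of_real (m - 1 / N) - p"
    using N unfolding right_diff_distrib qy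
    by (simp add: q_def of_real_def algebra_simps)
  ultimately have A: "pos (of_real (m - 1 / N) - p)" by simp
  show False
  proof (cases "m - 1 / N \<ge> 0")
    case True
    have "norm p \<le> m - 1 / N"
      using norm_le_of_pos[OF pos_sa[OF p(2)] A _ True] pos_add[OF pos_of_real[OF True] p(2)] by blast
    then show False using N by (simp add: m_def)
  next
    case False
    \<comment> \<open>Adding \<open>p\<close> turns a negative scalar into a positive
      element.\<close>
    have "pos (of_real (m - 1 / N) - p + p)" using A p(2) by (rule pos_add)
    then have "pos (- (of_real (1 / N - m) :: 'a))" by simp
    moreover have "pos (of_real (1 / N - m) :: 'a)" using False by (intro pos_of_real) simp
    ultimately have "(of_real (1 / N - m) :: 'a) = 0" using pos_antisym by blast
    then have "1 / N - m = 0" unfolding of_real_eq_0_iff .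
    then show False using False by simp
  qed
qed

text \<open>The Fukamiya-Kaplansky argument. If \<open>n\<close> is the negative part of
  \<open>h = adj a * a\<close>, then \<open>b = a * n\<close> satisfies
  \<open>adj b * b = - n^3\<close>, and a computation with real and imaginary parts shows that
  \<open>b * adj b\<close> is positive. By \<open>neg_adj_mult_eq_0\<close> the negative part
  vanishes.\<close>

theorem pos_adj_mult: "pos (adj a * a)"
proof -
  define h where "h = adj a * a"
  have h: "adj h = h" by (simp add: h_def adj_simps)
  \<comment> \<open>\<open>k\<close> is the absolute value of \<open>h\<close>. Its root
    \<open>q\<close> serves to write \<open>n^3 = n * k * n\<close> as the square of
    \<open>n * q\<close>.\<close>
  obtain k where k: "adj k = k" "h * h = k * k" "\<And>z. z * (h * h) = (h * h) * z \<Longrightarrow> z * k = k * z" "pos k"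
    using pos_root[OF pos_square[OF h]] by metis
  obtain q where q: "adj q = q" "k = q * q" "\<And>z. z * k = k * z \<Longrightarrow> z * q = q * z"
    using pos_root[OF k(4)] by metis
  have hk: "h * k = k * h" by (rule k(3)) (simp add: mult.assoc)
  define n where "n = (1/2) *\<^sub>R (k - h)"
  have n: "adj n = n" by (simp add: n_def adj_simps h k(1))
  have hh: "(1/2) *\<^sub>R h + (1/2) *\<^sub>R h = h" by (simp flip: scaleR_left_distrib)
  have "h + n = ((1/2) *\<^sub>R h + (1/2) *\<^sub>R h) + ((1/2) *\<^sub>R k - (1/2) *\<^sub>R h)"
    unfolding hh by (simp add: n_def scaleR_right_diff_distrib)
  also have "\<dots> = (1/2) *\<^sub>R (k + h)" by (simp add: scaleR_right_distrib)
  finally have "(h + n) * n = (1/4) *\<^sub>R ((k + h) * (k - h))" by (simp add: n_def)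
  also have "(k + h) * (k - h) = 0" using hk k(2) by (simp add: algebra_simps)
  finally have hn: "h * n = - (n * n)" by (simp add: algebra_simps add_eq_0_iff)
  have "n + n = k - h" by (simp add: n_def flip: scaleR_2)
  then have kn: "k = h + n + n" by (simp add: add.assoc)
  have kn2: "k * n = n * n" by (simp add: kn distrib_right hn)
  have nk: "n * k = k * n" by (simp add: n_def algebra_simps hk)
  have nq: "n * q = q * n" using nk by (rule q(3))
  define p where "p = n * n * n"
  define b where "b = a * n"
  have "adj b * b = n * (h * n)" by (simp add: b_def h_def adj_simps n mult.assoc)
  then have bp: "adj b * b = - p" by (simp add: hn p_def mult.assoc)
  have "p = n * (k * n)" by (simp add: p_def kn2 mult.assoc)
  also have "\<dots> = (n * q) * (n * q)" by (simp add: q(2) mult.assoc) (metis mult.assoc nq)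
  finally have "pos p" using pos_square[of "n * q"] by (simp add: adj_mult n q(1) nq)
  \<comment> \<open>Real and imaginary parts of \<open>b\<close>. The sum
    \<open>adj b * b + b * adj b\<close> equals \<open>2 (x^2 + y^2)\<close>, so
    \<open>b * adj b\<close> is \<open>2 (x^2 + y^2) + p\<close>.\<close>
  define x where "x = (1/2) *\<^sub>R (b + adj b)"
  define y where "y = (1/2) *\<^sub>R (iu * (adj b - b))"
  have sx: "adj x = x" by (simp add: x_def adj_simps algebra_simps)
  have sy: "adj y = y"
    using iu_commute[of b] iu_commute[of "adj b"] by (simp add: y_def adj_simps adj_iu algebra_simps)
  have "y * y = (1/4) *\<^sub>R (iu * (adj b - b) * (iu * (adj b - b)))" by (simp add: y_def)
  also have "iu * (adj b - b) * (iu * (adj b - b)) = - ((adj b - b) * (adj b - b))"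
    by (metis iu_left_commute iu_mult_iu mult.assoc)
  finally have yy: "y * y = - ((1/4) *\<^sub>R ((adj b - b) * (adj b - b)))" by simp
  have xx: "x * x = (1/4) *\<^sub>R ((b + adj b) * (b + adj b))" by (simp add: x_def)
  have "2 *\<^sub>R (x * x + y * y) = (1/2) *\<^sub>R ((b + adj b) * (b + adj b) - (adj b - b) * (adj b - b))"
    unfolding xx yy by (simp add: algebra_simps)
  also have "(b + adj b) * (b + adj b) - (adj b - b) * (adj b - b) = 2 *\<^sub>R (adj b * b + b * adj b)"
    by (simp add: algebra_simps scaleR_2)
  finally have "b * adj b = 2 *\<^sub>R (x * x + y * y) + p" by (simp add: bp)
  moreover have "pos \<dots>"
    using \<open>pos p\<close> pos_square[OF sx] pos_square[OF sy] by (intro pos_add pos_scaleR) auto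
  ultimately have "p = 0" using neg_adj_mult_eq_0[OF bp \<open>pos p\<close>] by metis
  then have "(n * n) * (n * n) = 0" by (simp add: p_def mult.assoc)
  then have "norm ((n * n) * (n * n)) = 0" by simp
  then have "n = 0" using norm_sa_square[OF n] norm_sa_square[of "n * n"] by (simp add: adj_mult n)
  then have "h = k" by (simp add: kn)
  then show ?thesis using k(4) h_def by simp
qed

section \<open>Hahn-Banach and states\<close>

text \<open>Positive homogeneity is asked as an inequality only, which passes easily to infima;
  using it for \<open>1 / r\<close> gives equality, see \<open>sublinear_scale\<close>.\<close>

definition sublinear :: "('a::real_vector \<Rightarrow> real) \<Rightarrow> bool" where
  "sublinear q \<longleftrightarrow> (\<forall>x y. q (x + y) \<le> q x + q y) \<and> (\<forall>r>0. \<forall>x. q (r *\<^sub>R x) \<le> r * q x)"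

lemma sublinear_zero: assumes "sublinear q" shows "q 0 = 0"
proof -
  have "q (0 + 0) \<le> q 0 + q 0" using assms unfolding sublinear_def by blast
  moreover have "q ((1/2) *\<^sub>R 0) \<le> (1/2) * q 0"
    using assms unfolding sublinear_def by (meson half_gt_zero zero_less_one)
  ultimately show ?thesis by simp
qed

lemma sublinear_scale: assumes "sublinear q" "r > 0" shows "q (r *\<^sub>R x) = r * q x"
proof (rule antisym)
  show "q (r *\<^sub>R x) \<le> r * q x" using assms unfolding sublinear_def by blast
  have "q ((1 / r) *\<^sub>R (r *\<^sub>R x)) \<le> (1 / r) * q (r *\<^sub>R x)"
    using assms unfolding sublinear_def by (meson zero_less_divide_1_iff)
  then show "r * q x \<le> q (r *\<^sub>R x)" using assms(2) by (simp add: field_simps)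
qed

lemma sublinear_lower: assumes "sublinear q" shows "- q (- x) \<le> q x"
proof -
  have "q (x + - x) \<le> q x + q (- x)" using assms unfolding sublinear_def by blast
  then show ?thesis using sublinear_zero[OF assms] by simp
qed

text \<open>The greatest sublinear functional below \<open>q\<close> whose value at
  \<open>- y\<close> is at most \<open>- q y\<close>. The choice \<open>t = 0\<close> gives the
  first bound, \<open>t = 1\<close> at \<open>x = - y\<close> the second.\<close>

definition shifted :: "('a::real_vector \<Rightarrow> real) \<Rightarrow> 'a \<Rightarrow> 'a \<Rightarrow> real" where
  "shifted q y x = (INF t\<in>{0..}. q (x + t *\<^sub>R y) - t * q y)"

lemma shifted_sublinear:
  assumes q: "sublinear q"
  shows "sublinear (shifted q y)" and "t \<ge> 0 \<Longrightarrow> shifted q y x \<le> q (x + t *\<^sub>R y) - t * q y"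
proof -
  have lb: "- q (- x) \<le> q (x + t *\<^sub>R y) - t * q y" if "t \<ge> 0" for x t
  proof -
    have "q (t *\<^sub>R y) = t * q y" using sublinear_scale[OF q, of t y] sublinear_zero[OF q] that
      by (cases "t = 0") auto
    moreover have "q ((x + t *\<^sub>R y) + - x) \<le> q (x + t *\<^sub>R y) + q (- x)"
      using q unfolding sublinear_def by blast
    ultimately show ?thesis by simp
  qed
  then have bdd: "bdd_below ((\<lambda>t. q (x + t *\<^sub>R y) - t * q y) ` {0..})" for x
    by (intro bdd_belowI2) auto
  have low: "shifted q y x \<le> q (x + t *\<^sub>R y) - t * q y" if "t \<ge> 0" for x t
    unfolding shifted_def by (rule cINF_lower[OF bdd]) (use that in simp)
  show "t \<ge> 0 \<Longrightarrow> shifted q y x \<le> q (x + t *\<^sub>R y) - t * q y" by (rule low)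
  have great: "c \<le> shifted q y x" if "\<And>t. t \<ge> 0 \<Longrightarrow> c \<le> q (x + t *\<^sub>R y) - t * q y" for c x
    unfolding shifted_def by (rule cINF_greatest) (use that in auto)
  show "sublinear (shifted q y)"
    unfolding sublinear_def
  proof (intro conjI allI impI)
    fix a b
    have "shifted q y (a + b) - (q (b + s *\<^sub>R y) - s * q y) \<le> shifted q y a" if s: "s \<ge> 0" for s
    proof (rule great)
      fix t :: real assume t: "t \<ge> 0"
      have "shifted q y (a + b) \<le> q ((a + b) + (t + s) *\<^sub>R y) - (t + s) * q y" using s t by (intro low) simp
      also have "(a + b) + (t + s) *\<^sub>R y = (a + t *\<^sub>R y) + (b + s *\<^sub>R y)" by (simp add: algebra_simps)
      also have "q \<dots> \<le> q (a + t *\<^sub>R y) + q (b + s *\<^sub>R y)" using q unfolding sublinear_def by blast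
      finally show "shifted q y (a + b) - (q (b + s *\<^sub>R y) - s * q y) \<le> q (a + t *\<^sub>R y) - t * q y"
        by (simp add: algebra_simps)
    qed
    then have "shifted q y (a + b) - shifted q y a \<le> shifted q y b"
      by (intro great) (simp add: algebra_simps)
    then show "shifted q y (a + b) \<le> shifted q y a + shifted q y b" by simp
  next
    fix r :: real and a assume r: "r > 0"
    have "shifted q y (r *\<^sub>R a) / r \<le> shifted q y a"
    proof (rule great)
      fix t :: real assume t: "t \<ge> 0"
      have "shifted q y (r *\<^sub>R a) \<le> q (r *\<^sub>R a + (r * t) *\<^sub>R y) - (r * t) * q y" using r t by (intro low) simp
      also have "r *\<^sub>R a + (r * t) *\<^sub>R y = r *\<^sub>R (a + t *\<^sub>R y)" by (simp add: algebra_simps)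
      also have "q \<dots> = r * q (a + t *\<^sub>R y)" using q r by (rule sublinear_scale)
      finally show "shifted q y (r *\<^sub>R a) / r \<le> q (a + t *\<^sub>R y) - t * q y" using r by (simp add: field_simps)
    qed
    then show "shifted q y (r *\<^sub>R a) \<le> r * shifted q y a" using r by (simp add: field_simps)
  qed
qed

text \<open>
  A minimal sublinear functional is linear: it coincides with each of its shifts, which gives
  superadditivity.
\<close>

lemma hahn_banach_sublinear:
  fixes p :: "'a::real_vector \<Rightarrow> real"
  assumes p: "sublinear p"
  obtains f where "linear f" "\<And>x. f x \<le> p x"
proof -
  define A where "A = {q. sublinear q \<and> q \<le> p}"
  \<comment> \<open>The order is reversed, so Zorn's lemma yields a minimal sublinear functional.
    Chains are bounded by pointwise infima, which are finite because every member lies above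
    \<open>- p (- x)\<close>.\<close>
  let ?P = "\<lambda>a b :: 'a \<Rightarrow> real. b \<le> a"
  have po: "partial_order_on A (relation_of ?P A)"
    by (rule partial_order_on_relation_ofI) auto
  have chain: "\<exists>u\<in>A. \<forall>a\<in>C. ?P a u" if C: "C \<in> Chains (relation_of ?P A)" for C
  proof (cases "C = {}")
    case True
    then show ?thesis using p unfolding A_def by auto
  next
    case False
    have CA: "C \<subseteq> A" using C by (rule Chains_relation_of)
    have tot: "a \<le> b \<or> b \<le> a" if "a \<in> C" "b \<in> C" for a b
      using C that unfolding Chains_def relation_of_def by blast
    define u where "u x = (INF q\<in>C. q x)" for x
    have "- p (- x) \<le> q x" if "q \<in> C" for q x
    proof -
      have q: "sublinear q" "q (- x) \<le> p (- x)" using that CA by (auto simp: A_def le_fun_def)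
      show ?thesis using sublinear_lower[OF q(1), of x] q(2) by simp
    qed
    then have bdd: "bdd_below ((\<lambda>q. q x) ` C)" for x by (intro bdd_belowI2) auto
    have low: "u x \<le> q x" if "q \<in> C" for q x unfolding u_def by (rule cINF_lower[OF bdd that])
    have great: "c \<le> u x" if "\<And>q. q \<in> C \<Longrightarrow> c \<le> q x" for c x
      unfolding u_def using False that by (rule cINF_greatest)
    have "sublinear u" unfolding sublinear_def
    proof (intro conjI allI impI)
      fix x y
      have "u (x + y) - q2 y \<le> u x" if q2: "q2 \<in> C" for q2
      proof (rule great)
        fix q1 assume q1: "q1 \<in> C"
        \<comment> \<open>In a chain one of \<open>q1\<close>, \<open>q2\<close> lies below the
          other, and subadditivity of that one suffices.\<close>
        obtain q where q: "q \<in> C" "q \<le> q1" "q \<le> q2" using tot[OF q1 q2] q1 q2 by blast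
        have "u (x + y) \<le> q (x + y)" by (rule low[OF q(1)])
        also have "\<dots> \<le> q x + q y" using q(1) CA unfolding A_def sublinear_def by blast
        also have "\<dots> \<le> q1 x + q2 y" using q(2,3) by (simp add: le_fun_def add_mono)
        finally show "u (x + y) - q2 y \<le> q1 x" by simp
      qed
      then have "u (x + y) - u x \<le> u y" by (intro great) (simp add: algebra_simps)
      then show "u (x + y) \<le> u x + u y" by simp
    next
      fix r :: real and x assume r: "r > 0"
      have "u (r *\<^sub>R x) / r \<le> u x"
      proof (rule great)
        fix q assume q: "q \<in> C"
        have "u (r *\<^sub>R x) \<le> q (r *\<^sub>R x)" by (rule low[OF q])
        also have "\<dots> \<le> r * q x" using q CA r unfolding A_def sublinear_def by blast
        finally show "u (r *\<^sub>R x) / r \<le> q x" using r by (simp add: field_simps)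
      qed
      then show "u (r *\<^sub>R x) \<le> r * u x" using r by (simp add: field_simps)
    qed
    moreover have "u \<le> p"
    proof -
      obtain q where "q \<in> C" using False by blast
      then have "u \<le> q" "q \<le> p" using low CA by (auto simp: le_fun_def A_def)
      then show ?thesis by simp
    qed
    ultimately show ?thesis using low unfolding A_def by (auto simp: le_fun_def)
  qed
  obtain f where f: "f \<in> A" "\<And>a. a \<in> A \<Longrightarrow> a \<le> f \<Longrightarrow> a = f"
    using predicate_Zorn[OF po chain] by metis
  have sf: "sublinear f" and fp: "f \<le> p" using f(1) by (auto simp: A_def)
  have add: "f (x + y) = f x + f y" for x y
  proof (rule antisym)
    show "f (x + y) \<le> f x + f y" using sf unfolding sublinear_def by blast
    have "shifted f y \<le> f"
      using shifted_sublinear(2)[OF sf, of 0 y] by (simp add: le_fun_def)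
    moreover have "shifted f y \<in> A"
      using calculation fp shifted_sublinear(1)[OF sf] unfolding A_def by auto
    ultimately have "shifted f y = f" using f(2) by blast
    then show "f x + f y \<le> f (x + y)"
      using shifted_sublinear(2)[OF sf, of 1 y x] by simp
  qed
  have neg: "f (- x) = - f x" for x using add[of x "- x"] sublinear_zero[OF sf] by simp
  have "f (r *\<^sub>R x) = r * f x" for r x
  proof (cases r "0::real" rule: linorder_cases)
    case less
    then have "f ((- r) *\<^sub>R x) = - r * f x" by (intro sublinear_scale[OF sf]) simp
    then show ?thesis using neg[of "r *\<^sub>R x"] by simp
  qed (use sublinear_zero[OF sf] sublinear_scale[OF sf] in auto)
  then have "linear f" using add by (intro linearI) auto
  then show thesis using that fp by (auto simp: le_fun_def)
qed

text \<open>Instead of extending from the line through \<open>v\<close>, Hahn-Banach is applied to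
  \<open>shifted norm v\<close>: its value at \<open>- v\<close> is at most \<open>- norm v\<close>,
  and this forces \<open>f v = norm v\<close>.\<close>

lemma norming_functional:
  fixes v :: "'a::real_normed_vector"
  obtains f where "linear f" "\<And>x. f x \<le> norm x" "f v = norm v"
proof -
  have n: "sublinear (norm :: 'a \<Rightarrow> real)" by (simp add: sublinear_def norm_triangle_ineq)
  obtain f where f: "linear f" "\<And>x. f x \<le> shifted norm v x"
    using hahn_banach_sublinear[OF shifted_sublinear(1)[OF n]] by metis
  have le: "f x \<le> norm x" for x
    using f(2)[of x] shifted_sublinear(2)[OF n, of 0 v x] by simp
  have "f (- v) \<le> - norm v"
    using f(2)[of "- v"] shifted_sublinear(2)[OF n, of 1 v "- v"] by simp
  then have "f v = norm v" using le[of v] linear_neg[OF f(1), of v] by simp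
  then show thesis using that f(1) le by blast
qed

section \<open>States, obtained from norming functionals\<close>

definition positive_functional :: "('a::cstar_ring \<Rightarrow> complex) \<Rightarrow> bool" where
  "positive_functional F \<longleftrightarrow>
     (\<forall>x y. F (x + y) = F x + F y) \<and> (\<forall>c x. F (csc c x) = c * F x) \<and>
     (\<forall>x. F (adj x) = cnj (F x)) \<and> (\<forall>x. pos x \<longrightarrow> 0 \<le> Re (F x)) \<and> (\<forall>x. cmod (F x) \<le> 2 * norm x)"

text \<open>The point of this sum is that a functional of norm at most 1 which norms it has to norm
  both \<open>1\<close> and \<open>h\<close>. The summand 1 in the coefficient keeps it nonzero when
  \<open>h = 0\<close>.\<close>

lemma norm_add_pos:
  assumes h: "pos h"
  shows "norm (of_real (norm h + 1) + h) = 2 * norm h + 1"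
proof (rule antisym)
  have "norm (of_real (norm h + 1) + h) \<le> norm (of_real (norm h + 1) :: 'a) + norm h"
    by (rule norm_triangle_ineq)
  also have "norm (of_real (norm h + 1) :: 'a) = norm h + 1" unfolding norm_of_real by simp
  finally show "norm (of_real (norm h + 1) + h) \<le> 2 * norm h + 1" by simp
  define m where "m = norm (of_real (norm h + 1) + h)"
  define k where "k = m - norm h - 1"
  have "pos (of_real m - (of_real (norm h + 1) + h))"
    by (rule pos_diff_of_norm_le) (use pos_sa[OF h] in \<open>auto simp: adj_simps m_def\<close>)
  then have A: "pos (of_real k - h)" by (simp add: k_def algebra_simps)
  have "k \<ge> 0"
  proof (rule ccontr)
    assume "\<not> k \<ge> 0"
    have "pos (of_real k - h + h)" using A h by (rule pos_add)
    then have "pos (- (of_real (- k) :: 'a))" by simp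
    moreover have "pos (of_real (- k) :: 'a)" using \<open>\<not> k \<ge> 0\<close> by (intro pos_of_real) simp
    ultimately have "(of_real (- k) :: 'a) = 0" using pos_antisym by blast
    then have "- k = 0" unfolding of_real_eq_0_iff .
    then show False using \<open>\<not> k \<ge> 0\<close> by simp
  qed
  then have "norm h \<le> k"
    using norm_le_of_pos[OF pos_sa[OF h] A] pos_add[OF pos_of_real h] by blast
  then show "2 * norm h + 1 \<le> norm (of_real (norm h + 1) + h)" by (simp add: k_def m_def)
qed

lemma norming_state:
  fixes h :: "'a::cstar_ring"
  assumes h: "pos h"
  obtains F where "positive_functional F" "F h = of_real (norm h)" "F 1 = 1"
proof -
  obtain f where f: "linear f" "\<And>x. f x \<le> norm x"
      "f (of_real (norm h + 1) + h) = norm (of_real (norm h + 1) + h)"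
    using norming_functional by blast
  have f1: "f 1 \<le> 1" "f h \<le> norm h" using f(2)[of 1] f(2)[of h] by simp_all
  have "f (of_real (norm h + 1) + h) = (norm h + 1) * f 1 + f h"
    unfolding of_real_def by (simp only: linear_add[OF f(1)] linear_cmul[OF f(1)] real_scaleR_def)
  then have e: "(norm h + 1) * f 1 + f h = 2 * norm h + 1" using f(3) norm_add_pos[OF h] by simp
  \<comment> \<open>A sum of two nonnegative terms that vanishes, so \<open>f\<close> attains the
    norm at \<open>1\<close> and at \<open>h\<close>.\<close>
  have "(norm h + 1) * (1 - f 1) + (norm h - f h) = 0" using e by (simp add: algebra_simps)
  moreover have "(norm h + 1) * (1 - f 1) \<ge> 0" "norm h - f h \<ge> 0" using f1 by auto
  ultimately have "(norm h + 1) * (1 - f 1) = 0" "norm h - f h = 0" by linarith+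
  moreover have "norm h + 1 \<noteq> 0" using norm_ge_zero[of h] by linarith
  ultimately have fh: "f h = norm h" "f 1 = 1" by auto
  \<comment> \<open>From \<open>f 1 = 1\<close>, \<open>f \<le> norm\<close> and the norm test for
    positive elements.\<close>
  have fpos: "f x \<ge> 0" if "pos x" for x
  proof -
    have "f (of_real (norm x) - x) \<le> norm (of_real (norm x) - x)" by (rule f(2))
    also have "\<dots> \<le> norm x" using that by (rule pos_norm_le) simp
    finally have "norm x * f 1 - f x \<le> norm x"
      unfolding of_real_def by (simp only: linear_diff[OF f(1)] linear_cmul[OF f(1)] real_scaleR_def)
    then show ?thesis using fh by simp
  qed
  have fabs: "\<bar>f x\<bar> \<le> norm x" for x using f(2)[of x] f(2)[of "- x"] linear_neg[OF f(1), of x] by simp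
  \<comment> \<open>Complexification of the real functional: \<open>re x\<close> and
    \<open>im x\<close> are self-adjoint, and \<open>F\<close> extends \<open>f\<close> from the
    self-adjoint elements.\<close>
  define re im where "re x = (1/2) *\<^sub>R (x + adj x)" and "im x = (1/2) *\<^sub>R (iu * (adj x - x))" for x :: 'a
  define F where "F x = Complex (f (re x)) (f (im x))" for x
  have add: "F (x + y) = F x + F y" for x y
  proof -
    have "re (x + y) = re x + re y" "im (x + y) = im x + im y"
      by (simp_all add: re_def im_def adj_simps algebra_simps)
    then show ?thesis by (simp add: F_def complex_eq_iff linear_add[OF f(1)])
  qed
  have scal: "F (r *\<^sub>R x) = of_real r * F x" for r x
  proof -
    have "re (r *\<^sub>R x) = r *\<^sub>R re x" "im (r *\<^sub>R x) = r *\<^sub>R im x"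
      by (simp_all add: re_def im_def adj_simps algebra_simps)
    then show ?thesis by (simp add: F_def complex_eq_iff linear_cmul[OF f(1)])
  qed
  have iu: "F (iu * x) = \<i> * F x" for x
  proof -
    have "adj (iu * x) = - (iu * adj x)" using iu_commute[of "adj x"] by (simp add: adj_simps adj_iu)
    then have "re (iu * x) = - im x" "im (iu * x) = re x"
      by (simp_all add: re_def im_def algebra_simps)
    then show ?thesis by (simp add: F_def complex_eq_iff linear_neg[OF f(1)])
  qed
  have csc: "F (csc c x) = c * F x" for c x
    unfolding csc_def add scal iu by (simp add: complex_eq_iff)
  have sa: "F x = of_real (f x)" if "adj x = x" for x
    using that by (simp add: F_def re_def im_def complex_eq_iff linear_0[OF f(1)] scaleR_half_double)
  have ad: "F (adj x) = cnj (F x)" for x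
  proof -
    have "re (adj x) = re x" "im (adj x) = - im x"
      by (simp_all add: re_def im_def algebra_simps)
    then show ?thesis by (simp add: F_def complex_eq_iff linear_neg[OF f(1)])
  qed
  \<comment> \<open>The factor 2 comes from bounding real and imaginary part separately;
    \<open>sn_le_norm\<close> inherits it.\<close>
  have bd: "cmod (F x) \<le> 2 * norm x" for x
  proof -
    have "norm (iu * y) = norm y" for y :: 'a
      using norm_csc[of \<i> y] by (simp add: csc_def)
    moreover have "norm (x + adj x) \<le> norm x + norm x" by (metis norm_adj norm_triangle_ineq)
    moreover have "norm (adj x - x) \<le> norm x + norm x" by (metis norm_adj norm_triangle_ineq4)
    ultimately have "norm (re x) \<le> norm x" "norm (im x) \<le> norm x" by (simp_all add: re_def im_def)
    moreover have "cmod (F x) \<le> \<bar>f (re x)\<bar> + \<bar>f (im x)\<bar>" using cmod_le[of "F x"] by (simp add: F_def)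
    ultimately show ?thesis using fabs[of "re x"] fabs[of "im x"] by linarith
  qed
  have "positive_functional F"
    unfolding positive_functional_def
    using add csc ad bd sa fpos pos_sa by (metis Re_complex_of_real)
  then show thesis using that sa[OF pos_sa[OF h]] sa[of 1] fh by simp
qed

section \<open>Normed complex modules\<close>

locale normed_module = module complex_ring M for M (structure) +
  fixes N :: "'a \<Rightarrow> real"
  assumes N_nonneg: "x \<in> carrier M \<Longrightarrow> 0 \<le> N x"
    and N_eq_0: "x \<in> carrier M \<Longrightarrow> N x = 0 \<Longrightarrow> x = \<zero>"
    and N_triangle: "\<lbrakk>x \<in> carrier M; y \<in> carrier M\<rbrakk> \<Longrightarrow> N (x \<oplus> y) \<le> N x + N y"
    and N_smult: "x \<in> carrier M \<Longrightarrow> N (c \<odot> x) = cmod c * N x"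

locale complex_module = module complex_ring M for M (structure)
begin

lemma smult_clos [simp, intro]: "x \<in> carrier M \<Longrightarrow> c \<odot> x \<in> carrier M"
  using smult_closed[of c x] by simp

lemma smult_add_left: "x \<in> carrier M \<Longrightarrow> (c + d) \<odot> x = c \<odot> x \<oplus> d \<odot> x"
  using smult_l_distr[of c d x] by simp

lemma smult_add_right: "x \<in> carrier M \<Longrightarrow> y \<in> carrier M \<Longrightarrow> c \<odot> (x \<oplus> y) = c \<odot> x \<oplus> c \<odot> y"
  using smult_r_distr[of c x y] by simp

lemma smult_smult: "x \<in> carrier M \<Longrightarrow> c \<odot> (d \<odot> x) = (c * d) \<odot> x"
  using smult_assoc1[of c d x] by simp

lemma smult_1 [simp]: "x \<in> carrier M \<Longrightarrow> 1 \<odot> x = x"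
  using smult_one[of x] by simp

lemma smult_0_left [simp]: "x \<in> carrier M \<Longrightarrow> 0 \<odot> x = \<zero>"
  using smult_l_null[of x] by simp

lemma smult_0_right [simp]: "c \<odot> \<zero> = \<zero>"
  using smult_r_null[of c] by simp

lemma minus_smult: assumes "x \<in> carrier M" shows "\<ominus> x = (- 1) \<odot> x"
proof -
  have "(- 1) \<odot> x \<oplus> x = \<zero>" using smult_add_left[of x "- 1" 1] assms by simp
  then show ?thesis using M.minus_equality[of "(- 1) \<odot> x" x] assms by simp
qed

text \<open>Differences are written as \<open>x \<oplus> (- 1) \<odot> y\<close> from here on, so
  that compatibility with sums and scalar multiples is enough to transport them through a
  homomorphism.\<close>

lemma diff_smult: "x \<in> carrier M \<Longrightarrow> y \<in> carrier M \<Longrightarrow> x \<ominus> y = x \<oplus> (- 1) \<odot> y"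
  by (simp add: a_minus_def minus_smult)

lemma add_neg [simp]: "x \<in> carrier M \<Longrightarrow> x \<oplus> (- 1) \<odot> x = \<zero>"
  using smult_add_left[of x 1 "-1"] by simp

lemma diff_eq_0: "\<lbrakk>x \<in> carrier M; y \<in> carrier M; x \<oplus> (- 1) \<odot> y = \<zero>\<rbrakk> \<Longrightarrow> x = y"
  using M.minus_equality[of x "(- 1) \<odot> y"] by (simp add: minus_smult smult_smult)

lemma diff_add_diff:
  assumes "x \<in> carrier M" "y \<in> carrier M" "z \<in> carrier M"
  shows "x \<oplus> (- 1) \<odot> z = (x \<oplus> (- 1) \<odot> y) \<oplus> (y \<oplus> (- 1) \<odot> z)"
proof -
  have "(x \<oplus> (- 1) \<odot> y) \<oplus> (y \<oplus> (- 1) \<odot> z) = x \<oplus> ((- 1) \<odot> y \<oplus> y) \<oplus> (- 1) \<odot> z"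
    using assms by (simp add: M.a_assoc)
  also have "(- 1) \<odot> y \<oplus> y = \<zero>" using assms add_neg[of y] by (simp add: M.a_comm)
  finally show ?thesis using assms by simp
qed

lemma submodule_iff:
  "submodule D complex_ring M \<longleftrightarrow>
     D \<subseteq> carrier M \<and> \<zero> \<in> D \<and> (\<forall>x\<in>D. \<forall>y\<in>D. x \<oplus> y \<in> D) \<and> (\<forall>c. \<forall>x\<in>D. c \<odot> x \<in> D)"
proof
  assume s: "submodule D complex_ring M"
  note e = submoduleE[OF s]
  obtain x where x: "x \<in> D" using e(2) by blast
  then have "0 \<odot> x = \<zero>" using e(1) by auto
  then have "\<zero> \<in> D" using e(4)[of 0 x] x by simp
  then show "D \<subseteq> carrier M \<and> \<zero> \<in> D \<and> (\<forall>x\<in>D. \<forall>y\<in>D. x \<oplus> y \<in> D) \<and> (\<forall>c. \<forall>x\<in>D. c \<odot> x \<in> D)"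
    using e by auto
next
  assume "D \<subseteq> carrier M \<and> \<zero> \<in> D \<and> (\<forall>x\<in>D. \<forall>y\<in>D. x \<oplus> y \<in> D) \<and> (\<forall>c. \<forall>x\<in>D. c \<odot> x \<in> D)"
  then show "submodule D complex_ring M"
    by (intro submoduleI) (auto simp: minus_smult subset_iff)
qed

lemma lin_span_submodule:
  assumes "S \<subseteq> carrier M" shows "submodule (lin_span M S) complex_ring M" "S \<subseteq> lin_span M S"
  using assms carrier_is_submodule unfolding lin_span_def submodule_iff by blast+

lemma lin_span_least: "submodule L complex_ring M \<Longrightarrow> S \<subseteq> L \<Longrightarrow> lin_span M S \<subseteq> L"
  unfolding lin_span_def by blast

end

sublocale normed_module \<subseteq> complex_module ..

context normed_module
begin

lemma N_zero [simp]: "N \<zero> = 0"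
  using N_smult[of \<zero> 0] by simp

lemma N_diff_commute:
  assumes "x \<in> carrier M" "y \<in> carrier M" shows "N (x \<oplus> (- 1) \<odot> y) = N (y \<oplus> (- 1) \<odot> x)"
proof -
  have "(- 1) \<odot> (x \<oplus> (- 1) \<odot> y) = y \<oplus> (- 1) \<odot> x"
    using assms by (simp add: smult_add_right smult_smult M.a_comm)
  then show ?thesis using N_smult[of "x \<oplus> (- 1) \<odot> y" "- 1"] assms by simp
qed

lemma N_diff_triangle:
  assumes "x \<in> carrier M" "y \<in> carrier M" "z \<in> carrier M"
  shows "N (x \<oplus> (- 1) \<odot> z) \<le> N (x \<oplus> (- 1) \<odot> y) + N (y \<oplus> (- 1) \<odot> z)"
  using assms by (subst diff_add_diff[of x y z]) (auto intro: N_triangle)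

lemma norm_dist_eq:
  "x \<in> carrier M \<Longrightarrow> y \<in> carrier M \<Longrightarrow> norm_dist M N x y = N (x \<oplus> (- 1) \<odot> y)"
  by (simp add: norm_dist_def diff_smult)

lemma Metric: "Metric_space (carrier M) (norm_dist M N)"
proof
  show "0 \<le> norm_dist M N x y" for x y by (simp add: norm_dist_def N_nonneg)
  show "norm_dist M N x y = norm_dist M N y x" for x y
    by (cases "x \<in> carrier M \<and> y \<in> carrier M") (auto simp: norm_dist_eq N_diff_commute, auto simp: norm_dist_def)
  show "norm_dist M N x y = 0 \<longleftrightarrow> x = y" if "x \<in> carrier M" "y \<in> carrier M" for x y
    using that N_eq_0[of "x \<oplus> (- 1) \<odot> y"] diff_eq_0[of x y] by (auto simp: norm_dist_eq)
  show "norm_dist M N x z \<le> norm_dist M N x y + norm_dist M N y z"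
    if "x \<in> carrier M" "y \<in> carrier M" "z \<in> carrier M" for x y z
    using that N_diff_triangle by (simp add: norm_dist_eq)
qed

sublocale MS: Metric_space "carrier M" "norm_dist M N" by (rule Metric)

lemma in_closure_iff:
  "x \<in> norm_topology M N closure_of S \<longleftrightarrow>
     x \<in> carrier M \<and> (\<forall>e>0. \<exists>s\<in>S. s \<in> carrier M \<and> N (x \<oplus> (- 1) \<odot> s) < e)"
proof -
  have "s \<in> MS.mball x e \<longleftrightarrow> s \<in> carrier M \<and> N (x \<oplus> (- 1) \<odot> s) < e" if "x \<in> carrier M" for s e
    using that by (auto simp: MS.in_mball norm_dist_eq)
  then show ?thesis unfolding norm_topology_def MS.metric_closure_of by blast
qed

lemma closedin_iff:
  "closedin (norm_topology M N) D \<longleftrightarrow>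
     D \<subseteq> carrier M \<and> (\<forall>x\<in>carrier M. (\<forall>e>0. \<exists>s\<in>D. N (x \<oplus> (- 1) \<odot> s) < e) \<longrightarrow> x \<in> D)"
proof -
  have "closedin (norm_topology M N) D \<longleftrightarrow> D \<subseteq> carrier M \<and> norm_topology M N closure_of D \<subseteq> D"
    by (metis MS.topspace_mtopology closure_of_subset_eq norm_topology_def)
  moreover have "norm_topology M N closure_of D \<subseteq> D \<longleftrightarrow>
      (\<forall>x\<in>carrier M. (\<forall>e>0. \<exists>s\<in>D. N (x \<oplus> (- 1) \<odot> s) < e) \<longrightarrow> x \<in> D)" if D: "D \<subseteq> carrier M"
  proof -
    have eq: "(\<exists>s\<in>D. s \<in> carrier M \<and> N (x \<oplus> (- 1) \<odot> s) < e) \<longleftrightarrow> (\<exists>s\<in>D. N (x \<oplus> (- 1) \<odot> s) < e)" for x e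
      using D by blast
    show ?thesis unfolding subset_iff in_closure_iff eq by blast
  qed
  ultimately show ?thesis by blast
qed

text \<open>Metric completeness unfolded to statements about \<open>N\<close>, the form in which it
  is used and proved for algebras and Hilbert spaces alike.\<close>

lemma complete_iff:
  "norm_complete M N \<longleftrightarrow>
     (\<forall>X :: nat \<Rightarrow> 'a. (\<forall>n. X n \<in> carrier M) \<and> (\<forall>e>0. \<exists>K. \<forall>m\<ge>K. \<forall>n\<ge>K. N (X m \<oplus> (- 1) \<odot> X n) < e) \<longrightarrow>
        (\<exists>x\<in>carrier M. \<forall>e>0. \<exists>K. \<forall>n\<ge>K. N (X n \<oplus> (- 1) \<odot> x) < e))"
proof -
  have c: "MS.MCauchy X \<longleftrightarrow>
      (\<forall>n. X n \<in> carrier M) \<and> (\<forall>e>0. \<exists>K. \<forall>m\<ge>K. \<forall>n\<ge>K. N (X m \<oplus> (- 1) \<odot> X n) < e)" for X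
    unfolding MS.MCauchy_def by (auto simp: image_subset_iff norm_dist_eq)
  have l: "(\<exists>x. limitin MS.mtopology X x sequentially) \<longleftrightarrow>
      (\<exists>x\<in>carrier M. \<forall>e>0. \<exists>K. \<forall>n\<ge>K. N (X n \<oplus> (- 1) \<odot> x) < e)" if "\<forall>n. X n \<in> carrier M" for X
    unfolding MS.limit_metric_sequentially Bex_def using that norm_dist_eq by auto
  show ?thesis unfolding norm_complete_def MS.mcomplete_def c using l by metis
qed

lemma closure_of_submodule:
  assumes "submodule D complex_ring M"
  shows "submodule (norm_topology M N closure_of D) complex_ring M"
  unfolding submodule_iff
proof (intro conjI ballI allI)
  have D: "D \<subseteq> carrier M" "\<zero> \<in> D" "\<And>x y. x \<in> D \<Longrightarrow> y \<in> D \<Longrightarrow> x \<oplus> y \<in> D" "\<And>c x. x \<in> D \<Longrightarrow> c \<odot> x \<in> D"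
    using assms unfolding submodule_iff by auto
  let ?C = "norm_topology M N closure_of D"
  show "?C \<subseteq> carrier M" by (auto simp: in_closure_iff)
  show "\<zero> \<in> ?C" using D by (auto simp: in_closure_iff intro!: bexI[of _ "\<zero>"])
  fix x assume x: "x \<in> ?C"
  then have xc: "x \<in> carrier M" by (simp add: in_closure_iff)
  show "x \<oplus> y \<in> ?C" if y: "y \<in> ?C" for y
    unfolding in_closure_iff
  proof (intro conjI allI impI)
    have yc: "y \<in> carrier M" using y by (simp add: in_closure_iff)
    show "x \<oplus> y \<in> carrier M" using xc yc by simp
    fix e :: real assume "e > 0"
    then have e: "e / 2 > 0" by simp
    obtain s where s: "s \<in> D" "s \<in> carrier M" "N (x \<oplus> (- 1) \<odot> s) < e / 2"
      using x e unfolding in_closure_iff by blast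
    obtain t where t: "t \<in> D" "t \<in> carrier M" "N (y \<oplus> (- 1) \<odot> t) < e / 2"
      using y e unfolding in_closure_iff by blast
    have "(x \<oplus> y) \<oplus> (- 1) \<odot> (s \<oplus> t) = (x \<oplus> (- 1) \<odot> s) \<oplus> (y \<oplus> (- 1) \<odot> t)"
      using xc yc s t by (simp add: smult_add_right M.a_ac)
    also have "N \<dots> \<le> N (x \<oplus> (- 1) \<odot> s) + N (y \<oplus> (- 1) \<odot> t)"
      by (rule N_triangle) (use xc yc s t in auto)
    finally show "\<exists>u\<in>D. u \<in> carrier M \<and> N ((x \<oplus> y) \<oplus> (- 1) \<odot> u) < e"
      using s t D by (intro bexI[of _ "s \<oplus> t"]) auto
  qed
  show "c \<odot> x \<in> ?C" for c
    unfolding in_closure_iff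
  proof (intro conjI allI impI)
    show "c \<odot> x \<in> carrier M" using xc by simp
    fix e :: real assume e: "e > 0"
    \<comment> \<open>Dividing by \<open>cmod c + 1\<close> covers \<open>c = 0\<close> as
      well.\<close>
    obtain s where s: "s \<in> D" "s \<in> carrier M" "N (x \<oplus> (- 1) \<odot> s) < e / (cmod c + 1)"
      using x e unfolding in_closure_iff by (metis divide_pos_pos norm_ge_zero add_nonneg_pos zero_less_one)
    have "c \<odot> x \<oplus> (- 1) \<odot> (c \<odot> s) = c \<odot> (x \<oplus> (- 1) \<odot> s)"
      using xc s by (simp add: smult_add_right smult_smult)
    then have "N (c \<odot> x \<oplus> (- 1) \<odot> (c \<odot> s)) = cmod c * N (x \<oplus> (- 1) \<odot> s)"
      using xc s by (simp add: N_smult)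
    also have "\<dots> \<le> (cmod c + 1) * N (x \<oplus> (- 1) \<odot> s)"
      using xc s N_nonneg by (intro mult_right_mono) auto
    also have "\<dots> < e" using s(3) add_nonneg_pos[OF norm_ge_zero[of c] zero_less_one]
      by (simp add: pos_less_divide_eq mult.commute)
    finally show "\<exists>u\<in>D. u \<in> carrier M \<and> N (c \<odot> x \<oplus> (- 1) \<odot> u) < e"
      using s D by (intro bexI[of _ "c \<odot> s"]) auto
  qed
qed

lemma closed_span_submodule:
  assumes "S \<subseteq> carrier M" shows "submodule (closed_span M N S) complex_ring M"
  unfolding closed_span_def by (rule closure_of_submodule[OF lin_span_submodule(1)[OF assms]])

lemma subset_closed_span:
  assumes "S \<subseteq> carrier M" shows "S \<subseteq> closed_span M N S"
  using lin_span_submodule(2)[OF assms] assms closure_of_subset[of "lin_span M S" "norm_topology M N"]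
    lin_span_submodule(1)[OF assms]
  unfolding closed_span_def norm_topology_def submodule_iff by auto

lemma closed_span_closedin: "closedin (norm_topology M N) (closed_span M N S)"
  unfolding closed_span_def by simp

lemma closed_span_least:
  assumes "submodule L complex_ring M" "closedin (norm_topology M N) L" "S \<subseteq> L"
  shows "closed_span M N S \<subseteq> L"
  unfolding closed_span_def
  by (rule closure_of_minimal[OF lin_span_least[OF assms(1,3)] assms(2)])

end

lemma cstar_normed_module:
  assumes "cstar_algebra A" shows "normed_module A (cnorm A)"
proof -
  interpret cstar_algebra A by (rule assms)
  show ?thesis
    by unfold_locales (simp_all add: cnorm_nonneg cnorm_eq_0 cnorm_triangle cnorm_smult)
qed

text \<open>The algebraic axioms restrict to \<open>D\<close>. Completeness is the real content: a
  Cauchy sequence in \<open>D\<close> converges in \<open>A\<close>, and its limit stays in the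
  closed set \<open>D\<close>.\<close>

lemma cstar_subalgebra_cstar_algebra:
  fixes A :: "('a, 'm) cstar_scheme"
  assumes A: "cstar_algebra A" and D: "cstar_subalgebra D A"
  shows "cstar_algebra (A\<lparr>carrier := D\<rparr>)"
proof -
  interpret cstar_algebra A by (rule A)
  interpret nm: normed_module A "cnorm A" by (rule cstar_normed_module[OF A])
  have sm: "submodule D complex_ring A" using D unfolding cstar_subalgebra_def by blast
  have DA: "D \<subseteq> carrier A" and clo: "\<And>x y. x \<in> D \<Longrightarrow> y \<in> D \<Longrightarrow> x \<oplus>\<^bsub>A\<^esub> y \<in> D"
      "\<And>c x. x \<in> D \<Longrightarrow> c \<odot>\<^bsub>A\<^esub> x \<in> D" "\<And>x y. x \<in> D \<Longrightarrow> y \<in> D \<Longrightarrow> x \<otimes>\<^bsub>A\<^esub> y \<in> D"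
      "\<And>x. x \<in> D \<Longrightarrow> star A x \<in> D"
    using D sm unfolding cstar_subalgebra_def nm.submodule_iff by auto
  let ?D = "A\<lparr>carrier := D\<rparr>"
  have m: "module complex_ring ?D"
    by (rule submodule.submodule_is_module[OF sm]) (rule cstar_algebra.axioms(1)[OF A])
  have dn: "normed_module ?D (cnorm A)"
    using m unfolding normed_module_def normed_module_axioms_def
    using DA by (auto simp: cnorm_nonneg cnorm_eq_0 cnorm_triangle cnorm_smult subset_iff)
  have cl: "\<forall>x\<in>carrier A. (\<forall>e>0. \<exists>s\<in>D. cnorm A (x \<oplus>\<^bsub>A\<^esub> (- 1) \<odot>\<^bsub>A\<^esub> s) < e) \<longrightarrow> x \<in> D"
    using D unfolding cstar_subalgebra_def nm.closedin_iff by blast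
  have "norm_complete ?D (cnorm A)"
  proof (rule normed_module.complete_iff[OF dn, THEN iffD2], intro allI impI, elim conjE)
    fix X :: "nat \<Rightarrow> 'a" assume X: "\<forall>n. X n \<in> carrier ?D"
      "\<forall>e>0. \<exists>K. \<forall>m\<ge>K. \<forall>n\<ge>K. cnorm A (X m \<oplus>\<^bsub>?D\<^esub> (- 1) \<odot>\<^bsub>?D\<^esub> X n) < e"
    then have XA: "X n \<in> carrier A" for n using DA by auto
    obtain x where x: "x \<in> carrier A" "\<forall>e>0. \<exists>K. \<forall>n\<ge>K. cnorm A (X n \<oplus>\<^bsub>A\<^esub> (- 1) \<odot>\<^bsub>A\<^esub> x) < e"
      using complete[unfolded nm.complete_iff, rule_format, of X] X XA by simp blast
    have "\<exists>s\<in>D. cnorm A (x \<oplus>\<^bsub>A\<^esub> (- 1) \<odot>\<^bsub>A\<^esub> s) < e" if e: "e > 0" for e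
    proof -
      obtain K where K: "\<And>n. n \<ge> K \<Longrightarrow> cnorm A (X n \<oplus>\<^bsub>A\<^esub> (- 1) \<odot>\<^bsub>A\<^esub> x) < e" using x(2) e by blast
      then have "cnorm A (x \<oplus>\<^bsub>A\<^esub> (- 1) \<odot>\<^bsub>A\<^esub> X K) < e"
        using nm.N_diff_commute[OF x(1) XA, of K] by simp
      moreover have "X K \<in> D" using X(1) by simp
      ultimately show ?thesis by blast
    qed
    then have "x \<in> D" using cl x(1) by blast
    then show "\<exists>x\<in>carrier ?D. \<forall>e>0. \<exists>K. \<forall>n\<ge>K. cnorm A (X n \<oplus>\<^bsub>?D\<^esub> (- 1) \<odot>\<^bsub>?D\<^esub> x) < e"
      using x(2) by auto
  qed
  then show ?thesis
    unfolding cstar_algebra_def cstar_algebra_axioms_def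
    using m DA
    by (auto simp: clo subset_iff mult_assoc mult_distr_l mult_distr_r smult_mult_l smult_mult_r
      star_star star_add star_smult star_mult cnorm_nonneg cnorm_eq_0 cnorm_triangle cnorm_smult cnorm_mult
      cstar_identity)
qed

section \<open>A universal unital C*-algebra\<close>

lemma (in cstar_algebra) cnorm_star: "x \<in> carrier A \<Longrightarrow> cnorm A (star A x) = cnorm A x"
proof -
  have le: "cnorm A x \<le> cnorm A (star A x)" if x: "x \<in> carrier A" for x
  proof (cases "cnorm A x = 0")
    case True then show ?thesis using cnorm_nonneg x star_closed by simp
  next
    case False
    then have "cnorm A x > 0" using cnorm_nonneg[OF x] by simp
    moreover have "cnorm A x * cnorm A x \<le> cnorm A (star A x) * cnorm A x"
      using cnorm_mult[of "star A x" x] cstar_identity[OF x] x star_closed by (simp add: power2_eq_square)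
    ultimately show ?thesis by simp
  qed
  assume "x \<in> carrier A"
  then show ?thesis using le[of x] le[of "star A x"] star_closed by (simp add: star_star)
qed

definition unital_cstar :: "'a cstar \<Rightarrow> bool" where
  "unital_cstar A \<longleftrightarrow> cstar_algebra A \<and> \<one>\<^bsub>A\<^esub> \<in> carrier A \<and>
     (\<forall>x\<in>carrier A. \<one>\<^bsub>A\<^esub> \<otimes>\<^bsub>A\<^esub> x = x \<and> x \<otimes>\<^bsub>A\<^esub> \<one>\<^bsub>A\<^esub> = x)"

locale unital_cstar_algebra = cstar_algebra A for A :: "'a cstar" (structure) +
  assumes one_closed [simp]: "\<one> \<in> carrier A"
    and one_left [simp]: "x \<in> carrier A \<Longrightarrow> \<one> \<otimes> x = x"
    and one_right [simp]: "x \<in> carrier A \<Longrightarrow> x \<otimes> \<one> = x"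
begin

sublocale normed_module A "cnorm A"
  by (rule cstar_normed_module) (rule cstar_algebra_axioms)

lemmas closed_rules [simp] = mult_closed star_closed

lemma star_one [simp]: "star A \<one> = \<one>"
proof -
  have "star A (star A \<one> \<otimes> \<one>) = star A \<one> \<otimes> star A (star A \<one>)" by (rule star_mult) simp_all
  then show ?thesis by (simp add: star_star)
qed

lemma cnorm_one: "cnorm A \<one> \<le> 1"
proof -
  have "cnorm A \<one> = (cnorm A \<one>)\<^sup>2" using cstar_identity[of \<one>] by simp
  then have "cnorm A \<one> * (cnorm A \<one> - 1) = 0" by (simp add: power2_eq_square algebra_simps)
  then show ?thesis by auto
qed

lemma star_zero: "star A \<zero> = \<zero>"
  using star_smult[of \<zero> 0] by simp

lemma mult_zero_right [simp]: "x \<in> carrier A \<Longrightarrow> x \<otimes> \<zero> = \<zero>"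
  using smult_mult_r[of x \<zero> 0] by simp

end

lemma unital_cstar_algebra_iff: "unital_cstar_algebra A \<longleftrightarrow> unital_cstar A"
  unfolding unital_cstar_def unital_cstar_algebra_def unital_cstar_algebra_axioms_def by blast

text \<open>
  Bounded families with a member in each unital C*-algebra on the type. These may all be zero algebras;
  the additional scalar coordinate guarantees \<open>0 \<noteq> 1\<close>.
\<close>

typedef 'a ucstar = "{(z :: complex, f :: 'a cstar \<Rightarrow> 'a).
    (\<forall>A. unital_cstar A \<longrightarrow> f A \<in> carrier A) \<and> (\<forall>A. \<not> unital_cstar A \<longrightarrow> f A = undefined) \<and>
    (\<exists>K. \<forall>A. unital_cstar A \<longrightarrow> cnorm A (f A) \<le> K)}"
proof -
  have "\<zero>\<^bsub>A\<^esub> \<in> carrier A \<and> cnorm A \<zero>\<^bsub>A\<^esub> = 0" if "unital_cstar A" for A :: "'a cstar"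
  proof -
    interpret unital_cstar_algebra A using that by (simp add: unital_cstar_algebra_iff)
    show ?thesis by simp
  qed
  then show ?thesis
    by (intro exI[of _ "(0, \<lambda>A. if unital_cstar A then \<zero>\<^bsub>A\<^esub> else undefined)"]) auto
qed

definition sca :: "'a ucstar \<Rightarrow> complex" where "sca x = fst (Rep_ucstar x)"
definition coord :: "'a ucstar \<Rightarrow> 'a cstar \<Rightarrow> 'a" where "coord x = snd (Rep_ucstar x)"
definition mk :: "complex \<Rightarrow> ('a cstar \<Rightarrow> 'a) \<Rightarrow> 'a ucstar" where
  "mk z f = Abs_ucstar (z, \<lambda>A. if unital_cstar A then f A else undefined)"

lemma coord_closed: "unital_cstar_algebra A \<Longrightarrow> coord x A \<in> carrier A"
  using Rep_ucstar[of x] by (auto simp: coord_def unital_cstar_algebra_iff)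

lemma ucstar_eqI:
  assumes "sca x = sca y" "\<And>A. unital_cstar_algebra A \<Longrightarrow> coord x A = coord y A" shows "x = y"
proof -
  have "coord x A = coord y A" for A
    using Rep_ucstar[of x] Rep_ucstar[of y] assms(2)[of A]
    by (cases "unital_cstar A") (auto simp: coord_def unital_cstar_algebra_iff)
  then have "Rep_ucstar x = Rep_ucstar y" using assms(1) by (simp add: sca_def coord_def prod_eq_iff fun_eq_iff)
  then show ?thesis by (simp add: Rep_ucstar_inject)
qed

text \<open>Every operation of the product goes through \<open>mk\<close>, so each needs a proof
  that its coordinates lie in the algebras and are uniformly bounded.\<close>

lemma mk:
  assumes "\<And>A. unital_cstar_algebra A \<Longrightarrow> f A \<in> carrier A" "\<And>A. unital_cstar_algebra A \<Longrightarrow> cnorm A (f A) \<le> K"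
  shows "sca (mk z f) = z" "unital_cstar_algebra A \<Longrightarrow> coord (mk z f) A = f A"
proof -
  have "Rep_ucstar (mk z f) = (z, \<lambda>A. if unital_cstar A then f A else undefined)"
    unfolding mk_def by (rule Abs_ucstar_inverse) (use assms in \<open>auto simp: unital_cstar_algebra_iff\<close>)
  then show "sca (mk z f) = z" "unital_cstar_algebra A \<Longrightarrow> coord (mk z f) A = f A" by (simp_all add: sca_def coord_def unital_cstar_algebra_iff)
qed

definition unorm :: "'a ucstar \<Rightarrow> real" where
  "unorm x = Sup (insert (cmod (sca x)) {cnorm A (coord x A) |A. unital_cstar_algebra A})"

lemma unorm_le_iff: "unorm x \<le> K \<longleftrightarrow> cmod (sca x) \<le> K \<and> (\<forall>A. unital_cstar_algebra A \<longrightarrow> cnorm A (coord x A) \<le> K)"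
proof -
  obtain L where L: "\<And>A. unital_cstar_algebra A \<Longrightarrow> cnorm A (coord x A) \<le> L"
    using Rep_ucstar[of x] unfolding coord_def unital_cstar_algebra_iff case_prod_beta mem_Collect_eq by blast
  have "bdd_above (insert (cmod (sca x)) {cnorm A (coord x A) |A. unital_cstar_algebra A})"
    using L by (intro bdd_aboveI[of _ "max (cmod (sca x)) L"]) (auto simp: le_max_iff_disj)
  then show ?thesis unfolding unorm_def by (subst cSup_le_iff) auto
qed

lemma unorm_upper: "cmod (sca x) \<le> unorm x" "unital_cstar_algebra A \<Longrightarrow> cnorm A (coord x A) \<le> unorm x"
  using unorm_le_iff[of x "unorm x"] by auto

lemma unorm_nonneg: "0 \<le> unorm x"
  using unorm_upper(1)[of x] norm_ge_zero order_trans by blast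

instantiation ucstar :: (type) real_normed_algebra_1
begin

definition "0 = mk 0 (\<lambda>A. \<zero>\<^bsub>A\<^esub>)"
definition "1 = mk 1 (\<lambda>A. \<one>\<^bsub>A\<^esub>)"
definition "x + y = mk (sca x + sca y) (\<lambda>A. coord x A \<oplus>\<^bsub>A\<^esub> coord y A)"
definition "x * y = mk (sca x * sca y) (\<lambda>A. coord x A \<otimes>\<^bsub>A\<^esub> coord y A)"
definition "- x = mk (- sca x) (\<lambda>A. (- 1) \<odot>\<^bsub>A\<^esub> coord x A)"
definition "x - y = mk (sca x - sca y) (\<lambda>A. coord x A \<oplus>\<^bsub>A\<^esub> (- 1) \<odot>\<^bsub>A\<^esub> coord y A)"
definition "r *\<^sub>R x = mk (of_real r * sca x) (\<lambda>A. of_real r \<odot>\<^bsub>A\<^esub> coord x A)"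
definition "norm x = unorm (x :: 'a ucstar)"
definition "sgn x = inverse (norm x) *\<^sub>R (x :: 'a ucstar)"
definition "dist x y = norm (x - y :: 'a ucstar)"
definition [code del]: "uniformity = (INF e\<in>{0<..}. principal {(x, y :: 'a ucstar). dist x y < e})"
definition [code del]: "open (U :: 'a ucstar set) \<longleftrightarrow> (\<forall>x\<in>U. \<forall>\<^sub>F (x', y) in uniformity. x' = x \<longrightarrow> y \<in> U)"

lemma norm_upper: "cmod (sca x) \<le> norm x" "unital_cstar_algebra A \<Longrightarrow> cnorm A (coord x A) \<le> norm x"
  using unorm_upper(1)[of x] unorm_upper(2)[of A x] by (simp_all add: norm_ucstar_def)

lemma norm_ucstar_nonneg: "0 \<le> norm (x :: 'a ucstar)"
  using unorm_nonneg[of x] by (simp add: norm_ucstar_def)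

lemma ucstar_zero: "sca 0 = 0" "unital_cstar_algebra A \<Longrightarrow> coord 0 A = \<zero>\<^bsub>A\<^esub>"
proof -
  have "\<zero>\<^bsub>A\<^esub> \<in> carrier A \<and> cnorm A \<zero>\<^bsub>A\<^esub> \<le> 0" if "unital_cstar_algebra A" for A :: "'a cstar"
  proof - interpret unital_cstar_algebra A by fact show ?thesis by simp qed
  then show "sca 0 = 0" "unital_cstar_algebra A \<Longrightarrow> coord 0 A = \<zero>\<^bsub>A\<^esub>" unfolding zero_ucstar_def by (blast intro: mk)+
qed

lemma ucstar_one: "sca 1 = 1" "unital_cstar_algebra A \<Longrightarrow> coord 1 A = \<one>\<^bsub>A\<^esub>"
proof -
  have "\<one>\<^bsub>A\<^esub> \<in> carrier A \<and> cnorm A \<one>\<^bsub>A\<^esub> \<le> 1" if "unital_cstar_algebra A" for A :: "'a cstar"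
  proof - interpret unital_cstar_algebra A by fact show ?thesis by (simp add: cnorm_one) qed
  then show "sca 1 = 1" "unital_cstar_algebra A \<Longrightarrow> coord 1 A = \<one>\<^bsub>A\<^esub>" unfolding one_ucstar_def by (blast intro: mk)+
qed

lemma ucstar_add: "sca (x + y) = sca x + sca y" "unital_cstar_algebra A \<Longrightarrow> coord (x + y) A = coord x A \<oplus>\<^bsub>A\<^esub> coord y A"
proof -
  have "coord x A \<oplus>\<^bsub>A\<^esub> coord y A \<in> carrier A \<and> cnorm A (coord x A \<oplus>\<^bsub>A\<^esub> coord y A) \<le> norm x + norm y" if A: "unital_cstar_algebra A" for A
  proof -
    interpret unital_cstar_algebra A by fact
    note c = coord_closed[OF A, of x] coord_closed[OF A, of y]
    show ?thesis using c cnorm_triangle[OF c] norm_upper(2)[OF A, of x] norm_upper(2)[OF A, of y] by simp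
  qed
  then show "sca (x + y) = sca x + sca y" "unital_cstar_algebra A \<Longrightarrow> coord (x + y) A = coord x A \<oplus>\<^bsub>A\<^esub> coord y A"
    unfolding plus_ucstar_def by (blast intro: mk)+
qed

lemma ucstar_smult_aux:
  fixes x :: "'a ucstar"
  shows
  "sca (mk (c * sca x) (\<lambda>A. c \<odot>\<^bsub>A\<^esub> coord x A)) = c * sca x"
  "unital_cstar_algebra A \<Longrightarrow> coord (mk (c * sca x) (\<lambda>A. c \<odot>\<^bsub>A\<^esub> coord x A)) A = c \<odot>\<^bsub>A\<^esub> coord x A"
proof -
  have "c \<odot>\<^bsub>A\<^esub> coord x A \<in> carrier A \<and> cnorm A (c \<odot>\<^bsub>A\<^esub> coord x A) \<le> cmod c * norm x" if A: "unital_cstar_algebra A" for A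
  proof -
    interpret unital_cstar_algebra A by fact
    note c = coord_closed[OF A, of x]
    show ?thesis using c norm_upper(2)[OF A, of x] by (simp add: cnorm_smult mult_left_mono)
  qed
  then show "sca (mk (c * sca x) (\<lambda>A. c \<odot>\<^bsub>A\<^esub> coord x A)) = c * sca x"
    "unital_cstar_algebra A \<Longrightarrow> coord (mk (c * sca x) (\<lambda>A. c \<odot>\<^bsub>A\<^esub> coord x A)) A = c \<odot>\<^bsub>A\<^esub> coord x A"
    by (blast intro: mk)+
qed

lemma ucstar_scaleR: "sca (r *\<^sub>R x) = of_real r * sca x" "unital_cstar_algebra A \<Longrightarrow> coord (r *\<^sub>R x) A = of_real r \<odot>\<^bsub>A\<^esub> coord x A"
  unfolding scaleR_ucstar_def by (rule ucstar_smult_aux; assumption)+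

lemma ucstar_minus: "sca (- x) = - sca x" "unital_cstar_algebra A \<Longrightarrow> coord (- x) A = (- 1) \<odot>\<^bsub>A\<^esub> coord x A"
  using ucstar_smult_aux[where c="- 1" and x=x] by (simp_all add: uminus_ucstar_def)

lemma ucstar_diff: "sca (x - y) = sca x - sca y" "unital_cstar_algebra A \<Longrightarrow> coord (x - y) A = coord x A \<oplus>\<^bsub>A\<^esub> (- 1) \<odot>\<^bsub>A\<^esub> coord y A"
proof -
  have "coord x A \<oplus>\<^bsub>A\<^esub> (- 1) \<odot>\<^bsub>A\<^esub> coord y A \<in> carrier A \<and>
      cnorm A (coord x A \<oplus>\<^bsub>A\<^esub> (- 1) \<odot>\<^bsub>A\<^esub> coord y A) \<le> norm x + norm y" if A: "unital_cstar_algebra A" for A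
  proof -
    interpret unital_cstar_algebra A by fact
    note c = coord_closed[OF A, of x] coord_closed[OF A, of y]
    show ?thesis using c cnorm_triangle[of "coord x A" "(- 1) \<odot>\<^bsub>A\<^esub> coord y A"]
        norm_upper(2)[OF A, of x] norm_upper(2)[OF A, of y] by (simp add: cnorm_smult)
  qed
  then show "sca (x - y) = sca x - sca y" "unital_cstar_algebra A \<Longrightarrow> coord (x - y) A = coord x A \<oplus>\<^bsub>A\<^esub> (- 1) \<odot>\<^bsub>A\<^esub> coord y A"
    unfolding minus_ucstar_def by (blast intro: mk)+
qed

lemma ucstar_mult: "sca (x * y) = sca x * sca y" "unital_cstar_algebra A \<Longrightarrow> coord (x * y) A = coord x A \<otimes>\<^bsub>A\<^esub> coord y A"
proof -
  have "coord x A \<otimes>\<^bsub>A\<^esub> coord y A \<in> carrier A \<and> cnorm A (coord x A \<otimes>\<^bsub>A\<^esub> coord y A) \<le> norm x * norm y" if A: "unital_cstar_algebra A" for A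
  proof -
    interpret unital_cstar_algebra A by fact
    note c = coord_closed[OF A, of x] coord_closed[OF A, of y]
    have "cnorm A (coord x A) * cnorm A (coord y A) \<le> norm x * norm y"
      using norm_upper(2)[OF A, of x] norm_upper(2)[OF A, of y] cnorm_nonneg c norm_ucstar_nonneg by (intro mult_mono) auto
    then show ?thesis using c cnorm_mult[OF c] by simp
  qed
  then show "sca (x * y) = sca x * sca y" "unital_cstar_algebra A \<Longrightarrow> coord (x * y) A = coord x A \<otimes>\<^bsub>A\<^esub> coord y A"
    unfolding times_ucstar_def by (blast intro: mk)+
qed

lemmas sca_simps = ucstar_zero(1) ucstar_one(1) ucstar_add(1) ucstar_scaleR(1)
  ucstar_minus(1) ucstar_diff(1) ucstar_mult(1)
lemmas coord_simps = ucstar_zero(2) ucstar_one(2) ucstar_add(2) ucstar_scaleR(2)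
  ucstar_minus(2) ucstar_diff(2) ucstar_mult(2)

lemma ucstar_norm_le_iff:
  "norm (x :: 'a ucstar) \<le> K \<longleftrightarrow> cmod (sca x) \<le> K \<and> (\<forall>A. unital_cstar_algebra A \<longrightarrow> cnorm A (coord x A) \<le> K)"
  by (simp add: norm_ucstar_def unorm_le_iff)

text \<open>Limits exist in each coordinate, and the Cauchy condition controls the distance to them
  uniformly over the coordinates. The inequality in the conclusion is weak because it is obtained by
  passing to a limit.\<close>

lemma ucstar_complete:
  fixes X :: "nat \<Rightarrow> 'a ucstar"
  assumes X: "\<And>e. e > 0 \<Longrightarrow> \<exists>K. \<forall>m\<ge>K. \<forall>n\<ge>K. norm (X m - X n) < e"
  obtains x where "\<And>e. e > 0 \<Longrightarrow> \<exists>K. \<forall>n\<ge>K. norm (X n - x) \<le> e"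
proof -
  have s: "cmod (sca (X m) - sca (X n)) \<le> norm (X m - X n)" for m n
    using norm_upper(1)[of "X m - X n"] by (simp add: sca_simps)
  have "Cauchy (\<lambda>n. sca (X n))"
    unfolding Cauchy_iff using X order_le_less_trans[OF s] by meson
  then obtain z where z: "(\<lambda>n. sca (X n)) \<longlonglongrightarrow> z" using Cauchy_convergent convergent_def by blast
  have "\<exists>a. a \<in> carrier A \<and> (\<forall>e>0. \<exists>K. \<forall>n\<ge>K. cnorm A (coord (X n) A \<oplus>\<^bsub>A\<^esub> (- 1) \<odot>\<^bsub>A\<^esub> a) < e)"
    if A: "unital_cstar_algebra A" for A
  proof -
    interpret unital_cstar_algebra A by fact
    have "cnorm A (coord (X m) A \<oplus>\<^bsub>A\<^esub> (- 1) \<odot>\<^bsub>A\<^esub> coord (X n) A) \<le> norm (X m - X n)" for m n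
      using norm_upper(2)[OF A, of "X m - X n"] by (simp add: coord_simps A)
    then have "\<forall>e>0. \<exists>K. \<forall>m\<ge>K. \<forall>n\<ge>K. cnorm A (coord (X m) A \<oplus>\<^bsub>A\<^esub> (- 1) \<odot>\<^bsub>A\<^esub> coord (X n) A) < e"
      using X order_le_less_trans by meson
    then show ?thesis using complete[unfolded complete_iff, rule_format, of "\<lambda>n. coord (X n) A"] coord_closed[OF A] by blast
  qed
  then obtain f where f: "\<And>A. unital_cstar_algebra A \<Longrightarrow> f A \<in> carrier A"
    "\<And>A e. unital_cstar_algebra A \<Longrightarrow> e > 0 \<Longrightarrow> \<exists>K. \<forall>n\<ge>K. cnorm A (coord (X n) A \<oplus>\<^bsub>A\<^esub> (- 1) \<odot>\<^bsub>A\<^esub> f A) < e"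
    by metis
  have lim: "cnorm A (coord (X n) A \<oplus>\<^bsub>A\<^esub> (- 1) \<odot>\<^bsub>A\<^esub> f A) \<le> e"
    if A: "unital_cstar_algebra A" and K: "\<And>m. m \<ge> K \<Longrightarrow> norm (X n - X m) < e" for A n e and K :: nat
  proof (rule field_le_epsilon)
    interpret unital_cstar_algebra A by fact
    fix d :: real assume d: "d > 0"
    obtain L where L: "\<And>m. m \<ge> L \<Longrightarrow> cnorm A (coord (X m) A \<oplus>\<^bsub>A\<^esub> (- 1) \<odot>\<^bsub>A\<^esub> f A) < d" using f(2)[OF A d] by blast
    define m where "m = max K L"
    have "cnorm A (coord (X n) A \<oplus>\<^bsub>A\<^esub> (- 1) \<odot>\<^bsub>A\<^esub> f A)
        \<le> cnorm A (coord (X n) A \<oplus>\<^bsub>A\<^esub> (- 1) \<odot>\<^bsub>A\<^esub> coord (X m) A) + cnorm A (coord (X m) A \<oplus>\<^bsub>A\<^esub> (- 1) \<odot>\<^bsub>A\<^esub> f A)"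
      by (rule N_diff_triangle) (use coord_closed[OF A] f(1)[OF A] in auto)
    also have "cnorm A (coord (X n) A \<oplus>\<^bsub>A\<^esub> (- 1) \<odot>\<^bsub>A\<^esub> coord (X m) A) \<le> norm (X n - X m)"
      using norm_upper(2)[OF A, of "X n - X m"] by (simp add: coord_simps A)
    finally show "cnorm A (coord (X n) A \<oplus>\<^bsub>A\<^esub> (- 1) \<odot>\<^bsub>A\<^esub> f A) \<le> e + d"
      using K[of m] L[of m] by (simp add: m_def)
  qed
  \<comment> \<open>From \<open>K1\<close> on the sequence stays within 1 of \<open>X K1\<close>;
    this bounds the limits uniformly, so that they form an element of the product.\<close>
  obtain K1 where K1: "\<And>m n. m \<ge> K1 \<Longrightarrow> n \<ge> K1 \<Longrightarrow> norm (X m - X n) < 1" using X[of 1] by auto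
  have bd: "cnorm A (f A) \<le> 1 + norm (X K1)" if A: "unital_cstar_algebra A" for A
  proof -
    interpret unital_cstar_algebra A by fact
    note c = coord_closed[OF A, of "X K1"] f(1)[OF A]
    have "cnorm A (f A \<oplus>\<^bsub>A\<^esub> (- 1) \<odot>\<^bsub>A\<^esub> \<zero>\<^bsub>A\<^esub>) \<le> cnorm A (f A \<oplus>\<^bsub>A\<^esub> (- 1) \<odot>\<^bsub>A\<^esub> coord (X K1) A) + cnorm A (coord (X K1) A \<oplus>\<^bsub>A\<^esub> (- 1) \<odot>\<^bsub>A\<^esub> \<zero>\<^bsub>A\<^esub>)"
      by (rule N_diff_triangle) (use c in auto)
    also have "cnorm A (f A \<oplus>\<^bsub>A\<^esub> (- 1) \<odot>\<^bsub>A\<^esub> coord (X K1) A) \<le> 1"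
      using lim[OF A, of K1 K1 1] K1 N_diff_commute[OF c] by simp
    finally show ?thesis using norm_upper(2)[OF A, of "X K1"] c by simp
  qed
  define x where "x = mk z f"
  have x: "sca x = z" "\<And>A. unital_cstar_algebra A \<Longrightarrow> coord x A = f A"
    unfolding x_def using mk[of f, OF f(1) bd] by auto
  show thesis
  proof (rule that)
    fix e :: real assume e: "e > 0"
    obtain K where K: "\<And>m n. m \<ge> K \<Longrightarrow> n \<ge> K \<Longrightarrow> norm (X m - X n) < e" using X[OF e] by blast
    obtain L where L: "\<And>n. n \<ge> L \<Longrightarrow> cmod (sca (X n) - z) < e" using LIMSEQ_D[OF z e] by auto
    have "norm (X n - x) \<le> e" if "n \<ge> max K L" for n
      unfolding ucstar_norm_le_iff
    proof (intro conjI allI impI)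
      show "cmod (sca (X n - x)) \<le> e" using L[of n] that by (simp add: sca_simps x)
      fix A :: "'a cstar" assume A: "unital_cstar_algebra A"
      show "cnorm A (coord (X n - x) A) \<le> e" using lim[OF A, of K n e] K that by (simp add: coord_simps A x)
    qed
    then show "\<exists>K. \<forall>n\<ge>K. norm (X n - x) \<le> e" by blast
  qed
qed

instance
proof
  fix x y z :: "'a ucstar" and r s :: real
  have c: "unital_cstar_algebra A \<Longrightarrow> coord w A \<in> carrier A" for A and w :: "'a ucstar" by (rule coord_closed)
  show "dist x y = norm (x - y)" by (rule dist_ucstar_def)
  show "sgn x = inverse (norm x) *\<^sub>R x" by (rule sgn_ucstar_def)
  show "uniformity = (INF e\<in>{0<..}. principal {(x, y :: 'a ucstar). dist x y < e})" by (rule uniformity_ucstar_def)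
  show "open U \<longleftrightarrow> (\<forall>x\<in>U. \<forall>\<^sub>F (x', y) in uniformity. x' = x \<longrightarrow> y \<in> U)" for U :: "'a ucstar set"
    by (rule open_ucstar_def)
  show "x + y + z = x + (y + z)"
  proof (rule ucstar_eqI)
    fix A :: "'a cstar" assume A: "unital_cstar_algebra A" then interpret unital_cstar_algebra A .
    show "coord (x + y + z) A = coord (x + (y + z)) A" by (simp add: coord_simps A c M.a_assoc)
  qed (simp add: sca_simps)
  show "x + y = y + x"
  proof (rule ucstar_eqI)
    fix A :: "'a cstar" assume A: "unital_cstar_algebra A" then interpret unital_cstar_algebra A .
    show "coord (x + y) A = coord (y + x) A" by (simp add: coord_simps A c M.a_comm)
  qed (simp add: sca_simps)
  show "0 + x = x"
  proof (rule ucstar_eqI)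
    fix A :: "'a cstar" assume A: "unital_cstar_algebra A" then interpret unital_cstar_algebra A .
    show "coord (0 + x) A = coord x A" by (simp add: coord_simps A c)
  qed (simp add: sca_simps)
  show "- x + x = 0"
  proof (rule ucstar_eqI)
    fix A :: "'a cstar" assume A: "unital_cstar_algebra A" then interpret unital_cstar_algebra A .
    show "coord (- x + x) A = coord 0 A" using add_neg[OF c[OF A, of x]] by (simp add: coord_simps A c M.a_comm)
  qed (simp add: sca_simps)
  show "x - y = x + - y"
    by (rule ucstar_eqI) (simp_all add: coord_simps sca_simps)
  show "r *\<^sub>R (x + y) = r *\<^sub>R x + r *\<^sub>R y"
  proof (rule ucstar_eqI)
    fix A :: "'a cstar" assume A: "unital_cstar_algebra A" then interpret unital_cstar_algebra A .
    show "coord (r *\<^sub>R (x + y)) A = coord (r *\<^sub>R x + r *\<^sub>R y) A" by (simp add: coord_simps A c smult_add_right)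
  qed (simp add: sca_simps algebra_simps)
  show "(r + s) *\<^sub>R x = r *\<^sub>R x + s *\<^sub>R x"
  proof (rule ucstar_eqI)
    fix A :: "'a cstar" assume A: "unital_cstar_algebra A" then interpret unital_cstar_algebra A .
    show "coord ((r + s) *\<^sub>R x) A = coord (r *\<^sub>R x + s *\<^sub>R x) A" by (simp add: coord_simps A c smult_add_left)
  qed (simp add: sca_simps algebra_simps)
  show "r *\<^sub>R s *\<^sub>R x = (r * s) *\<^sub>R x"
  proof (rule ucstar_eqI)
    fix A :: "'a cstar" assume A: "unital_cstar_algebra A" then interpret unital_cstar_algebra A .
    show "coord (r *\<^sub>R s *\<^sub>R x) A = coord ((r * s) *\<^sub>R x) A" by (simp add: coord_simps A c smult_smult)
  qed (simp add: sca_simps)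
  show "1 *\<^sub>R x = x"
  proof (rule ucstar_eqI)
    fix A :: "'a cstar" assume A: "unital_cstar_algebra A" then interpret unital_cstar_algebra A .
    show "coord (1 *\<^sub>R x) A = coord x A" by (simp add: coord_simps A c)
  qed (simp add: sca_simps)
  show "x * y * z = x * (y * z)"
  proof (rule ucstar_eqI)
    fix A :: "'a cstar" assume A: "unital_cstar_algebra A" then interpret unital_cstar_algebra A .
    show "coord (x * y * z) A = coord (x * (y * z)) A" by (simp add: coord_simps A c mult_assoc)
  qed (simp add: sca_simps)
  show "(x + y) * z = x * z + y * z"
  proof (rule ucstar_eqI)
    fix A :: "'a cstar" assume A: "unital_cstar_algebra A" then interpret unital_cstar_algebra A .
    show "coord ((x + y) * z) A = coord (x * z + y * z) A" by (simp add: coord_simps A c mult_distr_l)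
  qed (simp add: sca_simps algebra_simps)
  show "x * (y + z) = x * y + x * z"
  proof (rule ucstar_eqI)
    fix A :: "'a cstar" assume A: "unital_cstar_algebra A" then interpret unital_cstar_algebra A .
    show "coord (x * (y + z)) A = coord (x * y + x * z) A" by (simp add: coord_simps A c mult_distr_r)
  qed (simp add: sca_simps algebra_simps)
  show "1 * x = x"
  proof (rule ucstar_eqI)
    fix A :: "'a cstar" assume A: "unital_cstar_algebra A" then interpret unital_cstar_algebra A .
    show "coord (1 * x) A = coord x A" by (simp add: coord_simps A c)
  qed (simp add: sca_simps)
  show "x * 1 = x"
  proof (rule ucstar_eqI)
    fix A :: "'a cstar" assume A: "unital_cstar_algebra A" then interpret unital_cstar_algebra A .
    show "coord (x * 1) A = coord x A" by (simp add: coord_simps A c)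
  qed (simp add: sca_simps)
  show "r *\<^sub>R x * y = r *\<^sub>R (x * y)"
  proof (rule ucstar_eqI)
    fix A :: "'a cstar" assume A: "unital_cstar_algebra A" then interpret unital_cstar_algebra A .
    show "coord (r *\<^sub>R x * y) A = coord (r *\<^sub>R (x * y)) A" by (simp add: coord_simps A c smult_mult_l)
  qed (simp add: sca_simps)
  show "x * r *\<^sub>R y = r *\<^sub>R (x * y)"
  proof (rule ucstar_eqI)
    fix A :: "'a cstar" assume A: "unital_cstar_algebra A" then interpret unital_cstar_algebra A .
    show "coord (x * r *\<^sub>R y) A = coord (r *\<^sub>R (x * y)) A" by (simp add: coord_simps A c smult_mult_r)
  qed (simp add: sca_simps)
  show "(0 :: 'a ucstar) \<noteq> 1" using ucstar_zero(1) ucstar_one(1) by (metis zero_neq_one)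
  show n0: "norm x = 0 \<longleftrightarrow> x = 0"
  proof
    assume n: "norm x = 0"
    show "x = 0"
    proof (rule ucstar_eqI)
      fix A :: "'a cstar" assume A: "unital_cstar_algebra A" then interpret unital_cstar_algebra A .
      have "cnorm A (coord x A) = 0"
        using norm_upper(2)[OF A, of x] n cnorm_nonneg[OF c[OF A, of x]] by simp
      then show "coord x A = coord 0 A" using cnorm_eq_0[OF c[OF A]] by (simp add: coord_simps A)
    qed (use norm_upper(1)[of x] n in \<open>simp add: sca_simps\<close>)
  next
    assume x: "x = 0"
    have "norm x \<le> 0" unfolding ucstar_norm_le_iff x
    proof (intro conjI allI impI)
      fix A :: "'a cstar" assume A: "unital_cstar_algebra A" then interpret unital_cstar_algebra A .
      show "cnorm A (coord 0 A) \<le> 0" by (simp add: coord_simps A)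
    qed (simp add: sca_simps)
    then show "norm x = 0" using norm_ucstar_nonneg[of x] by simp
  qed
  show "norm (x + y) \<le> norm x + norm y"
    unfolding ucstar_norm_le_iff
  proof (intro conjI allI impI)
    show "cmod (sca (x + y)) \<le> norm x + norm y"
      unfolding sca_simps by (rule norm_triangle_mono; rule norm_upper(1))
    fix A :: "'a cstar" assume A: "unital_cstar_algebra A" then interpret unital_cstar_algebra A .
    show "cnorm A (coord (x + y) A) \<le> norm x + norm y"
      using cnorm_triangle[OF c[OF A] c[OF A], of x y] norm_upper(2)[OF A, of x] norm_upper(2)[OF A, of y]
      by (simp add: coord_simps A)
  qed
  \<comment> \<open>One inequality for all scalars suffices: the reverse one is the case
    \<open>1 / r\<close> at \<open>r *\<^sub>R x\<close>.\<close>
  have le: "norm (r *\<^sub>R x) \<le> \<bar>r\<bar> * norm x" for r and x :: "'a ucstar"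
    unfolding ucstar_norm_le_iff
  proof (intro conjI allI impI)
    show "cmod (sca (r *\<^sub>R x)) \<le> \<bar>r\<bar> * norm x"
      unfolding sca_simps by (simp add: norm_mult mult_left_mono norm_upper(1))
    fix A :: "'a cstar" assume A: "unital_cstar_algebra A" then interpret unital_cstar_algebra A .
    show "cnorm A (coord (r *\<^sub>R x) A) \<le> \<bar>r\<bar> * norm x"
      by (simp add: coord_simps A cnorm_smult c mult_left_mono norm_upper(2))
  qed
  show "norm (r *\<^sub>R x) = \<bar>r\<bar> * norm x"
  proof (rule antisym[OF le])
    show "\<bar>r\<bar> * norm x \<le> norm (r *\<^sub>R x)"
    proof (cases "r = 0")
      case False
      have e: "(1 / r) *\<^sub>R r *\<^sub>R x = x"
      proof (rule ucstar_eqI)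
        fix A :: "'a cstar" assume A: "unital_cstar_algebra A" then interpret unital_cstar_algebra A .
        show "coord ((1 / r) *\<^sub>R r *\<^sub>R x) A = coord x A" using False
          by (simp add: coord_simps A c smult_smult)
      qed (use False in \<open>simp add: sca_simps\<close>)
      show ?thesis using le[of "1 / r" "r *\<^sub>R x"] False unfolding e by (simp add: field_simps)
    qed (simp add: norm_ucstar_nonneg)
  qed
  show "norm (x * y) \<le> norm x * norm y"
    unfolding ucstar_norm_le_iff
  proof (intro conjI allI impI)
    show "cmod (sca (x * y)) \<le> norm x * norm y"
      unfolding sca_simps norm_mult by (intro mult_mono norm_upper(1) norm_ucstar_nonneg) simp
    fix A :: "'a cstar" assume A: "unital_cstar_algebra A" then interpret unital_cstar_algebra A .
    have "cnorm A (coord x A) * cnorm A (coord y A) \<le> norm x * norm y"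
      using norm_upper(2)[OF A, of x] norm_upper(2)[OF A, of y] cnorm_nonneg c[OF A] norm_ucstar_nonneg by (intro mult_mono) auto
    then show "cnorm A (coord (x * y) A) \<le> norm x * norm y"
      using cnorm_mult[OF c[OF A] c[OF A], of x y] by (simp add: coord_simps A)
  qed
  have "norm (1 :: 'a ucstar) \<le> 1" unfolding ucstar_norm_le_iff
  proof (intro conjI allI impI)
    fix A :: "'a cstar" assume A: "unital_cstar_algebra A" then interpret unital_cstar_algebra A .
    show "cnorm A (coord 1 A) \<le> 1" by (simp add: coord_simps A cnorm_one)
  qed (simp add: sca_simps)
  then show "norm (1 :: 'a ucstar) = 1" using norm_upper(1)[of "1 :: 'a ucstar"] by (simp add: sca_simps)
qed

end

instance ucstar :: (type) banach
proof
  fix X :: "nat \<Rightarrow> 'a ucstar" assume X: "Cauchy X"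
  have "\<exists>K. \<forall>m\<ge>K. \<forall>n\<ge>K. norm (X m - X n) < e" if "e > 0" for e
    using X that unfolding Cauchy_iff by blast
  then obtain x where x: "\<And>e. e > 0 \<Longrightarrow> \<exists>K. \<forall>n\<ge>K. norm (X n - x) \<le> e" using ucstar_complete by metis
  have "X \<longlonglongrightarrow> x"
  proof (rule LIMSEQ_I)
    fix e :: real assume "e > 0"
    then obtain K where "\<And>n. n \<ge> K \<Longrightarrow> norm (X n - x) \<le> e / 2" using x[of "e / 2"] by auto
    then show "\<exists>K. \<forall>n\<ge>K. norm (X n - x) < e"
      using \<open>e > 0\<close> by (intro exI[of _ K]) force
  qed
  then show "convergent X" unfolding convergent_def by blast
qed

instantiation ucstar :: (type) cstar_ring
begin

definition "iu = mk \<i> (\<lambda>A. \<i> \<odot>\<^bsub>A\<^esub> \<one>\<^bsub>A\<^esub>)"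
definition "adj x = mk (cnj (sca x)) (\<lambda>A. star A (coord x A))"

lemma ucstar_iu: "sca iu = \<i>" "unital_cstar_algebra A \<Longrightarrow> coord iu A = \<i> \<odot>\<^bsub>A\<^esub> \<one>\<^bsub>A\<^esub>"
proof -
  have "\<i> \<odot>\<^bsub>A\<^esub> \<one>\<^bsub>A\<^esub> \<in> carrier A \<and> cnorm A (\<i> \<odot>\<^bsub>A\<^esub> \<one>\<^bsub>A\<^esub>) \<le> 1" if "unital_cstar_algebra A" for A :: "'a cstar"
  proof - interpret unital_cstar_algebra A by fact show ?thesis by (simp add: cnorm_one cnorm_smult) qed
  then show "sca iu = \<i>" "unital_cstar_algebra A \<Longrightarrow> coord iu A = \<i> \<odot>\<^bsub>A\<^esub> \<one>\<^bsub>A\<^esub>" unfolding iu_ucstar_def by (blast intro: mk)+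
qed

lemma ucstar_adj: "sca (adj x) = cnj (sca x)" "unital_cstar_algebra A \<Longrightarrow> coord (adj x) A = star A (coord x A)"
proof -
  have "star A (coord x A) \<in> carrier A \<and> cnorm A (star A (coord x A)) \<le> norm x" if A: "unital_cstar_algebra A" for A
  proof -
    interpret unital_cstar_algebra A by fact
    note c = coord_closed[OF A, of x]
    show ?thesis using c norm_upper(2)[OF A, of x] by (simp add: cnorm_star)
  qed
  then show "sca (adj x) = cnj (sca x)" "unital_cstar_algebra A \<Longrightarrow> coord (adj x) A = star A (coord x A)"
    unfolding adj_ucstar_def by (blast intro: mk)+
qed

lemmas sca_star_simps = sca_simps ucstar_iu(1) ucstar_adj(1)
lemmas coord_star_simps = coord_simps ucstar_iu(2) ucstar_adj(2)

instance
proof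
  fix x y z :: "'a ucstar" and r s :: real
  have c: "unital_cstar_algebra A \<Longrightarrow> coord w A \<in> carrier A" for A and w :: "'a ucstar" by (rule coord_closed)
  show "adj (adj x) = x"
  proof (rule ucstar_eqI)
    fix A :: "'a cstar" assume A: "unital_cstar_algebra A" then interpret unital_cstar_algebra A .
    show "coord (adj (adj x)) A = coord x A" by (simp add: coord_star_simps A c star_star)
  qed (simp add: sca_star_simps)
  show "adj (x + y) = adj x + adj y"
  proof (rule ucstar_eqI)
    fix A :: "'a cstar" assume A: "unital_cstar_algebra A" then interpret unital_cstar_algebra A .
    show "coord (adj (x + y)) A = coord (adj x + adj y) A" by (simp add: coord_star_simps A c star_add)
  qed (simp add: sca_star_simps)
  show "adj (r *\<^sub>R x) = r *\<^sub>R adj x"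
  proof (rule ucstar_eqI)
    fix A :: "'a cstar" assume A: "unital_cstar_algebra A" then interpret unital_cstar_algebra A .
    show "coord (adj (r *\<^sub>R x)) A = coord (r *\<^sub>R adj x) A" by (simp add: coord_star_simps A c star_smult)
  qed (simp add: sca_star_simps)
  show "adj (x * y) = adj y * adj x"
  proof (rule ucstar_eqI)
    fix A :: "'a cstar" assume A: "unital_cstar_algebra A" then interpret unital_cstar_algebra A .
    show "coord (adj (x * y)) A = coord (adj y * adj x) A" by (simp add: coord_star_simps A c star_mult)
  qed (simp add: sca_star_simps)
  show "iu * iu = (- 1 :: 'a ucstar)"
  proof (rule ucstar_eqI)
    fix A :: "'a cstar" assume A: "unital_cstar_algebra A" then interpret unital_cstar_algebra A .
    show "coord (iu * iu) A = coord (- 1) A" by (simp add: coord_star_simps A smult_mult_l smult_mult_r smult_smult)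
  qed (simp add: sca_star_simps)
  show "iu * x = x * iu"
  proof (rule ucstar_eqI)
    fix A :: "'a cstar" assume A: "unital_cstar_algebra A" then interpret unital_cstar_algebra A .
    show "coord (iu * x) A = coord (x * iu) A" by (simp add: coord_star_simps A smult_mult_l smult_mult_r c)
  qed (simp add: sca_star_simps)
  show "adj iu = (- iu :: 'a ucstar)"
  proof (rule ucstar_eqI)
    fix A :: "'a cstar" assume A: "unital_cstar_algebra A" then interpret unital_cstar_algebra A .
    show "coord (adj iu) A = coord (- iu) A" by (simp add: coord_star_simps A star_smult smult_smult)
  qed (simp add: sca_star_simps)
  show "norm (adj x * x) = (norm x)\<^sup>2"
  proof (rule antisym)
    have sq: "cnorm A (coord (adj x * x) A) = (cnorm A (coord x A))\<^sup>2" if A: "unital_cstar_algebra A" for A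
    proof -
      interpret unital_cstar_algebra A by fact
      show ?thesis by (simp add: coord_star_simps A c cstar_identity)
    qed
    have sz: "cmod (sca (adj x * x)) = (cmod (sca x))\<^sup>2"
      by (simp add: sca_star_simps norm_mult power2_eq_square)
    have nn: "0 \<le> cnorm A (coord x A)" if A: "unital_cstar_algebra A" for A
    proof -
      interpret unital_cstar_algebra A by fact
      show ?thesis by (simp add: c cnorm_nonneg A)
    qed
    show "norm (adj x * x) \<le> (norm x)\<^sup>2"
      unfolding ucstar_norm_le_iff
      using norm_upper(1)[of x] norm_upper(2)[where x = x] nn by (auto simp: sq sz intro!: power_mono)
    have "norm x \<le> sqrt (norm (adj x * x))"
      unfolding ucstar_norm_le_iff
      using norm_upper(1)[of "adj x * x"] norm_upper(2)[where x = "adj x * x"] by (auto simp: sq[symmetric] sz[symmetric] intro!: real_le_rsqrt)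
    then show "(norm x)\<^sup>2 \<le> norm (adj x * x)"
      using norm_ucstar_nonneg[of "adj x * x"] norm_ucstar_nonneg[of x] by (metis power_mono real_sqrt_pow2)
  qed
qed

end

section \<open>The isometric, non-unital embedding of one algebra into the product\<close>

definition emb :: "'a cstar \<Rightarrow> 'a \<Rightarrow> 'a ucstar" where
  "emb A a = mk 0 (\<lambda>A'. if A' = A then a else \<zero>\<^bsub>A'\<^esub>)"

context unital_cstar_algebra
begin

lemma unital_A: "unital_cstar_algebra A" ..

lemma emb_sca: "a \<in> carrier A \<Longrightarrow> sca (emb A a) = 0"
  and emb_coord: "a \<in> carrier A \<Longrightarrow> unital_cstar_algebra A' \<Longrightarrow> coord (emb A a) A' = (if A' = A then a else \<zero>\<^bsub>A'\<^esub>)"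
proof -
  have "(if A' = A then a else \<zero>\<^bsub>A'\<^esub>) \<in> carrier A' \<and> cnorm A' (if A' = A then a else \<zero>\<^bsub>A'\<^esub>) \<le> cnorm A a"
    if a: "a \<in> carrier A" and A': "unital_cstar_algebra A'" for A'
  proof -
    interpret B: unital_cstar_algebra A' by fact
    show ?thesis using a cnorm_nonneg[OF a] by simp
  qed
  then show "a \<in> carrier A \<Longrightarrow> sca (emb A a) = 0"
    "a \<in> carrier A \<Longrightarrow> unital_cstar_algebra A' \<Longrightarrow> coord (emb A a) A' = (if A' = A then a else \<zero>\<^bsub>A'\<^esub>)"
    unfolding emb_def by (blast intro: mk)+
qed

lemma coord_emb [simp]: "a \<in> carrier A \<Longrightarrow> coord (emb A a) A = a"
  by (simp add: emb_coord unital_A)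

lemma emb_add: "a \<in> carrier A \<Longrightarrow> b \<in> carrier A \<Longrightarrow> emb A (a \<oplus> b) = emb A a + emb A b"
proof (rule ucstar_eqI)
  fix A' :: "'a cstar" assume *: "a \<in> carrier A" "b \<in> carrier A" and A': "unital_cstar_algebra A'"
  interpret B: unital_cstar_algebra A' by fact
  show "coord (emb A (a \<oplus> b)) A' = coord (emb A a + emb A b) A'" using * by (simp add: emb_coord A' coord_star_simps)
qed (simp add: emb_sca sca_star_simps)

lemma emb_mult: "a \<in> carrier A \<Longrightarrow> b \<in> carrier A \<Longrightarrow> emb A (a \<otimes> b) = emb A a * emb A b"
proof (rule ucstar_eqI)
  fix A' :: "'a cstar" assume *: "a \<in> carrier A" "b \<in> carrier A" and A': "unital_cstar_algebra A'"
  interpret B: unital_cstar_algebra A' by fact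
  show "coord (emb A (a \<otimes> b)) A' = coord (emb A a * emb A b) A'" using * by (simp add: emb_coord A' coord_star_simps)
qed (simp add: emb_sca sca_star_simps)

lemma emb_star: "a \<in> carrier A \<Longrightarrow> emb A (star A a) = adj (emb A a)"
proof (rule ucstar_eqI)
  fix A' :: "'a cstar" assume *: "a \<in> carrier A" and A': "unital_cstar_algebra A'"
  interpret B: unital_cstar_algebra A' by fact
  show "coord (emb A (star A a)) A' = coord (adj (emb A a)) A'" using * by (simp add: emb_coord A' coord_star_simps B.star_zero)
qed (simp add: emb_sca sca_star_simps)

lemma emb_smult: "a \<in> carrier A \<Longrightarrow> emb A (c \<odot> a) = csc c (emb A a)"
proof (rule ucstar_eqI)
  fix A' :: "'a cstar" assume *: "a \<in> carrier A" and A': "unital_cstar_algebra A'"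
  interpret B: unital_cstar_algebra A' by fact
  have "c = of_real (Re c) + of_real (Im c) * \<i>" by (simp add: complex_eq_iff)
  then have "of_real (Re c) \<odot> a \<oplus> of_real (Im c) \<odot> (\<i> \<odot> a) = c \<odot> a"
    using * by (simp add: smult_smult flip: smult_add_left)
  then show "coord (emb A (c \<odot> a)) A' = coord (csc c (emb A a)) A'"
    using * by (simp add: emb_coord A' coord_star_simps csc_def smult_mult_l)
qed (simp add: emb_sca sca_star_simps csc_def)

lemma emb_zero [simp]: "emb A \<zero> = 0"
  using emb_smult[of \<zero> 0] by simp

lemma norm_emb: "a \<in> carrier A \<Longrightarrow> norm (emb A a) = cnorm A a"
proof (rule antisym)
  assume a: "a \<in> carrier A"
  show "cnorm A a \<le> norm (emb A a)" using norm_upper(2)[OF unital_A, of "emb A a"] a by simp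
  show "norm (emb A a) \<le> cnorm A a"
    unfolding ucstar_norm_le_iff
  proof (intro conjI allI impI)
    fix A' :: "'a cstar" assume A': "unital_cstar_algebra A'"
    interpret B: unital_cstar_algebra A' by fact
    show "cnorm A' (coord (emb A a) A') \<le> cnorm A a" using a cnorm_nonneg[OF a] by (simp add: emb_coord A')
  qed (simp add: emb_sca a cnorm_nonneg)
qed

lemma emb_diff: "a \<in> carrier A \<Longrightarrow> b \<in> carrier A \<Longrightarrow> emb A (a \<oplus> (- 1) \<odot> b) = emb A a - emb A b"
  using csc_of_real[of "- 1"] by (simp add: emb_add emb_smult)

lemma norm_emb_diff: "a \<in> carrier A \<Longrightarrow> b \<in> carrier A \<Longrightarrow> norm (emb A a - emb A b) = cnorm A (a \<oplus> (- 1) \<odot> b)"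
  by (simp add: norm_emb flip: emb_diff)

lemma emb_inj: "a \<in> carrier A \<Longrightarrow> b \<in> carrier A \<Longrightarrow> emb A a = emb A b \<longleftrightarrow> a = b"
  by (metis coord_emb)

text \<open>The range consists of the elements whose scalar coordinate and whose coordinates other
  than \<open>A\<close> vanish, and each coordinate is bounded by the norm.\<close>

lemma closed_range_emb: "closed (emb A ` carrier A)"
  unfolding closed_sequential_limits
proof (intro allI impI, elim conjE)
  fix X x assume X: "\<forall>n. X n \<in> emb A ` carrier A" "X \<longlonglongrightarrow> x"
  have lim: "(\<lambda>n. norm (X n - x)) \<longlonglongrightarrow> 0" using X(2) by (simp add: LIM_zero tendsto_norm_zero)
  have "x = emb A (coord x A)"
  proof (rule ucstar_eqI)
    have "cmod (sca x) \<le> norm (X n - x)" for n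
    proof -
      obtain a where "a \<in> carrier A" "X n = emb A a" using X(1) by blast
      then show ?thesis using norm_upper(1)[of "X n - x"] by (simp add: sca_star_simps emb_sca)
    qed
    then have "cmod (sca x) \<le> 0" using lim LIMSEQ_le_const by blast
    then show "sca x = sca (emb A (coord x A))" by (simp add: emb_sca coord_closed unital_A)
    fix A' :: "'a cstar" assume A': "unital_cstar_algebra A'"
    interpret B: unital_cstar_algebra A' by fact
    have "coord x A' = \<zero>\<^bsub>A'\<^esub>" if "A' \<noteq> A"
    proof -
      have "cnorm A' (coord x A') \<le> norm (X n - x)" for n
      proof -
        obtain a where a: "a \<in> carrier A" "X n = emb A a" using X(1) by blast
        have "coord (X n - x) A' = (- 1) \<odot>\<^bsub>A'\<^esub> coord x A'"
          using a that by (simp add: coord_star_simps A' emb_coord coord_closed)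
        then show ?thesis using norm_upper(2)[OF A', of "X n - x"] by (simp add: B.cnorm_smult coord_closed A')
      qed
      then have "cnorm A' (coord x A') \<le> 0" using lim LIMSEQ_le_const by blast
      then show ?thesis using B.cnorm_eq_0 B.cnorm_nonneg coord_closed[OF A'] by (metis order_antisym)
    qed
    then show "coord x A' = coord (emb A (coord x A)) A'" by (simp add: emb_coord coord_closed unital_A A')
  qed
  then show "x \<in> emb A ` carrier A" using coord_closed[OF unital_A] by blast
qed

end

section \<open>Homomorphisms and generated subalgebras\<close>

text \<open>The stand-in for \<open>sqrt (1 - a^2)\<close>. The root is built in the product and
  returns to \<open>A\<close> because the range of \<open>emb\<close> is closed and stable under the
  iteration. As \<open>emb A \<one>\<close> is a projection different from 1, the equation is
  carried over in the form \<open>y + y - y * y = x\<close>.\<close>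

lemma (in unital_cstar_algebra) complementary_root:
  assumes a: "a \<in> carrier A" "star A a = a" "cnorm A a \<le> 1"
  obtains c where "c \<in> carrier A" "star A c = c" "a \<otimes> a \<oplus> c \<otimes> c = \<one>" "a \<otimes> c = c \<otimes> a"
proof -
  define x where "x = emb A (a \<otimes> a)"
  have ha: "adj (emb A a) = emb A a" using a emb_star by metis
  have xa: "x = emb A a * emb A a" using a by (simp add: x_def emb_mult)
  have sx: "adj x = x" by (simp add: xa adj_mult ha)
  have "norm x = (cnorm A a)\<^sup>2" unfolding xa norm_sa_square[OF ha] using a by (simp add: norm_emb)
  then have nx: "norm x \<le> 1" using a cnorm_nonneg by (simp add: power_le_one)
  obtain y where y: "(1 - y) * (1 - y) = 1 - x" "adj y = y" "\<And>z. z * x = x * z \<Longrightarrow> z * y = y * z"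
    and yS: "\<And>S. \<lbrakk>closed S; 0 \<in> S; x \<in> S; \<And>a b. a \<in> S \<Longrightarrow> b \<in> S \<Longrightarrow> a + b \<in> S; \<And>r a. a \<in> S \<Longrightarrow> r *\<^sub>R a \<in> S;
       \<And>a b. a \<in> S \<Longrightarrow> a * a \<in> S\<rbrakk> \<Longrightarrow> y \<in> S"
    using sa_root_exists[OF nx sx] by metis
  have "y \<in> emb A ` carrier A"
  proof (rule yS[OF closed_range_emb])
    show "0 \<in> emb A ` carrier A" by (metis M.zero_closed emb_zero image_eqI)
    show "x \<in> emb A ` carrier A" using a by (simp add: x_def)
    show "u + v \<in> emb A ` carrier A" if "u \<in> emb A ` carrier A" "v \<in> emb A ` carrier A" for u v
      using that by (auto simp flip: emb_add)
    show "r *\<^sub>R u \<in> emb A ` carrier A" if "u \<in> emb A ` carrier A" for r u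
      using that by (auto simp flip: emb_smult csc_of_real)
    show "u * u \<in> emb A ` carrier A" if "u \<in> emb A ` carrier A" for u
      using that by (auto simp flip: emb_mult)
  qed
  then obtain b where b: "b \<in> carrier A" "y = emb A b" by blast
  define c where "c = \<one> \<oplus> (- 1) \<odot> b"
  have cc: "c \<in> carrier A" using b by (simp add: c_def)
  have ec: "emb A c = emb A \<one> - y" using b by (simp add: c_def emb_diff)
  have e: "emb A \<one> * emb A z = emb A z" "emb A z * emb A \<one> = emb A z" if "z \<in> carrier A" for z
    using that by (simp_all flip: emb_mult)
  have "emb A (c \<otimes> c) = emb A \<one> - (y + y - y * y)"
    using cc e b(1) by (simp add: emb_mult ec b(2) algebra_simps)
  also have "y + y - y * y = x" using y(1) by (simp add: algebra_simps)
  finally have "emb A (c \<otimes> c) = emb A \<one> - x" .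
  then have "emb A (a \<otimes> a \<oplus> c \<otimes> c) = emb A \<one>" using a cc by (simp add: emb_add x_def)
  then have 1: "a \<otimes> a \<oplus> c \<otimes> c = \<one>" using a cc by (subst (asm) emb_inj) auto
  have "emb A (star A c) = emb A c"
    using y(2) by (simp add: emb_star cc ec adj_diff flip: emb_star[of \<one>])
  then have 2: "star A c = c" using cc by (subst (asm) emb_inj) auto
  have "emb A a * y = y * emb A a" by (rule y(3)) (simp add: xa mult.assoc)
  then have "emb A (a \<otimes> c) = emb A (c \<otimes> a)" using a cc e by (simp add: emb_mult ec algebra_simps)
  then have 3: "a \<otimes> c = c \<otimes> a" using a cc by (subst (asm) emb_inj) auto
  show thesis using that cc 1 2 3 by blast
qed

lemma cstar_homD:
  assumes "cstar_hom A B \<phi>"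
  shows "x \<in> carrier A \<Longrightarrow> \<phi> x \<in> carrier B"
    and "x \<in> carrier A \<Longrightarrow> y \<in> carrier A \<Longrightarrow> \<phi> (x \<oplus>\<^bsub>A\<^esub> y) = \<phi> x \<oplus>\<^bsub>B\<^esub> \<phi> y"
    and "x \<in> carrier A \<Longrightarrow> \<phi> (c \<odot>\<^bsub>A\<^esub> x) = c \<odot>\<^bsub>B\<^esub> \<phi> x"
    and "x \<in> carrier A \<Longrightarrow> y \<in> carrier A \<Longrightarrow> \<phi> (x \<otimes>\<^bsub>A\<^esub> y) = \<phi> x \<otimes>\<^bsub>B\<^esub> \<phi> y"
    and "x \<in> carrier A \<Longrightarrow> \<phi> (star A x) = star B (\<phi> x)"
  using assms unfolding cstar_hom_def by auto

text \<open>For self-adjoint \<open>b\<close> of norm at most 1 with complementary root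
  \<open>c\<close>, the squares of the images add up to \<open>\<phi> \<one>\<close>, a projection
  of norm at most 1, and \<open>norm_le_sum_squares\<close> applies. This allows a non-unital
  \<open>\<phi>\<close>. General elements reduce to self-adjoint ones by the C*-identity.\<close>

lemma hom_contractive:
  assumes A: "unital_cstar_algebra A" and B: "unital_cstar_algebra B" and hom: "cstar_hom A B \<phi>" and a: "a \<in> carrier A"
  shows "cnorm B (\<phi> a) \<le> cnorm A a"
proof -
  interpret A: unital_cstar_algebra A by (rule A)
  interpret B: unital_cstar_algebra B by (rule B)
  note h = cstar_homD[OF hom]
  have p: "cnorm B (\<phi> \<one>\<^bsub>A\<^esub>) \<le> 1"
  proof -
    have "\<phi> (star A \<one>\<^bsub>A\<^esub> \<otimes>\<^bsub>A\<^esub> \<one>\<^bsub>A\<^esub>) = star B (\<phi> \<one>\<^bsub>A\<^esub>) \<otimes>\<^bsub>B\<^esub> \<phi> \<one>\<^bsub>A\<^esub>" by (simp only: h A.one_closed A.closed_rules)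
    then have "cnorm B (\<phi> \<one>\<^bsub>A\<^esub>) = (cnorm B (\<phi> \<one>\<^bsub>A\<^esub>))\<^sup>2"
      using B.cstar_identity[OF h(1)[OF A.one_closed]] by simp
    then have "cnorm B (\<phi> \<one>\<^bsub>A\<^esub>) * (cnorm B (\<phi> \<one>\<^bsub>A\<^esub>) - 1) = 0" by (simp add: power2_eq_square algebra_simps)
    then show ?thesis by auto
  qed
  have unit: "cnorm B (\<phi> b) \<le> 1" if b: "b \<in> carrier A" "star A b = b" "cnorm A b \<le> 1" for b
  proof -
    obtain c where c: "c \<in> carrier A" "star A c = c" "b \<otimes>\<^bsub>A\<^esub> b \<oplus>\<^bsub>A\<^esub> c \<otimes>\<^bsub>A\<^esub> c = \<one>\<^bsub>A\<^esub>" "b \<otimes>\<^bsub>A\<^esub> c = c \<otimes>\<^bsub>A\<^esub> b"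
      using A.complementary_root[OF b] by metis
    let ?b = "emb B (\<phi> b)" and ?c = "emb B (\<phi> c)"
    have "(norm ?b)\<^sup>2 \<le> norm (?b * ?b + ?c * ?c)"
    proof (rule norm_le_sum_squares)
      show "adj ?b = ?b" "adj ?c = ?c" using b c h by (metis B.emb_star)+
      show "?b * ?c = ?c * ?b" using b(1) c(1,4) h(1,4) by (metis B.emb_mult)
    qed
    also have "?b * ?b + ?c * ?c = emb B (\<phi> \<one>\<^bsub>A\<^esub>)"
      unfolding c(3)[symmetric] using b(1) c(1) h(1) by (simp add: h(2,4) B.emb_add B.emb_mult)
    also have "norm \<dots> \<le> 1" using p h(1) by (simp add: B.norm_emb)
    finally show ?thesis using b h(1) by (simp add: B.norm_emb abs_square_le_1 B.cnorm_nonneg)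
  qed
  have sa: "cnorm B (\<phi> b) \<le> cnorm A b" if b: "b \<in> carrier A" "star A b = b" for b
  proof (cases "cnorm A b = 0")
    case True
    then have "b = 0 \<odot>\<^bsub>A\<^esub> b" using A.cnorm_eq_0 b by simp
    then have "\<phi> b = 0 \<odot>\<^bsub>B\<^esub> \<phi> b" using h(3) b by metis
    then have "cnorm B (\<phi> b) = 0" using b h(1) B.cnorm_smult[of "\<phi> b" 0] by simp
    then show ?thesis using True by simp
  next
    case False
    then have t: "cnorm A b > 0" using A.cnorm_nonneg b by (simp add: less_le)
    have "cnorm B (\<phi> (of_real (1 / cnorm A b) \<odot>\<^bsub>A\<^esub> b)) \<le> 1"
      by (rule unit) (use b t in \<open>simp_all add: A.star_smult A.cnorm_smult norm_divide\<close>)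
    then show ?thesis using b h(1) t by (simp add: h(3) B.cnorm_smult norm_divide field_simps)
  qed
  have "(cnorm B (\<phi> a))\<^sup>2 = cnorm B (\<phi> (star A a \<otimes>\<^bsub>A\<^esub> a))"
    using a h(1) by (simp add: h(4,5) B.cstar_identity)
  also have "\<dots> \<le> cnorm A (star A a \<otimes>\<^bsub>A\<^esub> a)"
    by (rule sa) (use a in \<open>simp_all add: A.star_mult A.star_star\<close>)
  also have "\<dots> = (cnorm A a)\<^sup>2" using a by (rule A.cstar_identity)
  finally show ?thesis by (rule power2_le_imp_le[OF _ A.cnorm_nonneg[OF a]])
qed

section \<open>Closures of subalgebras, extension by continuity, and separability\<close>

lemma closure_binary:
  assumes "continuous_on UNIV f" "\<And>x y. x \<in> S \<Longrightarrow> y \<in> S \<Longrightarrow> f (x, y) \<in> S" "x \<in> closure S" "y \<in> closure S"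
  shows "f (x, y) \<in> closure (S :: 'x::topological_space set)"
proof -
  have "f ` closure (S \<times> S) \<subseteq> closure S"
    by (rule image_closure_subset) (use assms(1,2) closure_subset in \<open>auto intro: continuous_on_subset\<close>)
  then show ?thesis using assms(3,4) by (auto simp: closure_Times)
qed

lemma closure_unary:
  assumes "continuous_on UNIV f" "\<And>x. x \<in> S \<Longrightarrow> f x \<in> S" "x \<in> closure S"
  shows "f x \<in> closure (S :: 'x::topological_space set)"
proof -
  have "f ` closure S \<subseteq> closure S"
    by (rule image_closure_subset) (use assms(1,2) closure_subset in \<open>auto intro: continuous_on_subset\<close>)
  then show ?thesis using assms(3) by auto
qed

lemma closure_add_closed:
  fixes S :: "'x::real_normed_algebra set"
  assumes "\<And>x y. x \<in> S \<Longrightarrow> y \<in> S \<Longrightarrow> x + y \<in> S" "x \<in> closure S" "y \<in> closure S"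
  shows "x + y \<in> closure S"
proof -
  have "(\<lambda>p. fst p + snd p) (x, y) \<in> closure S"
    by (rule closure_binary[OF _ _ assms(2,3)]) (auto intro!: continuous_intros assms(1))
  then show ?thesis by simp
qed

lemma closure_mult_closed:
  fixes S :: "'x::real_normed_algebra set"
  assumes "\<And>x y. x \<in> S \<Longrightarrow> y \<in> S \<Longrightarrow> x * y \<in> S" "x \<in> closure S" "y \<in> closure S"
  shows "x * y \<in> closure S"
proof -
  have "(\<lambda>p. fst p * snd p) (x, y) \<in> closure S"
    by (rule closure_binary[OF _ _ assms(2,3)]) (auto intro!: continuous_intros assms(1))
  then show ?thesis by simp
qed

lemma continuous_on_adj_UNIV: "continuous_on UNIV (adj :: 'x::cstar_ring \<Rightarrow> 'x)"
  and continuous_on_csc_UNIV: "continuous_on UNIV (csc c :: 'x::cstar_ring \<Rightarrow> 'x)"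
  by (intro continuous_intros)+

definition star_subalgebra :: "'a::cstar_ring set \<Rightarrow> bool" where
  "star_subalgebra S \<longleftrightarrow> 0 \<in> S \<and> (\<forall>x\<in>S. \<forall>y\<in>S. x + y \<in> S \<and> x * y \<in> S) \<and> (\<forall>x\<in>S. adj x \<in> S \<and> (\<forall>c. csc c x \<in> S))"

lemma star_subalgebra_closure:
  assumes "star_subalgebra S" shows "star_subalgebra (closure S)"
proof -
  have "x + y \<in> closure S" "x * y \<in> closure S" if "x \<in> closure S" "y \<in> closure S" for x y
    using closure_add_closed[OF _ that] closure_mult_closed[OF _ that] assms
    unfolding star_subalgebra_def by blast+
  moreover have "adj x \<in> closure S" "csc c x \<in> closure S" if "x \<in> closure S" for x c
    using closure_unary[OF continuous_on_adj_UNIV _ that] closure_unary[OF continuous_on_csc_UNIV _ that] assms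
    unfolding star_subalgebra_def by blast+
  moreover have "0 \<in> closure S" using assms subsetD[OF closure_subset] unfolding star_subalgebra_def by blast
  ultimately show ?thesis unfolding star_subalgebra_def by simp
qed

text \<open>
  A contractive *-homomorphism is extended from a dense *-subalgebra by closing up its graph.
\<close>

lemma contractive_relation_extension:
  fixes R :: "('a::cstar_ring \<times> 'b::cstar_ring) set"
  assumes zero: "(0, 0) \<in> R"
    and add: "\<And>a b a' b'. (a, b) \<in> R \<Longrightarrow> (a', b') \<in> R \<Longrightarrow> (a + a', b + b') \<in> R"
    and mult: "\<And>a b a' b'. (a, b) \<in> R \<Longrightarrow> (a', b') \<in> R \<Longrightarrow> (a * a', b * b') \<in> R"
    and adj: "\<And>a b. (a, b) \<in> R \<Longrightarrow> (adj a, adj b) \<in> R"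
    and csc: "\<And>a b c. (a, b) \<in> R \<Longrightarrow> (csc c a, csc c b) \<in> R"
    and norm: "\<And>a b. (a, b) \<in> R \<Longrightarrow> norm b \<le> norm a"
  obtains \<phi> where "\<And>a b. (a, b) \<in> R \<Longrightarrow> \<phi> a = b"
    "\<And>a. a \<in> closure (Domain R) \<Longrightarrow> \<phi> a \<in> closure (Range R)"
    "\<And>a. a \<in> closure (Domain R) \<Longrightarrow> norm (\<phi> a) \<le> norm a"
    "\<And>a a'. a \<in> closure (Domain R) \<Longrightarrow> a' \<in> closure (Domain R) \<Longrightarrow> \<phi> (a + a') = \<phi> a + \<phi> a'"
    "\<And>a a'. a \<in> closure (Domain R) \<Longrightarrow> a' \<in> closure (Domain R) \<Longrightarrow> \<phi> (a * a') = \<phi> a * \<phi> a'"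
    "\<And>a. a \<in> closure (Domain R) \<Longrightarrow> \<phi> (adj a) = adj (\<phi> a)"
    "\<And>a c. a \<in> closure (Domain R) \<Longrightarrow> \<phi> (csc c a) = csc c (\<phi> a)"
proof -
  have diff: "(a - a', b - b') \<in> R" if "(a, b) \<in> R" "(a', b') \<in> R" for a b a' b'
    using add[OF that(1) csc[OF that(2), of "of_real (- 1)"]] unfolding csc_of_real by simp
  define R' where "R' = closure R"
  have add': "(a + a', b + b') \<in> R'" and mult': "(a * a', b * b') \<in> R'" and diff': "(a - a', b - b') \<in> R'"
    if "(a, b) \<in> R'" "(a', b') \<in> R'" for a b a' b'
  proof -
    have "(\<lambda>p. (fst (fst p) + fst (snd p), snd (fst p) + snd (snd p))) ((a, b), (a', b')) \<in> R'"
      unfolding R'_def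
      by (rule closure_binary) (use that add in \<open>auto simp: R'_def intro!: continuous_intros\<close>)
    then show "(a + a', b + b') \<in> R'" by simp
    have "(\<lambda>p. (fst (fst p) * fst (snd p), snd (fst p) * snd (snd p))) ((a, b), (a', b')) \<in> R'"
      unfolding R'_def
      by (rule closure_binary) (use that mult in \<open>auto simp: R'_def intro!: continuous_intros\<close>)
    then show "(a * a', b * b') \<in> R'" by simp
    have "(\<lambda>p. (fst (fst p) - fst (snd p), snd (fst p) - snd (snd p))) ((a, b), (a', b')) \<in> R'"
      unfolding R'_def
      by (rule closure_binary) (use that diff in \<open>auto simp: R'_def intro!: continuous_intros\<close>)
    then show "(a - a', b - b') \<in> R'" by simp
  qed
  have adj': "(adj a, adj b) \<in> R'" and csc': "(csc c a, csc c b) \<in> R'" if "(a, b) \<in> R'" for a b c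
  proof -
    have "(\<lambda>p. (adj (fst p), adj (snd p))) (a, b) \<in> R'"
      unfolding R'_def
      by (rule closure_unary) (use that adj in \<open>auto simp: R'_def intro!: continuous_intros\<close>)
    then show "(adj a, adj b) \<in> R'" by simp
    have "(\<lambda>p. (csc c (fst p), csc c (snd p))) (a, b) \<in> R'"
      unfolding R'_def
      by (rule closure_unary) (use that csc in \<open>auto simp: R'_def intro!: continuous_intros\<close>)
    then show "(csc c a, csc c b) \<in> R'" by simp
  qed
  have "closed {p :: 'a \<times> 'b. norm (snd p) \<le> norm (fst p)}"
    by (intro closed_Collect_le continuous_intros)
  then have "R' \<subseteq> {p. norm (snd p) \<le> norm (fst p)}"
    unfolding R'_def using norm by (intro closure_minimal) auto
  then have norm': "norm b \<le> norm a" if "(a, b) \<in> R'" for a b using that by auto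
  \<comment> \<open>Two pairs over the same \<open>a\<close> differ by a pair with first component
    0, and contractivity kills its second component.\<close>
  have sv: "b = b'" if "(a, b) \<in> R'" "(a, b') \<in> R'" for a b b'
    using norm'[OF diff'[OF that]] by simp
  have ex: "\<exists>b. (a, b) \<in> R'" if "a \<in> closure (Domain R)" for a
  proof -
    obtain X where X: "\<And>n. X n \<in> Domain R" "X \<longlonglongrightarrow> a" using \<open>a \<in> closure (Domain R)\<close> unfolding closure_sequential by blast
    then have "\<forall>n. \<exists>y. (X n, y) \<in> R" by blast
    then obtain Y where Y: "\<And>n. (X n, Y n) \<in> R" by metis
    have le: "norm (Y m - Y n) \<le> norm (X m - X n)" for m n by (rule norm[OF diff[OF Y Y]])
    have "Cauchy X" using X(2) by (rule LIMSEQ_imp_Cauchy)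
    then have "Cauchy Y" unfolding Cauchy_iff using order_le_less_trans[OF le] by meson
    then obtain b where "Y \<longlonglongrightarrow> b" using Cauchy_convergent convergent_def by blast
    then have "(\<lambda>n. (X n, Y n)) \<longlonglongrightarrow> (a, b)" using X(2) by (intro tendsto_Pair)
    then have "(a, b) \<in> R'"
      unfolding R'_def closure_sequential using Y by (intro exI[of _ "\<lambda>n. (X n, Y n)"]) simp
    then show ?thesis by blast
  qed
  define \<phi> where "\<phi> a = (SOME b. (a, b) \<in> R')" for a
  have phi: "(a, \<phi> a) \<in> R'" if "a \<in> closure (Domain R)" for a
    unfolding \<phi>_def by (rule someI_ex[OF ex[OF that]])
  have eq: "\<phi> a = b" if "(a, b) \<in> R'" for a b
    using someI[of "\<lambda>b. (a, b) \<in> R'" b] that sv unfolding \<phi>_def by blast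
  have sub: "R \<subseteq> R'" by (simp add: R'_def closure_subset)
  have range: "b \<in> closure (Range R)" if "(a, b) \<in> R'" for a b
  proof -
    have "snd ` closure R \<subseteq> closure (Range R)"
      by (rule image_closure_subset)
        (auto intro!: continuous_intros subsetD[OF closure_subset])
    then show ?thesis using that unfolding R'_def by force
  qed
  show thesis
  proof (rule that)
    show "\<phi> a = b" if "(a, b) \<in> R" for a b using eq sub that by blast
    show "\<phi> a \<in> closure (Range R)" if "a \<in> closure (Domain R)" for a using range phi that by blast
    show "norm (\<phi> a) \<le> norm a" if "a \<in> closure (Domain R)" for a using norm' phi that by blast
    show "\<phi> (a + a') = \<phi> a + \<phi> a'" if "a \<in> closure (Domain R)" "a' \<in> closure (Domain R)" for a a'
      using eq add' phi that by blast
    show "\<phi> (a * a') = \<phi> a * \<phi> a'" if "a \<in> closure (Domain R)" "a' \<in> closure (Domain R)" for a a'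
      using eq mult' phi that by blast
    show "\<phi> (adj a) = adj (\<phi> a)" if "a \<in> closure (Domain R)" for a using eq adj' phi that by blast
    show "\<phi> (csc c a) = csc c (\<phi> a)" if "a \<in> closure (Domain R)" for a c using eq csc' phi that by blast
  qed
qed

text \<open>To stay countable, \<open>Q\<close> is closed only under multiplication by scalars from
  a countable dense set \<open>C\<close>. The remaining complex multiples appear in the closure, by
  continuity of \<open>csc\<close> in the scalar.\<close>

lemma countable_dense_star_subalgebra:
  fixes S :: "'a::cstar_ring set"
  assumes S: "countable S"
  obtains Q where "countable Q" "S \<subseteq> Q" "star_subalgebra (closure Q)"
    "\<And>T. star_subalgebra T \<Longrightarrow> S \<subseteq> T \<Longrightarrow> Q \<subseteq> T"
proof -
  obtain C :: "complex set" where C: "countable C" "\<And>X. open X \<Longrightarrow> X \<noteq> {} \<Longrightarrow> \<exists>d\<in>C. d \<in> X"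
    using countable_dense_setE by blast
  define F where "F X = X \<union> (\<lambda>(x, y). x + y) ` (X \<times> X) \<union> (\<lambda>(x, y). x * y) ` (X \<times> X) \<union> adj ` X \<union>
      (\<lambda>(c, x). csc c x) ` (C \<times> X)" for X :: "'a set"
  define G where "G n = (F ^^ n) (insert 0 S)" for n
  define Q where "Q = (\<Union>n. G n)"
  have G0: "G 0 = insert 0 S" and GS: "G (Suc n) = F (G n)" for n by (simp_all add: G_def)
  have "countable (G n)" for n
    by (induction n) (use S C in \<open>simp_all add: G0 GS F_def\<close>)
  then have cQ: "countable Q" by (simp add: Q_def)
  have mono: "G m \<subseteq> G n" if "m \<le> n" for m n
    using that by (induction rule: dec_induct) (auto simp: GS F_def)
  have zQ: "0 \<in> Q" "S \<subseteq> Q" unfolding Q_def using G0 by blast+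
  have binQ: "x + y \<in> Q" "x * y \<in> Q" if xy: "x \<in> Q" "y \<in> Q" for x y
  proof -
    obtain m n where "x \<in> G m" "y \<in> G n" using xy unfolding Q_def by blast
    then have "x \<in> G (max m n)" "y \<in> G (max m n)" using mono[of m "max m n"] mono[of n "max m n"] by auto
    then have "x + y \<in> G (Suc (max m n))" "x * y \<in> G (Suc (max m n))" unfolding GS F_def by force+
    then show "x + y \<in> Q" "x * y \<in> Q" unfolding Q_def by blast+
  qed
  have unQ: "adj x \<in> Q" "c \<in> C \<Longrightarrow> csc c x \<in> Q" if x: "x \<in> Q" for x c
  proof -
    obtain n where "x \<in> G n" using x unfolding Q_def by blast
    then have "adj x \<in> G (Suc n)" "c \<in> C \<Longrightarrow> csc c x \<in> G (Suc n)" unfolding GS F_def by force+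
    then show "adj x \<in> Q" "c \<in> C \<Longrightarrow> csc c x \<in> Q" unfolding Q_def by blast+
  qed
  have cscQ: "csc c x \<in> closure Q" if x: "x \<in> closure Q" for c x
  proof -
    have "csc d x \<in> closure Q" if "d \<in> C" for d
      using closure_unary[OF continuous_on_csc_UNIV _ x] unQ(2) that by blast
    moreover have "c \<in> closure C"
      unfolding closure_iff_nhds_not_empty using C(2) by (metis disjoint_iff empty_iff subsetD)
    moreover have "continuous_on UNIV (\<lambda>c. csc c x)"
      unfolding csc_def by (intro continuous_intros)
    then have "(\<lambda>c. csc c x) ` closure C \<subseteq> closure Q"
      using calculation(1) by (intro image_closure_subset) (auto intro: continuous_on_subset)
    ultimately show ?thesis by blast
  qed
  have "x + y \<in> closure Q" "x * y \<in> closure Q" if "x \<in> closure Q" "y \<in> closure Q" for x y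
    using closure_add_closed[OF _ that] closure_mult_closed[OF _ that] binQ by blast+
  moreover have "adj x \<in> closure Q" if "x \<in> closure Q" for x
    using closure_unary[OF continuous_on_adj_UNIV _ that] unQ(1) by blast
  ultimately have sQ: "star_subalgebra (closure Q)"
    unfolding star_subalgebra_def using cscQ subsetD[OF closure_subset zQ(1)] by simp
  have least: "Q \<subseteq> T" if T: "star_subalgebra T" "S \<subseteq> T" for T
  proof -
    have "G n \<subseteq> T" for n
    proof (induction n)
      case 0 then show ?case using T by (simp add: G0 star_subalgebra_def)
    next
      case (Suc n)
      then show ?case using T(1) unfolding GS F_def star_subalgebra_def by (auto simp: subset_iff)
    qed
    then show ?thesis unfolding Q_def by blast
  qed
  show thesis by (rule that[OF cQ zQ(2) sQ least])
qed

lemma cstar_subalgebra_iff: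
  assumes "cstar_algebra A"
  shows "cstar_subalgebra D A \<longleftrightarrow> D \<subseteq> carrier A \<and> \<zero>\<^bsub>A\<^esub> \<in> D \<and> (\<forall>x\<in>D. \<forall>y\<in>D. x \<oplus>\<^bsub>A\<^esub> y \<in> D) \<and>
     (\<forall>c. \<forall>x\<in>D. c \<odot>\<^bsub>A\<^esub> x \<in> D) \<and> (\<forall>x\<in>D. \<forall>y\<in>D. x \<otimes>\<^bsub>A\<^esub> y \<in> D) \<and> (\<forall>x\<in>D. star A x \<in> D) \<and>
     (\<forall>x\<in>carrier A. (\<forall>e>0. \<exists>s\<in>D. cnorm A (x \<oplus>\<^bsub>A\<^esub> (- 1) \<odot>\<^bsub>A\<^esub> s) < e) \<longrightarrow> x \<in> D)"
proof -
  interpret normed_module A "cnorm A" using assms by (rule cstar_normed_module)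
  show ?thesis unfolding cstar_subalgebra_def submodule_iff closedin_iff
    by (intro iffI; elim conjE; intro conjI; assumption)
qed

lemma cstar_subalgebra_carrier:
  assumes "cstar_algebra A" shows "cstar_subalgebra (carrier A) A"
proof -
  interpret cstar_algebra A by fact
  show ?thesis unfolding cstar_subalgebra_iff[OF assms] by (auto simp: mult_closed star_closed smult_closed)
qed

lemma cstar_generated_subalgebra:
  assumes A: "cstar_algebra A" and S: "S \<subseteq> carrier A"
  shows "cstar_subalgebra (cstar_generated A S) A" "S \<subseteq> cstar_generated A S"
proof -
  let ?F = "{D. cstar_subalgebra D A \<and> S \<subseteq> D}"
  have F: "carrier A \<in> ?F" using cstar_subalgebra_carrier[OF A] S by blast
  show "S \<subseteq> cstar_generated A S" unfolding cstar_generated_def by blast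
  have D: "\<And>D. D \<in> ?F \<Longrightarrow> cstar_subalgebra D A" by blast
  show "cstar_subalgebra (cstar_generated A S) A"
    unfolding cstar_subalgebra_iff[OF A]
  proof (intro conjI ballI allI impI)
    show "cstar_generated A S \<subseteq> carrier A" using F unfolding cstar_generated_def by blast
  next
    fix x assume x: "x \<in> carrier A" "\<forall>e>0. \<exists>s\<in>cstar_generated A S. cnorm A (x \<oplus>\<^bsub>A\<^esub> (- 1) \<odot>\<^bsub>A\<^esub> s) < e"
    show "x \<in> cstar_generated A S"
      unfolding cstar_generated_def
    proof (rule InterI)
      fix D assume "D \<in> ?F"
      then have "\<forall>x\<in>carrier A. (\<forall>e>0. \<exists>s\<in>D. cnorm A (x \<oplus>\<^bsub>A\<^esub> (- 1) \<odot>\<^bsub>A\<^esub> s) < e) \<longrightarrow> x \<in> D"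
        "cstar_generated A S \<subseteq> D"
        unfolding cstar_subalgebra_iff[OF A] cstar_generated_def by blast+
      then show "x \<in> D" using x by (meson subsetD)
    qed
  qed (auto simp: cstar_generated_def cstar_subalgebra_iff[OF A])
qed

lemma cstar_generated_least: "cstar_subalgebra D A \<Longrightarrow> S \<subseteq> D \<Longrightarrow> cstar_generated A S \<subseteq> D"
  unfolding cstar_generated_def by blast

context unital_cstar_algebra
begin

lemma star_subalgebra_range_emb: "star_subalgebra (emb A ` carrier A)"
  unfolding star_subalgebra_def
proof (intro conjI ballI allI)
  show "0 \<in> emb A ` carrier A" by (metis M.zero_closed emb_zero image_eqI)
qed (auto simp flip: emb_add emb_mult emb_star emb_smult)

lemma cstar_subalgebra_vimage_emb:
  assumes T: "star_subalgebra T" "closed T"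
  shows "cstar_subalgebra {a \<in> carrier A. emb A a \<in> T} A"
  unfolding cstar_subalgebra_iff[OF cstar_algebra_axioms]
proof (intro conjI ballI allI impI)
  fix x assume x: "x \<in> carrier A" "\<forall>e>0. \<exists>s\<in>{a \<in> carrier A. emb A a \<in> T}. cnorm A (x \<oplus> (- 1) \<odot> s) < e"
  have "emb A x \<in> closure T"
    unfolding closure_approachable dist_norm
  proof (intro allI impI)
    fix e :: real assume "e > 0"
    then obtain s where "s \<in> carrier A" "emb A s \<in> T" "cnorm A (x \<oplus> (- 1) \<odot> s) < e" using x(2) by blast
    then show "\<exists>y\<in>T. norm (y - emb A x) < e"
      using x(1) by (metis norm_emb_diff norm_minus_commute)
  qed
  then show "x \<in> {a \<in> carrier A. emb A a \<in> T}" using x T(2) by simp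
qed (use T(1) in \<open>auto simp: star_subalgebra_def emb_add emb_mult emb_star emb_smult\<close>)

text \<open>Separability of a countably generated algebra; it is what keeps GNS spaces small enough
  for the universe.\<close>

lemma dense_countable:
  assumes S: "countable S" "S \<subseteq> carrier A" "cstar_generated A S = carrier A"
  obtains Q where "countable Q" "Q \<subseteq> emb A ` carrier A" "emb A ` carrier A \<subseteq> closure Q"
proof -
  obtain Q where Q: "countable Q" "emb A ` S \<subseteq> Q" "star_subalgebra (closure Q)"
    "\<And>T. star_subalgebra T \<Longrightarrow> emb A ` S \<subseteq> T \<Longrightarrow> Q \<subseteq> T"
    using countable_dense_star_subalgebra[of "emb A ` S"] S(1) by (metis countable_image)
  have "S \<subseteq> {a \<in> carrier A. emb A a \<in> closure Q}" using S(2) Q(2) closure_subset by blast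
  then have "carrier A \<subseteq> {a \<in> carrier A. emb A a \<in> closure Q}"
    using cstar_generated_least[OF cstar_subalgebra_vimage_emb[OF Q(3) closed_closure]] S(3) by blast
  then show thesis using that Q(1) Q(4)[OF star_subalgebra_range_emb] S(2) by blast
qed

end

section \<open>Hilbert spaces and adjoints\<close>

text \<open>The choice \<open>t = - r * cnj c\<close> turns the hypothesis into a quadratic in the
  real number \<open>r\<close>. Isolated because it serves Hilbert spaces, the semi-inner product of
  a positive functional, and the stationarity condition in \<open>riesz\<close>.\<close>

lemma cauchy_schwarz_discriminant:
  fixes a b :: real and c :: complex
  assumes pos: "\<And>t. 0 \<le> a + 2 * Re (t * c) + (cmod t)\<^sup>2 * b" and b: "b \<ge> 0"
  shows "(cmod c)\<^sup>2 \<le> a * b"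
proof -
  have cc: "Re (- of_real r * cnj c * c) = - r * (cmod c)\<^sup>2" for r
    by (simp add: complex_norm_square[symmetric] mult.assoc mult.commute[of "cnj c"] flip: of_real_mult of_real_minus)
  have "cmod (- of_real r * cnj c) = \<bar>r\<bar> * cmod c" for r by (simp add: norm_mult)
  then have r: "0 \<le> a - 2 * r * (cmod c)\<^sup>2 + r\<^sup>2 * (cmod c)\<^sup>2 * b" for r
    using pos[of "- of_real r * cnj c"] unfolding cc by (simp add: power_mult_distrib)
  show ?thesis
  proof (cases "b = 0")
    case True
    have "(cmod c)\<^sup>2 = 0"
    proof (rule ccontr)
      assume n: "(cmod c)\<^sup>2 \<noteq> 0"
      \<comment> \<open>For \<open>b = 0\<close> the expression is affine in \<open>r\<close>, and
        this value of \<open>r\<close> makes it \<open>- 1\<close>.\<close>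
      then show False using r[of "(a + 1) / (2 * (cmod c)\<^sup>2)"] True by (simp add: field_simps)
    qed
    then show ?thesis using True by simp
  next
    case False
    then have b0: "b > 0" using b by simp
    have "0 \<le> a - (cmod c)\<^sup>2 / b" using r[of "1 / b"] False by (simp add: power2_eq_square)
    then show ?thesis using b0 by (simp add: field_simps)
  qed
qed

text \<open>The axioms of \<open>hilbert_space\<close> other than completeness, so that the norm of
  the GNS space is at hand while its completeness is being proved.\<close>

locale pre_hilbert = module complex_ring H for H :: "('h, 'm) inner_space_scheme" (structure) +
  assumes cinner_add: "\<lbrakk>x \<in> carrier H; y \<in> carrier H; z \<in> carrier H\<rbrakk>
          \<Longrightarrow> cinner H (x \<oplus> y) z = cinner H x z + cinner H y z"
    and cinner_smult: "\<lbrakk>x \<in> carrier H; y \<in> carrier H\<rbrakk> \<Longrightarrow> cinner H (c \<odot> x) y = c * cinner H x y"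
    and cinner_cnj: "\<lbrakk>x \<in> carrier H; y \<in> carrier H\<rbrakk> \<Longrightarrow> cinner H y x = cnj (cinner H x y)"
    and cinner_nonneg: "x \<in> carrier H \<Longrightarrow> 0 \<le> Re (cinner H x x)"
    and cinner_eq_0: "x \<in> carrier H \<Longrightarrow> cinner H x x = 0 \<Longrightarrow> x = \<zero>"
begin

sublocale complex_module H ..

lemma cinner_add_right: "\<lbrakk>x \<in> carrier H; y \<in> carrier H; z \<in> carrier H\<rbrakk>
    \<Longrightarrow> cinner H z (x \<oplus> y) = cinner H z x + cinner H z y"
  using cinner_add[of x y z] by (metis M.a_closed cinner_cnj complex_cnj_add)

lemma cinner_smult_right: "\<lbrakk>x \<in> carrier H; y \<in> carrier H\<rbrakk> \<Longrightarrow> cinner H y (c \<odot> x) = cnj c * cinner H y x"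
  using cinner_smult[of x y c] by (metis smult_clos cinner_cnj complex_cnj_mult)

lemma hnorm_nonneg: "x \<in> carrier H \<Longrightarrow> 0 \<le> hnorm H x"
  by (simp add: hnorm_def cinner_nonneg)

lemma hnorm_sq: "x \<in> carrier H \<Longrightarrow> (hnorm H x)\<^sup>2 = Re (cinner H x x)"
  by (simp add: hnorm_def cinner_nonneg)

lemma cinner_self: "x \<in> carrier H \<Longrightarrow> cinner H x x = of_real ((hnorm H x)\<^sup>2)"
  using cinner_cnj[of x x] by (simp add: hnorm_sq complex_eq_iff)

lemma hnorm_sq_add:
  assumes "x \<in> carrier H" "y \<in> carrier H"
  shows "(hnorm H (x \<oplus> t \<odot> y))\<^sup>2 = (hnorm H x)\<^sup>2 + 2 * Re (t * cinner H y x) + (cmod t)\<^sup>2 * (hnorm H y)\<^sup>2"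
proof -
  have "cinner H (x \<oplus> t \<odot> y) (x \<oplus> t \<odot> y)
      = cinner H x x + t * cinner H y x + cnj (t * cinner H y x) + t * cnj t * cinner H y y"
    using assms cinner_cnj[of y x]
    by (simp add: cinner_add cinner_add_right cinner_smult cinner_smult_right algebra_simps)
  also have "t * cnj t = of_real ((cmod t)\<^sup>2)" by (simp only: complex_norm_square)
  finally show ?thesis using assms by (simp add: hnorm_sq)
qed

lemma cauchy_schwarz:
  assumes "x \<in> carrier H" "y \<in> carrier H" shows "cmod (cinner H x y) \<le> hnorm H x * hnorm H y"
proof -
  have "(cmod (cinner H x y))\<^sup>2 \<le> (hnorm H y)\<^sup>2 * (hnorm H x)\<^sup>2"
  proof (rule cauchy_schwarz_discriminant)
    fix t
    show "0 \<le> (hnorm H y)\<^sup>2 + 2 * Re (t * cinner H x y) + (cmod t)\<^sup>2 * (hnorm H x)\<^sup>2"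
      unfolding hnorm_sq_add[OF assms(2,1), symmetric] by simp
  qed simp
  then have "(cmod (cinner H x y))\<^sup>2 \<le> (hnorm H x * hnorm H y)\<^sup>2" by (simp add: power_mult_distrib mult.commute)
  then show ?thesis by (rule power2_le_imp_le) (use assms hnorm_nonneg in simp)
qed

lemma hnorm_smult: assumes "x \<in> carrier H" shows "hnorm H (c \<odot> x) = cmod c * hnorm H x"
proof -
  have "cinner H (c \<odot> x) (c \<odot> x) = of_real ((cmod c)\<^sup>2) * cinner H x x"
    unfolding complex_norm_square using assms by (simp add: cinner_smult cinner_smult_right)
  then have "(hnorm H (c \<odot> x))\<^sup>2 = (cmod c * hnorm H x)\<^sup>2"
    using assms by (simp add: hnorm_sq power_mult_distrib)
  then show ?thesis using assms hnorm_nonneg by (simp add: power2_eq_iff_nonneg)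
qed

sublocale normed_module H "hnorm H"
proof
  fix x y assume x: "x \<in> carrier H"
  show "0 \<le> hnorm H x" by (rule hnorm_nonneg[OF x])
  show "x = \<zero>" if "hnorm H x = 0" using cinner_eq_0[OF x] cinner_self[OF x] that by simp
  show "hnorm H (c \<odot> x) = cmod c * hnorm H x" for c by (rule hnorm_smult[OF x])
  assume y: "y \<in> carrier H"
  have "Re (cinner H y x) \<le> hnorm H x * hnorm H y"
    using cauchy_schwarz[OF y x] complex_Re_le_cmod[of "cinner H y x"] by (simp add: mult.commute)
  then have "(hnorm H (x \<oplus> y))\<^sup>2 \<le> (hnorm H x + hnorm H y)\<^sup>2"
    using hnorm_sq_add[OF x y, of 1] y by (simp add: power2_sum)
  then show "hnorm H (x \<oplus> y) \<le> hnorm H x + hnorm H y"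
    by (rule power2_le_imp_le) (use x y hnorm_nonneg in simp)
qed

lemma cinner_diff_right:
  "\<lbrakk>x \<in> carrier H; y \<in> carrier H; z \<in> carrier H\<rbrakk> \<Longrightarrow> cinner H z (x \<oplus> (- 1) \<odot> y) = cinner H z x - cinner H z y"
  by (simp add: cinner_add_right cinner_smult_right)

lemma cinner_ext:
  assumes "x \<in> carrier H" "y \<in> carrier H" "\<And>z. z \<in> carrier H \<Longrightarrow> cinner H z x = cinner H z y"
  shows "x = y"
proof -
  have "cinner H (x \<oplus> (- 1) \<odot> y) (x \<oplus> (- 1) \<odot> y) = 0" using assms by (simp add: cinner_diff_right)
  then show ?thesis using assms cinner_eq_0 diff_eq_0 by simp
qed

end

text \<open>The arithmetic of the Cauchy estimate in \<open>riesz\<close>: \<open>a\<close> and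
  \<open>b\<close> bound the excess of two values of the functional over its infimum
  \<open>m\<close>.\<close>

lemma minimizing_gap:
  fixes N :: real
  assumes "a \<le> l" "b \<le> l" "N \<le> 2 * (u - m) + 2 * (v - m)" "u < m + a" "v < m + b" "l < E / 4"
  shows "N < E"
proof -
  have "N \<le> 2 * (u - m) + 2 * (v - m)" by fact
  also have "\<dots> \<le> 2 * a + 2 * b" using assms(4,5) by (intro add_mono) auto
  also have "\<dots> \<le> 2 * l + 2 * l" using assms(1,2) by (intro add_mono) auto
  also have "\<dots> < E" using assms(6) by simp
  finally show ?thesis .
qed

context hilbert_space
begin

sublocale pre_hilbert H
  by unfold_locales (simp_all add: cinner_add cinner_smult cinner_cnj[symmetric] cinner_nonneg cinner_eq_0)

text \<open>A variational proof. The functional \<open>J\<close> is bounded below by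
  \<open>- K^2\<close>, the parallelogram law makes a minimizing sequence Cauchy, and stationarity
  at its limit \<open>z\<close> is the asserted representation of \<open>g\<close>.\<close>

lemma riesz:
  assumes add: "\<And>x y. x \<in> carrier H \<Longrightarrow> y \<in> carrier H \<Longrightarrow> g (x \<oplus> y) = g x + g y"
    and scal: "\<And>c x. x \<in> carrier H \<Longrightarrow> g (c \<odot> x) = c * g x"
    and bound: "\<And>x. x \<in> carrier H \<Longrightarrow> cmod (g x) \<le> K * hnorm H x"
  obtains z where "z \<in> carrier H" "\<And>x. x \<in> carrier H \<Longrightarrow> g x = cinner H x z"
proof -
  define J where "J x = (hnorm H x)\<^sup>2 - 2 * Re (g x)" for x
  have "- K\<^sup>2 \<le> J x" if "x \<in> carrier H" for x
  proof -
    have "Re (g x) \<le> K * hnorm H x" using bound[OF that] complex_Re_le_cmod order_trans by blast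
    moreover have "0 \<le> (hnorm H x - K)\<^sup>2" by simp
    ultimately show ?thesis by (simp add: J_def power2_diff algebra_simps)
  qed
  then have bdd: "bdd_below (J ` carrier H)" by (intro bdd_belowI2) auto
  define m where "m = Inf (J ` carrier H)"
  have mle: "m \<le> J x" if "x \<in> carrier H" for x unfolding m_def using bdd that by (intro cINF_lower)
  define c where "c n = inverse (real (Suc n))" for n
  have "\<exists>x\<in>carrier H. J x < m + c n" for n
    using cInf_lessD[of "J ` carrier H" "m + inverse (real (Suc n))"] M.zero_closed
    unfolding m_def c_def by auto
  then obtain X where X: "\<And>n. X n \<in> carrier H" "\<And>n. J (X n) < m + c n" by metis
  have J_add: "J (x \<oplus> t \<odot> y) = J x + 2 * Re (t * (cinner H y x - g y)) + (cmod t)\<^sup>2 * (hnorm H y)\<^sup>2"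
    if "x \<in> carrier H" "y \<in> carrier H" for x y t
    using that by (simp add: J_def hnorm_sq_add add scal algebra_simps)
  \<comment> \<open>The parallelogram law, with \<open>m\<close> as a lower bound for
    \<open>J\<close> at the midpoint of \<open>x\<close> and \<open>y\<close>.\<close>
  have par: "(hnorm H (x \<oplus> (- 1) \<odot> y))\<^sup>2 \<le> 2 * (J x - m) + 2 * (J y - m)"
    if x: "x \<in> carrier H" and y: "y \<in> carrier H" for x y
  proof -
    have "m \<le> J ((1/2) \<odot> (x \<oplus> 1 \<odot> y))" using x y by (intro mle) simp
    also have "\<dots> = (1/4) * (hnorm H (x \<oplus> 1 \<odot> y))\<^sup>2 - Re (g x) - Re (g y)"
      using x y by (simp add: J_def hnorm_smult scal add power_mult_distrib power2_eq_square field_simps)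
    finally have "4 * m \<le> (hnorm H (x \<oplus> 1 \<odot> y))\<^sup>2 - 4 * Re (g x) - 4 * Re (g y)" by simp
    then show ?thesis unfolding hnorm_sq_add[OF x y] J_def by simp
  qed
  have "\<forall>e>0. \<exists>K. \<forall>m\<ge>K. \<forall>n\<ge>K. hnorm H (X m \<oplus> (- 1) \<odot> X n) < e"
  proof (intro allI impI)
    fix e :: real assume e: "e > 0"
    obtain L where L: "c L < e\<^sup>2 / 4" using reals_Archimedean[of "e\<^sup>2 / 4"] e unfolding c_def by auto
    have "hnorm H (X i \<oplus> (- 1) \<odot> X j) < e" if ij: "i \<ge> L" "j \<ge> L" for i j
    proof -
      have "c i \<le> c L" "c j \<le> c L" using ij unfolding c_def by (auto intro!: le_imp_inverse_le)
      then have "(hnorm H (X i \<oplus> (- 1) \<odot> X j))\<^sup>2 < e\<^sup>2"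
        using par[OF X(1) X(1), of i j] X(2)[of i] X(2)[of j] L
        minimizing_gap by blast
      then show ?thesis using e by (intro power2_less_imp_less[of _ e]) auto
    qed
    then show "\<exists>K. \<forall>m\<ge>K. \<forall>n\<ge>K. hnorm H (X m \<oplus> (- 1) \<odot> X n) < e" by blast
  qed
  then obtain z where z: "z \<in> carrier H" "\<forall>e>0. \<exists>K. \<forall>n\<ge>K. hnorm H (X n \<oplus> (- 1) \<odot> z) < e"
    using complete[unfolded complete_iff, rule_format, of X] X(1) by blast
  have lim0: "(\<lambda>n. hnorm H (X n \<oplus> (- 1) \<odot> z)) \<longlonglongrightarrow> 0"
    by (rule LIMSEQ_I) (use z X(1) hnorm_nonneg in simp)
  show thesis
  proof (rule that[OF z(1)])
    fix y assume y: "y \<in> carrier H"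
    have b1: "cmod (cinner H y (X n) - cinner H y z) \<le> hnorm H y * hnorm H (X n \<oplus> (- 1) \<odot> z)" for n
      using cauchy_schwarz[OF y, of "X n \<oplus> (- 1) \<odot> z"] X(1)[of n] y z(1) by (simp add: cinner_diff_right)
    have b2: "(\<lambda>n. hnorm H y * hnorm H (X n \<oplus> (- 1) \<odot> z)) \<longlonglongrightarrow> 0"
      by (rule tendsto_mult_right_zero[OF lim0])
    have "(\<lambda>n. cinner H y (X n) - cinner H y z) \<longlonglongrightarrow> 0"
      by (rule Lim_null_comparison[OF always_eventually b2]) (rule allI, rule b1)
    then have lim: "(\<lambda>n. cinner H y (X n)) \<longlonglongrightarrow> cinner H y z" by (simp add: LIM_zero_cancel)
    \<comment> \<open>Perturbing \<open>X n\<close> by \<open>t \<odot> y\<close> can lower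
      \<open>J\<close> by at most \<open>c n\<close>, which tends to 0. The discriminant lemma with
      first coefficient 0 then leaves \<open>cinner H y z = g y\<close>.\<close>
    have "0 \<le> 0 + 2 * Re (t * (cinner H y z - g y)) + (cmod t)\<^sup>2 * (hnorm H y)\<^sup>2" for t
    proof (rule LIMSEQ_le_const)
      show "(\<lambda>n. c n + 2 * Re (t * (cinner H y (X n) - g y)) + (cmod t)\<^sup>2 * (hnorm H y)\<^sup>2)
          \<longlonglongrightarrow> 0 + 2 * Re (t * (cinner H y z - g y)) + (cmod t)\<^sup>2 * (hnorm H y)\<^sup>2"
        by (intro tendsto_intros lim LIMSEQ_inverse_real_of_nat[folded c_def])
      have "0 \<le> c n + 2 * Re (t * (cinner H y (X n) - g y)) + (cmod t)\<^sup>2 * (hnorm H y)\<^sup>2" for n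
        using mle[of "X n \<oplus> t \<odot> y"] J_add[OF X(1)[of n] y, of t] X(1)[of n] X(2)[of n] y by simp
      then show "\<exists>N. \<forall>n\<ge>N. 0 \<le> c n + 2 * Re (t * (cinner H y (X n) - g y)) + (cmod t)\<^sup>2 * (hnorm H y)\<^sup>2"
        by blast
    qed
    then have "(cmod (cinner H y z - g y))\<^sup>2 \<le> 0 * (hnorm H y)\<^sup>2" by (rule cauchy_schwarz_discriminant) simp
    then show "g y = cinner H y z" by simp
  qed
qed

lemma bounded_opD:
  assumes "bounded_op H T"
  shows "x \<in> carrier H \<Longrightarrow> T x \<in> carrier H"
    and "x \<in> carrier H \<Longrightarrow> y \<in> carrier H \<Longrightarrow> T (x \<oplus> y) = T x \<oplus> T y"
    and "x \<in> carrier H \<Longrightarrow> T (c \<odot> x) = c \<odot> T x"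
  using assms unfolding bounded_op_def by auto

lemma bounded_op_ext:
  assumes "bounded_op H S" "bounded_op H T" "\<And>x. x \<in> carrier H \<Longrightarrow> S x = T x" shows "S = T"
  using assms unfolding bounded_op_def by (auto intro: PiE_ext)

lemma adjoint_unique:
  assumes S: "bounded_op H S" "\<And>x y. x \<in> carrier H \<Longrightarrow> y \<in> carrier H \<Longrightarrow> cinner H (T x) y = cinner H x (S y)"
  shows "adjoint_op H T = S"
  unfolding adjoint_op_def
proof (rule the_equality)
  show "bounded_op H S \<and> (\<forall>x\<in>carrier H. \<forall>y\<in>carrier H. cinner H (T x) y = cinner H x (S y))" using S by blast
  fix S' assume S': "bounded_op H S' \<and> (\<forall>x\<in>carrier H. \<forall>y\<in>carrier H. cinner H (T x) y = cinner H x (S' y))"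
  show "S' = S"
  proof (rule bounded_op_ext)
    show "S' y = S y" if "y \<in> carrier H" for y
      by (rule cinner_ext) (use S S' bounded_opD(1) that in \<open>auto simp flip: S(2)\<close>)
  qed (use S S' in auto)
qed

text \<open>Riesz, applied for each \<open>y\<close> to the functional sending \<open>x\<close> to
  the inner product of \<open>T x\<close> with \<open>y\<close>, gives the values of the adjoint;
  its linearity follows by testing against all vectors, its bound by testing against its own
  value.\<close>

lemma adjoint_exists:
  assumes T: "bounded_op H T"
  shows "bounded_op H (adjoint_op H T)"
    and "\<And>x y. x \<in> carrier H \<Longrightarrow> y \<in> carrier H \<Longrightarrow> cinner H (T x) y = cinner H x (adjoint_op H T y)"
proof -
  note Tc = bounded_opD[OF T]
  obtain K0 where K0: "\<And>x. x \<in> carrier H \<Longrightarrow> hnorm H (T x) \<le> K0 * hnorm H x"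
    using T unfolding bounded_op_def by blast
  define K where "K = \<bar>K0\<bar>"
  have K: "hnorm H (T x) \<le> K * hnorm H x" if "x \<in> carrier H" for x
    using K0[OF that] mult_right_mono[OF abs_ge_self hnorm_nonneg[OF that], of K0] by (simp add: K_def)
  have "\<exists>z. z \<in> carrier H \<and> (\<forall>x\<in>carrier H. cinner H (T x) y = cinner H x z)" if y: "y \<in> carrier H" for y
  proof -
    have bd: "cmod (cinner H (T x) y) \<le> (K * hnorm H y) * hnorm H x" if x: "x \<in> carrier H" for x
      using cauchy_schwarz[OF Tc(1)[OF x] y] mult_right_mono[OF K[OF x] hnorm_nonneg[OF y]] by (simp add: mult_ac)
    show ?thesis
    proof (rule riesz[of "\<lambda>x. cinner H (T x) y", OF _ _ bd])
      show "cinner H (T (u \<oplus> v)) y = cinner H (T u) y + cinner H (T v) y" if "u \<in> carrier H" "v \<in> carrier H" for u v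
        using that y Tc(1) by (simp add: Tc(2) cinner_add)
      show "cinner H (T (c \<odot> u)) y = c * cinner H (T u) y" if "u \<in> carrier H" for c u
        using that y Tc(1) by (simp add: Tc(3) cinner_smult)
    qed blast+
  qed
  then obtain S0 where S0: "\<And>y. y \<in> carrier H \<Longrightarrow> S0 y \<in> carrier H"
    "\<And>x y. y \<in> carrier H \<Longrightarrow> x \<in> carrier H \<Longrightarrow> cinner H (T x) y = cinner H x (S0 y)" by metis
  define S where "S = restrict S0 (carrier H)"
  have S: "\<And>y. y \<in> carrier H \<Longrightarrow> S y \<in> carrier H"
    "\<And>x y. y \<in> carrier H \<Longrightarrow> x \<in> carrier H \<Longrightarrow> cinner H x (S y) = cinner H (T x) y"
    using S0 by (simp_all add: S_def)
  have bS: "bounded_op H S"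
    unfolding bounded_op_def
  proof (intro conjI ballI allI exI[of _ K])
    show "S \<in> carrier H \<rightarrow>\<^sub>E carrier H" using S0 by (auto simp: S_def)
    fix x assume x: "x \<in> carrier H"
    show "S (x \<oplus> y) = S x \<oplus> S y" if y: "y \<in> carrier H" for y
      by (rule cinner_ext) (use x y S(1) Tc(1) in \<open>simp_all add: S(2) cinner_add_right\<close>)
    show "S (c \<odot> x) = c \<odot> S x" for c
      by (rule cinner_ext) (use x S(1) Tc(1) in \<open>simp_all add: S(2) cinner_smult_right\<close>)
    show "hnorm H (S x) \<le> K * hnorm H x"
    proof (cases "hnorm H (S x) = 0")
      case True then show ?thesis using hnorm_nonneg[OF x] by (simp add: K_def)
    next
      case False
      have "of_real ((hnorm H (S x))\<^sup>2) = cinner H (T (S x)) x"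
        using cinner_self[OF S(1)[OF x]] S(2)[OF x S(1)[OF x]] by simp
      then have "(hnorm H (S x))\<^sup>2 = cmod (cinner H (T (S x)) x)" by (metis norm_of_real abs_power2)
      also have "\<dots> \<le> hnorm H (T (S x)) * hnorm H x" by (rule cauchy_schwarz) (use x S Tc in auto)
      also have "\<dots> \<le> K * hnorm H (S x) * hnorm H x"
        by (rule mult_right_mono) (use K S x hnorm_nonneg in auto)
      finally have "hnorm H (S x) * hnorm H (S x) \<le> hnorm H (S x) * (K * hnorm H x)"
        by (simp add: power2_eq_square mult_ac)
      then show ?thesis using False hnorm_nonneg[OF S(1)[OF x]] by simp
    qed
  qed
  have "adjoint_op H T = S" by (rule adjoint_unique[OF bS]) (simp add: S(2))
  then show "bounded_op H (adjoint_op H T)"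
    "\<And>x y. x \<in> carrier H \<Longrightarrow> y \<in> carrier H \<Longrightarrow> cinner H (T x) y = cinner H x (adjoint_op H T y)"
    using bS S by simp_all
qed

text \<open>For the complementary root \<open>c\<close> of \<open>a\<close>, \<open>\<parallel>\<rho>(a)x\<parallel>\<^sup>2 + \<parallel>\<rho>(c)x\<parallel>\<^sup>2 = \<langle>\<rho>(1)x, x\<rangle>\<close>.\<close>

lemma rep_contractive:
  assumes A: "unital_cstar_algebra A" and rho: "cstar_hom A (bounded_ops H) \<rho>" and a: "a \<in> carrier A" and x: "x \<in> carrier H"
  shows "hnorm H (\<rho> a x) \<le> cnorm A a * hnorm H x"
proof -
  interpret A: unital_cstar_algebra A by (rule A)
  note h = cstar_homD[OF rho]
  have bd: "bounded_op H (\<rho> b)" if "b \<in> carrier A" for b using h(1)[OF that] by (simp add: bounded_ops_def)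
  have cl: "\<rho> b y \<in> carrier H" if "b \<in> carrier A" "y \<in> carrier H" for b y using bd bounded_opD(1) that by blast
  have mul: "\<rho> (b \<otimes>\<^bsub>A\<^esub> c) y = \<rho> b (\<rho> c y)" if "b \<in> carrier A" "c \<in> carrier A" "y \<in> carrier H" for b c y
    using h(4)[OF that(1,2)] that by (simp add: bounded_ops_def compose_def)
  have adds: "\<rho> (b \<oplus>\<^bsub>A\<^esub> c) y = \<rho> b y \<oplus> \<rho> c y" if "b \<in> carrier A" "c \<in> carrier A" "y \<in> carrier H" for b c y
    using h(2)[OF that(1,2)] that by (simp add: bounded_ops_def)
  have sm: "\<rho> (c \<odot>\<^bsub>A\<^esub> b) y = c \<odot> \<rho> b y" if "b \<in> carrier A" "y \<in> carrier H" for b c y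
    using h(3)[OF that(1)] that by (simp add: bounded_ops_def)
  have st: "cinner H (\<rho> b y) z = cinner H y (\<rho> (star A b) z)" if "b \<in> carrier A" "y \<in> carrier H" "z \<in> carrier H" for b y z
    using h(5)[OF that(1)] adjoint_exists(2)[OF bd[OF that(1)] that(2,3)] by (simp add: bounded_ops_def)
  have sq: "(hnorm H (\<rho> b y))\<^sup>2 = Re (cinner H y (\<rho> (star A b \<otimes>\<^bsub>A\<^esub> b) y))" if "b \<in> carrier A" "y \<in> carrier H" for b y
    using that cl by (simp add: hnorm_sq st mul)
  \<comment> \<open>\<open>\<rho>\<close> may be non-unital, so \<open>\<rho> \<one>\<close> is a
    projection and only this inequality is available.\<close>
  have one: "hnorm H (\<rho> \<one>\<^bsub>A\<^esub> y) \<le> hnorm H y" if y: "y \<in> carrier H" for y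
  proof (cases "hnorm H (\<rho> \<one>\<^bsub>A\<^esub> y) = 0")
    case True then show ?thesis using hnorm_nonneg y by simp
  next
    case False
    have "(hnorm H (\<rho> \<one>\<^bsub>A\<^esub> y))\<^sup>2 = Re (cinner H y (\<rho> \<one>\<^bsub>A\<^esub> y))" using sq[of "\<one>\<^bsub>A\<^esub>" y] y by simp
    also have "\<dots> \<le> cmod (cinner H y (\<rho> \<one>\<^bsub>A\<^esub> y))" by (rule complex_Re_le_cmod)
    also have "\<dots> \<le> hnorm H y * hnorm H (\<rho> \<one>\<^bsub>A\<^esub> y)" by (rule cauchy_schwarz) (use y cl in auto)
    finally have "hnorm H (\<rho> \<one>\<^bsub>A\<^esub> y) * hnorm H (\<rho> \<one>\<^bsub>A\<^esub> y) \<le> hnorm H y * hnorm H (\<rho> \<one>\<^bsub>A\<^esub> y)"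
      by (simp add: power2_eq_square)
    then show ?thesis using False hnorm_nonneg[OF cl[OF A.one_closed y]] by simp
  qed
  have unit: "hnorm H (\<rho> b y) \<le> hnorm H y"
    if b: "b \<in> carrier A" "star A b = b" "cnorm A b \<le> 1" and y: "y \<in> carrier H" for b y
  proof -
    obtain c where c: "c \<in> carrier A" "star A c = c" "b \<otimes>\<^bsub>A\<^esub> b \<oplus>\<^bsub>A\<^esub> c \<otimes>\<^bsub>A\<^esub> c = \<one>\<^bsub>A\<^esub>"
      using A.complementary_root[OF b] by metis
    have "(hnorm H (\<rho> b y))\<^sup>2 + (hnorm H (\<rho> c y))\<^sup>2 = Re (cinner H y (\<rho> (b \<otimes>\<^bsub>A\<^esub> b \<oplus>\<^bsub>A\<^esub> c \<otimes>\<^bsub>A\<^esub> c) y))"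
      using b(1,2) c(1,2) y cl by (simp add: sq adds cinner_add_right)
    also have "\<dots> = (hnorm H (\<rho> \<one>\<^bsub>A\<^esub> y))\<^sup>2" unfolding c(3) using sq[of "\<one>\<^bsub>A\<^esub>" y] y by simp
    also have "\<dots> \<le> (hnorm H y)\<^sup>2" using one[OF y] hnorm_nonneg cl y by (intro power_mono) auto
    finally have "(hnorm H (\<rho> b y))\<^sup>2 \<le> (hnorm H y)\<^sup>2" using zero_le_power2[of "hnorm H (\<rho> c y)"] by linarith
    then show ?thesis by (rule power2_le_imp_le) (rule hnorm_nonneg[OF y])
  qed
  have sa: "hnorm H (\<rho> b y) \<le> cnorm A b * hnorm H y"
    if b: "b \<in> carrier A" "star A b = b" and y: "y \<in> carrier H" for b y
  proof (cases "cnorm A b = 0")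
    case True
    then have "b = 0 \<odot>\<^bsub>A\<^esub> b" using A.cnorm_eq_0 b by simp
    then have "\<rho> b y = 0 \<odot> \<rho> b y" using sm[of b y 0] b y by simp
    then have "hnorm H (\<rho> b y) = 0" using hnorm_smult[of "\<rho> b y" 0] cl b y by simp
    then show ?thesis using True by simp
  next
    case False
    then have t: "cnorm A b > 0" using A.cnorm_nonneg b by (simp add: less_le)
    have "hnorm H (\<rho> (of_real (1 / cnorm A b) \<odot>\<^bsub>A\<^esub> b) y) \<le> hnorm H y"
      by (rule unit[OF _ _ _ y]) (use b t in \<open>simp_all add: A.star_smult A.cnorm_smult norm_divide\<close>)
    then show ?thesis using b y t cl by (simp add: sm hnorm_smult norm_divide field_simps)
  qed
  have "(hnorm H (\<rho> a x))\<^sup>2 \<le> cmod (cinner H x (\<rho> (star A a \<otimes>\<^bsub>A\<^esub> a) x))"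
    unfolding sq[OF a x] by (rule complex_Re_le_cmod)
  also have "\<dots> \<le> hnorm H x * hnorm H (\<rho> (star A a \<otimes>\<^bsub>A\<^esub> a) x)"
    by (rule cauchy_schwarz) (use a x cl in auto)
  also have "\<dots> \<le> hnorm H x * (cnorm A (star A a \<otimes>\<^bsub>A\<^esub> a) * hnorm H x)"
    by (intro mult_left_mono sa) (use a x hnorm_nonneg in \<open>auto simp: A.star_mult A.star_star\<close>)
  also have "\<dots> = (cnorm A a * hnorm H x)\<^sup>2" using a by (simp add: A.cstar_identity power2_eq_square mult_ac)
  finally show ?thesis by (rule power2_le_imp_le) (use a x A.cnorm_nonneg hnorm_nonneg in simp)
qed

end

section \<open>The Gelfand-Naimark-Segal construction\<close>

text \<open>The GNS semi-inner product. The adjoint sits on the second argument because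
  \<open>cinner\<close> is linear in the first.\<close>

definition ss :: "('u::cstar_ring \<Rightarrow> complex) \<Rightarrow> 'u \<Rightarrow> 'u \<Rightarrow> complex" where
  "ss F x y = F (adj y * x)"

definition sn :: "('u::cstar_ring \<Rightarrow> complex) \<Rightarrow> 'u \<Rightarrow> real" where
  "sn F x = sqrt (Re (ss F x x))"

definition cseq :: "('u::cstar_ring \<Rightarrow> complex) \<Rightarrow> 'u set \<Rightarrow> (nat \<Rightarrow> 'u) \<Rightarrow> bool" where
  "cseq F D X \<longleftrightarrow> (\<forall>n. X n \<in> D) \<and> (\<forall>e>0. \<exists>K. \<forall>m\<ge>K. \<forall>n\<ge>K. sn F (X m - X n) < e)"

locale pos_functional =
  fixes F :: "'u::cstar_ring \<Rightarrow> complex"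
  assumes F: "positive_functional F"
begin

lemma F_add: "F (x + y) = F x + F y"
  and F_csc: "F (csc c x) = c * F x"
  and F_adj: "F (adj x) = cnj (F x)"
  and F_pos: "pos x \<Longrightarrow> 0 \<le> Re (F x)"
  and F_bound: "cmod (F x) \<le> 2 * norm x"
  using F unfolding positive_functional_def by blast+

lemma F_scaleR: "F (r *\<^sub>R x) = of_real r * F x"
  using F_csc[of "of_real r" x] by (simp add: csc_of_real)

lemma F_diff: "F (x - y) = F x - F y"
  using F_add[of x "(- 1) *\<^sub>R y"] F_scaleR[of "- 1" y] by simp

lemma ss_add_left: "ss F (x + y) z = ss F x z + ss F y z"
  and ss_add_right: "ss F z (x + y) = ss F z x + ss F z y"
  and ss_diff_left: "ss F (x - y) z = ss F x z - ss F y z"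
  and ss_diff_right: "ss F z (x - y) = ss F z x - ss F z y"
  and ss_csc_left: "ss F (csc c x) z = c * ss F x z"
  and ss_csc_right: "ss F z (csc c x) = cnj c * ss F z x"
  by (simp_all add: ss_def adj_simps adj_csc distrib_left distrib_right left_diff_distrib right_diff_distrib
    F_add F_diff csc_mult_left csc_mult_right F_csc)

lemma ss_cnj: "ss F y x = cnj (ss F x y)"
  by (simp add: ss_def adj_mult flip: F_adj)

lemma ss_mult_left: "ss F (a * x) y = ss F x (adj a * y)"
  by (simp add: ss_def adj_mult mult.assoc)

lemma ss_nonneg: "0 \<le> Re (ss F x x)"
  by (simp add: ss_def F_pos pos_adj_mult)

lemma sn_nonneg [simp]: "0 \<le> sn F x"
  by (simp add: sn_def ss_nonneg)

lemma sn_sq: "(sn F x)\<^sup>2 = Re (ss F x x)"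
  by (simp add: sn_def ss_nonneg)

lemma ss_self: "ss F x x = of_real ((sn F x)\<^sup>2)"
  using ss_cnj[of x x] by (simp add: sn_sq complex_eq_iff)

lemma sn_sq_add: "(sn F (x + csc t y))\<^sup>2 = (sn F x)\<^sup>2 + 2 * Re (t * ss F y x) + (cmod t)\<^sup>2 * (sn F y)\<^sup>2"
proof -
  have "ss F (x + csc t y) (x + csc t y) = ss F x x + t * ss F y x + cnj (t * ss F y x) + t * cnj t * ss F y y"
    using ss_cnj[of x y] by (simp add: ss_add_left ss_add_right ss_csc_left ss_csc_right algebra_simps)
  also have "t * cnj t = of_real ((cmod t)\<^sup>2)" by (simp only: complex_norm_square)
  finally show ?thesis by (simp add: sn_sq)
qed

lemma ss_cauchy_schwarz: "cmod (ss F x y) \<le> sn F x * sn F y"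
proof -
  have "(cmod (ss F x y))\<^sup>2 \<le> (sn F y)\<^sup>2 * (sn F x)\<^sup>2"
  proof (rule cauchy_schwarz_discriminant)
    fix t
    show "0 \<le> (sn F y)\<^sup>2 + 2 * Re (t * ss F x y) + (cmod t)\<^sup>2 * (sn F x)\<^sup>2"
      unfolding sn_sq_add[symmetric] by simp
  qed simp
  then have "(cmod (ss F x y))\<^sup>2 \<le> (sn F x * sn F y)\<^sup>2" by (simp add: power_mult_distrib mult.commute)
  then show ?thesis by (rule power2_le_imp_le) simp
qed

lemma sn_add: "sn F (x + y) \<le> sn F x + sn F y"
proof -
  have "Re (ss F y x) \<le> sn F x * sn F y"
    using ss_cauchy_schwarz[of y x] complex_Re_le_cmod[of "ss F y x"] by (simp add: mult.commute)
  then have "(sn F (x + y))\<^sup>2 \<le> (sn F x + sn F y)\<^sup>2"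
    using sn_sq_add[of x 1 y] by (simp add: power2_sum)
  then show ?thesis by (rule power2_le_imp_le) simp
qed

lemma sn_csc: "sn F (csc c x) = cmod c * sn F x"
proof -
  have "ss F (csc c x) (csc c x) = of_real ((cmod c)\<^sup>2) * ss F x x"
    unfolding complex_norm_square by (simp add: ss_csc_left ss_csc_right)
  then have "(sn F (csc c x))\<^sup>2 = (cmod c * sn F x)\<^sup>2" by (simp add: sn_sq power_mult_distrib)
  then show ?thesis by (simp add: power2_eq_iff_nonneg)
qed

lemma sn_zero [simp]: "sn F 0 = 0"
  using sn_csc[of 0 0] by simp

lemma sn_diff_commute: "sn F (x - y) = sn F (y - x)"
  using sn_csc[of "- 1" "x - y"] csc_of_real[of "- 1" "x - y"] by simp

lemma sn_abs_diff: "\<bar>sn F x - sn F y\<bar> \<le> sn F (x - y)"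
  using sn_add[of "x - y" y] sn_add[of "y - x" x] sn_diff_commute[of x y] by simp

lemma sn_le_norm: "sn F x \<le> 2 * norm x"
proof -
  have "(sn F x)\<^sup>2 \<le> cmod (F (adj x * x))" unfolding sn_sq ss_def by (rule complex_Re_le_cmod)
  also have "\<dots> \<le> 2 * (norm x)\<^sup>2" using F_bound[of "adj x * x"] by (simp add: norm_adj_mult)
  also have "\<dots> \<le> (2 * norm x)\<^sup>2" by (simp add: power_mult_distrib)
  finally show ?thesis by (rule power2_le_imp_le) simp
qed

text \<open>The positive element \<open>norm a ^ 2 - adj a * a\<close> is a square
  \<open>h * h\<close>, and \<open>F\<close> is nonnegative at \<open>adj (h * x) * (h * x)\<close>.
  It makes left multiplication by \<open>a\<close> bounded on the GNS space.\<close>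

lemma F_adj_mult_mono: "Re (F (adj (a * x) * (a * x))) \<le> (norm a)\<^sup>2 * Re (F (adj x * x))"
proof -
  have "pos (of_real ((norm a)\<^sup>2) - adj a * a)"
    by (rule pos_diff_of_norm_le) (simp_all add: adj_mult norm_adj_mult)
  then obtain h where h: "adj h = h" "of_real ((norm a)\<^sup>2) - adj a * a = h * h" unfolding pos_def by blast
  have "adj (h * x) * (h * x) = adj x * (h * h) * x" by (simp add: adj_mult h mult.assoc)
  also have "\<dots> = (norm a)\<^sup>2 *\<^sub>R (adj x * x) - adj (a * x) * (a * x)"
    unfolding h(2)[symmetric] by (simp add: algebra_simps of_real_def adj_mult del: of_real_power)
  finally have "F (adj (h * x) * (h * x)) = of_real ((norm a)\<^sup>2) * F (adj x * x) - F (adj (a * x) * (a * x))"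
    by (simp only: F_diff F_scaleR)
  then show ?thesis using F_pos[OF pos_adj_mult[of "h * x"]] by simp
qed

lemma sn_mult: "sn F (a * x) \<le> norm a * sn F x"
proof -
  have "(sn F (a * x))\<^sup>2 \<le> (norm a * sn F x)\<^sup>2"
    unfolding power_mult_distrib sn_sq ss_def by (rule F_adj_mult_mono)
  then show ?thesis by (rule power2_le_imp_le) simp
qed

lemma ss_diff_bound: "cmod (ss F x y - ss F x' y') \<le> sn F (x - x') * sn F y + sn F x' * sn F (y - y')"
proof -
  have "ss F x y - ss F x' y' = ss F (x - x') y + ss F x' (y - y')" by (simp add: ss_diff_left ss_diff_right)
  then show ?thesis using norm_triangle_mono[OF ss_cauchy_schwarz ss_cauchy_schwarz] by simp
qed

lemma cseq_in: "cseq F D X \<Longrightarrow> X n \<in> D"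
  unfolding cseq_def by blast

lemma cseq_cauchy: "cseq F D X \<Longrightarrow> e > 0 \<Longrightarrow> \<exists>K. \<forall>m\<ge>K. \<forall>n\<ge>K. sn F (X m - X n) < e"
  unfolding cseq_def by blast

lemma cseq_sn_convergent: assumes "cseq F D X" shows "convergent (\<lambda>n. sn F (X n))"
proof -
  have "Cauchy (\<lambda>n. sn F (X n))"
    unfolding Cauchy_iff real_norm_def
    using cseq_cauchy[OF assms] order_le_less_trans[OF sn_abs_diff] by meson
  then show ?thesis by (rule Cauchy_convergent)
qed

lemma cseq_bounded: assumes "cseq F D X" obtains M where "M > 0" "\<And>n. sn F (X n) \<le> M"
proof -
  have "Bseq (\<lambda>n. sn F (X n))" by (rule convergent_imp_Bseq[OF cseq_sn_convergent[OF assms]])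
  then show thesis using that by (auto elim!: BseqE)
qed

lemma tendsto_ss_diff:
  assumes "(\<lambda>n. sn F (X n - X' n)) \<longlonglongrightarrow> 0" "(\<lambda>n. sn F (Y n - Y' n)) \<longlonglongrightarrow> 0"
    "\<And>n. sn F (Y n) \<le> M" "\<And>n. sn F (X' n) \<le> L"
  shows "(\<lambda>n. ss F (X n) (Y n) - ss F (X' n) (Y' n)) \<longlonglongrightarrow> 0"
proof (rule Lim_null_comparison)
  have "(\<lambda>n. sn F (X n - X' n) * M + L * sn F (Y n - Y' n)) \<longlonglongrightarrow> 0 * M + L * 0"
    by (intro tendsto_intros assms)
  then show "(\<lambda>n. sn F (X n - X' n) * M + L * sn F (Y n - Y' n)) \<longlonglongrightarrow> 0" by simp
  have "cmod (ss F (X n) (Y n) - ss F (X' n) (Y' n)) \<le> sn F (X n - X' n) * M + L * sn F (Y n - Y' n)" for n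
    using ss_diff_bound[of "X n" "Y n" "X' n" "Y' n"]
      mult_left_mono[OF assms(3)[of n] sn_nonneg[of "X n - X' n"]]
      mult_right_mono[OF assms(4)[of n] sn_nonneg[of "Y n - Y' n"]] by linarith
  then show "\<forall>\<^sub>F n in sequentially. cmod (ss F (X n) (Y n) - ss F (X' n) (Y' n)) \<le> sn F (X n - X' n) * M + L * sn F (Y n - Y' n)"
    by (intro always_eventually allI)
qed

lemma cseq_ss_convergent: assumes X: "cseq F D X" and Y: "cseq F D Y" shows "convergent (\<lambda>n. ss F (X n) (Y n))"
proof -
  obtain L where L: "L > 0" "\<And>n. sn F (X n) \<le> L" using cseq_bounded[OF X] by blast
  obtain M where M: "M > 0" "\<And>n. sn F (Y n) \<le> M" using cseq_bounded[OF Y] by blast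
  have "Cauchy (\<lambda>n. ss F (X n) (Y n))"
    unfolding Cauchy_iff
  proof (intro allI impI)
    fix e :: real assume e: "e > 0"
    obtain K where K: "\<And>m n. m \<ge> K \<Longrightarrow> n \<ge> K \<Longrightarrow> sn F (X m - X n) < e / (2 * M)"
      using cseq_cauchy[OF X, of "e / (2 * M)"] e M by auto
    obtain K' where K': "\<And>m n. m \<ge> K' \<Longrightarrow> n \<ge> K' \<Longrightarrow> sn F (Y m - Y n) < e / (2 * L)"
      using cseq_cauchy[OF Y, of "e / (2 * L)"] e L by auto
    have "cmod (ss F (X m) (Y m) - ss F (X n) (Y n)) < e" if "m \<ge> max K K'" "n \<ge> max K K'" for m n
    proof -
      have "sn F (X m - X n) * sn F (Y m) \<le> sn F (X m - X n) * M" using M by (intro mult_left_mono) auto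
      also have "\<dots> < e / (2 * M) * M" using M K[of m n] that by (intro mult_strict_right_mono) auto
      finally have 1: "sn F (X m - X n) * sn F (Y m) < e / 2" using M by simp
      have "sn F (X n) * sn F (Y m - Y n) \<le> L * sn F (Y m - Y n)" using L by (intro mult_right_mono) auto
      also have "\<dots> < L * (e / (2 * L))" using L K'[of m n] that by (intro mult_strict_left_mono) auto
      finally have "sn F (X n) * sn F (Y m - Y n) < e / 2" using L by simp
      then show ?thesis using 1 ss_diff_bound[of "X m" "Y m" "X n" "Y n"] by linarith
    qed
    then show "\<exists>K. \<forall>m\<ge>K. \<forall>n\<ge>K. cmod (ss F (X m) (Y m) - ss F (X n) (Y n)) < e" by blast
  qed
  then show ?thesis by (rule Cauchy_convergent)
qed

lemma cseq_const: "x \<in> D \<Longrightarrow> cseq F D (\<lambda>_. x)"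
  unfolding cseq_def by simp

lemma cseq_add:
  assumes D: "star_subalgebra D" and X: "cseq F D X" and Y: "cseq F D Y" shows "cseq F D (\<lambda>n. X n + Y n)"
  unfolding cseq_def
proof (intro conjI allI impI)
  show "X n + Y n \<in> D" for n using D cseq_in X Y unfolding star_subalgebra_def by blast
  fix e :: real assume e: "e > 0"
  obtain K where K: "\<And>m n. m \<ge> K \<Longrightarrow> n \<ge> K \<Longrightarrow> sn F (X m - X n) < e / 2" using cseq_cauchy[OF X, of "e / 2"] e by auto
  obtain L where L: "\<And>m n. m \<ge> L \<Longrightarrow> n \<ge> L \<Longrightarrow> sn F (Y m - Y n) < e / 2" using cseq_cauchy[OF Y, of "e / 2"] e by auto
  have "sn F (X m + Y m - (X n + Y n)) < e" if "m \<ge> max K L" "n \<ge> max K L" for m n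
    using sn_add[of "X m - X n" "Y m - Y n"] K[of m n] L[of m n] that by (simp add: algebra_simps)
  then show "\<exists>K. \<forall>m\<ge>K. \<forall>n\<ge>K. sn F (X m + Y m - (X n + Y n)) < e" by blast
qed

lemma cseq_scale:
  assumes "\<And>n. T (X n) \<in> D" "\<And>x y. sn F (T x - T y) \<le> C * sn F (x - y)" and X: "cseq F D X"
  shows "cseq F D (\<lambda>n. T (X n))"
  unfolding cseq_def
proof (intro conjI allI impI)
  show "T (X n) \<in> D" for n by fact
  fix e :: real assume e: "e > 0"
  have "e / (\<bar>C\<bar> + 1) > 0" using e by simp
  then obtain K where K: "\<And>m n. m \<ge> K \<Longrightarrow> n \<ge> K \<Longrightarrow> sn F (X m - X n) < e / (\<bar>C\<bar> + 1)" using cseq_cauchy[OF X] by blast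
  have "sn F (T (X m) - T (X n)) < e" if "m \<ge> K" "n \<ge> K" for m n
  proof -
    have "sn F (T (X m) - T (X n)) \<le> C * sn F (X m - X n)" by fact
    also have "\<dots> \<le> (\<bar>C\<bar> + 1) * sn F (X m - X n)" by (intro mult_right_mono) auto
    also have "\<dots> < (\<bar>C\<bar> + 1) * (e / (\<bar>C\<bar> + 1))" using K[OF that] by (intro mult_strict_left_mono) auto
    also have "\<dots> = e" by simp
    finally show ?thesis .
  qed
  then show "\<exists>K. \<forall>m\<ge>K. \<forall>n\<ge>K. sn F (T (X m) - T (X n)) < e" by blast
qed

lemma cseq_csc: "star_subalgebra D \<Longrightarrow> cseq F D X \<Longrightarrow> cseq F D (\<lambda>n. csc c (X n))"
  by (rule cseq_scale[where T = "csc c" and C = "cmod c"])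
    (auto simp: star_subalgebra_def cseq_in sn_csc simp flip: csc_diff_right)

lemma cseq_mult: "star_subalgebra D \<Longrightarrow> a \<in> D \<Longrightarrow> cseq F D X \<Longrightarrow> cseq F D (\<lambda>n. a * X n)"
  by (rule cseq_scale[where T = "(*) a" and C = "norm a"])
    (auto simp: star_subalgebra_def cseq_in sn_mult simp flip: right_diff_distrib)

end

text \<open>
  The vectors of the GNS space are encoded by an injection \<open>e\<close> of Cauchy sequences modulo null
  sequences into the type \<open>'h\<close>.
\<close>

locale gns = pos_functional F for F :: "'u::cstar_ring \<Rightarrow> complex" +
  fixes D :: "'u set" and q :: 'u and e :: "(nat \<Rightarrow> 'u) \<Rightarrow> 'h"
  assumes D: "star_subalgebra D" and q: "q \<in> D" "\<And>x. x \<in> D \<Longrightarrow> q * x = x" "\<And>x. x \<in> D \<Longrightarrow> x * q = x"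
    and e_eq: "\<And>X Y. cseq F D X \<Longrightarrow> cseq F D Y \<Longrightarrow> e X = e Y \<longleftrightarrow> (\<lambda>n. sn F (X n - Y n)) \<longlonglongrightarrow> 0"
begin

text \<open>A chosen representative of a vector. The operations are defined on representatives;
  \<open>HH_add\<close>, \<open>HH_smult\<close>, \<open>HH_cinner\<close> and \<open>opr\<close>
  show that any Cauchy sequence of the class gives the same result.\<close>

definition rp :: "'h \<Rightarrow> nat \<Rightarrow> 'u" where "rp x = (SOME X. cseq F D X \<and> e X = x)"

definition HH :: "'h inner_space" where
  "HH = \<lparr>carrier = e ` {X. cseq F D X}, monoid.mult = (\<lambda>x y. x), one = e (\<lambda>_. 0), ring.zero = e (\<lambda>_. 0),
     add = (\<lambda>x y. e (\<lambda>n. rp x n + rp y n)), smult = (\<lambda>c x. e (\<lambda>n. csc c (rp x n))),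
     cinner = (\<lambda>x y. lim (\<lambda>n. ss F (rp x n) (rp y n)))\<rparr>"

definition opr :: "'u \<Rightarrow> 'h \<Rightarrow> 'h" where "opr a = (\<lambda>x\<in>carrier HH. e (\<lambda>n. a * rp x n))"

lemma in_HH: "x \<in> carrier HH \<longleftrightarrow> (\<exists>X. cseq F D X \<and> x = e X)"
  by (auto simp: HH_def)

lemma rp: assumes "cseq F D X" shows "cseq F D (rp (e X))" "(\<lambda>n. sn F (rp (e X) n - X n)) \<longlonglongrightarrow> 0"
proof -
  have *: "cseq F D (rp (e X)) \<and> e (rp (e X)) = e X"
    unfolding rp_def by (rule someI[of "\<lambda>Y. cseq F D Y \<and> e Y = e X" X]) (use assms in simp)
  then show "cseq F D (rp (e X))" "(\<lambda>n. sn F (rp (e X) n - X n)) \<longlonglongrightarrow> 0" using e_eq assms by blast+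
qed

lemma null_le:
  assumes "\<And>n. sn F (Z n) \<le> g n" "g \<longlonglongrightarrow> 0" shows "(\<lambda>n. sn F (Z n)) \<longlonglongrightarrow> 0"
  by (rule Lim_null_comparison[OF _ assms(2)]) (use assms(1) in \<open>auto intro!: always_eventually\<close>)

lemma HH_zero: "\<zero>\<^bsub>HH\<^esub> = e (\<lambda>_. 0)"
  by (simp add: HH_def)

lemma HH_add: assumes X: "cseq F D X" and Y: "cseq F D Y" shows "e X \<oplus>\<^bsub>HH\<^esub> e Y = e (\<lambda>n. X n + Y n)"
proof -
  have "(\<lambda>n. sn F ((rp (e X) n + rp (e Y) n) - (X n + Y n))) \<longlonglongrightarrow> 0"
  proof (rule null_le)
    show "sn F ((rp (e X) n + rp (e Y) n) - (X n + Y n)) \<le> sn F (rp (e X) n - X n) + sn F (rp (e Y) n - Y n)" for n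
      using sn_add[of "rp (e X) n - X n" "rp (e Y) n - Y n"] by (simp add: algebra_simps)
    show "(\<lambda>n. sn F (rp (e X) n - X n) + sn F (rp (e Y) n - Y n)) \<longlonglongrightarrow> 0"
      using tendsto_add[OF rp(2)[OF X] rp(2)[OF Y]] by simp
  qed
  then show ?thesis
    using e_eq[OF cseq_add[OF D rp(1)[OF X] rp(1)[OF Y]] cseq_add[OF D X Y]] by (simp add: HH_def)
qed

lemma HH_smult: assumes X: "cseq F D X" shows "c \<odot>\<^bsub>HH\<^esub> e X = e (\<lambda>n. csc c (X n))"
proof -
  have "(\<lambda>n. sn F (csc c (rp (e X) n) - csc c (X n))) \<longlonglongrightarrow> 0"
    unfolding csc_diff_right[symmetric] sn_csc by (rule tendsto_mult_right_zero[OF rp(2)[OF X]])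
  then show ?thesis
    using e_eq[OF cseq_csc[OF D rp(1)[OF X]] cseq_csc[OF D X], of c c] by (simp add: HH_def)
qed

lemma HH_cinner: assumes X: "cseq F D X" and Y: "cseq F D Y"
  shows "(\<lambda>n. ss F (X n) (Y n)) \<longlonglongrightarrow> cinner HH (e X) (e Y)"
proof -
  obtain M where M: "\<And>n. sn F (rp (e Y) n) \<le> M" using cseq_bounded[OF rp(1)[OF Y]] by blast
  obtain L where L: "\<And>n. sn F (X n) \<le> L" using cseq_bounded[OF X] by blast
  have d: "(\<lambda>n. ss F (rp (e X) n) (rp (e Y) n) - ss F (X n) (Y n)) \<longlonglongrightarrow> 0"
    by (rule tendsto_ss_diff[OF rp(2)[OF X] rp(2)[OF Y] M L])
  have c: "(\<lambda>n. ss F (X n) (Y n)) \<longlonglongrightarrow> lim (\<lambda>n. ss F (X n) (Y n))"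
    using cseq_ss_convergent[OF X Y] by (simp add: convergent_LIMSEQ_iff)
  have "(\<lambda>n. ss F (rp (e X) n) (rp (e Y) n)) \<longlonglongrightarrow> lim (\<lambda>n. ss F (X n) (Y n))"
    using tendsto_add[OF d c] by simp
  then have "cinner HH (e X) (e Y) = lim (\<lambda>n. ss F (X n) (Y n))" by (simp add: HH_def limI)
  then show ?thesis using c by simp
qed

lemma HH_hnorm: assumes X: "cseq F D X" shows "(\<lambda>n. sn F (X n)) \<longlonglongrightarrow> hnorm HH (e X)"
  unfolding sn_def hnorm_def by (intro tendsto_intros HH_cinner X)

lemma in_carrier: "cseq F D X \<Longrightarrow> e X \<in> carrier HH"
  using in_HH by blast

lemma cseq_zero: "cseq F D (\<lambda>_. 0)"
  using D by (intro cseq_const) (simp add: star_subalgebra_def)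

lemma HH_module: "module complex_ring HH"
proof (rule moduleI)
  show "abelian_group HH"
  proof (rule abelian_groupI)
    show "\<zero>\<^bsub>HH\<^esub> \<in> carrier HH" by (simp add: HH_zero in_carrier cseq_zero)
    fix x assume x: "x \<in> carrier HH"
    then obtain X where X: "cseq F D X" "x = e X" unfolding in_HH by blast
    show "\<zero>\<^bsub>HH\<^esub> \<oplus>\<^bsub>HH\<^esub> x = x" by (simp add: HH_zero X HH_add cseq_zero)
    have "csc (- 1) (X n) + X n = 0" for n using csc_of_real[of "- 1" "X n"] by simp
    then have "e (\<lambda>n. csc (- 1) (X n)) \<oplus>\<^bsub>HH\<^esub> x = \<zero>\<^bsub>HH\<^esub>" by (simp add: X HH_add cseq_csc D HH_zero)
    then show "\<exists>y\<in>carrier HH. y \<oplus>\<^bsub>HH\<^esub> x = \<zero>\<^bsub>HH\<^esub>" using in_carrier[OF cseq_csc[OF D X(1)]] by blast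
    fix y assume "y \<in> carrier HH"
    then obtain Y where Y: "cseq F D Y" "y = e Y" unfolding in_HH by blast
    show "x \<oplus>\<^bsub>HH\<^esub> y \<in> carrier HH" by (simp add: X Y HH_add in_carrier cseq_add D)
    show "x \<oplus>\<^bsub>HH\<^esub> y = y \<oplus>\<^bsub>HH\<^esub> x" by (simp add: X Y HH_add add.commute)
    fix z assume "z \<in> carrier HH"
    then obtain Z where Z: "cseq F D Z" "z = e Z" unfolding in_HH by blast
    show "x \<oplus>\<^bsub>HH\<^esub> y \<oplus>\<^bsub>HH\<^esub> z = x \<oplus>\<^bsub>HH\<^esub> (y \<oplus>\<^bsub>HH\<^esub> z)" by (simp add: X Y Z HH_add cseq_add D add.assoc)
  qed
  fix a b x assume "x \<in> carrier HH"
  then obtain X where X: "cseq F D X" "x = e X" unfolding in_HH by blast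
  show "a \<odot>\<^bsub>HH\<^esub> x \<in> carrier HH" by (simp add: X HH_smult in_carrier cseq_csc D)
  show "(a \<oplus>\<^bsub>complex_ring\<^esub> b) \<odot>\<^bsub>HH\<^esub> x = a \<odot>\<^bsub>HH\<^esub> x \<oplus>\<^bsub>HH\<^esub> b \<odot>\<^bsub>HH\<^esub> x"
    by (simp add: X HH_smult HH_add cseq_csc D csc_add_left)
  show "(a \<otimes>\<^bsub>complex_ring\<^esub> b) \<odot>\<^bsub>HH\<^esub> x = a \<odot>\<^bsub>HH\<^esub> (b \<odot>\<^bsub>HH\<^esub> x)"
    by (simp add: X HH_smult cseq_csc D csc_assoc)
  show "\<one>\<^bsub>complex_ring\<^esub> \<odot>\<^bsub>HH\<^esub> x = x" by (simp add: X HH_smult)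
  fix y assume "y \<in> carrier HH"
  then obtain Y where Y: "cseq F D Y" "y = e Y" unfolding in_HH by blast
  show "a \<odot>\<^bsub>HH\<^esub> (x \<oplus>\<^bsub>HH\<^esub> y) = a \<odot>\<^bsub>HH\<^esub> x \<oplus>\<^bsub>HH\<^esub> a \<odot>\<^bsub>HH\<^esub> y"
    by (simp add: X Y HH_smult HH_add cseq_csc cseq_add D csc_add_right)
qed (rule cring_complex_ring)

lemma HH_pre_hilbert: "pre_hilbert HH"
proof (intro pre_hilbert.intro pre_hilbert_axioms.intro HH_module)
  fix x y z c assume "x \<in> carrier HH"
  then obtain X where X: "cseq F D X" "x = e X" unfolding in_HH by blast
  have "(\<lambda>n. Re (ss F (X n) (X n))) \<longlonglongrightarrow> Re (cinner HH x x)"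
    unfolding X(2) by (intro tendsto_intros HH_cinner X)
  then show "0 \<le> Re (cinner HH x x)" by (rule LIMSEQ_le_const) (simp add: ss_nonneg)
  show "x = \<zero>\<^bsub>HH\<^esub>" if "cinner HH x x = 0"
  proof -
    have "(\<lambda>n. sn F (X n - 0)) \<longlonglongrightarrow> 0" using HH_hnorm[OF X(1)] that by (simp add: hnorm_def X(2))
    then show ?thesis using e_eq[OF X(1) cseq_zero] by (simp add: X(2) HH_zero)
  qed
  assume "y \<in> carrier HH"
  then obtain Y where Y: "cseq F D Y" "y = e Y" unfolding in_HH by blast
  show "cinner HH (c \<odot>\<^bsub>HH\<^esub> x) y = c * cinner HH x y"
  proof (rule LIMSEQ_unique)
    show "(\<lambda>n. c * ss F (X n) (Y n)) \<longlonglongrightarrow> cinner HH (c \<odot>\<^bsub>HH\<^esub> x) y"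
      using HH_cinner[OF cseq_csc[OF D X(1)] Y(1)] by (simp add: X Y HH_smult ss_csc_left)
    show "(\<lambda>n. c * ss F (X n) (Y n)) \<longlonglongrightarrow> c * cinner HH x y" unfolding X Y by (intro tendsto_intros HH_cinner X Y)
  qed
  show "cinner HH y x = cnj (cinner HH x y)"
  proof (rule LIMSEQ_unique)
    show "(\<lambda>n. cnj (ss F (X n) (Y n))) \<longlonglongrightarrow> cinner HH y x"
      using HH_cinner[OF Y(1) X(1)] by (simp add: X Y flip: ss_cnj)
    show "(\<lambda>n. cnj (ss F (X n) (Y n))) \<longlonglongrightarrow> cnj (cinner HH x y)" unfolding X Y by (intro tendsto_intros HH_cinner X Y)
  qed
  assume "z \<in> carrier HH"
  then obtain Z where Z: "cseq F D Z" "z = e Z" unfolding in_HH by blast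
  show "cinner HH (x \<oplus>\<^bsub>HH\<^esub> y) z = cinner HH x z + cinner HH y z"
  proof (rule LIMSEQ_unique)
    show "(\<lambda>n. ss F (X n) (Z n) + ss F (Y n) (Z n)) \<longlonglongrightarrow> cinner HH (x \<oplus>\<^bsub>HH\<^esub> y) z"
      using HH_cinner[OF cseq_add[OF D X(1) Y(1)] Z(1)] by (simp add: X Y Z HH_add ss_add_left)
    show "(\<lambda>n. ss F (X n) (Z n) + ss F (Y n) (Z n)) \<longlonglongrightarrow> cinner HH x z + cinner HH y z"
      unfolding X Y Z by (intro tendsto_intros HH_cinner X Y Z)
  qed
qed

sublocale HH: pre_hilbert HH by (rule HH_pre_hilbert)

lemma HH_hnorm_diff:
  assumes X: "cseq F D X" and Y: "cseq F D Y"
  shows "(\<lambda>n. sn F (X n - Y n)) \<longlonglongrightarrow> hnorm HH (e X \<oplus>\<^bsub>HH\<^esub> (- 1) \<odot>\<^bsub>HH\<^esub> e Y)"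
proof -
  have 1: "e X \<oplus>\<^bsub>HH\<^esub> (- 1) \<odot>\<^bsub>HH\<^esub> e Y = e (\<lambda>n. X n + csc (- 1) (Y n))"
    by (simp add: HH_smult HH_add X Y cseq_csc D)
  have 2: "X n + csc (- 1) (Y n) = X n - Y n" for n using csc_of_real[of "- 1" "Y n"] by simp
  show ?thesis using HH_hnorm[OF cseq_add[OF D X cseq_csc[OF D Y, of "- 1"]]] unfolding 1 unfolding 2 .
qed

text \<open>Classes of constant sequences are dense. Approximating the k-th given vector by a
  constant \<open>x k\<close> within \<open>1 / (k + 1)\<close> produces a Cauchy sequence
  \<open>x\<close> in \<open>D\<close>, and its class is the limit.\<close>

lemma HH_complete: "norm_complete HH (hnorm HH)"
  unfolding HH.complete_iff
proof (intro allI impI, elim conjE)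
  fix \<xi> :: "nat \<Rightarrow> 'h"
  assume \<xi>: "\<forall>n. \<xi> n \<in> carrier HH" and cauchy: "\<forall>r>0. \<exists>K. \<forall>m\<ge>K. \<forall>n\<ge>K. hnorm HH (\<xi> m \<oplus>\<^bsub>HH\<^esub> (- 1) \<odot>\<^bsub>HH\<^esub> \<xi> n) < r"
  define d where "d x y = hnorm HH (x \<oplus>\<^bsub>HH\<^esub> (- 1) \<odot>\<^bsub>HH\<^esub> y)" for x y
  define J where "J x = e (\<lambda>_. x)" for x
  have J: "J x \<in> carrier HH" if "x \<in> D" for x unfolding J_def by (intro in_carrier cseq_const that)
  have dJ: "d (J x) (J y) = sn F (x - y)" if "x \<in> D" "y \<in> D" for x y
    using HH_hnorm_diff[OF cseq_const cseq_const, of x y] that unfolding d_def J_def by (simp add: LIMSEQ_const_iff)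
  have tri: "d x z \<le> d x y + d y z" if "x \<in> carrier HH" "y \<in> carrier HH" "z \<in> carrier HH" for x y z
    unfolding d_def using that by (rule HH.N_diff_triangle)
  have sym: "d x y = d y x" if "x \<in> carrier HH" "y \<in> carrier HH" for x y
    unfolding d_def using that by (rule HH.N_diff_commute)
  have "\<exists>x\<in>D. d (\<xi> k) (J x) \<le> inverse (real (Suc k))" for k
  proof -
    obtain X where X: "cseq F D X" "\<xi> k = e X" using \<xi> in_HH by blast
    obtain K where K: "\<And>m n. m \<ge> K \<Longrightarrow> n \<ge> K \<Longrightarrow> sn F (X m - X n) < inverse (real (Suc k))"
      using cseq_cauchy[OF X(1), of "inverse (real (Suc k))"] by auto
    have "(\<lambda>n. sn F (X n - X K)) \<longlonglongrightarrow> d (\<xi> k) (J (X K))"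
      using HH_hnorm_diff[OF X(1) cseq_const[OF cseq_in[OF X(1)]]] by (simp add: d_def J_def X(2))
    then have "d (\<xi> k) (J (X K)) \<le> inverse (real (Suc k))"
      by (rule LIMSEQ_le_const2) (use K in \<open>auto intro!: exI[of _ K] less_imp_le\<close>)
    then show ?thesis using cseq_in[OF X(1)] by blast
  qed
  then obtain x where x: "\<And>k. x k \<in> D" "\<And>k. d (\<xi> k) (J (x k)) \<le> inverse (real (Suc k))" by metis
  have small: "\<exists>K. \<forall>k\<ge>K. inverse (real (Suc k)) < r" if r: "r > 0" for r :: real
  proof -
    obtain K where K: "inverse (real (Suc K)) < r" using reals_Archimedean[OF r] by blast
    have "inverse (real (Suc k)) < r" if "k \<ge> K" for k
      by (rule order_le_less_trans[OF _ K]) (use that in \<open>auto intro!: le_imp_inverse_le\<close>)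
    then show ?thesis by blast
  qed
  have cs: "cseq F D x"
    unfolding cseq_def
  proof (intro conjI allI impI)
    show "x n \<in> D" for n by (rule x(1))
    fix r :: real assume "r > 0"
    then have r: "r / 3 > 0" by simp
    obtain K where K: "\<And>k. k \<ge> K \<Longrightarrow> inverse (real (Suc k)) < r / 3" using small[OF r] by blast
    obtain L where L: "\<And>m n. m \<ge> L \<Longrightarrow> n \<ge> L \<Longrightarrow> d (\<xi> m) (\<xi> n) < r / 3" using cauchy r unfolding d_def by blast
    have "sn F (x m - x n) < r" if mn: "m \<ge> max K L" "n \<ge> max K L" for m n
    proof -
      have c: "\<xi> m \<in> carrier HH" "\<xi> n \<in> carrier HH" "J (x m) \<in> carrier HH" "J (x n) \<in> carrier HH" using \<xi> J x(1) by auto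
      have "sn F (x m - x n) = d (J (x m)) (J (x n))" by (simp add: dJ x(1))
      also have "\<dots> \<le> d (J (x m)) (\<xi> m) + (d (\<xi> m) (\<xi> n) + d (\<xi> n) (J (x n)))"
        using tri[OF c(3,1,4)] tri[OF c(1,2,4)] by simp
      also have "\<dots> < r / 3 + (r / 3 + r / 3)"
        using K[of m] K[of n] L[of m n] mn x(2)[of m] x(2)[of n] sym[OF c(1,3)] by (intro add_strict_mono) auto
      finally show ?thesis by simp
    qed
    then show "\<exists>K. \<forall>m\<ge>K. \<forall>n\<ge>K. sn F (x m - x n) < r" by blast
  qed
  show "\<exists>x\<in>carrier HH. \<forall>r>0. \<exists>K. \<forall>n\<ge>K. hnorm HH (\<xi> n \<oplus>\<^bsub>HH\<^esub> (- 1) \<odot>\<^bsub>HH\<^esub> x) < r"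
  proof (intro bexI[of _ "e x"] allI impI)
    fix r :: real assume "r > 0"
    then have r: "r / 3 > 0" by simp
    obtain K where K: "\<And>k. k \<ge> K \<Longrightarrow> inverse (real (Suc k)) < r / 3" using small[OF r] by blast
    obtain L where L: "\<And>m n. m \<ge> L \<Longrightarrow> n \<ge> L \<Longrightarrow> sn F (x m - x n) < r / 3" using cseq_cauchy[OF cs r] by blast
    have "d (\<xi> k) (e x) < r" if k: "k \<ge> max K L" for k
    proof -
      have "(\<lambda>n. sn F (x k - x n)) \<longlonglongrightarrow> d (J (x k)) (e x)"
        using HH_hnorm_diff[OF cseq_const[OF x(1)] cs] by (simp add: d_def J_def)
      then have "d (J (x k)) (e x) \<le> r / 3"
        by (rule LIMSEQ_le_const2) (use L k in \<open>auto intro!: exI[of _ L] less_imp_le\<close>)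
      moreover have "d (\<xi> k) (e x) \<le> d (\<xi> k) (J (x k)) + d (J (x k)) (e x)"
        by (rule tri) (use \<xi> J x(1) cs in_carrier in auto)
      ultimately show ?thesis using x(2)[of k] K[of k] k r by simp
    qed
    then show "\<exists>K. \<forall>n\<ge>K. hnorm HH (\<xi> n \<oplus>\<^bsub>HH\<^esub> (- 1) \<odot>\<^bsub>HH\<^esub> e x) < r" unfolding d_def by blast
  qed (rule in_carrier[OF cs])
qed

lemma HH_hilbert: "hilbert_space HH"
  by (intro hilbert_space.intro hilbert_space_axioms.intro HH_module HH_complete)
    (simp_all add: HH.cinner_add HH.cinner_smult HH.cinner_cnj[symmetric] HH.cinner_nonneg HH.cinner_eq_0)

lemma opr: assumes a: "a \<in> D" and X: "cseq F D X" shows "opr a (e X) = e (\<lambda>n. a * X n)"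
proof -
  have "(\<lambda>n. sn F (a * rp (e X) n - a * X n)) \<longlonglongrightarrow> 0"
  proof (rule null_le)
    show "sn F (a * rp (e X) n - a * X n) \<le> norm a * sn F (rp (e X) n - X n)" for n
      using sn_mult[of a "rp (e X) n - X n"] by (simp add: right_diff_distrib)
    show "(\<lambda>n. norm a * sn F (rp (e X) n - X n)) \<longlonglongrightarrow> 0" by (rule tendsto_mult_right_zero[OF rp(2)[OF X]])
  qed
  then show ?thesis
    using e_eq[OF cseq_mult[OF D a rp(1)[OF X]] cseq_mult[OF D a X]] X by (simp add: opr_def in_carrier)
qed

lemma opr_bounded: assumes a: "a \<in> D" shows "bounded_op HH (opr a)"
  unfolding bounded_op_def
proof (intro conjI ballI allI exI[of _ "norm a"])
  show "opr a \<in> carrier HH \<rightarrow>\<^sub>E carrier HH"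
  proof
    fix x assume "x \<in> carrier HH"
    then obtain X where X: "cseq F D X" "x = e X" unfolding in_HH by blast
    show "opr a x \<in> carrier HH" by (simp add: X opr a in_carrier cseq_mult D)
  qed (simp add: opr_def)
  fix x assume "x \<in> carrier HH"
  then obtain X where X: "cseq F D X" "x = e X" unfolding in_HH by blast
  show "opr a (c \<odot>\<^bsub>HH\<^esub> x) = c \<odot>\<^bsub>HH\<^esub> opr a x" for c
    by (simp add: X opr a HH_smult cseq_csc cseq_mult D csc_mult_right)
  show "hnorm HH (opr a x) \<le> norm a * hnorm HH x"
  proof (rule LIMSEQ_le)
    show "(\<lambda>n. sn F (a * X n)) \<longlonglongrightarrow> hnorm HH (opr a x)" using HH_hnorm[OF cseq_mult[OF D a X(1)]] by (simp add: X opr a)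
    show "(\<lambda>n. norm a * sn F (X n)) \<longlonglongrightarrow> norm a * hnorm HH x" unfolding X(2) by (intro tendsto_intros HH_hnorm X)
  qed (simp add: sn_mult)
  fix y assume "y \<in> carrier HH"
  then obtain Y where Y: "cseq F D Y" "y = e Y" unfolding in_HH by blast
  show "opr a (x \<oplus>\<^bsub>HH\<^esub> y) = opr a x \<oplus>\<^bsub>HH\<^esub> opr a y"
    by (simp add: X Y opr a HH_add cseq_add cseq_mult D distrib_left)
qed

lemma D_clos: "a \<in> D \<Longrightarrow> b \<in> D \<Longrightarrow> a + b \<in> D" "a \<in> D \<Longrightarrow> b \<in> D \<Longrightarrow> a * b \<in> D" "a \<in> D \<Longrightarrow> adj a \<in> D" "a \<in> D \<Longrightarrow> csc c a \<in> D"
  using D unfolding star_subalgebra_def by blast+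

lemma opr_adj: assumes a: "a \<in> D" shows "adjoint_op HH (opr a) = opr (adj a)"
proof -
  interpret hilbert_space HH by (rule HH_hilbert)
  show ?thesis
  proof (rule adjoint_unique)
    show "bounded_op HH (opr (adj a))" using a by (intro opr_bounded D_clos)
    fix x y assume "x \<in> carrier HH" "y \<in> carrier HH"
    then obtain X Y where X: "cseq F D X" "x = e X" and Y: "cseq F D Y" "y = e Y" unfolding in_HH by blast
    show "cinner HH (opr a x) y = cinner HH x (opr (adj a) y)"
    proof (rule LIMSEQ_unique)
      show "(\<lambda>n. ss F (a * X n) (Y n)) \<longlonglongrightarrow> cinner HH (opr a x) y"
        using HH_cinner[OF cseq_mult[OF D a X(1)] Y(1)] by (simp add: X Y opr a)
      show "(\<lambda>n. ss F (a * X n) (Y n)) \<longlonglongrightarrow> cinner HH x (opr (adj a) y)"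
        using HH_cinner[OF X(1) cseq_mult[OF D D_clos(3)[OF a] Y(1)]] by (simp add: X Y opr a ss_mult_left D_clos)
    qed
  qed
qed

lemma opr_hom:
  assumes a: "a \<in> D" and b: "b \<in> D"
  shows "opr (a + b) = opr a \<oplus>\<^bsub>bounded_ops HH\<^esub> opr b" "opr (a * b) = opr a \<otimes>\<^bsub>bounded_ops HH\<^esub> opr b"
    "opr (csc c a) = c \<odot>\<^bsub>bounded_ops HH\<^esub> opr a"
proof -
  have x: "opr a x = e (\<lambda>n. a * rp x n)" if "x \<in> carrier HH" for a x using that by (simp add: opr_def)
  have r: "cseq F D (rp x)" if "x \<in> carrier HH" for x using that rp(1) unfolding in_HH by blast
  show "opr (a + b) = opr a \<oplus>\<^bsub>bounded_ops HH\<^esub> opr b"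
    by (rule ext) (auto simp: bounded_ops_def opr_def HH_add cseq_mult D a b r distrib_right restrict_def)
  show "opr (csc c a) = c \<odot>\<^bsub>bounded_ops HH\<^esub> opr a"
    by (rule ext) (auto simp: bounded_ops_def opr_def HH_smult cseq_mult D a r csc_mult_left restrict_def)
  have "opr (a * b) x = opr a (opr b x)" if "x \<in> carrier HH" for x
    using opr[OF a cseq_mult[OF D b r[OF that]]] that by (simp add: x mult.assoc)
  then show "opr (a * b) = opr a \<otimes>\<^bsub>bounded_ops HH\<^esub> opr b"
    by (intro ext) (auto simp: bounded_ops_def compose_def restrict_def, simp add: opr_def)
qed

text \<open>\<open>q\<close> is the unit of \<open>D\<close> and may differ from the unit of the
  ambient algebra, yet it acts as the identity because all representatives have terms in
  \<open>D\<close>.\<close>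

lemma opr_unit: "opr q = (\<lambda>x\<in>carrier HH. x)"
proof
  fix x
  show "opr q x = (\<lambda>x\<in>carrier HH. x) x"
  proof (cases "x \<in> carrier HH")
    case True
    then obtain X where X: "cseq F D X" "x = e X" unfolding in_HH by blast
    then show ?thesis using True by (simp add: opr q cseq_in)
  qed (simp add: opr_def)
qed

text \<open>The class of the constant sequence \<open>q\<close> is the cyclic vector of the
  construction, and \<open>sn F a\<close> is the square root of
  \<open>Re (F (adj a * a))\<close>.\<close>

lemma opr_vector:
  assumes a: "a \<in> D" shows "e (\<lambda>_. q) \<in> carrier HH" "hnorm HH (e (\<lambda>_. q)) = sn F q" "hnorm HH (opr a (e (\<lambda>_. q))) = sn F a"
proof -
  show "e (\<lambda>_. q) \<in> carrier HH" by (intro in_carrier cseq_const q)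
  show "hnorm HH (e (\<lambda>_. q)) = sn F q" using HH_hnorm[OF cseq_const[OF q(1)]] by (simp add: LIMSEQ_const_iff)
  show "hnorm HH (opr a (e (\<lambda>_. q))) = sn F a"
    using HH_hnorm[OF cseq_const[OF a]] by (simp add: opr a q cseq_const LIMSEQ_const_iff)
qed

end

section \<open>The size of GNS spaces, and enough representations on the given universe\<close>

lemma complex_sequences_lepoll:
  assumes "(UNIV :: real set) \<lesssim> (UNIV :: 'h set)"
  obtains \<iota> :: "(nat \<Rightarrow> complex) \<Rightarrow> 'h" where "inj \<iota>"
proof -
  \<comment> \<open>A Dedekind-type coding: each term is described by the rational points below it
    in both coordinates, so the whole sequence becomes a subset of a countable set.\<close>
  define f :: "(nat \<Rightarrow> complex) \<Rightarrow> nat set" where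
    "f \<phi> = to_nat ` {(n :: nat, r :: rat, s :: rat). of_rat r < Re (\<phi> n) \<and> of_rat s < Im (\<phi> n)}" for \<phi>
  have "inj f"
  proof (rule injI, rule ext)
    fix \<phi> \<psi> n assume "f \<phi> = f \<psi>"
    then have S: "{(n :: nat, r :: rat, s :: rat). of_rat r < Re (\<phi> n) \<and> of_rat s < Im (\<phi> n)} =
        {(n, r, s). of_rat r < Re (\<psi> n) \<and> of_rat s < Im (\<psi> n)}"
      unfolding f_def by (subst (asm) inj_image_eq_iff) auto
    have *: "of_rat r < Re (\<phi> n) \<and> of_rat s < Im (\<phi> n) \<longleftrightarrow> of_rat r < Re (\<psi> n) \<and> of_rat s < Im (\<psi> n)" for r s :: rat
      using S unfolding set_eq_iff by auto
    \<comment> \<open>Real and imaginary parts are tested jointly, so comparing one of them needs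
      some rational number below the other.\<close>
    have small: "\<exists>r::rat. of_rat r < x" for x :: real using of_rat_dense[of "x - 1" x] by auto
    have le: "Re (\<phi> n) \<le> Re (\<psi> n) \<and> Im (\<phi> n) \<le> Im (\<psi> n)"
      if *: "\<And>r s :: rat. of_rat r < Re (\<phi> n) \<and> of_rat s < Im (\<phi> n) \<longrightarrow> of_rat r < Re (\<psi> n) \<and> of_rat s < Im (\<psi> n)" for \<phi> \<psi> :: "nat \<Rightarrow> complex"
    proof (intro conjI)
      show "Re (\<phi> n) \<le> Re (\<psi> n)"
      proof (rule ccontr)
        assume "\<not> ?thesis"
        then obtain r where r: "Re (\<psi> n) < of_rat r" "of_rat r < Re (\<phi> n)" using of_rat_dense[of "Re (\<psi> n)" "Re (\<phi> n)"] by auto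
        obtain s :: rat where "of_rat s < Im (\<phi> n)" using small by blast
        then show False using *[of r s] r by simp
      qed
      show "Im (\<phi> n) \<le> Im (\<psi> n)"
      proof (rule ccontr)
        assume "\<not> ?thesis"
        then obtain r where r: "Im (\<psi> n) < of_rat r" "of_rat r < Im (\<phi> n)" using of_rat_dense[of "Im (\<psi> n)" "Im (\<phi> n)"] by auto
        obtain s :: rat where "of_rat s < Re (\<phi> n)" using small by blast
        then show False using *[of s r] r by simp
      qed
    qed
    show "\<phi> n = \<psi> n" using le[of \<phi> \<psi>] le[of \<psi> \<phi>] * by (simp add: complex_eq_iff)
  qed
  moreover have "(UNIV :: nat set set) \<lesssim> (UNIV :: 'h set)"
    using assms nat_sets_eqpoll_reals by (meson eqpoll_imp_lepoll lepoll_trans)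
  then obtain g :: "nat set \<Rightarrow> 'h" where "inj g" unfolding lepoll_def by auto
  ultimately have "inj (g \<circ> f)" by (intro inj_compose)
  then show thesis by (rule that)
qed

text \<open>A vector of the completed space is determined by its inner products with a dense set.
  The limits of \<open>ss F (X n) d\<close> for \<open>d\<close> in the countable set
  \<open>Q\<close> therefore encode the class of \<open>X\<close> as a complex sequence, which
  \<open>\<iota>\<close> sends into \<open>'h\<close>.\<close>

lemma (in pos_functional) encoding_exists:
  fixes \<iota> :: "(nat \<Rightarrow> complex) \<Rightarrow> 'h"
  assumes D: "star_subalgebra D" and Q: "countable Q" "Q \<subseteq> D" "D \<subseteq> closure Q" and \<iota>: "inj \<iota>"
  obtains e :: "(nat \<Rightarrow> 'u) \<Rightarrow> 'h" where
    "\<And>X Y. cseq F D X \<Longrightarrow> cseq F D Y \<Longrightarrow> e X = e Y \<longleftrightarrow> (\<lambda>n. sn F (X n - Y n)) \<longlonglongrightarrow> 0"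
proof
  define e where "e X = \<iota> (\<lambda>k. lim (\<lambda>n. ss F (X n) (from_nat_into Q k)))" for X
  have "0 \<in> D" using D by (simp add: star_subalgebra_def)
  then have ne: "Q \<noteq> {}" using Q by auto
  have dQ: "from_nat_into Q k \<in> Q" for k by (rule from_nat_into[OF ne])
  fix X Y assume X: "cseq F D X" and Y: "cseq F D Y"
  have conv: "(\<lambda>n. ss F (W n) x) \<longlonglongrightarrow> lim (\<lambda>n. ss F (W n) x)" if "cseq F D W" "x \<in> Q" for W x
    using cseq_ss_convergent[OF that(1) cseq_const, of x] that Q(2) by (auto simp: convergent_LIMSEQ_iff)
  show "e X = e Y \<longleftrightarrow> (\<lambda>n. sn F (X n - Y n)) \<longlonglongrightarrow> 0"
  proof
    assume "(\<lambda>n. sn F (X n - Y n)) \<longlonglongrightarrow> 0"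
    have "lim (\<lambda>n. ss F (X n) x) = lim (\<lambda>n. ss F (Y n) x)" if x: "x \<in> Q" for x
    proof -
      obtain L where L: "\<And>n. sn F (Y n) \<le> L" using cseq_bounded[OF Y] by blast
      have "(\<lambda>n. ss F (X n) x - ss F (Y n) x) \<longlonglongrightarrow> 0"
        by (rule tendsto_ss_diff[OF \<open>(\<lambda>n. sn F (X n - Y n)) \<longlonglongrightarrow> 0\<close> _ order_refl L]) simp
      then show ?thesis using tendsto_diff[OF conv[OF X x] conv[OF Y x]] LIMSEQ_unique by fastforce
    qed
    then show "e X = e Y" unfolding e_def by (simp add: dQ)
  next
    assume "e X = e Y"
    then have eq: "lim (\<lambda>n. ss F (X n) (from_nat_into Q k)) = lim (\<lambda>n. ss F (Y n) (from_nat_into Q k))" for k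
      using \<iota> unfolding e_def by (metis (no_types, lifting) injD)
    define Z where "Z n = X n + csc (- 1) (Y n)" for n
    have Zd: "Z n = X n - Y n" for n using csc_of_real[of "- 1" "Y n"] by (simp add: Z_def)
    have Z: "cseq F D Z" unfolding Z_def by (intro cseq_add cseq_csc D X Y)
    have null: "(\<lambda>n. ss F (Z n) x) \<longlonglongrightarrow> 0" if x: "x \<in> Q" for x
    proof -
      obtain k where "x = from_nat_into Q k" using from_nat_into_surj[OF Q(1) x] by blast
      then show ?thesis using tendsto_diff[OF conv[OF X x] conv[OF Y x]] eq[of k] by (simp add: Zd ss_diff_left)
    qed
    obtain M where M: "M > 0" "\<And>n. sn F (Z n) \<le> M" using cseq_bounded[OF Z] by blast
    have tri: "cmod (u + v + w) \<le> cmod u + cmod v + cmod w" for u v w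
      using norm_triangle_ineq[of "u + v" w] norm_triangle_ineq[of u v] by simp
    have "(\<lambda>n. sn F (Z n)) \<longlonglongrightarrow> 0"
    proof (rule LIMSEQ_I)
      fix r :: real assume r: "r > 0"
      \<comment> \<open>Splitting \<open>ss F (Z n) (Z n)\<close> through \<open>Z K\<close> and an
        element \<open>d\<close> of \<open>Q\<close> gives two terms of size at most
        \<open>M * \<delta>\<close> and one below \<open>\<delta>\<close>; \<open>C\<close> adds up
        these coefficients.\<close>
      define C where "C = M + M + 1"
      have C: "C > 0" using M(1) by (simp add: C_def)
      define \<delta> where "\<delta> = r\<^sup>2 / 2 / C"
      have \<delta>: "\<delta> > 0" using r C by (simp add: \<delta>_def)
      obtain K where K: "\<And>m n. m \<ge> K \<Longrightarrow> n \<ge> K \<Longrightarrow> sn F (Z m - Z n) < \<delta>" using cseq_cauchy[OF Z \<delta>] by blast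
      have "Z K \<in> closure Q" using cseq_in[OF Z] Q(3) by blast
      \<comment> \<open>Half of \<open>\<delta>\<close>, to absorb the factor 2 of
        \<open>sn_le_norm\<close>.\<close>
      then obtain d where d: "d \<in> Q" "norm (d - Z K) < \<delta> / 2"
        using \<delta> unfolding closure_approachable dist_norm by (meson half_gt_zero)
      have sd: "sn F (Z K - d) \<le> \<delta>" using sn_le_norm[of "Z K - d"] d(2) by (simp add: norm_minus_commute)
      obtain N where N: "\<And>n. n \<ge> N \<Longrightarrow> cmod (ss F (Z n) d) < \<delta>" using LIMSEQ_D[OF null[OF d(1)] \<delta>] by auto
      have "sn F (Z n) < r" if n: "n \<ge> max K N" for n
      proof -
        have "ss F (Z n) (Z n) = ss F (Z n) (Z n - Z K) + ss F (Z n) (Z K - d) + ss F (Z n) d"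
          by (simp add: ss_diff_right)
        moreover have "cmod (ss F (Z n) (Z n - Z K)) \<le> M * \<delta>"
          by (rule order_trans[OF ss_cauchy_schwarz mult_mono]) (use M K[of n K] n in auto)
        moreover have "cmod (ss F (Z n) (Z K - d)) \<le> M * \<delta>"
          by (rule order_trans[OF ss_cauchy_schwarz mult_mono]) (use M sd in auto)
        ultimately have "cmod (ss F (Z n) (Z n)) \<le> M * \<delta> + M * \<delta> + \<delta>"
          using N[of n] n tri[of "ss F (Z n) (Z n - Z K)" "ss F (Z n) (Z K - d)" "ss F (Z n) d"] by simp
        also have "M * \<delta> + M * \<delta> + \<delta> = C * \<delta>" by (simp add: C_def algebra_simps)
        also have "\<dots> = r\<^sup>2 / 2" using C by (simp add: \<delta>_def)
        also have "\<dots> < r\<^sup>2" using r by simp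
        finally have "(sn F (Z n))\<^sup>2 < r\<^sup>2" by (simp add: ss_self norm_power)
        then show ?thesis using r by (simp add: power_less_imp_less_base)
      qed
      then show "\<exists>K. \<forall>n\<ge>K. norm (sn F (Z n) - 0) < r" by (intro exI[of _ "max K N"]) simp
    qed
    then show "(\<lambda>n. sn F (X n - Y n)) \<longlonglongrightarrow> 0" by (simp add: Zd)
  qed
qed

text \<open>The state is chosen to norm \<open>adj a0 * a0\<close>, so the norm of this particular
  \<open>a0\<close> is attained at the cyclic vector. That vector comes from
  \<open>emb A \<one>\<close>, a projection below 1, which is why its norm is only known to be at
  most 1.\<close>

theorem gns_representation:
  assumes A: "unital_cstar_algebra A" and S: "countable S" "S \<subseteq> carrier A" "cstar_generated A S = carrier A"
    and card: "(UNIV :: real set) \<lesssim> (UNIV :: 'h set)" and a0: "a0 \<in> carrier A"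
  obtains H :: "'h inner_space" and \<sigma> \<xi> where "hilbert_space H" "cstar_hom A (bounded_ops H) \<sigma>"
    "\<sigma> \<one>\<^bsub>A\<^esub> = (\<lambda>x\<in>carrier H. x)" "\<xi> \<in> carrier H" "hnorm H \<xi> \<le> 1" "hnorm H (\<sigma> a0 \<xi>) = cnorm A a0"
proof -
  interpret unital_cstar_algebra A by (rule A)
  obtain Q where Q: "countable Q" "Q \<subseteq> emb A ` carrier A" "emb A ` carrier A \<subseteq> closure Q"
    using dense_countable[OF S] by blast
  obtain \<iota> :: "(nat \<Rightarrow> complex) \<Rightarrow> 'h" where \<iota>: "inj \<iota>" using complex_sequences_lepoll[OF card] by blast
  obtain F where st: "positive_functional F" "F (adj (emb A a0) * emb A a0) = of_real (norm (adj (emb A a0) * emb A a0))" "F 1 = 1"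
    using norming_state[OF pos_adj_mult[of "emb A a0"]] by blast
  interpret pos_functional F by unfold_locales (rule st(1))
  let ?D = "emb A ` carrier A"
  obtain e :: "(nat \<Rightarrow> 'a ucstar) \<Rightarrow> 'h" where
    e: "\<And>X Y. cseq F ?D X \<Longrightarrow> cseq F ?D Y \<Longrightarrow> e X = e Y \<longleftrightarrow> (\<lambda>n. sn F (X n - Y n)) \<longlonglongrightarrow> 0"
    using encoding_exists[OF star_subalgebra_range_emb Q \<iota>] by blast
  interpret gns F ?D "emb A \<one>\<^bsub>A\<^esub>" e
    by unfold_locales (use star_subalgebra_range_emb e in \<open>auto simp flip: emb_mult\<close>)
  define \<sigma> where "\<sigma> a = opr (emb A a)" for a
  have D: "emb A a \<in> ?D" if "a \<in> carrier A" for a using that by blast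
  have hom: "cstar_hom A (bounded_ops HH) \<sigma>"
    unfolding cstar_hom_def
  proof (intro conjI ballI allI)
    show "\<sigma> \<in> carrier A \<rightarrow> carrier (bounded_ops HH)" using opr_bounded D by (auto simp: \<sigma>_def bounded_ops_def)
    fix x assume x: "x \<in> carrier A"
    show "\<sigma> (star A x) = star (bounded_ops HH) (\<sigma> x)"
      using opr_adj[OF D[OF x]] x by (simp add: \<sigma>_def emb_star bounded_ops_def)
    show "\<sigma> (c \<odot>\<^bsub>A\<^esub> x) = c \<odot>\<^bsub>bounded_ops HH\<^esub> \<sigma> x" for c
      using opr_hom(3)[OF D[OF x] D[OF x]] x by (simp add: \<sigma>_def emb_smult)
    fix y assume y: "y \<in> carrier A"
    show "\<sigma> (x \<oplus>\<^bsub>A\<^esub> y) = \<sigma> x \<oplus>\<^bsub>bounded_ops HH\<^esub> \<sigma> y"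
      using opr_hom(1)[OF D[OF x] D[OF y]] x y by (simp add: \<sigma>_def emb_add)
    show "\<sigma> (x \<otimes>\<^bsub>A\<^esub> y) = \<sigma> x \<otimes>\<^bsub>bounded_ops HH\<^esub> \<sigma> y"
      using opr_hom(2)[OF D[OF x] D[OF y]] x y by (simp add: \<sigma>_def emb_mult)
  qed
  note v = opr_vector[OF D[OF a0]]
  have "sn F (emb A \<one>\<^bsub>A\<^esub>) \<le> 1"
  proof -
    let ?q = "adj (emb A \<one>\<^bsub>A\<^esub>) * emb A \<one>\<^bsub>A\<^esub>"
    have "norm ?q \<le> 1" using cnorm_one cnorm_nonneg[OF one_closed] by (simp add: norm_adj_mult norm_emb power_le_one)
    then have "pos (of_real 1 - ?q)" by (intro pos_diff_of_norm_le) (simp_all add: adj_mult)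
    then have "0 \<le> Re (F (1 - ?q))" using F_pos by simp
    then have "Re (ss F (emb A \<one>\<^bsub>A\<^esub>) (emb A \<one>\<^bsub>A\<^esub>)) \<le> 1" by (simp add: F_diff st(3) ss_def)
    then show ?thesis by (simp add: sn_def)
  qed
  moreover have "sn F (emb A a0) = cnorm A a0"
    using a0 cnorm_nonneg[OF a0] by (simp add: sn_def ss_def st(2) norm_adj_mult norm_emb)
  ultimately show thesis
    using that[OF HH_hilbert hom] v opr_unit by (simp add: \<sigma>_def)
qed

lemma nondegenerate_rep_unital:
  assumes H: "hilbert_space H" and hom: "cstar_hom A (bounded_ops H) \<sigma>"
    and u: "u \<in> carrier A" "\<sigma> u = (\<lambda>x\<in>carrier H. x)"
  shows "nondegenerate_rep A H \<sigma>"
  unfolding nondegenerate_rep_def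
proof (intro conjI hom)
  interpret hilbert_space H by (rule H)
  let ?S = "{\<sigma> a h |a h. a \<in> carrier A \<and> h \<in> carrier H}"
  have "\<sigma> a h \<in> carrier H" if "a \<in> carrier A" "h \<in> carrier H" for a h
    using cstar_homD(1)[OF hom that(1)] bounded_opD(1) that(2) by (simp add: bounded_ops_def)
  then have S: "?S \<subseteq> carrier H" by blast
  have "h \<in> ?S" if h: "h \<in> carrier H" for h
  proof -
    have "h = \<sigma> u h" using h u(2) by simp
    then show ?thesis using h u(1) by blast
  qed
  then show "closed_span H (hnorm H) ?S = carrier H"
    using subset_closed_span[OF S] closed_span_submodule[OF S] unfolding submodule_iff by blast
qed

text \<open>GNS for the difference of \<open>x\<close> and \<open>y\<close>. The representation
  obtained sends the unit to the identity, hence is nondegenerate and qualifies for the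
  hypothesis.\<close>

lemma representations_separate:
  assumes A: "unital_cstar_algebra A" and S: "countable S" "S \<subseteq> carrier A" "cstar_generated A S = carrier A"
    and card: "(UNIV :: real set) \<lesssim> (UNIV :: 'h set)"
    and xy: "x \<in> carrier A" "y \<in> carrier A"
    and eq: "\<And>(H :: 'h inner_space) \<sigma>. hilbert_space H \<Longrightarrow> nondegenerate_rep A H \<sigma> \<Longrightarrow> cstar_hom A (bounded_ops H) \<sigma> \<Longrightarrow> \<sigma> x = \<sigma> y"
  shows "x = y"
proof -
  interpret unital_cstar_algebra A by (rule A)
  let ?a = "x \<oplus>\<^bsub>A\<^esub> (- 1) \<odot>\<^bsub>A\<^esub> y"
  have a: "?a \<in> carrier A" using xy by simp
  obtain H :: "'h inner_space" and \<sigma> \<xi> where H: "hilbert_space H" "cstar_hom A (bounded_ops H) \<sigma>"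
    "\<sigma> \<one>\<^bsub>A\<^esub> = (\<lambda>x\<in>carrier H. x)" "\<xi> \<in> carrier H" "hnorm H \<xi> \<le> 1" "hnorm H (\<sigma> ?a \<xi>) = cnorm A ?a"
    using gns_representation[OF A S card a] by metis
  interpret H: hilbert_space H by (rule H(1))
  have "\<sigma> x = \<sigma> y" by (rule eq[OF H(1) nondegenerate_rep_unital[OF H(1,2) one_closed H(3)] H(2)])
  moreover have "\<sigma> ?a = \<sigma> x \<oplus>\<^bsub>bounded_ops H\<^esub> (- 1) \<odot>\<^bsub>bounded_ops H\<^esub> \<sigma> y"
    using cstar_homD(2,3)[OF H(2)] xy by simp
  moreover have "\<sigma> y \<xi> \<in> carrier H"
    using cstar_homD(1)[OF H(2) xy(2)] H.bounded_opD(1) H(4) by (simp add: bounded_ops_def)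
  ultimately have "\<sigma> ?a \<xi> = \<zero>\<^bsub>H\<^esub>" using H(4) by (simp add: bounded_ops_def)
  then have "cnorm A ?a = 0" using H(6) by simp
  then show ?thesis using cnorm_eq_0[OF a] diff_eq_0 xy by blast
qed

section \<open>The algebra \<open>B\<^sub>P\<close> as a unital C*-algebra\<close>

context ordered_pair
begin

lemma mult_in_cone: "s \<in> P \<Longrightarrow> t \<in> P \<Longrightarrow> s \<otimes> t \<in> P"
  by (rule submonoid.m_closed[OF submonoid_axioms])

lemma one_in_cone: "\<one> \<in> P"
  by (rule submonoid.one_closed[OF submonoid_axioms])

lemma coset_subset_cone: "s \<in> P \<Longrightarrow> s <# P \<subseteq> P"
  by (auto simp: l_coset_def mult_in_cone)

lemma upper_bound_left_iff:
  assumes "s \<in> P" "t \<in> P"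
  shows "upper_bound_in (left_le G P) P {s, t} u \<longleftrightarrow> u \<in> s <# P \<and> u \<in> t <# P"
  using coset_subset_cone[OF assms(1)] cone_carrier assms
  by (auto simp: upper_bound_in_def left_le_def mem_coset_cone_iff)

lemma coset_trans:
  assumes "s \<in> P" "u \<in> s <# P" "x \<in> u <# P" shows "x \<in> s <# P"
proof -
  obtain p r where "p \<in> P" "u = s \<otimes> p" "r \<in> P" "x = u \<otimes> r" using assms by (auto simp: l_coset_def)
  then have "x = s \<otimes> (p \<otimes> r)" "p \<otimes> r \<in> P" using assms(1) cone_carrier mult_in_cone by (auto simp: m_assoc)
  then show ?thesis by (auto simp: l_coset_def)
qed

lemma coset_antisym:
  assumes "u \<in> P" "v \<in> P" "u \<in> v <# P" "v \<in> u <# P" shows "u = v"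
proof -
  have c: "u \<in> carrier G" "v \<in> carrier G" using assms cone_carrier by auto
  have "inv u \<otimes> v \<in> P" "inv v \<otimes> u \<in> P" using assms by (simp_all add: mem_coset_cone_iff)
  moreover have "inv u \<otimes> v = inv (inv v \<otimes> u)" using c by (simp add: inv_mult_group)
  ultimately have "inv u \<otimes> v \<in> P \<inter> m_inv G ` P" by blast
  then have "inv u \<otimes> v = \<one>" using cone_proper by blast
  then have "u \<otimes> (inv u \<otimes> v) = u" using c by simp
  then show ?thesis using c by (simp add: m_assoc[symmetric])
qed

text \<open>Upper bounds for the left order are the common elements of two right ideals. So
  \<open>sP\<close> and \<open>tP\<close> either meet in \<open>uP\<close> for the join
  \<open>u\<close>, or not at all; the left order is used below in this form.\<close>

lemma join_left:
  assumes ql: "quasi_lattice G P (left_le G P)" and s: "s \<in> P" and t: "t \<in> P"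
  shows "join_in (left_le G P) P s t = Some u \<Longrightarrow> u \<in> P \<and> (\<forall>x. x \<in> u <# P \<longleftrightarrow> x \<in> s <# P \<and> x \<in> t <# P)"
    and "join_in (left_le G P) P s t = None \<Longrightarrow> \<not> (x \<in> s <# P \<and> x \<in> t <# P)"
proof -
  note ub = upper_bound_left_iff[OF s t]
  show "join_in (left_le G P) P s t = None \<Longrightarrow> \<not> (x \<in> s <# P \<and> x \<in> t <# P)"
    using ub by (auto simp: join_in_def split: if_splits)
  assume j: "join_in (left_le G P) P s t = Some u"
  then have ex: "\<exists>u. upper_bound_in (left_le G P) P {s, t} u" and u: "u = (THE u. lub_in (left_le G P) P {s, t} u)"
    by (auto simp: join_in_def split: if_splits)
  have lub: "lub_in (left_le G P) P {s, t} v \<longleftrightarrow>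
      v \<in> s <# P \<and> v \<in> t <# P \<and> (\<forall>x. x \<in> s <# P \<and> x \<in> t <# P \<longrightarrow> x \<in> v <# P)" for v
  proof -
    have "left_le G P v x \<longleftrightarrow> x \<in> v <# P" if "v \<in> s <# P" "x \<in> s <# P" for x
    proof -
      have "v \<in> P" "x \<in> P" using coset_subset_cone[OF s] that by auto
      then show ?thesis using cone_carrier by (simp add: left_le_def mem_coset_cone_iff)
    qed
    then show ?thesis unfolding lub_in_def ub by blast
  qed
  have "finite {s, t}" "{s, t} \<subseteq> carrier G" using s t cone_carrier by auto
  then obtain v where v: "lub_in (left_le G P) P {s, t} v" using ql ex unfolding quasi_lattice_def by blast
  have "w = v" if w: "lub_in (left_le G P) P {s, t} w" for w
  proof (rule coset_antisym)
    show "w \<in> P" "v \<in> P" using v w coset_subset_cone[OF s] unfolding lub by auto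
    show "w \<in> v <# P" "v \<in> w <# P" using v w unfolding lub by blast+
  qed
  then have "u = v" unfolding u using v by blast
  then show "u \<in> P \<and> (\<forall>x. x \<in> u <# P \<longleftrightarrow> x \<in> s <# P \<and> x \<in> t <# P)"
    using v coset_subset_cone[OF s] coset_trans[OF s, of v] coset_trans[OF t, of v] unfolding lub by blast
qed

lemma join_left_one:
  assumes "quasi_lattice G P (left_le G P)" "s \<in> P" "t \<in> P" "t \<in> s <# P"
  shows "join_in (left_le G P) P s t = Some t"
proof (cases "join_in (left_le G P) P s t")
  case None
  have "t \<in> t <# P" using assms(3) one_in_cone cone_carrier by (simp add: mem_coset_cone_iff)
  then show ?thesis using join_left(2)[OF assms(1-3) None] assms(4) by blast
next
  case (Some u)
  note u = join_left(1)[OF assms(1-3) Some]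
  have tt: "t \<in> t <# P" using assms(3) one_in_cone cone_carrier by (simp add: mem_coset_cone_iff)
  have "u \<in> P" using u by blast
  then have uu: "u \<in> u <# P" using one_in_cone cone_carrier by (simp add: mem_coset_cone_iff)
  have "u = t"
  proof (rule coset_antisym)
    show "t \<in> u <# P" using u tt assms(4) by blast
    show "u \<in> t <# P" using u uu by blast
  qed (use u assms in blast)+
  then show ?thesis using Some by simp
qed

section \<open>Bounded functions on the cone as a C*-algebra\<close>

lemma linf_norm_le_iff:
  assumes "f \<in> carrier (linf P)" shows "cnorm (linf P) f \<le> K \<longleftrightarrow> (\<forall>x\<in>P. cmod (f x) \<le> K)"
proof -
  have "bdd_above ((\<lambda>x. cmod (f x)) ` P)" using assms by (force simp: linf_def bounded_iff bdd_above_def)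
  moreover have "P \<noteq> {}" using one_in_cone by blast
  ultimately show ?thesis by (simp add: linf_def cSUP_le_iff)
qed

lemma linf_upper: "f \<in> carrier (linf P) \<Longrightarrow> x \<in> P \<Longrightarrow> cmod (f x) \<le> cnorm (linf P) f"
  using linf_norm_le_iff[of f "cnorm (linf P) f"] by auto

lemma linf_carrier_iff: "f \<in> carrier (linf P) \<longleftrightarrow> (\<forall>x. x \<notin> P \<longrightarrow> f x = 0) \<and> (\<exists>K. \<forall>x\<in>P. cmod (f x) \<le> K)"
  by (auto simp: linf_def bounded_iff)

lemma linf_ops [simp]:
  "f \<oplus>\<^bsub>linf P\<^esub> g = (\<lambda>x. f x + g x)" "f \<otimes>\<^bsub>linf P\<^esub> g = (\<lambda>x. f x * g x)" "\<zero>\<^bsub>linf P\<^esub> = (\<lambda>x. 0)"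
  "c \<odot>\<^bsub>linf P\<^esub> f = (\<lambda>x. c * f x)" "star (linf P) f = (\<lambda>x. cnj (f x))" "\<one>\<^bsub>linf P\<^esub> = indicator P"
  by (simp_all add: linf_def)

lemma linf_closed:
  assumes f: "f \<in> carrier (linf P)" and g: "g \<in> carrier (linf P)"
  shows "(\<lambda>x. f x + g x) \<in> carrier (linf P)" "(\<lambda>x. f x * g x) \<in> carrier (linf P)"
    "(\<lambda>x. c * f x) \<in> carrier (linf P)" "(\<lambda>x. cnj (f x)) \<in> carrier (linf P)"
proof -
  obtain K L where K: "\<And>x. x \<in> P \<Longrightarrow> cmod (f x) \<le> K" and L: "\<And>x. x \<in> P \<Longrightarrow> cmod (g x) \<le> L"
    using f g unfolding linf_carrier_iff by blast
  have z: "\<And>x. x \<notin> P \<Longrightarrow> f x = 0" "\<And>x. x \<notin> P \<Longrightarrow> g x = 0" using f g unfolding linf_carrier_iff by blast+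
  show "(\<lambda>x. f x + g x) \<in> carrier (linf P)"
    unfolding linf_carrier_iff using K L z by (auto intro!: exI[of _ "K + L"] norm_triangle_mono)
  have "cmod (f x * g x) \<le> K * L" if "x \<in> P" for x
    unfolding norm_mult using K[OF that] L[OF that] order_trans[OF norm_ge_zero K[OF that]] by (intro mult_mono) auto
  then show "(\<lambda>x. f x * g x) \<in> carrier (linf P)" unfolding linf_carrier_iff using z by auto
  show "(\<lambda>x. c * f x) \<in> carrier (linf P)"
    unfolding linf_carrier_iff using K z by (auto simp: norm_mult intro!: exI[of _ "cmod c * K"] mult_left_mono)
  show "(\<lambda>x. cnj (f x)) \<in> carrier (linf P)" unfolding linf_carrier_iff using K z by auto
qed

lemma linf_module: "module complex_ring (linf P)"
proof (rule moduleI)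
  show "abelian_group (linf P)"
  proof (rule abelian_groupI)
    show "\<zero>\<^bsub>linf P\<^esub> \<in> carrier (linf P)" by (auto simp: linf_carrier_iff)
    fix f assume f: "f \<in> carrier (linf P)"
    show "\<exists>g\<in>carrier (linf P). g \<oplus>\<^bsub>linf P\<^esub> f = \<zero>\<^bsub>linf P\<^esub>"
      using linf_closed(3)[OF f f, of "- 1"] by (intro bexI[of _ "\<lambda>x. - 1 * f x"]) auto
  qed (auto simp: linf_closed add_ac)
qed (auto simp: linf_closed cring_complex_ring algebra_simps)

lemma linf_normed: "normed_module (linf P) (cnorm (linf P))"
proof (intro normed_module.intro normed_module_axioms.intro linf_module)
  fix f c assume f: "f \<in> carrier (linf P)"
  have "0 \<le> cmod (f \<one>)" by simp
  also have "\<dots> \<le> cnorm (linf P) f" by (rule linf_upper[OF f one_in_cone])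
  finally show nn: "0 \<le> cnorm (linf P) f" .
  show "f = \<zero>\<^bsub>linf P\<^esub>" if "cnorm (linf P) f = 0"
  proof
    fix x
    show "f x = \<zero>\<^bsub>linf P\<^esub> x"
      using linf_upper[OF f, of x] f that by (cases "x \<in> P") (auto simp: linf_carrier_iff)
  qed
  show "cnorm (linf P) (c \<odot>\<^bsub>linf P\<^esub> f) = cmod c * cnorm (linf P) f"
  proof (rule antisym)
    show "cnorm (linf P) (c \<odot>\<^bsub>linf P\<^esub> f) \<le> cmod c * cnorm (linf P) f"
      using f by (simp add: linf_norm_le_iff linf_closed norm_mult mult_left_mono linf_upper)
    show "cmod c * cnorm (linf P) f \<le> cnorm (linf P) (c \<odot>\<^bsub>linf P\<^esub> f)"
    proof (cases "c = 0")
      case True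
      have "0 \<le> cmod ((\<lambda>x. c * f x) \<one>)" by simp
      also have "\<dots> \<le> cnorm (linf P) (\<lambda>x. c * f x)" by (rule linf_upper[OF linf_closed(3)[OF f f] one_in_cone])
      finally show ?thesis using True by simp
    next
      case False
      have "cmod (f x) \<le> cnorm (linf P) (\<lambda>x. c * f x) / cmod c" if "x \<in> P" for x
        using linf_upper[OF linf_closed(3)[OF f f] that, of c] False by (simp add: norm_mult field_simps)
      then have "cnorm (linf P) f \<le> cnorm (linf P) (\<lambda>x. c * f x) / cmod c" using f by (simp add: linf_norm_le_iff)
      then show ?thesis using False by (simp add: field_simps)
    qed
  qed
  fix g assume g: "g \<in> carrier (linf P)"
  show "cnorm (linf P) (f \<oplus>\<^bsub>linf P\<^esub> g) \<le> cnorm (linf P) f + cnorm (linf P) g"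
    using f g by (auto simp: linf_norm_le_iff linf_closed intro!: norm_triangle_mono linf_upper)
qed

lemma linf_complete: "norm_complete (linf P) (cnorm (linf P))"
proof (rule normed_module.complete_iff[OF linf_normed, THEN iffD2], intro allI impI, elim conjE)
  fix X :: "nat \<Rightarrow> 'g \<Rightarrow> complex"
  assume X: "\<forall>n. X n \<in> carrier (linf P)"
    and cauchy: "\<forall>e>0. \<exists>K. \<forall>m\<ge>K. \<forall>n\<ge>K. cnorm (linf P) (X m \<oplus>\<^bsub>linf P\<^esub> (- 1) \<odot>\<^bsub>linf P\<^esub> X n) < e"
  have dc: "(\<lambda>x. f x + - 1 * g x) \<in> carrier (linf P)" if "f \<in> carrier (linf P)" "g \<in> carrier (linf P)" for f g
    using linf_closed(1)[OF that(1) linf_closed(3)[OF that(2,2), of "- 1"]] .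
  have up: "cmod (X m x - X n x) \<le> cnorm (linf P) (X m \<oplus>\<^bsub>linf P\<^esub> (- 1) \<odot>\<^bsub>linf P\<^esub> X n)" if "x \<in> P" for m n x
    using linf_upper[OF dc[of "X m" "X n"] that] X by simp
  have C: "\<exists>K. \<forall>m\<ge>K. \<forall>n\<ge>K. \<forall>x\<in>P. cmod (X m x - X n x) < e" if "e > 0" for e
    using cauchy that up order_le_less_trans by meson
  have "convergent (\<lambda>n. X n x)" for x
  proof (cases "x \<in> P")
    case True
    then have "Cauchy (\<lambda>n. X n x)" unfolding Cauchy_iff using C by meson
    then show ?thesis by (rule Cauchy_convergent)
  next
    case False
    then have "(\<lambda>n. X n x) = (\<lambda>n. 0)" using X by (auto simp: linf_carrier_iff)
    then show ?thesis by (simp add: convergent_const)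
  qed
  then obtain f where f: "\<And>x. (\<lambda>n. X n x) \<longlonglongrightarrow> f x" unfolding convergent_def by metis
  have lim: "cmod (X n x - f x) \<le> e" if K: "\<And>m. m \<ge> K \<Longrightarrow> cmod (X n x - X m x) < e" for n x e K
  proof (rule LIMSEQ_le_const2)
    show "(\<lambda>m. cmod (X n x - X m x)) \<longlonglongrightarrow> cmod (X n x - f x)" by (intro tendsto_intros f)
    show "\<exists>N. \<forall>m\<ge>N. cmod (X n x - X m x) \<le> e" using K less_imp_le by blast
  qed
  have fc: "f \<in> carrier (linf P)"
    unfolding linf_carrier_iff
  proof (intro conjI allI impI)
    fix x assume "x \<notin> P"
    then have "(\<lambda>n. X n x) = (\<lambda>n. 0)" using X by (auto simp: linf_carrier_iff)
    then show "f x = 0" using f[of x] by (simp add: LIMSEQ_const_iff)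
  next
    obtain K where K: "\<And>m n x. m \<ge> K \<Longrightarrow> n \<ge> K \<Longrightarrow> x \<in> P \<Longrightarrow> cmod (X m x - X n x) < 1" using C[of 1] by auto
    obtain L where L: "\<And>x. x \<in> P \<Longrightarrow> cmod (X K x) \<le> L" using X unfolding linf_carrier_iff by blast
    have "cmod (f x) \<le> L + 1" if "x \<in> P" for x
    proof -
      have "cmod (X K x - f x) \<le> 1" by (rule lim[of K]) (use K that in auto)
      then show ?thesis using L[OF that] norm_triangle_ineq4[of "X K x" "X K x - f x"] by simp
    qed
    then show "\<exists>K. \<forall>x\<in>P. cmod (f x) \<le> K" by blast
  qed
  show "\<exists>x\<in>carrier (linf P). \<forall>e>0. \<exists>K. \<forall>n\<ge>K. cnorm (linf P) (X n \<oplus>\<^bsub>linf P\<^esub> (- 1) \<odot>\<^bsub>linf P\<^esub> x) < e"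
  proof (intro bexI[of _ f] fc allI impI)
    fix e :: real assume e: "e > 0"
    then obtain K where K: "\<And>m n x. m \<ge> K \<Longrightarrow> n \<ge> K \<Longrightarrow> x \<in> P \<Longrightarrow> cmod (X m x - X n x) < e / 2" using C[of "e / 2"] by auto
    have "cnorm (linf P) (X n \<oplus>\<^bsub>linf P\<^esub> (- 1) \<odot>\<^bsub>linf P\<^esub> f) \<le> e / 2" if "n \<ge> K" for n
    proof -
      have "cmod (X n x - f x) \<le> e / 2" if "x \<in> P" for x
        by (rule lim[of K]) (use K \<open>n \<ge> K\<close> that in auto)
      then show ?thesis using linf_norm_le_iff[OF dc[of "X n" f], of "e / 2"] X fc by simp
    qed
    then show "\<exists>K. \<forall>n\<ge>K. cnorm (linf P) (X n \<oplus>\<^bsub>linf P\<^esub> (- 1) \<odot>\<^bsub>linf P\<^esub> f) < e"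
      using e by (intro exI[of _ K]) fastforce
  qed
qed

lemma linf_cstar: "cstar_algebra (linf P)"
proof -
  interpret normed_module "linf P" "cnorm (linf P)" by (rule linf_normed)
  show ?thesis
  proof (intro cstar_algebra.intro cstar_algebra_axioms.intro linf_module linf_complete)
    fix f c assume f: "f \<in> carrier (linf P)"
    show "cnorm (linf P) f = 0 \<Longrightarrow> f = \<zero>\<^bsub>linf P\<^esub>" by (rule N_eq_0[OF f])
    show "0 \<le> cnorm (linf P) f" by (rule N_nonneg[OF f])
    show "cnorm (linf P) (c \<odot>\<^bsub>linf P\<^esub> f) = cmod c * cnorm (linf P) f" by (rule N_smult[OF f])
    show "cnorm (linf P) (star (linf P) f \<otimes>\<^bsub>linf P\<^esub> f) = (cnorm (linf P) f)\<^sup>2"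
    proof (rule antisym)
      have s: "cmod (cnj (f x) * f x) = (cmod (f x))\<^sup>2" for x by (simp add: norm_mult power2_eq_square)
      have c: "(\<lambda>x. cnj (f x) * f x) \<in> carrier (linf P)" by (rule linf_closed(2)[OF linf_closed(4)[OF f f] f])
      show "cnorm (linf P) (star (linf P) f \<otimes>\<^bsub>linf P\<^esub> f) \<le> (cnorm (linf P) f)\<^sup>2"
        using c f by (simp add: linf_norm_le_iff s del: complex_mod_mult_cnj) (auto intro!: power_mono linf_upper)
      have "cnorm (linf P) f \<le> sqrt (cnorm (linf P) (\<lambda>x. cnj (f x) * f x))"
        unfolding linf_norm_le_iff[OF f] using linf_upper[OF c] unfolding s by (auto intro: real_le_rsqrt)
      then show "(cnorm (linf P) f)\<^sup>2 \<le> cnorm (linf P) (star (linf P) f \<otimes>\<^bsub>linf P\<^esub> f)"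
        using power_mono[OF _ N_nonneg[OF f], of "sqrt (cnorm (linf P) (\<lambda>x. cnj (f x) * f x))" 2] N_nonneg[OF c] by simp
    qed
    fix g assume g: "g \<in> carrier (linf P)"
    show "cnorm (linf P) (f \<oplus>\<^bsub>linf P\<^esub> g) \<le> cnorm (linf P) f + cnorm (linf P) g" by (rule N_triangle[OF f g])
    show "cnorm (linf P) (f \<otimes>\<^bsub>linf P\<^esub> g) \<le> cnorm (linf P) f * cnorm (linf P) g"
      using linf_closed(2)[OF f g] f g N_nonneg[OF f]
      by (auto simp: linf_norm_le_iff norm_mult intro!: mult_mono linf_upper)
  qed (auto simp: linf_closed algebra_simps fun_eq_iff)
qed

section \<open>The characteristic functions and the algebra that they span\<close>

lemma chi_closed: "t \<in> P \<Longrightarrow> chi G P t \<in> carrier (linf P)"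
  using coset_subset_cone[of t] by (auto simp: linf_carrier_iff chi_def indicator_def intro!: exI[of _ 1])

lemma chi_mult:
  assumes "quasi_lattice G P (left_le G P)" "s \<in> P" "t \<in> P"
  shows "(\<lambda>x. chi G P s x * chi G P t x) = (case join_in (left_le G P) P s t of Some u \<Rightarrow> chi G P u | None \<Rightarrow> (\<lambda>x. 0))"
  using join_left[OF assms] by (auto simp: chi_def indicator_def fun_eq_iff split: option.split)

lemma chi_one: "chi G P \<one> = indicator P"
proof -
  have "\<one> <# P = P" using cone_carrier by (auto simp: l_coset_def)
  then show ?thesis by (simp add: chi_def)
qed

text \<open>Products are handled in two stages. Multiplication by one \<open>chi G P s\<close>
  preserves the closed span since it does so on generators, by \<open>chi_mult\<close>; with this
  known, multiplication by an arbitrary element is again only checked on generators.\<close>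

lemma BP_subalgebra:
  assumes ql: "quasi_lattice G P (left_le G P)"
  shows "cstar_subalgebra (carrier (BP G P)) (linf P)"
proof -
  interpret normed_module "linf P" "cnorm (linf P)" by (rule linf_normed)
  interpret L: cstar_algebra "linf P" by (rule linf_cstar)
  have chi: "chi G P ` P \<subseteq> carrier (linf P)" using chi_closed by blast
  define C where "C = closed_span (linf P) (cnorm (linf P)) (chi G P ` P)"
  have sm: "submodule C complex_ring (linf P)" unfolding C_def by (rule closed_span_submodule[OF chi])
  have cl: "closedin (norm_topology (linf P) (cnorm (linf P))) C" unfolding C_def by (rule closed_span_closedin)
  have chiC: "chi G P t \<in> C" if "t \<in> P" for t using subset_closed_span[OF chi] that unfolding C_def by blast
  have CL: "C \<subseteq> carrier (linf P)" "\<zero>\<^bsub>linf P\<^esub> \<in> C" and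
    clo: "\<And>x y. x \<in> C \<Longrightarrow> y \<in> C \<Longrightarrow> x \<oplus>\<^bsub>linf P\<^esub> y \<in> C" "\<And>c x. x \<in> C \<Longrightarrow> c \<odot>\<^bsub>linf P\<^esub> x \<in> C"
    using sm unfolding submodule_iff by blast+
  have Ccl: "x \<in> C" if "x \<in> carrier (linf P)" "\<And>e. e > 0 \<Longrightarrow> \<exists>s\<in>C. cnorm (linf P) (x \<oplus>\<^bsub>linf P\<^esub> (- 1) \<odot>\<^bsub>linf P\<^esub> s) < e" for x
    using cl that unfolding closedin_iff by blast
  have least: "C \<subseteq> L" if "submodule L complex_ring (linf P)" "closedin (norm_topology (linf P) (cnorm (linf P))) L" "\<And>t. t \<in> P \<Longrightarrow> chi G P t \<in> L" for L
    unfolding C_def using that by (intro closed_span_least) auto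
  \<comment> \<open>A bounded additive map preserves \<open>C\<close> if it maps the generators into
    \<open>C\<close>. The scalar rule allows \<open>T (c f) = d (T f)\<close> with some other
    \<open>d\<close>, so that complex conjugation is covered.\<close>
  have pull: "C \<subseteq> {f \<in> carrier (linf P). T f \<in> C}"
    if Tc: "\<And>f. f \<in> carrier (linf P) \<Longrightarrow> T f \<in> carrier (linf P)"
      and Ta: "\<And>f g. f \<in> carrier (linf P) \<Longrightarrow> g \<in> carrier (linf P) \<Longrightarrow> T (f \<oplus>\<^bsub>linf P\<^esub> g) = T f \<oplus>\<^bsub>linf P\<^esub> T g"
      and Ts: "\<And>f c. f \<in> carrier (linf P) \<Longrightarrow> \<exists>d. T (c \<odot>\<^bsub>linf P\<^esub> f) = d \<odot>\<^bsub>linf P\<^esub> T f"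
      and Tm: "\<And>f. f \<in> carrier (linf P) \<Longrightarrow> T ((- 1) \<odot>\<^bsub>linf P\<^esub> f) = (- 1) \<odot>\<^bsub>linf P\<^esub> T f"
      and Tn: "\<And>f. f \<in> carrier (linf P) \<Longrightarrow> cnorm (linf P) (T f) \<le> K * cnorm (linf P) f"
      and Tchi: "\<And>t. t \<in> P \<Longrightarrow> T (chi G P t) \<in> C" for T K
  proof (rule least)
    let ?L = "{f \<in> carrier (linf P). T f \<in> C}"
    have T0: "T \<zero>\<^bsub>linf P\<^esub> = \<zero>\<^bsub>linf P\<^esub>"
    proof -
      have "cnorm (linf P) (T \<zero>\<^bsub>linf P\<^esub>) \<le> 0" using Tn[of "\<zero>\<^bsub>linf P\<^esub>"] by (simp del: linf_ops)
      then show ?thesis using N_nonneg N_eq_0 Tc by (metis M.zero_closed order_antisym)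
    qed
    show "submodule ?L complex_ring (linf P)"
      unfolding submodule_iff
    proof (intro conjI ballI allI)
      show "\<zero>\<^bsub>linf P\<^esub> \<in> ?L" using T0 CL by (simp del: linf_ops)
      fix f assume f: "f \<in> ?L"
      show "c \<odot>\<^bsub>linf P\<^esub> f \<in> ?L" for c
        using f clo(2) Ts[of f c] by (auto simp del: linf_ops)
      fix g assume g: "g \<in> ?L"
      show "f \<oplus>\<^bsub>linf P\<^esub> g \<in> ?L" using f g clo(1) Ta by (auto simp del: linf_ops)
    qed blast
    show "closedin (norm_topology (linf P) (cnorm (linf P))) ?L"
      unfolding closedin_iff
    proof (intro conjI ballI impI)
      fix f assume f: "f \<in> carrier (linf P)" "\<forall>e>0. \<exists>s\<in>?L. cnorm (linf P) (f \<oplus>\<^bsub>linf P\<^esub> (- 1) \<odot>\<^bsub>linf P\<^esub> s) < e"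
      have "T f \<in> C"
      proof (rule Ccl[OF Tc[OF f(1)]])
        fix e :: real assume e: "e > 0"
        then have "e / (\<bar>K\<bar> + 1) > 0" by simp
        then obtain s where s: "s \<in> carrier (linf P)" "T s \<in> C" "cnorm (linf P) (f \<oplus>\<^bsub>linf P\<^esub> (- 1) \<odot>\<^bsub>linf P\<^esub> s) < e / (\<bar>K\<bar> + 1)"
          using f(2) by blast
        let ?d = "f \<oplus>\<^bsub>linf P\<^esub> (- 1) \<odot>\<^bsub>linf P\<^esub> s"
        have d: "?d \<in> carrier (linf P)" by (intro M.a_closed smult_clos f(1) s(1))
        have "T ?d = T f \<oplus>\<^bsub>linf P\<^esub> (- 1) \<odot>\<^bsub>linf P\<^esub> T s"
          using Ta[OF f(1) smult_clos[OF s(1)]] Tm[OF s(1)] by (simp del: linf_ops)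
        then have "cnorm (linf P) (T f \<oplus>\<^bsub>linf P\<^esub> (- 1) \<odot>\<^bsub>linf P\<^esub> T s) \<le> K * cnorm (linf P) ?d" using Tn[OF d] by (simp del: linf_ops)
        also have "\<dots> \<le> (\<bar>K\<bar> + 1) * cnorm (linf P) ?d" by (rule mult_right_mono) (use N_nonneg[OF d] in auto)
        also have "\<dots> < e" using s(3) by (simp add: pos_less_divide_eq mult.commute del: linf_ops)
        finally show "\<exists>s\<in>C. cnorm (linf P) (T f \<oplus>\<^bsub>linf P\<^esub> (- 1) \<odot>\<^bsub>linf P\<^esub> s) < e" using s(2) by blast
      qed
      then show "f \<in> ?L" using f(1) by blast
    qed blast
    show "chi G P t \<in> ?L" if "t \<in> P" for t using that chi_closed Tchi by blast
  qed
  have multchi: "C \<subseteq> {f \<in> carrier (linf P). (\<lambda>x. chi G P s x * f x) \<in> C}" if s: "s \<in> P" for s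
  proof (rule pull)
    fix f assume f: "f \<in> carrier (linf P)"
    show "(\<lambda>x. chi G P s x * f x) \<in> carrier (linf P)" by (rule linf_closed[OF chi_closed[OF s] f])
    then show "cnorm (linf P) (\<lambda>x. chi G P s x * f x) \<le> cnorm (linf P) (chi G P s) * cnorm (linf P) f"
      using L.cnorm_mult[OF chi_closed[OF s] f] by simp
  next
    fix t assume t: "t \<in> P"
    show "(\<lambda>x. chi G P s x * chi G P t x) \<in> C"
      unfolding chi_mult[OF ql s t] using chiC CL(2) join_left(1)[OF ql s t] by (auto split: option.split)
  qed (auto simp: algebra_simps fun_eq_iff)
  have mult: "C \<subseteq> {f \<in> carrier (linf P). (\<lambda>x. f x * g x) \<in> C}" if g: "g \<in> C" for g
  proof (rule pull)
    have gL: "g \<in> carrier (linf P)" using g CL by blast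
    fix f assume f: "f \<in> carrier (linf P)"
    show "(\<lambda>x. f x * g x) \<in> carrier (linf P)" by (rule linf_closed[OF f gL])
    then show "cnorm (linf P) (\<lambda>x. f x * g x) \<le> cnorm (linf P) g * cnorm (linf P) f"
      using L.cnorm_mult[OF f gL] by (simp add: mult.commute)
  next
    fix t assume t: "t \<in> P"
    show "(\<lambda>x. chi G P t x * g x) \<in> C" using multchi[OF t] g by blast
  qed (auto simp: algebra_simps fun_eq_iff)
  have star: "C \<subseteq> {f \<in> carrier (linf P). (\<lambda>x. cnj (f x)) \<in> C}"
  proof (rule pull)
    fix f c assume f: "f \<in> carrier (linf P)"
    show "(\<lambda>x. cnj (f x)) \<in> carrier (linf P)" by (rule linf_closed[OF f f])
    then show "cnorm (linf P) (\<lambda>x. cnj (f x)) \<le> 1 * cnorm (linf P) f"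
      using f by (simp add: linf_norm_le_iff linf_upper)
    show "\<exists>d. (\<lambda>x. cnj ((c \<odot>\<^bsub>linf P\<^esub> f) x)) = d \<odot>\<^bsub>linf P\<^esub> (\<lambda>x. cnj (f x))" by (rule exI[of _ "cnj c"]) auto
  next
    fix t assume "t \<in> P"
    moreover have "(\<lambda>x. cnj (chi G P t x)) = chi G P t" by (auto simp: chi_def indicator_def)
    ultimately show "(\<lambda>x. cnj (chi G P t x)) \<in> C" using chiC by simp
  qed auto
  have "carrier (BP G P) = C" by (simp add: BP_def C_def)
  then show ?thesis
    unfolding cstar_subalgebra_def using sm cl mult star by auto
qed

lemma BP_unital_cstar_algebra: assumes ql: "quasi_lattice G P (left_le G P)" shows "unital_cstar_algebra (BP G P)"
proof -
  interpret normed_module "linf P" "cnorm (linf P)" by (rule linf_normed)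
  have e: "BP G P = (linf P)\<lparr>carrier := carrier (BP G P)\<rparr>" by (simp add: BP_def)
  have c: "cstar_algebra (BP G P)"
    by (subst e) (rule cstar_subalgebra_cstar_algebra[OF linf_cstar BP_subalgebra[OF ql]])
  have L: "carrier (BP G P) \<subseteq> carrier (linf P)" using BP_subalgebra[OF ql] by (simp add: cstar_subalgebra_def submodule_iff)
  have "chi G P ` P \<subseteq> carrier (linf P)" using chi_closed by blast
  from subset_closed_span[OF this] have "chi G P \<one> \<in> carrier (BP G P)"
    unfolding BP_def using one_in_cone by auto
  then have 1: "\<one>\<^bsub>BP G P\<^esub> \<in> carrier (BP G P)" by (simp add: chi_one) (simp add: BP_def)
  have "indicator P x * f x = f x" if "f \<in> carrier (BP G P)" for f :: "'g \<Rightarrow> complex" and x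
    using L that by (cases "x \<in> P") (auto simp: linf_carrier_iff subset_iff)
  then show ?thesis
    unfolding unital_cstar_algebra_def unital_cstar_algebra_axioms_def using c 1 by (auto simp: BP_def fun_eq_iff mult.commute)
qed

lemma BP_carrier_linf: "f \<in> carrier (BP G P) \<Longrightarrow> f \<in> carrier (linf P)"
  and chi_in_BP: "t \<in> P \<Longrightarrow> chi G P t \<in> carrier (BP G P)"
proof -
  interpret normed_module "linf P" "cnorm (linf P)" by (rule linf_normed)
  have "chi G P ` P \<subseteq> carrier (linf P)" using chi_closed by blast
  note subset_closed_span[OF this] closed_span_submodule[OF this]
  then show "f \<in> carrier (BP G P) \<Longrightarrow> f \<in> carrier (linf P)" "t \<in> P \<Longrightarrow> chi G P t \<in> carrier (BP G P)"
    unfolding BP_def submodule_iff by auto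
qed

text \<open>The elements with property \<open>Q\<close> form a closed subspace containing the
  generators; the case \<open>lim\<close> is closedness in approximate form.\<close>

lemma BP_induct [consumes 1, case_names chi zero add scale lim]:
  assumes f: "f \<in> carrier (BP G P)"
    and chi: "\<And>t. t \<in> P \<Longrightarrow> Q (chi G P t)" and zero: "Q (\<lambda>x. 0)"
    and add: "\<And>f g. f \<in> carrier (BP G P) \<Longrightarrow> g \<in> carrier (BP G P) \<Longrightarrow> Q f \<Longrightarrow> Q g \<Longrightarrow> Q (\<lambda>x. f x + g x)"
    and scale: "\<And>c f. f \<in> carrier (BP G P) \<Longrightarrow> Q f \<Longrightarrow> Q (\<lambda>x. c * f x)"
    and lim: "\<And>f. f \<in> carrier (BP G P) \<Longrightarrow>
      (\<And>e. e > 0 \<Longrightarrow> \<exists>g\<in>carrier (BP G P). Q g \<and> cnorm (linf P) (\<lambda>x. f x - g x) < e) \<Longrightarrow> Q f"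
  shows "Q f"
proof -
  interpret normed_module "linf P" "cnorm (linf P)" by (rule linf_normed)
  have chiL: "chi G P ` P \<subseteq> carrier (linf P)" using chi_closed by blast
  let ?L = "{f \<in> carrier (BP G P). Q f}"
  have BP: "carrier (BP G P) = closed_span (linf P) (cnorm (linf P)) (chi G P ` P)" by (simp add: BP_def)
  have sm: "submodule (carrier (BP G P)) complex_ring (linf P)" unfolding BP by (rule closed_span_submodule[OF chiL])
  have cl: "closedin (norm_topology (linf P) (cnorm (linf P))) (carrier (BP G P))" unfolding BP by (rule closed_span_closedin)
  have "carrier (BP G P) \<subseteq> ?L"
    unfolding BP
  proof (rule closed_span_least, unfold BP[symmetric])
    show "submodule ?L complex_ring (linf P)"
      using sm zero add scale unfolding submodule_iff by auto
    show "closedin (norm_topology (linf P) (cnorm (linf P))) ?L"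
      unfolding closedin_iff
    proof (intro conjI ballI impI)
      show "?L \<subseteq> carrier (linf P)" using BP_carrier_linf by blast
      fix f assume f: "f \<in> carrier (linf P)" "\<forall>e>0. \<exists>s\<in>?L. cnorm (linf P) (f \<oplus>\<^bsub>linf P\<^esub> (- 1) \<odot>\<^bsub>linf P\<^esub> s) < e"
      then have "f \<in> carrier (BP G P)" using cl unfolding closedin_iff by blast
      moreover have "\<exists>g\<in>carrier (BP G P). Q g \<and> cnorm (linf P) (\<lambda>x. f x - g x) < e" if "e > 0" for e
        using f(2) that by auto
      ultimately show "f \<in> ?L" using lim by blast
    qed
    show "chi G P ` P \<subseteq> ?L" using chi chi_in_BP by blast
  qed
  then show ?thesis using f by blast
qed

end

section \<open>Commuting families of projections indexed by the cone\<close>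

text \<open>The graph of the linear extension of \<open>c t \<mapsto> p t\<close>, as a relation:
  nothing has to be known about the uniqueness of linear combinations, since single-valuedness will
  follow from \<open>R_norm\<close>.\<close>

inductive span_rel :: "('g \<Rightarrow> 'g \<Rightarrow> complex) \<Rightarrow> ('g \<Rightarrow> 'u::cstar_ring) \<Rightarrow> 'g set \<Rightarrow> ('g \<Rightarrow> complex) \<Rightarrow> 'u \<Rightarrow> bool"
  for c p P where
  gen: "t \<in> P \<Longrightarrow> span_rel c p P (c t) (p t)"
| add: "span_rel c p P f a \<Longrightarrow> span_rel c p P g b \<Longrightarrow> span_rel c p P (\<lambda>x. f x + g x) (a + b)"
| scale: "span_rel c p P f a \<Longrightarrow> span_rel c p P (\<lambda>x. k * f x) (csc k a)"

text \<open>Models the range projections of a left covariant representation inside a larger algebra;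
  \<open>p \<one>\<close> is the unit of the family and may differ from 1.\<close>

locale cone_projections = ordered_pair G P for G :: "('g, 'm) monoid_scheme" (structure) and P +
  fixes p :: "'g \<Rightarrow> 'u::cstar_ring"
  assumes ql: "quasi_lattice G P (left_le G P)"
    and p_adj: "t \<in> P \<Longrightarrow> adj (p t) = p t"
    and p_mult: "s \<in> P \<Longrightarrow> t \<in> P \<Longrightarrow> p s * p t = (case join_in (left_le G P) P s t of Some u \<Rightarrow> p u | None \<Rightarrow> 0)"
begin

abbreviation "R \<equiv> span_rel (chi G P) p P"

lemma p_below: "s \<in> P \<Longrightarrow> t \<in> P \<Longrightarrow> t \<in> s <# P \<Longrightarrow> p s * p t = p t"
  by (simp add: p_mult join_left_one[OF ql])

text \<open>The product is again some \<open>p u\<close> or 0, hence self-adjoint, and its adjoint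
  is the product in the other order.\<close>

lemma p_commute: "s \<in> P \<Longrightarrow> t \<in> P \<Longrightarrow> p s * p t = p t * p s"
proof -
  assume st: "s \<in> P" "t \<in> P"
  have "adj (p s * p t) = p s * p t"
    unfolding p_mult[OF st] using join_left(1)[OF ql st] p_adj by (auto split: option.split)
  then show ?thesis using st by (simp add: adj_mult p_adj)
qed

lemma self_coset: "t \<in> P \<Longrightarrow> t \<in> t <# P"
  using one_in_cone cone_carrier by (simp add: mem_coset_cone_iff)

lemma p_idem: "t \<in> P \<Longrightarrow> p t * p t = p t"
  by (simp add: p_below self_coset)

lemma p_one: "t \<in> P \<Longrightarrow> p \<one> * p t = p t"
  by (rule p_below) (use one_in_cone cone_carrier in \<open>auto simp: mem_coset_cone_iff\<close>)

lemma R_zero: "R (\<lambda>x. 0) 0"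
  using span_rel.scale[OF span_rel.gen[OF one_in_cone], where k = 0 and c = "chi G P" and p = p] by simp

lemma R_adj: "R f a \<Longrightarrow> R (\<lambda>x. cnj (f x)) (adj a)"
proof (induction rule: span_rel.induct)
  case (gen t)
  have "(\<lambda>x. cnj (chi G P t x)) = chi G P t" by (auto simp: chi_def indicator_def)
  then show ?case using span_rel.gen[OF gen] p_adj[OF gen] by simp
next
  case (add f a g b) then show ?case using span_rel.add by (simp add: adj_add)
next
  case (scale f a k) then show ?case using span_rel.scale by (simp add: adj_csc)
qed

lemma R_gen_mult: "R g b \<Longrightarrow> t \<in> P \<Longrightarrow> R (\<lambda>x. chi G P t x * g x) (p t * b)"
proof (induction rule: span_rel.induct)
  case (gen s)
  show ?case
    unfolding chi_mult[OF ql gen(2,1)] p_mult[OF gen(2,1)]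
    using span_rel.gen join_left(1)[OF ql gen(2,1)] R_zero by (auto split: option.split)
next
  case (add f a g b) then show ?case using span_rel.add[OF add.IH(1,2)] by (simp add: distrib_left)
next
  case (scale f a k)
  have "(\<lambda>x. k * (chi G P t x * f x)) = (\<lambda>x. chi G P t x * (k * f x))" by (simp add: mult.left_commute)
  then show ?case using span_rel.scale[OF scale.IH, of k] scale.prems by (simp add: csc_mult_right)
qed

lemma R_mult: "R f a \<Longrightarrow> R g b \<Longrightarrow> R (\<lambda>x. f x * g x) (a * b)"
proof (induction rule: span_rel.induct)
  case (gen t) then show ?case using R_gen_mult by blast
next
  case (add f a f' a') then show ?case using span_rel.add[OF add.IH(1,2)] by (simp add: distrib_right)
next
  case (scale f a k) then show ?case using span_rel.scale[OF scale.IH, of k] by (simp add: csc_mult_left mult.assoc)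
qed

lemma R_unit: "R f a \<Longrightarrow> p \<one> * a = a"
  by (induction rule: span_rel.induct) (simp_all add: p_one distrib_left csc_mult_right)

lemma R_carrier: "R f a \<Longrightarrow> f \<in> carrier (linf P)"
  by (induction rule: span_rel.induct) (auto intro: chi_closed linf_closed)

text \<open>\<open>F\<close> collects the generators that occur in \<open>a\<close>. If each of them
  acts on \<open>Q\<close> as 1 or 0 according to whether its ideal contains \<open>x\<close>, then
  \<open>a\<close> acts on \<open>Q\<close> as its function value at \<open>x\<close>.\<close>

lemma R_eval:
  "R g a \<Longrightarrow> \<exists>F. finite F \<and> F \<subseteq> P \<and> (\<forall>Q x. (\<forall>t\<in>F. Q * p t = (if x \<in> t <# P then Q else 0)) \<longrightarrow> Q * a = csc (g x) Q)"
proof (induction rule: span_rel.induct)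
  case (gen t)
  then show ?case by (intro exI[of _ "{t}"]) (auto simp: chi_def)
next
  case (add f a g b)
  let ?Z = "\<lambda>F a f. \<forall>Q x. (\<forall>t\<in>F. Q * p t = (if x \<in> t <# P then Q else 0)) \<longrightarrow> Q * a = csc (f x) Q"
  obtain F where F: "finite F \<and> F \<subseteq> P \<and> ?Z F a f" using add.IH(1) by (rule exE)
  obtain F' where F': "finite F' \<and> F' \<subseteq> P \<and> ?Z F' b g" using add.IH(2) by (rule exE)
  show ?case
  proof (intro exI[of _ "F \<union> F'"] conjI allI impI)
    fix Q x assume *: "\<forall>t\<in>F \<union> F'. Q * p t = (if x \<in> t <# P then Q else 0)"
    have "Q * a = csc (f x) Q" "Q * b = csc (g x) Q"
      by (rule F[THEN conjunct2, THEN conjunct2, rule_format] F'[THEN conjunct2, THEN conjunct2, rule_format], use * in simp)+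
    then show "Q * (a + b) = csc (f x + g x) Q" by (simp add: distrib_left csc_add_left)
  qed (use F F' in auto)
next
  case (scale f a k)
  let ?Z = "\<lambda>F a f. \<forall>Q x. (\<forall>t\<in>F. Q * p t = (if x \<in> t <# P then Q else 0)) \<longrightarrow> Q * a = csc (f x) Q"
  obtain F where F: "finite F \<and> F \<subseteq> P \<and> ?Z F a f" using scale.IH by (rule exE)
  show ?case
  proof (intro exI[of _ F] conjI allI impI)
    fix Q x assume *: "\<forall>t\<in>F. Q * p t = (if x \<in> t <# P then Q else 0)"
    have "Q * a = csc (f x) Q"
      by (rule F[THEN conjunct2, THEN conjunct2, rule_format]) (use * in simp)
    then show "Q * csc k a = csc (k * f x) Q" by (simp add: csc_mult_right csc_assoc)
  qed (use F in auto)
qed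

text \<open>
  A projection \<open>Q\<close> below \<open>p u\<close> and orthogonal to \<open>p s\<close> for \<open>s\<close> in \<open>E\<close> is split along \<open>p t\<close> for all
  \<open>t\<close> in a finite set \<open>F\<close>. On each of the resulting pieces \<open>a\<close> acts as the scalar \<open>g u\<close>, unless
  \<open>u\<close> lies in \<open>s P\<close> for some \<open>s\<close> in \<open>E\<close>, in which case the piece vanishes.
\<close>

definition piece :: "'g \<Rightarrow> 'g set \<Rightarrow> 'u \<Rightarrow> bool" where
  "piece u E Q \<longleftrightarrow> u \<in> P \<and> adj Q = Q \<and> Q * Q = Q \<and> (\<forall>t\<in>P. Q * p t = p t * Q) \<and> Q * p u = Q \<and> (\<forall>s\<in>E. Q * p s = 0)"

lemma pos_pieces:
  assumes F: "finite F" "F \<subseteq> P"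
    and ev: "\<And>Q x. (\<forall>t\<in>F. Q * p t = (if x \<in> t <# P then Q else 0)) \<Longrightarrow> Q * a = csc (g x) Q"
    and g: "\<And>x. x \<in> P \<Longrightarrow> g x = of_real (r x) \<and> r x \<ge> 0"
  shows "finite S \<Longrightarrow> S \<subseteq> F \<Longrightarrow> piece u E Q \<Longrightarrow> (\<forall>t\<in>F - S. u \<in> t <# P \<or> t \<in> E) \<Longrightarrow> pos (Q * a)"
proof (induction S arbitrary: u E Q rule: finite_induct)
  \<comment> \<open>Every \<open>t\<close> in \<open>F\<close> is settled: either \<open>u\<close>
    lies in \<open>tP\<close> and \<open>Q * p t = Q\<close>, or \<open>t\<close> is in
    \<open>E\<close> and \<open>Q * p t = 0\<close>. If both hold for one \<open>t\<close>, then
    \<open>Q = 0\<close>; otherwise \<open>ev\<close> applies at the point \<open>u\<close>.\<close>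
  case empty
  then have Q: "u \<in> P" "adj Q = Q" "Q * Q = Q" "Q * p u = Q" "\<And>s. s \<in> E \<Longrightarrow> Q * p s = 0" unfolding piece_def by blast+
  have up: "Q * p t = Q" if "t \<in> F" "u \<in> t <# P" for t
  proof -
    have "t \<in> P" using that F by blast
    then have "p u * p t = p u" using p_below[OF _ Q(1) that(2)] p_commute Q(1) by simp
    then show ?thesis by (metis Q(4) mult.assoc)
  qed
  show ?case
  proof (cases "\<exists>t\<in>F. t \<in> E \<and> u \<in> t <# P")
    case True
    then have "Q = 0" using up Q(5) by metis
    then show ?thesis by simp
  next
    case False
    have "Q * a = csc (g u) Q"
      by (rule ev) (use False up Q(5) empty(3) in auto)
    then have "Q * a = r u *\<^sub>R (Q * Q)" using g[OF Q(1)] Q(3) by (simp add: csc_of_real)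
    then show ?thesis using pos_scaleR[OF pos_square[OF Q(2)], of "r u"] g[OF Q(1)] by simp
  qed
next
  case (insert t S)
  then have t: "t \<in> P" "t \<in> F" and Q: "u \<in> P" "adj Q = Q" "Q * Q = Q" "\<And>s. s \<in> P \<Longrightarrow> Q * p s = p s * Q" "Q * p u = Q" "\<And>s. s \<in> E \<Longrightarrow> Q * p s = 0"
    using F unfolding piece_def by blast+
  have E: "\<And>t'. t' \<in> F - insert t S \<Longrightarrow> u \<in> t' <# P \<or> t' \<in> E" using insert.prems by blast
  \<comment> \<open>\<open>Q1\<close> moves below \<open>p t\<close> and is relabelled by the join
    of \<open>u\<close> and \<open>t\<close>; \<open>Q2\<close> keeps the label \<open>u\<close> and
    adds \<open>t\<close> to the excluded set.\<close>
  define Q1 where "Q1 = Q * p t"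
  define Q2 where "Q2 = Q - Q1"
  have Q1p: "Q1 * p s = Q * p s * p t" if "s \<in> P" for s
    unfolding Q1_def mult.assoc using p_commute[OF t(1) that] by simp
  have Q1: "adj Q1 = Q1" "Q1 * Q1 = Q1" "Q1 * Q = Q1" "Q * Q1 = Q1" "Q1 * p t = Q1"
  proof -
    show a: "adj Q1 = Q1" unfolding Q1_def adj_mult Q(2) p_adj[OF t(1)] using Q(4)[OF t(1)] by simp
    show "Q1 * p t = Q1" unfolding Q1_def mult.assoc p_idem[OF t(1)] ..
    show c: "Q * Q1 = Q1" unfolding Q1_def mult.assoc[symmetric] Q(3) ..
    show d: "Q1 * Q = Q1" using arg_cong[OF c, of adj] by (simp add: adj_mult a Q(2))
    show "Q1 * Q1 = Q1" by (metis \<open>Q1 * p t = Q1\<close> Q1_def d mult.assoc)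
  qed
  have Q1c: "Q1 * p s = p s * Q1" if "s \<in> P" for s
    unfolding Q1p[OF that] unfolding Q1_def Q(4)[OF that] mult.assoc ..
  have pos1: "pos (Q1 * a)"
  proof (cases "join_in (left_le G P) P u t")
    \<comment> \<open>Without a common upper bound \<open>p u * p t = 0\<close>, and this piece
      vanishes.\<close>
    case None
    have "Q1 = Q * (p u * p t)" unfolding Q1_def by (simp add: mult.assoc[symmetric] Q(5))
    then show ?thesis using None by (simp add: p_mult[OF Q(1) t(1)])
  next
    case (Some w)
    note w = join_left(1)[OF ql Q(1) t(1) Some]
    have ww: "w \<in> w <# P" using w self_coset by blast
    have "Q1 * p w = Q1 * (p u * p t)" using Some by (simp add: p_mult[OF Q(1) t(1)])
    also have "\<dots> = Q1" unfolding mult.assoc[symmetric] Q1p[OF Q(1)] Q(5) Q1_def[symmetric] Q1(5) ..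
    finally have pw: "Q1 * p w = Q1" .
    have "Q1 * p s = 0" if "s \<in> E" for s
    proof (cases "s \<in> P")
      case True then show ?thesis using Q1p[OF True] Q(6)[OF that] by simp
    next
      case False
      have "Q1 * p s = Q1 * (Q * p s)" by (simp add: mult.assoc[symmetric] Q1(3))
      then show ?thesis using Q(6)[OF that] by simp
    qed
    then have "piece w E Q1" unfolding piece_def using w Q1 Q1c pw by blast
    moreover have "\<forall>t'\<in>F - S. w \<in> t' <# P \<or> t' \<in> E"
    proof
      fix t' assume t': "t' \<in> F - S"
      show "w \<in> t' <# P \<or> t' \<in> E"
      proof (cases "t' = t")
        case True then show ?thesis using w ww by blast
      next
        case False
        then have "u \<in> t' <# P \<or> t' \<in> E" using E t' by blast
        moreover have "w \<in> u <# P" using w ww by blast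
        moreover have "t' \<in> P" using t' F by blast
        ultimately show ?thesis using coset_trans[of t' u w] by blast
      qed
    qed
    ultimately show ?thesis using insert.IH insert.prems(1) by blast
  qed
  have "piece u (insert t E) Q2"
    unfolding piece_def
  proof (intro conjI ballI)
    show "u \<in> P" by fact
    show "adj Q2 = Q2" by (simp add: Q2_def adj_diff Q(2) Q1(1))
    show "Q2 * Q2 = Q2" by (simp add: Q2_def left_diff_distrib right_diff_distrib Q(3) Q1)
    show "Q2 * p s = p s * Q2" if "s \<in> P" for s
      using Q(4)[OF that] Q1c[OF that] by (simp add: Q2_def left_diff_distrib right_diff_distrib)
    show "Q2 * p u = Q2" using Q1p[OF Q(1)] by (simp add: Q2_def left_diff_distrib Q(5) flip: Q1_def)
    show "Q2 * p s = 0" if "s \<in> insert t E" for s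
    proof (cases "s = t")
      case True then show ?thesis by (simp add: Q2_def left_diff_distrib Q1(5) flip: Q1_def)
    next
      case False
      then have "Q * p s = 0" using that Q(6) by blast
      moreover have "Q1 * p s = Q1 * (Q * p s)" by (simp add: mult.assoc[symmetric] Q1(3))
      ultimately show ?thesis by (simp add: Q2_def left_diff_distrib)
    qed
  qed
  then have pos2: "pos (Q2 * a)" using insert.IH insert.prems(1) E by blast
  have "Q * a = Q1 * a + Q2 * a" by (simp add: Q2_def left_diff_distrib)
  then show ?case using pos_add[OF pos1 pos2] by simp
qed

text \<open>The splitting starts from \<open>p \<one>\<close> labelled by \<open>\<one>\<close>,
  with nothing excluded and all of \<open>F\<close> still to be treated.\<close>

lemma R_pos:
  assumes a: "R g a" and g: "\<And>x. x \<in> P \<Longrightarrow> g x = of_real (r x) \<and> r x \<ge> 0" shows "pos a"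
proof -
  obtain F where F: "finite F \<and> F \<subseteq> P \<and>
      (\<forall>Q x. (\<forall>t\<in>F. Q * p t = (if x \<in> t <# P then Q else 0)) \<longrightarrow> Q * a = csc (g x) Q)"
    using R_eval[OF a] by (rule exE)
  have pc: "piece \<one> {} (p \<one>)"
    unfolding piece_def using one_in_cone p_adj p_idem p_commute by auto
  have "pos (p \<one> * a)"
    by (rule pos_pieces[where F = F and g = g and r = r and S = F and u = "\<one>" and E = "{}" and Q = "p \<one>"])
      (use F g pc in auto)
  then show ?thesis by (simp add: R_unit[OF a])
qed

text \<open>Positivity is applied to \<open>M^2 - |f|^2\<close> for \<open>M\<close> the supremum of
  \<open>|f|\<close>, which gives \<open>adj a * a\<close> at most \<open>M^2\<close> times
  \<open>p \<one>\<close>. Adding \<open>M^2 (1 - p \<one>)\<close> passes to the unit of the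
  ambient algebra.\<close>

lemma R_norm: assumes a: "R f a" shows "norm a \<le> cnorm (linf P) f"
proof -
  define M where "M = cnorm (linf P) f"
  have f: "f \<in> carrier (linf P)" by (rule R_carrier[OF a])
  have M: "\<And>x. x \<in> P \<Longrightarrow> cmod (f x) \<le> M" unfolding M_def by (rule linf_upper[OF f])
  have M0: "0 \<le> M" using M[OF one_in_cone] norm_ge_zero order_trans by blast
  let ?g = "\<lambda>x. of_real (M\<^sup>2) * chi G P \<one> x + - 1 * (cnj (f x) * f x)"
  let ?X = "csc (of_real (M\<^sup>2)) (p \<one>) + csc (- 1) (adj a * a)"
  have "R ?g ?X"
    by (intro span_rel.add span_rel.scale span_rel.gen one_in_cone R_mult R_adj a)
  moreover have "?g x = of_real (M\<^sup>2 - (cmod (f x))\<^sup>2) \<and> M\<^sup>2 - (cmod (f x))\<^sup>2 \<ge> 0" if "x \<in> P" for x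
    using that M[OF that] M0 complex_norm_square[of "f x"] by (simp add: chi_one mult.commute power_mono)
  ultimately have "pos ?X" by (rule R_pos)
  moreover have "?X = M\<^sup>2 *\<^sub>R p \<one> - adj a * a"
    using csc_of_real[of "M\<^sup>2" "p \<one>"] csc_of_real[of "- 1" "adj a * a"] by simp
  ultimately have 1: "pos (M\<^sup>2 *\<^sub>R p \<one> - adj a * a)" by simp
  have "(1 - p \<one>) * (1 - p \<one>) = 1 - p \<one>" by (simp add: left_diff_distrib right_diff_distrib p_idem one_in_cone)
  then have "pos (1 - p \<one>)" using pos_square[of "1 - p \<one>"] by (simp add: adj_diff p_adj one_in_cone)
  then have "pos (M\<^sup>2 *\<^sub>R (1 - p \<one>))" by (rule pos_scaleR) simp
  from pos_add[OF this 1] have 2: "pos (of_real (M\<^sup>2) - adj a * a)" by (simp add: of_real_def scaleR_right_diff_distrib)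
  have "norm (adj a * a) \<le> M\<^sup>2"
    by (rule norm_le_of_pos[OF _ 2]) (simp_all add: adj_mult pos_add pos_of_real pos_adj_mult del: of_real_power)
  then have "(norm a)\<^sup>2 \<le> M\<^sup>2" by (simp add: norm_adj_mult)
  then show ?thesis unfolding M_def[symmetric] by (rule power2_le_imp_le) (rule M0)
qed

end

text \<open>\<open>contractive_relation_extension\<close> transported through \<open>emb\<close>.
  Density is phrased by subalgebras: each one containing the domain of \<open>R\<close> is the whole
  algebra.\<close>

lemma unital_relation_extension:
  assumes A: "unital_cstar_algebra A" and B: "unital_cstar_algebra B" and R: "R \<subseteq> carrier A \<times> carrier B"
    and zero: "(\<zero>\<^bsub>A\<^esub>, \<zero>\<^bsub>B\<^esub>) \<in> R"
    and add: "\<And>a b a' b'. (a, b) \<in> R \<Longrightarrow> (a', b') \<in> R \<Longrightarrow> (a \<oplus>\<^bsub>A\<^esub> a', b \<oplus>\<^bsub>B\<^esub> b') \<in> R"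
    and mult: "\<And>a b a' b'. (a, b) \<in> R \<Longrightarrow> (a', b') \<in> R \<Longrightarrow> (a \<otimes>\<^bsub>A\<^esub> a', b \<otimes>\<^bsub>B\<^esub> b') \<in> R"
    and star: "\<And>a b. (a, b) \<in> R \<Longrightarrow> (star A a, star B b) \<in> R"
    and smult: "\<And>c a b. (a, b) \<in> R \<Longrightarrow> (c \<odot>\<^bsub>A\<^esub> a, c \<odot>\<^bsub>B\<^esub> b) \<in> R"
    and norm: "\<And>a b. (a, b) \<in> R \<Longrightarrow> cnorm B b \<le> cnorm A a"
    and dense: "\<And>D. cstar_subalgebra D A \<Longrightarrow> Domain R \<subseteq> D \<Longrightarrow> carrier A \<subseteq> D"
  obtains \<phi> where "cstar_hom A B \<phi>" "\<And>a b. (a, b) \<in> R \<Longrightarrow> \<phi> a = b"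
proof -
  interpret A: unital_cstar_algebra A by (rule A)
  interpret B: unital_cstar_algebra B by (rule B)
  define R' where "R' = (\<lambda>(a, b). (emb A a, emb B b)) ` R"
  have R'I: "(emb A a, emb B b) \<in> R'" if "(a, b) \<in> R" for a b using that unfolding R'_def by force
  have R'E: "\<exists>a b. (a, b) \<in> R \<and> a \<in> carrier A \<and> b \<in> carrier B \<and> u = emb A a \<and> v = emb B b" if "(u, v) \<in> R'" for u v
    using that R unfolding R'_def by auto
  have R'0: "(0, 0) \<in> R'" using R'I[OF zero] by simp
  have R'add: "(u + u', v + v') \<in> R'" "(u * u', v * v') \<in> R'" if uv: "(u, v) \<in> R'" "(u', v') \<in> R'" for u v u' v'
  proof -
    obtain a b where ab: "(a, b) \<in> R" "a \<in> carrier A" "b \<in> carrier B" "u = emb A a" "v = emb B b" using R'E[OF uv(1)] by blast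
    obtain a' b' where ab': "(a', b') \<in> R" "a' \<in> carrier A" "b' \<in> carrier B" "u' = emb A a'" "v' = emb B b'" using R'E[OF uv(2)] by blast
    show "(u + u', v + v') \<in> R'" "(u * u', v * v') \<in> R'"
      using R'I[OF add[OF ab(1) ab'(1)]] R'I[OF mult[OF ab(1) ab'(1)]] ab ab' by (simp_all add: A.emb_add B.emb_add A.emb_mult B.emb_mult)
  qed
  have R'adj: "(adj u, adj v) \<in> R'" "(csc c u, csc c v) \<in> R'" "norm v \<le> norm u" if uv: "(u, v) \<in> R'" for u v c
  proof -
    obtain a b where ab: "(a, b) \<in> R" "a \<in> carrier A" "b \<in> carrier B" "u = emb A a" "v = emb B b" using R'E[OF uv] by blast
    show "(adj u, adj v) \<in> R'" "(csc c u, csc c v) \<in> R'" "norm v \<le> norm u"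
      using R'I[OF star[OF ab(1)]] R'I[OF smult[OF ab(1)]] norm[OF ab(1)] ab
      by (simp_all add: A.emb_star B.emb_star A.emb_smult B.emb_smult A.norm_emb B.norm_emb)
  qed
  show thesis
  proof (rule contractive_relation_extension[of R'])
    show "(0, 0) \<in> R'" by (rule R'0)
    show "(u + u', v + v') \<in> R'" "(u * u', v * v') \<in> R'" if "(u, v) \<in> R'" "(u', v') \<in> R'" for u v u' v'
      using R'add[OF that] by blast+
    show "(adj u, adj v) \<in> R'" "norm v \<le> norm u" if "(u, v) \<in> R'" for u v
      using R'adj[OF that] by blast+
    show "(csc c u, csc c v) \<in> R'" if "(u, v) \<in> R'" for u v c
      by (rule R'adj(2)[OF that])
  next
    fix \<psi>
    assume \<psi>: "\<And>u v. (u, v) \<in> R' \<Longrightarrow> \<psi> u = v"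
    "\<And>u. u \<in> closure (Domain R') \<Longrightarrow> \<psi> u \<in> closure (Range R')"
    "\<And>u. u \<in> closure (Domain R') \<Longrightarrow> norm (\<psi> u) \<le> norm u"
    "\<And>u u'. u \<in> closure (Domain R') \<Longrightarrow> u' \<in> closure (Domain R') \<Longrightarrow> \<psi> (u + u') = \<psi> u + \<psi> u'"
    "\<And>u u'. u \<in> closure (Domain R') \<Longrightarrow> u' \<in> closure (Domain R') \<Longrightarrow> \<psi> (u * u') = \<psi> u * \<psi> u'"
    "\<And>u. u \<in> closure (Domain R') \<Longrightarrow> \<psi> (adj u) = adj (\<psi> u)"
    "\<And>u c. u \<in> closure (Domain R') \<Longrightarrow> \<psi> (csc c u) = csc c (\<psi> u)"
    have "star_subalgebra (Domain R')"
      unfolding star_subalgebra_def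
    proof (intro conjI ballI allI)
      show "0 \<in> Domain R'" using R'0 by (rule DomainI)
      fix x assume "x \<in> Domain R'"
      then obtain y where y: "(x, y) \<in> R'" by (rule DomainE)
      show "adj x \<in> Domain R'" using R'adj(1)[OF y] by (rule DomainI)
      show "csc c x \<in> Domain R'" for c using R'adj(2)[OF y] by (rule DomainI)
      fix x' assume "x' \<in> Domain R'"
      then obtain y' where y': "(x', y') \<in> R'" by (rule DomainE)
      show "x + x' \<in> Domain R'" using R'add(1)[OF y y'] by (rule DomainI)
      show "x * x' \<in> Domain R'" using R'add(2)[OF y y'] by (rule DomainI)
    qed
    then have sc: "star_subalgebra (closure (Domain R'))" by (rule star_subalgebra_closure)
    have "Domain R \<subseteq> {a \<in> carrier A. emb A a \<in> closure (Domain R')}"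
      using R R'I closure_subset by blast
    then have "carrier A \<subseteq> {a \<in> carrier A. emb A a \<in> closure (Domain R')}"
      by (rule dense[OF A.cstar_subalgebra_vimage_emb[OF sc closed_closure]])
    then have dom: "emb A a \<in> closure (Domain R')" if "a \<in> carrier A" for a using that by blast
    have "closure (Range R') \<subseteq> emb B ` carrier B"
      by (rule closure_minimal[OF _ B.closed_range_emb]) (use R'E in blast)
    then have ran: "\<psi> (emb A a) \<in> emb B ` carrier B" if "a \<in> carrier A" for a using \<psi>(2)[OF dom[OF that]] by blast
    define \<phi> where "\<phi> a = coord (\<psi> (emb A a)) B" for a
    have \<phi>: "\<phi> a \<in> carrier B" "emb B (\<phi> a) = \<psi> (emb A a)" if "a \<in> carrier A" for a
      using ran[OF that] by (auto simp: \<phi>_def)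
    have eqI: "x = y" if "x \<in> carrier B" "y \<in> carrier B" "emb B x = emb B y" for x y using that B.emb_inj by blast
    have "cstar_hom A B \<phi>"
      unfolding cstar_hom_def
    proof (intro conjI ballI allI)
      show "\<phi> \<in> carrier A \<rightarrow> carrier B" using \<phi> by blast
      fix x assume x: "x \<in> carrier A"
      show "\<phi> (star A x) = star B (\<phi> x)"
        by (rule eqI) (use x \<phi> in \<open>simp_all add: A.emb_star B.emb_star \<psi> dom\<close>)
      show "\<phi> (c \<odot>\<^bsub>A\<^esub> x) = c \<odot>\<^bsub>B\<^esub> \<phi> x" for c
        by (rule eqI) (use x \<phi> in \<open>simp_all add: A.emb_smult B.emb_smult \<psi> dom\<close>)
      fix y assume y: "y \<in> carrier A"
      show "\<phi> (x \<oplus>\<^bsub>A\<^esub> y) = \<phi> x \<oplus>\<^bsub>B\<^esub> \<phi> y"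
        by (rule eqI) (use x y \<phi> in \<open>simp_all add: A.emb_add B.emb_add \<psi> dom\<close>)
      show "\<phi> (x \<otimes>\<^bsub>A\<^esub> y) = \<phi> x \<otimes>\<^bsub>B\<^esub> \<phi> y"
        by (rule eqI) (use x y \<phi> in \<open>simp_all add: A.emb_mult B.emb_mult \<psi> dom\<close>)
    qed
    moreover have "\<phi> a = b" if "(a, b) \<in> R" for a b
      using \<psi>(1)[OF R'I[OF that]] that R by (auto simp: \<phi>_def)
    ultimately show thesis using that by blast
  qed
qed

text \<open>The argument is due to Halmos and Wallen.\<close>

lemma projections_commute:
  fixes v w :: "'u::cstar_ring"
  assumes v: "v * adj v * v = v" and w: "w * adj w * w = w" and vw: "(v * w) * adj (v * w) * (v * w) = v * w"
  shows "(adj v * v) * (w * adj w) = (w * adj w) * (adj v * v)"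
proof -
  define a b where "a = adj v * v" and "b = w * adj w"
  have a: "adj a = a" and b: "adj b = b" by (simp_all add: a_def b_def adj_mult)
  have "a * a = adj v * (v * adj v * v)" by (simp add: a_def mult.assoc)
  then have aa: "a * a = a" by (simp add: v a_def)
  have "b * b = (w * adj w * w) * adj w" by (simp add: b_def mult.assoc)
  then have bb: "b * b = b" by (simp add: w b_def)
  \<comment> \<open>The hypothesis on \<open>v * w\<close> makes \<open>a * b\<close> idempotent.
    Then \<open>x = (1 - b) * a * b\<close> has
    \<open>adj x * x = b * a * b - b * a * b * a * b = 0\<close>, so
    \<open>a * b = b * a * b\<close>, which is self-adjoint.\<close>
  have "a * b * a * b = adj v * ((v * w) * adj (v * w) * (v * w)) * adj w"
    by (simp add: a_def b_def adj_mult mult.assoc)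
  then have abab: "a * b * a * b = a * b" unfolding vw by (simp add: a_def b_def mult.assoc)
  have bab: "b * a * b * a * b = b * a * b" using abab by (metis mult.assoc)
  define x where "x = a * b - b * a * b"
  have ax: "adj x = b * a - b * a * b" by (simp add: x_def adj_diff adj_mult a b mult.assoc)
  have "adj x * x = b * (a * a) * b - b * a * b * a * b - (b * a * b * a * b - b * a * (b * b) * a * b)"
    unfolding ax unfolding x_def by (simp add: algebra_simps)
  also have "\<dots> = 0" unfolding aa bb bab by simp
  finally have "norm (adj x * x) = 0" by simp
  then have "x = 0" by (simp add: norm_adj_mult)
  then have e: "a * b = b * a * b" by (simp add: x_def)
  have "adj (a * b) = adj (b * a * b)" using e by (rule arg_cong)
  then have h: "b * a = b * a * b" unfolding adj_mult a b mult.assoc .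
  have "a * b = b * a" by (rule trans[OF e h[symmetric]])
  then show ?thesis unfolding a_def b_def .
qed

section \<open>Covariant pairs and the crossed product\<close>

context cstar_algebra
begin

lemma left_fixed_closed:
  assumes e: "e \<in> carrier A" and x: "x \<in> carrier A"
    and ap: "\<And>r. r > 0 \<Longrightarrow> \<exists>s\<in>carrier A. e \<otimes> s = s \<and> cnorm A (x \<oplus> (- 1) \<odot> s) < r"
  shows "e \<otimes> x = x"
proof -
  interpret cn: normed_module A "cnorm A" by (rule cstar_normed_module) (rule cstar_algebra_axioms)
  let ?z = "e \<otimes> x \<oplus> (- 1) \<odot> x"
  have z: "?z \<in> carrier A" using e x mult_closed by simp
  have "cnorm A ?z \<le> 0 + r" if r: "r > 0" for r
  proof -
    have c0: "cnorm A e + 1 > 0" using cnorm_nonneg[OF e] by simp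
    then obtain s where s: "s \<in> carrier A" "e \<otimes> s = s" "cnorm A (x \<oplus> (- 1) \<odot> s) < r / (cnorm A e + 1)"
      using ap[of "r / (cnorm A e + 1)"] r by auto
    let ?d = "x \<oplus> (- 1) \<odot> s"
    have d: "?d \<in> carrier A" using x s by simp
    have "e \<otimes> ?d = e \<otimes> x \<oplus> (- 1) \<odot> s" using e x s by (simp add: mult_distr_r smult_mult_r)
    then have "cnorm A (e \<otimes> x \<oplus> (- 1) \<odot> s) \<le> cnorm A e * cnorm A ?d" using cnorm_mult[OF e d] by simp
    moreover have "cnorm A ?z \<le> cnorm A (e \<otimes> x \<oplus> (- 1) \<odot> s) + cnorm A (s \<oplus> (- 1) \<odot> x)"
      by (rule cn.N_diff_triangle) (use e x s mult_closed in auto)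
    moreover have "cnorm A (s \<oplus> (- 1) \<odot> x) = cnorm A ?d" by (rule cn.N_diff_commute[OF s(1) x])
    ultimately have "cnorm A ?z \<le> (cnorm A e + 1) * cnorm A ?d" by (simp add: algebra_simps)
    also have "\<dots> \<le> r" using s(3) c0 by (simp add: pos_less_divide_eq mult.commute)
    finally show ?thesis by simp
  qed
  then have "cnorm A ?z \<le> 0" by (rule field_le_epsilon)
  then have "?z = \<zero>" using cnorm_eq_0[OF z] cnorm_nonneg[OF z] by simp
  then show ?thesis using cn.diff_eq_0 e x mult_closed by blast
qed

text \<open>What fixes the generators and their adjoints fixes all they generate; including
  \<open>star A x\<close> in the condition makes the set closed under adjoints. Used with
  \<open>e = V \<one>\<close>.\<close>

lemma unit_subalgebra:
  assumes e: "e \<in> carrier A"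
  shows "cstar_subalgebra {x \<in> carrier A. e \<otimes> x = x \<and> e \<otimes> star A x = star A x} A"
  unfolding cstar_subalgebra_iff[OF cstar_algebra_axioms]
proof (intro conjI ballI allI impI)
  interpret cn: normed_module A "cnorm A" by (rule cstar_normed_module) (rule cstar_algebra_axioms)
  let ?L = "{x \<in> carrier A. e \<otimes> x = x \<and> e \<otimes> star A x = star A x}"
  have z: "e \<otimes> \<zero> = \<zero>" using smult_mult_r[OF e M.zero_closed, of 0] e mult_closed by simp
  have sz: "star A \<zero> = \<zero>" using star_smult[OF M.zero_closed, of 0] star_closed by simp
  show "\<zero> \<in> ?L" using z sz by simp
  show "x \<oplus> y \<in> ?L" if "x \<in> ?L" "y \<in> ?L" for x y using that e star_closed by (simp add: mult_distr_r star_add)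
  show "c \<odot> x \<in> ?L" if "x \<in> ?L" for c x using that e star_closed by (simp add: smult_mult_r star_smult)
  show "star A x \<in> ?L" if "x \<in> ?L" for x using that star_closed by (simp add: star_star)
  show "x \<otimes> y \<in> ?L" if "x \<in> ?L" "y \<in> ?L" for x y
  proof -
    have "e \<otimes> (x \<otimes> y) = x \<otimes> y" "e \<otimes> (star A y \<otimes> star A x) = star A y \<otimes> star A x"
      using that e star_closed by (auto simp flip: mult_assoc)
    then show ?thesis using that mult_closed by (simp add: star_mult)
  qed
  fix x assume x: "x \<in> carrier A" "\<forall>r>0. \<exists>s\<in>?L. cnorm A (x \<oplus> (- 1) \<odot> s) < r"
  have 1: "e \<otimes> x = x" by (rule left_fixed_closed[OF e x(1)]) (use x(2) in blast)
  have 2: "e \<otimes> star A x = star A x"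
  proof (rule left_fixed_closed[OF e star_closed[OF x(1)]])
    fix r :: real assume "r > 0"
    then obtain s where s: "s \<in> ?L" "cnorm A (x \<oplus> (- 1) \<odot> s) < r" using x(2) by blast
    have "star A (x \<oplus> (- 1) \<odot> s) = star A x \<oplus> (- 1) \<odot> star A s" using x s by (simp add: star_add star_smult)
    then have "cnorm A (star A x \<oplus> (- 1) \<odot> star A s) = cnorm A (x \<oplus> (- 1) \<odot> s)"
      using cnorm_star[of "x \<oplus> (- 1) \<odot> s"] x s by simp
    then show "\<exists>t\<in>carrier A. e \<otimes> t = t \<and> cnorm A (star A x \<oplus> (- 1) \<odot> t) < r"
      using s star_closed by (intro bexI[of _ "star A s"]) auto
  qed
  show "x \<in> ?L" using 1 2 x(1) by simp
qed blast

text \<open>Here \<open>q = star A p \<otimes> p\<close> is a projection because \<open>p\<close> is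
  a partial isometry, and idempotence gives \<open>star A p \<otimes> q = q = q \<otimes> p\<close>.
  Hence \<open>x = p - q\<close> has \<open>star A x \<otimes> x = 0\<close>, and
  \<open>p = q\<close>.\<close>

lemma idempotent_sa:
  assumes p: "p \<in> carrier A" and pp: "p \<otimes> p = p" and pi: "p \<otimes> star A p \<otimes> p = p"
  shows "star A p = p"
proof -
  interpret cn: normed_module A "cnorm A" by (rule cstar_normed_module) (rule cstar_algebra_axioms)
  have sp: "star A p \<in> carrier A" using p by (rule star_closed)
  define q where "q = star A p \<otimes> p"
  have q: "q \<in> carrier A" "star A q = q" using p sp by (auto simp: q_def mult_closed star_mult star_star)
  have sps: "star A p \<otimes> star A p = star A p" using star_mult[OF p p] pp by simp
  have 1: "star A p \<otimes> q = q" using p sp sps by (simp add: q_def flip: mult_assoc)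
  have 2: "q \<otimes> p = q" using p sp pp by (simp add: q_def mult_assoc)
  have "q \<otimes> q = star A p \<otimes> (p \<otimes> star A p \<otimes> p)" using p sp by (simp add: q_def mult_assoc mult_closed)
  then have 3: "q \<otimes> q = q" by (simp add: pi q_def)
  define x where "x = p \<oplus> (- 1) \<odot> q"
  have x: "x \<in> carrier A" using p q by (simp add: x_def)
  have sx: "star A x = star A p \<oplus> (- 1) \<odot> q" using p q by (simp add: x_def star_add star_smult)
  have "star A x \<otimes> x = (star A p \<otimes> p \<oplus> (- 1) \<odot> q) \<oplus> ((- 1) \<odot> (q \<oplus> (- 1) \<odot> q))"
    unfolding sx unfolding x_def using p q sp
    by (simp add: mult_distr_l mult_distr_r smult_mult_l smult_mult_r mult_closed 1 2 3 cn.smult_add_right cn.smult_smult)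
  also have "\<dots> = \<zero>" using q by (simp flip: q_def)
  finally have "(cnorm A x)\<^sup>2 = 0" using cstar_identity[OF x] by simp
  then have "x = \<zero>" using cnorm_eq_0[OF x] by simp
  then have "p = q" unfolding x_def using cn.diff_eq_0 p q by blast
  then show ?thesis using q by simp
qed

end

text \<open>Allows a unit that is found only afterwards to be stored in the field
  \<open>one\<close>, so that the results on unital algebras become applicable.\<close>

lemma cstar_algebra_update_one:
  fixes A :: "('a, 'm) cstar_scheme"
  assumes "cstar_algebra A" shows "cstar_algebra (A\<lparr>one := e\<rparr>)"
proof -
  interpret cstar_algebra A by fact
  interpret cn: normed_module A "cnorm A" by (rule cstar_normed_module) (rule cstar_algebra_axioms)
  let ?B = "A\<lparr>one := e\<rparr>"
  have "abelian_group A" ..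
  then have "abelian_group ?B"
    by (simp add: abelian_group_def abelian_monoid_def abelian_group_axioms_def)
  then have m: "module complex_ring ?B"
    by (rule moduleI[OF cring_complex_ring])
      (use smult_closed smult_l_distr smult_r_distr smult_assoc1 smult_one in auto)
  have n: "normed_module ?B (cnorm A)"
    using m unfolding normed_module_def normed_module_axioms_def
    by (auto simp: cnorm_nonneg cnorm_eq_0 cnorm_triangle cnorm_smult)
  have "norm_complete ?B (cnorm A)"
    using complete unfolding normed_module.complete_iff[OF n] cn.complete_iff by simp
  then show ?thesis
    unfolding cstar_algebra_def cstar_algebra_axioms_def
    using m
    by (auto simp: mult_closed star_closed mult_assoc mult_distr_l mult_distr_r smult_mult_l smult_mult_r
      star_star star_add star_smult star_mult cnorm_nonneg cnorm_eq_0 cnorm_triangle cnorm_smult cnorm_mult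
      cstar_identity)
qed

lemma cstar_subalgebra_update_one:
  fixes A :: "('a, 'm) cstar_scheme"
  assumes "cstar_algebra A" shows "cstar_subalgebra D (A\<lparr>one := e\<rparr>) \<longleftrightarrow> cstar_subalgebra D A"
  unfolding cstar_subalgebra_iff[OF assms] cstar_subalgebra_iff[OF cstar_algebra_update_one[OF assms]] by simp

lemma cstar_generated_update_one:
  fixes A :: "('a, 'm) cstar_scheme"
  assumes "cstar_algebra A" shows "cstar_generated (A\<lparr>one := e\<rparr>) S = cstar_generated A S"
  unfolding cstar_generated_def cstar_subalgebra_update_one[OF assms] ..

lemma cstar_hom_compose: "cstar_hom A B \<phi> \<Longrightarrow> cstar_hom B C \<psi> \<Longrightarrow> cstar_hom A C (\<psi> \<circ> \<phi>)"
  unfolding cstar_hom_def by (auto simp: Pi_iff)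

text \<open>Through scaling by 0 it shows that a homomorphism into operators preserves zero; the
  zero operator is extensional, which is why membership of \<open>T\<close> is assumed.\<close>

lemma bounded_ops_zero: "T \<in> carrier (bounded_ops H) \<Longrightarrow> hilbert_space H \<Longrightarrow> 0 \<odot>\<^bsub>bounded_ops H\<^esub> T = \<zero>\<^bsub>bounded_ops H\<^esub>"
proof -
  assume "hilbert_space H"
  then interpret hilbert_space H .
  assume T: "T \<in> carrier (bounded_ops H)"
  show ?thesis using T bounded_opD(1)[of T] by (auto simp: bounded_ops_def fun_eq_iff)
qed

lemma partial_isometric_rep_hom:
  assumes hom: "cstar_hom A L \<sigma>" and V: "partial_isometric_rep G P \<omega> A V"
    and A: "cstar_algebra A" and P: "\<And>s t. s \<in> P \<Longrightarrow> t \<in> P \<Longrightarrow> s \<otimes>\<^bsub>G\<^esub> t \<in> P"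
  shows "partial_isometric_rep G P \<omega> L (\<sigma> \<circ> V)"
proof -
  interpret cstar_algebra A by fact
  note h = cstar_homD[OF hom]
  have V: "V s \<in> carrier A" "V s \<otimes>\<^bsub>A\<^esub> star A (V s) \<otimes>\<^bsub>A\<^esub> V s = V s" "t \<in> P \<Longrightarrow> V s \<otimes>\<^bsub>A\<^esub> V t = \<omega> s t \<odot>\<^bsub>A\<^esub> V (s \<otimes>\<^bsub>G\<^esub> t)"
    if "s \<in> P" for s t using V that unfolding partial_isometric_rep_def partial_isometry_def by blast+
  show ?thesis
    unfolding partial_isometric_rep_def partial_isometry_def comp_apply
  proof (intro conjI ballI)
    fix s assume s: "s \<in> P"
    show "\<sigma> (V s) \<in> carrier L" by (rule h(1)[OF V(1)[OF s]])
    have "\<sigma> (V s \<otimes>\<^bsub>A\<^esub> star A (V s) \<otimes>\<^bsub>A\<^esub> V s) = \<sigma> (V s) \<otimes>\<^bsub>L\<^esub> star L (\<sigma> (V s)) \<otimes>\<^bsub>L\<^esub> \<sigma> (V s)"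
      using V(1)[OF s] by (simp add: h mult_closed star_closed)
    then show "\<sigma> (V s) \<otimes>\<^bsub>L\<^esub> star L (\<sigma> (V s)) \<otimes>\<^bsub>L\<^esub> \<sigma> (V s) = \<sigma> (V s)" by (simp add: V(2)[OF s])
    fix t assume t: "t \<in> P"
    show "\<sigma> (V s) \<otimes>\<^bsub>L\<^esub> \<sigma> (V t) = \<omega> s t \<odot>\<^bsub>L\<^esub> \<sigma> (V (s \<otimes>\<^bsub>G\<^esub> t))"
      using h(4)[OF V(1)[OF s] V(1)[OF t]] h(3)[OF V(1)[OF P[OF s t]]] V(3)[OF s t] by simp
  qed
qed

section \<open>Bounded linear maps on the algebra of the cone, and normalisation of the
  multiplier\<close>

context ordered_pair
begin

lemma BP_ops [simp]:
  "f \<oplus>\<^bsub>BP G P\<^esub> g = (\<lambda>x. f x + g x)" "f \<otimes>\<^bsub>BP G P\<^esub> g = (\<lambda>x. f x * g x)" "\<zero>\<^bsub>BP G P\<^esub> = (\<lambda>x. 0)"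
  "c \<odot>\<^bsub>BP G P\<^esub> f = (\<lambda>x. c * f x)" "star (BP G P) f = (\<lambda>x. cnj (f x))" "\<one>\<^bsub>BP G P\<^esub> = chi G P \<one>"
  "cnorm (BP G P) f = cnorm (linf P) f"
  by (simp_all add: BP_def chi_one)

lemma BP_closed:
  assumes "f \<in> carrier (BP G P)" "g \<in> carrier (BP G P)"
  shows "(\<lambda>x. f x + g x) \<in> carrier (BP G P)" "(\<lambda>x. c * f x) \<in> carrier (BP G P)" "(\<lambda>x. f x - g x) \<in> carrier (BP G P)"
proof -
  interpret normed_module "linf P" "cnorm (linf P)" by (rule linf_normed)
  have "chi G P ` P \<subseteq> carrier (linf P)" using chi_closed by blast
  from closed_span_submodule[OF this]
  have *: "\<And>f g. f \<in> carrier (BP G P) \<Longrightarrow> g \<in> carrier (BP G P) \<Longrightarrow> (\<lambda>x. f x + g x) \<in> carrier (BP G P)"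
    "\<And>c f. f \<in> carrier (BP G P) \<Longrightarrow> (\<lambda>x. c * f x) \<in> carrier (BP G P)"
    unfolding submodule_iff BP_def by auto
  show "(\<lambda>x. f x + g x) \<in> carrier (BP G P)" "(\<lambda>x. c * f x) \<in> carrier (BP G P)" using * assms by blast+
  show "(\<lambda>x. f x - g x) \<in> carrier (BP G P)" using *(1)[OF assms(1) *(2)[OF assms(2), of "- 1"]] by simp
qed

text \<open>Reduces identities on the whole algebra to the generators. In the limit case the
  constant \<open>2 * \<bar>K\<bar> + 1\<close> absorbs the errors of both maps and is positive for
  every \<open>K\<close>.\<close>

lemma BP_maps_eq:
  fixes T T' :: "('g \<Rightarrow> complex) \<Rightarrow> 'u::cstar_ring"
  assumes f: "f \<in> carrier (BP G P)"
    and add: "\<And>f g. f \<in> carrier (BP G P) \<Longrightarrow> g \<in> carrier (BP G P) \<Longrightarrow> T (\<lambda>x. f x + g x) = T f + T g \<and> T' (\<lambda>x. f x + g x) = T' f + T' g"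
    and scale: "\<And>c f. f \<in> carrier (BP G P) \<Longrightarrow> T (\<lambda>x. c * f x) = csc c (T f) \<and> T' (\<lambda>x. c * f x) = csc c (T' f)"
    and bound: "\<And>f. f \<in> carrier (BP G P) \<Longrightarrow> norm (T f) \<le> K * cnorm (linf P) f \<and> norm (T' f) \<le> K * cnorm (linf P) f"
    and chi: "\<And>t. t \<in> P \<Longrightarrow> T (chi G P t) = T' (chi G P t)"
  shows "T f = T' f"
  using f
proof (induction rule: BP_induct)
  case (chi t) then show ?case by (rule assms(5))
next
  case zero
  show ?case using scale[OF chi_in_BP[OF one_in_cone], of 0] by simp
next
  case (add f g) then show ?case using assms(2) by simp
next
  case (scale c f) then show ?case using assms(3) by simp
next
  case (lim f)
  have "norm (T f - T' f) \<le> 0 + r" if r: "r > 0" for r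
  proof -
    have C: "2 * \<bar>K\<bar> + 1 > 0" by simp
    then have "r / (2 * \<bar>K\<bar> + 1) > 0" using r by simp
    then obtain g where g: "g \<in> carrier (BP G P)" "T g = T' g" "cnorm (linf P) (\<lambda>x. f x - g x) < r / (2 * \<bar>K\<bar> + 1)"
      using lim(2) by blast
    let ?d = "\<lambda>x. f x - g x"
    let ?n = "cnorm (linf P) ?d"
    have d: "?d \<in> carrier (BP G P)" using BP_closed(3)[OF lim(1) g(1)] .
    have n0: "?n \<ge> 0" using normed_module.N_nonneg[OF linf_normed BP_carrier_linf[OF d]] .
    have "T f = T ?d + T g" "T' f = T' ?d + T' g" using assms(2)[OF d g(1)] by simp_all
    then have "T f - T' f = T ?d - T' ?d" using g(2) by simp
    also have "norm \<dots> \<le> norm (T ?d) + norm (T' ?d)" by (rule norm_triangle_ineq4)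
    also have "\<dots> \<le> K * ?n + K * ?n" using bound[OF d] by (intro add_mono) auto
    also have "\<dots> \<le> (2 * \<bar>K\<bar> + 1) * ?n" using mult_right_mono[OF abs_ge_self[of K] n0] n0 by (simp add: algebra_simps)
    also have "\<dots> \<le> r" using g(3) C by (simp add: pos_less_divide_eq mult.commute)
    finally show ?thesis by simp
  qed
  then have "norm (T f - T' f) \<le> 0" by (rule field_le_epsilon)
  then show ?case by simp
qed

lemma tau_ops:
  "tau G P s (\<lambda>x. f x + g x) = (\<lambda>x. tau G P s f x + tau G P s g x)"
  "tau G P s (\<lambda>x. c * f x) = (\<lambda>x. c * tau G P s f x)"
  "tau G P s (\<lambda>x. f x - g x) = (\<lambda>x. tau G P s f x - tau G P s g x)"
  "tau G P s (\<lambda>x. 0) = (\<lambda>x. 0)"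
  by (auto simp: tau_def)

lemma BP_approx:
  assumes ql: "quasi_lattice G P (left_le G P)" and f: "f \<in> carrier (linf P)"
    and ap: "\<And>e. e > 0 \<Longrightarrow> \<exists>g\<in>carrier (BP G P). cnorm (linf P) (\<lambda>x. f x - g x) < e"
  shows "f \<in> carrier (BP G P)"
  using BP_subalgebra[OF ql] f ap unfolding cstar_subalgebra_iff[OF linf_cstar] by simp

lemma tau_BP:
  assumes ql: "quasi_lattice G P (left_le G P)" and s: "s \<in> P" and f: "f \<in> carrier (BP G P)"
  shows "tau G P s f \<in> carrier (BP G P)"
  using f
proof (induction rule: BP_induct)
  case (chi t) then show ?case using s by (simp add: tau_chi chi_in_BP mult_in_cone)
next
  case zero show ?case using BP_closed(2)[OF chi_in_BP[OF s] chi_in_BP[OF s], of 0] by (simp add: tau_ops)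
next
  case (add f g) then show ?case by (simp add: tau_ops BP_closed)
next
  case (scale c f) then show ?case by (simp add: tau_ops BP_closed)
next
  case (lim f)
  show ?case
  proof (rule BP_approx[OF ql])
    show "tau G P s f \<in> carrier (linf P)" using cstar_homD(1)[OF cstar_hom_tau[OF s] BP_carrier_linf[OF lim(1)]] .
    fix e :: real assume "e > 0"
    then obtain g where g: "g \<in> carrier (BP G P)" "tau G P s g \<in> carrier (BP G P)" "cnorm (linf P) (\<lambda>x. f x - g x) < e"
      using lim(2) by blast
    have "cnorm (linf P) (\<lambda>x. tau G P s f x - tau G P s g x) = cnorm (linf P) (\<lambda>x. f x - g x)"
      using cnorm_tau[OF s BP_carrier_linf[OF BP_closed(3)[OF lim(1) g(1)]]] by (simp add: tau_ops)
    then show "\<exists>g\<in>carrier (BP G P). cnorm (linf P) (\<lambda>x. tau G P s f x - g x) < e" using g by metis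
  qed
qed

text \<open>\<open>\<phi>\<close> is contractive, so approximations are carried over and closedness
  of \<open>D\<close> applies. With the identity for \<open>\<phi>\<close> it says that the
  characteristic functions generate the algebra.\<close>

lemma BP_hom_in_subalgebra:
  assumes ql: "quasi_lattice G P (left_le G P)" and B: "unital_cstar_algebra B" and hom: "cstar_hom (BP G P) B \<phi>"
    and D: "cstar_subalgebra D B" and chi: "\<And>t. t \<in> P \<Longrightarrow> \<phi> (chi G P t) \<in> D"
    and f: "f \<in> carrier (BP G P)"
  shows "\<phi> f \<in> D"
proof -
  interpret B: unital_cstar_algebra B by fact
  note h = cstar_homD[OF hom]
  have D0: "\<zero>\<^bsub>B\<^esub> \<in> D" and Dadd: "\<And>x y. x \<in> D \<Longrightarrow> y \<in> D \<Longrightarrow> x \<oplus>\<^bsub>B\<^esub> y \<in> D"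
    and Dsm: "\<And>c x. x \<in> D \<Longrightarrow> c \<odot>\<^bsub>B\<^esub> x \<in> D"
    and Dcl: "\<And>x. x \<in> carrier B \<Longrightarrow> \<forall>e>0. \<exists>s\<in>D. cnorm B (x \<oplus>\<^bsub>B\<^esub> (- 1) \<odot>\<^bsub>B\<^esub> s) < e \<Longrightarrow> x \<in> D"
    using D unfolding cstar_subalgebra_iff[OF B.cstar_algebra_axioms] by blast+
  have sm: "\<phi> (\<lambda>x. c * f x) = c \<odot>\<^bsub>B\<^esub> \<phi> f" if "f \<in> carrier (BP G P)" for c f using h(3)[OF that, of c] by simp
  have ad: "\<phi> (\<lambda>x. f x + g x) = \<phi> f \<oplus>\<^bsub>B\<^esub> \<phi> g" if "f \<in> carrier (BP G P)" "g \<in> carrier (BP G P)" for f g using h(2)[OF that] by simp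
  show ?thesis
    using f
  proof (induction rule: BP_induct)
    case (chi t) then show ?case by (rule assms(5))
  next
    case zero
    have "\<phi> (\<lambda>x. 0) = 0 \<odot>\<^bsub>B\<^esub> \<phi> (chi G P \<one>)" using sm[OF chi_in_BP[OF one_in_cone], of 0] by simp
    then show ?case using h(1)[OF chi_in_BP[OF one_in_cone]] D0 by simp
  next
    case (add f g) then show ?case by (simp add: ad Dadd)
  next
    case (scale c f) then show ?case by (simp add: sm Dsm)
  next
    case (lim f)
    have "\<exists>s\<in>D. cnorm B (\<phi> f \<oplus>\<^bsub>B\<^esub> (- 1) \<odot>\<^bsub>B\<^esub> s) < e" if "e > 0" for e
    proof -
      obtain g where g: "g \<in> carrier (BP G P)" "\<phi> g \<in> D" "cnorm (linf P) (\<lambda>x. f x - g x) < e" using lim(2)[OF \<open>e > 0\<close>] by blast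
      have "\<phi> (\<lambda>x. f x - g x) = \<phi> f \<oplus>\<^bsub>B\<^esub> (- 1) \<odot>\<^bsub>B\<^esub> \<phi> g"
        using ad[OF lim(1) BP_closed(2)[OF g(1) g(1), of "- 1"]] sm[OF g(1), of "- 1"] by simp
      then have "cnorm B (\<phi> f \<oplus>\<^bsub>B\<^esub> (- 1) \<odot>\<^bsub>B\<^esub> \<phi> g) \<le> cnorm (linf P) (\<lambda>x. f x - g x)"
        using hom_contractive[OF BP_unital_cstar_algebra[OF ql] B hom BP_closed(3)[OF lim(1) g(1)]] by simp
      then show ?thesis using g by (intro bexI[of _ "\<phi> g"]) auto
    qed
    then show ?case by (intro Dcl h(1) lim(1)) blast
  qed
qed

text \<open>The cocycle identity at \<open>(e, e, s)\<close> and at \<open>(s, e, e)\<close> shows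
  that both numbers equal their squares, and they are nonzero.\<close>

lemma multiplier_one:
  assumes "multiplier G P \<omega>" "s \<in> P" shows "\<omega> \<one> s = 1" "\<omega> s \<one> = 1" "\<omega> s t * cnj (\<omega> s t) = 1 \<or> t \<notin> P"
proof -
  have m: "\<And>s t. s \<in> P \<Longrightarrow> t \<in> P \<Longrightarrow> cmod (\<omega> s t) = 1" "\<omega> \<one> \<one> = 1"
    "\<And>r s t. r \<in> P \<Longrightarrow> s \<in> P \<Longrightarrow> t \<in> P \<Longrightarrow> \<omega> r s * \<omega> (r \<otimes> s) t = \<omega> r (s \<otimes> t) * \<omega> s t"
    using assms(1) unfolding multiplier_def by blast+
  have nz: "\<omega> s t \<noteq> 0" if "s \<in> P" "t \<in> P" for s t using m(1)[OF that] by auto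
  have sc: "s \<in> carrier G" using assms(2) cone_carrier by blast
  have "\<omega> \<one> s = \<omega> \<one> s * \<omega> \<one> s" using m(3)[OF one_in_cone one_in_cone assms(2)] m(2) sc by simp
  then show "\<omega> \<one> s = 1" using nz[OF one_in_cone assms(2)] by simp
  have "\<omega> s \<one> * \<omega> s \<one> = \<omega> s \<one>" using m(3)[OF assms(2) one_in_cone one_in_cone] m(2) sc by simp
  then show "\<omega> s \<one> = 1" using nz[OF assms(2) one_in_cone] by simp
  show "\<omega> s t * cnj (\<omega> s t) = 1 \<or> t \<notin> P"
    using m(1)[OF assms(2), of t] complex_norm_square[of "\<omega> s t"] by auto
qed

end

section \<open>From bicovariant representations to covariant pairs, and the lift\<close>

context ordered_pair
begin

text \<open>The homomorphism is determined by \<open>1\<^sub>t \<mapsto> V\<^sub>t V\<^sub>t\<^sup>*\<close>.\<close>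

lemma bicovariant_pair:
  fixes A :: "'a cstar"
  assumes ql: "quasi_lattice G P (left_le G P)" and mult: "multiplier G P \<omega>"
    and A: "unital_cstar_algebra A" and V: "bicovariant_rep G P \<omega> A V" and V1: "V \<one> = \<one>\<^bsub>A\<^esub>"
  obtains \<pi> where "cstar_hom (BP G P) A \<pi>" "\<pi> (chi G P \<one>) = \<one>\<^bsub>A\<^esub>"
    "\<And>s f. s \<in> P \<Longrightarrow> f \<in> carrier (BP G P) \<Longrightarrow> \<pi> (tau G P s f) = V s \<otimes>\<^bsub>A\<^esub> \<pi> f \<otimes>\<^bsub>A\<^esub> star A (V s)"
    "\<And>s f. s \<in> P \<Longrightarrow> f \<in> carrier (BP G P) \<Longrightarrow>
        star A (V s) \<otimes>\<^bsub>A\<^esub> V s \<otimes>\<^bsub>A\<^esub> \<pi> f = \<pi> f \<otimes>\<^bsub>A\<^esub> star A (V s) \<otimes>\<^bsub>A\<^esub> V s"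
proof -
  interpret A: unital_cstar_algebra A by (rule A)
  interpret BP: unital_cstar_algebra "BP G P" by (rule BP_unital_cstar_algebra[OF ql])
  have Vc: "V s \<in> carrier A" and Vp: "V s \<otimes>\<^bsub>A\<^esub> star A (V s) \<otimes>\<^bsub>A\<^esub> V s = V s" if "s \<in> P" for s
    using V that unfolding bicovariant_rep_def partial_isometric_rep_def partial_isometry_def by blast+
  have Vm: "V s \<otimes>\<^bsub>A\<^esub> V t = \<omega> s t \<odot>\<^bsub>A\<^esub> V (s \<otimes> t)" if "s \<in> P" "t \<in> P" for s t
    using V that unfolding bicovariant_rep_def partial_isometric_rep_def by blast
  have Vl: "V s \<otimes>\<^bsub>A\<^esub> star A (V s) \<otimes>\<^bsub>A\<^esub> V t \<otimes>\<^bsub>A\<^esub> star A (V t) =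
      (case join_in (left_le G P) P s t of Some u \<Rightarrow> V u \<otimes>\<^bsub>A\<^esub> star A (V u) | None \<Rightarrow> \<zero>\<^bsub>A\<^esub>)" if "s \<in> P" "t \<in> P" for s t
    using V that unfolding bicovariant_rep_def left_covariant_def by blast
  define v where "v s = emb A (V s)" for s
  define p where "p s = v s * adj (v s)" for s
  have vp: "v s * adj (v s) * v s = v s" if "s \<in> P" for s
    using arg_cong[OF Vp[OF that], of "emb A"] Vc[OF that] by (simp add: v_def A.emb_mult A.emb_star)
  have vm: "v s * v t = csc (\<omega> s t) (v (s \<otimes> t))" if "s \<in> P" "t \<in> P" for s t
    using arg_cong[OF Vm[OF that], of "emb A"] Vc that mult_in_cone[OF that] by (simp add: v_def A.emb_mult A.emb_smult)
  have pe: "p s = emb A (V s \<otimes>\<^bsub>A\<^esub> star A (V s))" if "s \<in> P" for s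
    using Vc[OF that] by (simp add: p_def v_def A.emb_mult A.emb_star)
  have VV: "V s \<otimes>\<^bsub>A\<^esub> star A (V s) \<in> carrier A" if "s \<in> P" for s using Vc[OF that] by simp
  \<comment> \<open>The product rule for the range projections is left covariance of
    \<open>V\<close>.\<close>
  interpret cone_projections G P p
  proof
    show "quasi_lattice G P (left_le G P)" by (rule ql)
    show "adj (p t) = p t" for t by (simp add: p_def adj_mult)
    fix s t assume st: "s \<in> P" "t \<in> P"
    have "p s * p t = emb A (V s \<otimes>\<^bsub>A\<^esub> star A (V s) \<otimes>\<^bsub>A\<^esub> V t \<otimes>\<^bsub>A\<^esub> star A (V t))"
      using Vc[OF st(1)] Vc[OF st(2)] by (simp add: p_def v_def A.emb_mult A.emb_star mult.assoc)
    then show "p s * p t = (case join_in (left_le G P) P s t of Some u \<Rightarrow> p u | None \<Rightarrow> 0)"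
      unfolding Vl[OF st] using join_left(1)[OF ql st] pe by (auto split: option.split)
  qed
  \<comment> \<open>The graph of the wanted homomorphism on the linear span of the generators;
    \<open>R_norm\<close> makes it contractive, hence extendable.\<close>
  define R0 where "R0 = {(f, a). f \<in> carrier (BP G P) \<and> a \<in> carrier A \<and> R f (emb A a)}"
  have gen: "(chi G P t, V t \<otimes>\<^bsub>A\<^esub> star A (V t)) \<in> R0" if "t \<in> P" for t
    unfolding R0_def using chi_in_BP[OF that] VV[OF that] span_rel.gen[OF that, of "chi G P" p] by (simp add: pe[OF that])
  obtain \<pi> where \<pi>: "cstar_hom (BP G P) A \<pi>" "\<And>f a. (f, a) \<in> R0 \<Longrightarrow> \<pi> f = a"
  proof (rule unital_relation_extension[OF BP_unital_cstar_algebra[OF ql] A, of R0])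
    show "R0 \<subseteq> carrier (BP G P) \<times> carrier A" unfolding R0_def by blast
    show "(\<zero>\<^bsub>BP G P\<^esub>, \<zero>\<^bsub>A\<^esub>) \<in> R0" unfolding R0_def using R_zero BP.M.zero_closed by simp
    show "(f \<oplus>\<^bsub>BP G P\<^esub> g, a \<oplus>\<^bsub>A\<^esub> b) \<in> R0" if "(f, a) \<in> R0" "(g, b) \<in> R0" for f a g b
      using that BP.M.a_closed[of f g] span_rel.add[of "chi G P" p P f "emb A a" g "emb A b"] unfolding R0_def by (simp add: A.emb_add)
    show "(f \<otimes>\<^bsub>BP G P\<^esub> g, a \<otimes>\<^bsub>A\<^esub> b) \<in> R0" if "(f, a) \<in> R0" "(g, b) \<in> R0" for f a g b
      using that BP.mult_closed[of f g] R_mult[of f "emb A a" g "emb A b"] unfolding R0_def by (simp add: A.emb_mult)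
    show "(star (BP G P) f, star A a) \<in> R0" if "(f, a) \<in> R0" for f a
      using that BP.star_closed[of f] R_adj[of f "emb A a"] unfolding R0_def by (simp add: A.emb_star)
    show "(c \<odot>\<^bsub>BP G P\<^esub> f, c \<odot>\<^bsub>A\<^esub> a) \<in> R0" if "(f, a) \<in> R0" for c f a
      using that BP.smult_clos[of f c] span_rel.scale[of "chi G P" p P f "emb A a" c] unfolding R0_def by (simp add: A.emb_smult)
    show "cnorm A a \<le> cnorm (BP G P) f" if "(f, a) \<in> R0" for f a
      using that R_norm[of f "emb A a"] unfolding R0_def by (simp add: A.norm_emb)
    show "carrier (BP G P) \<subseteq> D" if D: "cstar_subalgebra D (BP G P)" "Domain R0 \<subseteq> D" for D
    proof
      fix f assume f: "f \<in> carrier (BP G P)"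
      have id: "cstar_hom (BP G P) (BP G P) (\<lambda>f. f)" by (simp add: cstar_hom_def)
      show "f \<in> D"
        by (rule BP_hom_in_subalgebra[OF ql BP_unital_cstar_algebra[OF ql] id D(1) _ f]) (use gen D(2) in blast)
    qed
  qed blast
  note h = cstar_homD[OF \<pi>(1)]
  have pchi: "\<pi> (chi G P t) = V t \<otimes>\<^bsub>A\<^esub> star A (V t)" if "t \<in> P" for t by (rule \<pi>(2)[OF gen[OF that]])
  have hadd: "\<pi> (\<lambda>x. f x + g x) = \<pi> f \<oplus>\<^bsub>A\<^esub> \<pi> g" if "f \<in> carrier (BP G P)" "g \<in> carrier (BP G P)" for f g using h(2)[OF that] by simp
  have hscale: "\<pi> (\<lambda>x. c * f x) = c \<odot>\<^bsub>A\<^esub> \<pi> f" if "f \<in> carrier (BP G P)" for c f using h(3)[OF that, of c] by simp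
  have contr: "norm (emb A (\<pi> f)) \<le> cnorm (linf P) f" if "f \<in> carrier (BP G P)" for f
    using hom_contractive[OF BP_unital_cstar_algebra[OF ql] A \<pi>(1) that] h(1)[OF that] by (simp add: A.norm_emb)
  have n0: "0 \<le> cnorm (linf P) f" if "f \<in> carrier (BP G P)" for f
    by (rule normed_module.N_nonneg[OF linf_normed BP_carrier_linf[OF that]])
  have lin: "emb A (\<pi> (\<lambda>x. f x + g x)) = emb A (\<pi> f) + emb A (\<pi> g)" "emb A (\<pi> (\<lambda>x. c * f x)) = csc c (emb A (\<pi> f))"
    if "f \<in> carrier (BP G P)" "g \<in> carrier (BP G P)" for f g c
    using that h(1) by (simp_all add: hadd hscale A.emb_add A.emb_smult)
  have norm3: "norm (a * x * b) \<le> (norm a * norm b) * cnorm (linf P) f" if "norm x \<le> cnorm (linf P) f" for a x b :: "'a ucstar" and f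
  proof -
    have "norm (a * x * b) \<le> norm a * norm x * norm b" by (meson norm_mult_ineq order_trans mult_right_mono norm_ge_zero)
    also have "\<dots> \<le> norm a * cnorm (linf P) f * norm b" using that by (intro mult_right_mono mult_left_mono) auto
    finally show ?thesis by (simp add: mult_ac)
  qed
  have pc: "emb A (\<pi> (chi G P t)) = p t" if "t \<in> P" for t using pchi[OF that] pe[OF that] by simp
  \<comment> \<open>On generators this reads
    \<open>v s * p t * adj (v s) = p (s \<otimes> t)\<close>, true because
    \<open>\<omega> s t\<close> has modulus 1. The constant is the sum of the bounds for the two
    sides, so that it serves both.\<close>
  have cov: "emb A (\<pi> (tau G P s f)) = v s * emb A (\<pi> f) * adj (v s)" if s: "s \<in> P" and f: "f \<in> carrier (BP G P)" for s f
  proof (rule BP_maps_eq[OF f, where K = "1 + norm (v s) * norm (adj (v s))"])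
    fix f assume f: "f \<in> carrier (BP G P)"
    show "emb A (\<pi> (tau G P s (\<lambda>x. c * f x))) = csc c (emb A (\<pi> (tau G P s f))) \<and>
        v s * emb A (\<pi> (\<lambda>x. c * f x)) * adj (v s) = csc c (v s * emb A (\<pi> f) * adj (v s))" for c
      by (simp add: tau_ops lin[OF tau_BP[OF ql s f] tau_BP[OF ql s f]] lin[OF f f] csc_mult_left csc_mult_right)
    have "norm (emb A (\<pi> (tau G P s f))) \<le> 1 * cnorm (linf P) f"
      using contr[OF tau_BP[OF ql s f]] cnorm_tau[OF s BP_carrier_linf[OF f]] by simp
    also have "\<dots> \<le> (1 + norm (v s) * norm (adj (v s))) * cnorm (linf P) f" by (intro mult_right_mono n0 f) simp
    finally have 1: "norm (emb A (\<pi> (tau G P s f))) \<le> (1 + norm (v s) * norm (adj (v s))) * cnorm (linf P) f" .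
    have "norm (v s * emb A (\<pi> f) * adj (v s)) \<le> (norm (v s) * norm (adj (v s))) * cnorm (linf P) f"
      by (rule norm3[OF contr[OF f]])
    also have "\<dots> \<le> (1 + norm (v s) * norm (adj (v s))) * cnorm (linf P) f" by (intro mult_right_mono n0 f) simp
    finally show "norm (emb A (\<pi> (tau G P s f))) \<le> (1 + norm (v s) * norm (adj (v s))) * cnorm (linf P) f \<and>
        norm (v s * emb A (\<pi> f) * adj (v s)) \<le> (1 + norm (v s) * norm (adj (v s))) * cnorm (linf P) f" using 1 by blast
    fix g assume g: "g \<in> carrier (BP G P)"
    show "emb A (\<pi> (tau G P s (\<lambda>x. f x + g x))) = emb A (\<pi> (tau G P s f)) + emb A (\<pi> (tau G P s g)) \<and>
        v s * emb A (\<pi> (\<lambda>x. f x + g x)) * adj (v s) = v s * emb A (\<pi> f) * adj (v s) + v s * emb A (\<pi> g) * adj (v s)"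
      by (simp add: tau_ops lin[OF tau_BP[OF ql s f] tau_BP[OF ql s g]] lin[OF f g] distrib_left distrib_right)
  next
    fix t assume t: "t \<in> P"
    have st: "s \<otimes> t \<in> P" by (rule mult_in_cone[OF s t])
    have w: "\<omega> s t * cnj (\<omega> s t) = 1" using multiplier_one(3)[OF mult s, of t] t by blast
    have "v s * p t * adj (v s) = (v s * v t) * adj (v s * v t)" by (simp add: p_def adj_mult mult.assoc)
    also have "\<dots> = csc (\<omega> s t * cnj (\<omega> s t)) (p (s \<otimes> t))"
      unfolding vm[OF s t] adj_csc csc_mult_left csc_mult_right csc_assoc p_def by (simp add: mult.commute)
    also have "\<dots> = p (s \<otimes> t)" unfolding w by simp
    finally show "emb A (\<pi> (tau G P s (chi G P t))) = v s * emb A (\<pi> (chi G P t)) * adj (v s)"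
      unfolding tau_chi[OF s t] pc[OF t] pc[OF st] by simp
  qed
  have com: "(adj (v s) * v s) * emb A (\<pi> f) = emb A (\<pi> f) * (adj (v s) * v s)" if s: "s \<in> P" and f: "f \<in> carrier (BP G P)" for s f
  proof (rule BP_maps_eq[OF f, where K = "norm (adj (v s) * v s)"])
    let ?q = "adj (v s) * v s"
    fix f assume f: "f \<in> carrier (BP G P)"
    show "?q * emb A (\<pi> (\<lambda>x. c * f x)) = csc c (?q * emb A (\<pi> f)) \<and>
        emb A (\<pi> (\<lambda>x. c * f x)) * ?q = csc c (emb A (\<pi> f) * ?q)" for c
      by (simp only: lin[OF f f] csc_mult_left csc_mult_right)
    have "norm (emb A (\<pi> f) * ?q) \<le> cnorm (linf P) f * norm ?q"
      by (rule order_trans[OF norm_mult_ineq mult_right_mono[OF contr[OF f]]]) simp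
    moreover have "norm (?q * emb A (\<pi> f)) \<le> norm ?q * cnorm (linf P) f"
      by (rule order_trans[OF norm_mult_ineq mult_left_mono[OF contr[OF f]]]) simp
    ultimately show "norm (?q * emb A (\<pi> f)) \<le> norm ?q * cnorm (linf P) f \<and>
        norm (emb A (\<pi> f) * ?q) \<le> norm ?q * cnorm (linf P) f" by (simp add: mult.commute)
    fix g assume g: "g \<in> carrier (BP G P)"
    show "?q * emb A (\<pi> (\<lambda>x. f x + g x)) = ?q * emb A (\<pi> f) + ?q * emb A (\<pi> g) \<and>
        emb A (\<pi> (\<lambda>x. f x + g x)) * ?q = emb A (\<pi> f) * ?q + emb A (\<pi> g) * ?q"
      by (simp only: lin[OF f g] distrib_left distrib_right)
  next
    fix t assume t: "t \<in> P"
    have st: "s \<otimes> t \<in> P" by (rule mult_in_cone[OF s t])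
    have w: "\<omega> s t * cnj (\<omega> s t) = 1" using multiplier_one(3)[OF mult s, of t] t by blast
    \<comment> \<open>\<open>v s * v t\<close> is a unimodular multiple of
      \<open>v (s \<otimes> t)\<close> and therefore a partial isometry, which is the hypothesis of
      \<open>projections_commute\<close>.\<close>
    have "(v s * v t) * adj (v s * v t) * (v s * v t)
        = csc (\<omega> s t * (\<omega> s t * cnj (\<omega> s t))) (v (s \<otimes> t) * adj (v (s \<otimes> t)) * v (s \<otimes> t))"
      unfolding vm[OF s t] adj_csc csc_mult_left csc_mult_right csc_assoc by (simp add: mult_ac)
    also have "\<dots> = v s * v t" unfolding w vp[OF st] vm[OF s t] by simp
    finally show "adj (v s) * v s * emb A (\<pi> (chi G P t)) = emb A (\<pi> (chi G P t)) * (adj (v s) * v s)"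
      unfolding pc[OF t] p_def by (rule projections_commute[OF vp[OF s] vp[OF t]])
  qed
  show thesis
  proof (rule that[OF \<pi>(1)])
    show "\<pi> (chi G P \<one>) = \<one>\<^bsub>A\<^esub>" by (simp add: pchi one_in_cone V1)
    fix s f assume s: "s \<in> P" and f: "f \<in> carrier (BP G P)"
    note c = Vc[OF s] h(1)[OF f] h(1)[OF tau_BP[OF ql s f]]
    have "emb A (\<pi> (tau G P s f)) = emb A (V s \<otimes>\<^bsub>A\<^esub> \<pi> f \<otimes>\<^bsub>A\<^esub> star A (V s))"
      using cov[OF s f] c by (simp add: v_def A.emb_mult A.emb_star)
    then show "\<pi> (tau G P s f) = V s \<otimes>\<^bsub>A\<^esub> \<pi> f \<otimes>\<^bsub>A\<^esub> star A (V s)"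
      using A.emb_inj[of "\<pi> (tau G P s f)" "V s \<otimes>\<^bsub>A\<^esub> \<pi> f \<otimes>\<^bsub>A\<^esub> star A (V s)"] c by simp
    have "emb A (star A (V s) \<otimes>\<^bsub>A\<^esub> V s \<otimes>\<^bsub>A\<^esub> \<pi> f) = emb A (\<pi> f \<otimes>\<^bsub>A\<^esub> star A (V s) \<otimes>\<^bsub>A\<^esub> V s)"
      using com[OF s f] c by (simp add: v_def A.emb_mult A.emb_star mult.assoc)
    then show "star A (V s) \<otimes>\<^bsub>A\<^esub> V s \<otimes>\<^bsub>A\<^esub> \<pi> f = \<pi> f \<otimes>\<^bsub>A\<^esub> star A (V s) \<otimes>\<^bsub>A\<^esub> V s"
      using A.emb_inj[of "star A (V s) \<otimes>\<^bsub>A\<^esub> V s \<otimes>\<^bsub>A\<^esub> \<pi> f" "\<pi> f \<otimes>\<^bsub>A\<^esub> star A (V s) \<otimes>\<^bsub>A\<^esub> V s"] c by simp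
  qed
qed

text \<open>The relations pass through \<open>\<sigma>\<close>, and its value at the unit supplies
  nondegeneracy. The assumption \<open>rj\<close> ensures that \<open>V u\<close> lies in
  \<open>A\<close> for a right join \<open>u\<close>.\<close>

lemma covariant_pair_of_rep:
  fixes A :: "'a cstar" and H :: "'h inner_space"
  assumes A: "unital_cstar_algebra A" and V: "bicovariant_rep G P \<omega> A V"
    and \<pi>: "cstar_hom (BP G P) A \<pi>" "\<pi> (chi G P \<one>) = \<one>\<^bsub>A\<^esub>"
      "\<And>s f. s \<in> P \<Longrightarrow> f \<in> carrier (BP G P) \<Longrightarrow> \<pi> (tau G P s f) = V s \<otimes>\<^bsub>A\<^esub> \<pi> f \<otimes>\<^bsub>A\<^esub> star A (V s)"
      "\<And>s f. s \<in> P \<Longrightarrow> f \<in> carrier (BP G P) \<Longrightarrow>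
        star A (V s) \<otimes>\<^bsub>A\<^esub> V s \<otimes>\<^bsub>A\<^esub> \<pi> f = \<pi> f \<otimes>\<^bsub>A\<^esub> star A (V s) \<otimes>\<^bsub>A\<^esub> V s"
    and H: "hilbert_space H" and \<sigma>: "cstar_hom A (bounded_ops H) \<sigma>" "\<sigma> \<one>\<^bsub>A\<^esub> = (\<lambda>x\<in>carrier H. x)"
    and rj: "\<And>s t u. s \<in> P \<Longrightarrow> t \<in> P \<Longrightarrow> join_in (right_le G P) P s t = Some u \<Longrightarrow> u \<in> P"
  shows "nica_toeplitz_covariant G P \<omega> H (\<sigma> \<circ> \<pi>) (\<sigma> \<circ> V)"
  unfolding nica_toeplitz_covariant_def Let_def
proof (intro conjI ballI)
  interpret A: unital_cstar_algebra A by (rule A)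
  note h = cstar_homD[OF \<sigma>(1)]
  note hp = cstar_homD[OF \<pi>(1)]
  have Vc: "V s \<in> carrier A" if "s \<in> P" for s
    using V that unfolding bicovariant_rep_def partial_isometric_rep_def partial_isometry_def by blast
  show "nondegenerate_rep (BP G P) H (\<sigma> \<circ> \<pi>)"
    by (rule nondegenerate_rep_unital[OF H cstar_hom_compose[OF \<pi>(1) \<sigma>(1)] chi_in_BP[OF one_in_cone]]) (simp add: \<pi>(2) \<sigma>(2))
  show "partial_isometric_rep G P \<omega> (bounded_ops H) (\<sigma> \<circ> V)"
    by (rule partial_isometric_rep_hom[OF \<sigma>(1) _ A.cstar_algebra_axioms mult_in_cone]) (use V in \<open>simp_all add: bicovariant_rep_def\<close>)
  show "right_covariant G P (bounded_ops H) (\<sigma> \<circ> V)"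
    unfolding right_covariant_def comp_apply
  proof (intro ballI)
    fix s t assume st: "s \<in> P" "t \<in> P"
    note c = Vc[OF st(1)] Vc[OF st(2)]
    have z: "\<sigma> \<zero>\<^bsub>A\<^esub> = \<zero>\<^bsub>bounded_ops H\<^esub>"
      using h(3)[OF A.M.zero_closed, of 0] bounded_ops_zero[OF h(1)[OF A.M.zero_closed] H] by simp
    have "star A (V s) \<otimes>\<^bsub>A\<^esub> V s \<otimes>\<^bsub>A\<^esub> star A (V t) \<otimes>\<^bsub>A\<^esub> V t =
        (case join_in (right_le G P) P s t of Some u \<Rightarrow> star A (V u) \<otimes>\<^bsub>A\<^esub> V u | None \<Rightarrow> \<zero>\<^bsub>A\<^esub>)"
      using V st unfolding bicovariant_rep_def right_covariant_def by blast
    from arg_cong[OF this, of \<sigma>]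
    show "star (bounded_ops H) (\<sigma> (V s)) \<otimes>\<^bsub>bounded_ops H\<^esub> \<sigma> (V s) \<otimes>\<^bsub>bounded_ops H\<^esub> star (bounded_ops H) (\<sigma> (V t)) \<otimes>\<^bsub>bounded_ops H\<^esub> \<sigma> (V t) =
        (case join_in (right_le G P) P s t of Some u \<Rightarrow> star (bounded_ops H) (\<sigma> (V u)) \<otimes>\<^bsub>bounded_ops H\<^esub> \<sigma> (V u) | None \<Rightarrow> \<zero>\<^bsub>bounded_ops H\<^esub>)"
      using c rj[OF st] Vc by (auto simp: h z split: option.splits)
  qed
  fix s f assume s: "s \<in> P" and f: "f \<in> carrier (BP G P)"
  note c = Vc[OF s] hp(1)[OF f]
  show "(\<sigma> \<circ> \<pi>) (tau G P s f) = (\<sigma> \<circ> V) s \<otimes>\<^bsub>bounded_ops H\<^esub> (\<sigma> \<circ> \<pi>) f \<otimes>\<^bsub>bounded_ops H\<^esub> star (bounded_ops H) ((\<sigma> \<circ> V) s)"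
    using c by (simp add: \<pi>(3)[OF s f] h)
  show "star (bounded_ops H) ((\<sigma> \<circ> V) s) \<otimes>\<^bsub>bounded_ops H\<^esub> (\<sigma> \<circ> V) s \<otimes>\<^bsub>bounded_ops H\<^esub> (\<sigma> \<circ> \<pi>) f =
      (\<sigma> \<circ> \<pi>) f \<otimes>\<^bsub>bounded_ops H\<^esub> star (bounded_ops H) ((\<sigma> \<circ> V) s) \<otimes>\<^bsub>bounded_ops H\<^esub> (\<sigma> \<circ> V) s"
    using arg_cong[OF \<pi>(4)[OF s f], of \<sigma>] c by (simp add: h)
qed

text \<open>The universal property is applied to \<open>\<sigma> \<circ> V\<close> for every unital
  representation \<open>\<sigma>\<close> of \<open>A\<close> on the universe; the relation
  \<open>R\<close> glues the resulting representations of \<open>B\<close> into one homomorphism to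
  \<open>A\<close>.\<close>

lemma lift_unital:
  fixes A :: "'a cstar" and B :: "'b cstar"
  assumes ql: "quasi_lattice G P (left_le G P)" and mult: "multiplier G P \<omega>"
    and card: "(UNIV :: real set) \<lesssim> (UNIV :: 'h set)"
    and A: "unital_cstar_algebra A" and V: "bicovariant_rep G P \<omega> A V" and V1: "V \<one> = \<one>\<^bsub>A\<^esub>" and gA: "cstar_generated A (V ` P) = carrier A"
    and B: "unital_cstar_algebra B" and iP: "i ` P \<subseteq> carrier B" and gB: "cstar_generated B (i ` P) = carrier B"
    and univ: "\<And>(H :: 'h inner_space) \<pi> W. hilbert_space H \<Longrightarrow> nica_toeplitz_covariant G P \<omega> H \<pi> W \<Longrightarrow>
        \<exists>\<rho>. cstar_hom B (bounded_ops H) \<rho> \<and> (\<forall>s\<in>P. \<rho> (i s) = W s)"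
    and rj: "\<And>s t u. s \<in> P \<Longrightarrow> t \<in> P \<Longrightarrow> join_in (right_le G P) P s t = Some u \<Longrightarrow> u \<in> P"
  obtains \<phi> where "cstar_hom B A \<phi>" "\<And>s. s \<in> P \<Longrightarrow> \<phi> (i s) = V s"
proof -
  interpret A: unital_cstar_algebra A by (rule A)
  interpret B: unital_cstar_algebra B by (rule B)
  have Vc: "V s \<in> carrier A" if "s \<in> P" for s
    using V that unfolding bicovariant_rep_def partial_isometric_rep_def partial_isometry_def by blast
  obtain \<pi> where \<pi>: "cstar_hom (BP G P) A \<pi>" "\<pi> (chi G P \<one>) = \<one>\<^bsub>A\<^esub>"
      "\<And>s f. s \<in> P \<Longrightarrow> f \<in> carrier (BP G P) \<Longrightarrow> \<pi> (tau G P s f) = V s \<otimes>\<^bsub>A\<^esub> \<pi> f \<otimes>\<^bsub>A\<^esub> star A (V s)"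
      "\<And>s f. s \<in> P \<Longrightarrow> f \<in> carrier (BP G P) \<Longrightarrow>
        star A (V s) \<otimes>\<^bsub>A\<^esub> V s \<otimes>\<^bsub>A\<^esub> \<pi> f = \<pi> f \<otimes>\<^bsub>A\<^esub> star A (V s) \<otimes>\<^bsub>A\<^esub> V s"
    using bicovariant_pair[OF ql mult A V V1] by metis
  define rel where "rel H \<sigma> \<rho> \<longleftrightarrow> hilbert_space H \<and> cstar_hom A (bounded_ops H) \<sigma> \<and> \<sigma> \<one>\<^bsub>A\<^esub> = (\<lambda>x\<in>carrier H. x) \<and>
      cstar_hom B (bounded_ops H) \<rho> \<and> (\<forall>s\<in>P. \<rho> (i s) = \<sigma> (V s))" for H :: "'h inner_space" and \<sigma> \<rho>
  have ex: "\<exists>\<rho>. rel H \<sigma> \<rho>" if "hilbert_space H" "cstar_hom A (bounded_ops H) \<sigma>" "\<sigma> \<one>\<^bsub>A\<^esub> = (\<lambda>x\<in>carrier H. x)" for H :: "'h inner_space" and \<sigma>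
    using univ[OF that(1) covariant_pair_of_rep[OF A V \<pi> that rj]] that unfolding rel_def by auto
  \<comment> \<open>Agreement in all pairs \<open>\<sigma>\<close>, \<open>\<rho>\<close> at once,
    for every admissible \<open>\<rho>\<close>: this is visibly stable under the operations and
    involves no choice.\<close>
  define R where "R = {(b, a). b \<in> carrier B \<and> a \<in> carrier A \<and> (\<forall>H \<sigma> \<rho>. rel H \<sigma> \<rho> \<longrightarrow> \<rho> b = \<sigma> a)}"
  have homs: "cstar_hom A (bounded_ops H) \<sigma>" "cstar_hom B (bounded_ops H) \<rho>" if "rel H \<sigma> \<rho>" for H \<sigma> \<rho>
    using that unfolding rel_def by blast+
  show thesis
  proof (rule unital_relation_extension[OF B A, of R])
    show "R \<subseteq> carrier B \<times> carrier A" unfolding R_def by blast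
    show "(\<zero>\<^bsub>B\<^esub>, \<zero>\<^bsub>A\<^esub>) \<in> R"
      unfolding R_def
    proof (clarsimp)
      fix H \<sigma> \<rho> assume r: "rel H \<sigma> \<rho>"
      then have "hilbert_space H" unfolding rel_def by blast
      then show "\<rho> \<zero>\<^bsub>B\<^esub> = \<sigma> \<zero>\<^bsub>A\<^esub>"
        using cstar_homD(1,3)[OF homs(1)[OF r] A.M.zero_closed] cstar_homD(1,3)[OF homs(2)[OF r] B.M.zero_closed] bounded_ops_zero
        by (metis A.smult_0_right B.smult_0_right)
    qed
    show "(b \<oplus>\<^bsub>B\<^esub> b', a \<oplus>\<^bsub>A\<^esub> a') \<in> R" "(b \<otimes>\<^bsub>B\<^esub> b', a \<otimes>\<^bsub>A\<^esub> a') \<in> R" if "(b, a) \<in> R" "(b', a') \<in> R" for a b a' b'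
      using that unfolding R_def by (auto simp: cstar_homD[OF homs(1)] cstar_homD[OF homs(2)])
    show "(star B b, star A a) \<in> R" "(c \<odot>\<^bsub>B\<^esub> b, c \<odot>\<^bsub>A\<^esub> a) \<in> R" if "(b, a) \<in> R" for a b c
      using that unfolding R_def by (auto simp: cstar_homD[OF homs(1)] cstar_homD[OF homs(2)])
    show "cnorm A a \<le> cnorm B b" if ab: "(b, a) \<in> R" for a b
    proof -
      have a: "a \<in> carrier A" and b: "b \<in> carrier B" using ab unfolding R_def by auto
      have "countable (V ` P)" "V ` P \<subseteq> carrier A" using countable_cone Vc by auto
      then obtain H :: "'h inner_space" and \<sigma> \<xi> where H: "hilbert_space H" "cstar_hom A (bounded_ops H) \<sigma>"
        "\<sigma> \<one>\<^bsub>A\<^esub> = (\<lambda>x\<in>carrier H. x)" "\<xi> \<in> carrier H" "hnorm H \<xi> \<le> 1" "hnorm H (\<sigma> a \<xi>) = cnorm A a"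
        using gns_representation[OF A _ _ gA card a] by metis
      obtain \<rho> where r: "rel H \<sigma> \<rho>" using ex[OF H(1-3)] by blast
      interpret H: hilbert_space H by (rule H(1))
      \<comment> \<open>\<open>\<sigma>\<close> was chosen to attain the norm of \<open>a\<close> at
        \<open>\<xi>\<close>; its partner \<open>\<rho>\<close> takes the same value at
        \<open>b\<close>, and representations are contractive.\<close>
      have "cnorm A a = hnorm H (\<rho> b \<xi>)" using ab r H(6) unfolding R_def by auto
      also have "\<dots> \<le> cnorm B b * hnorm H \<xi>" by (rule H.rep_contractive[OF B homs(2)[OF r] b H(4)])
      also have "\<dots> \<le> cnorm B b * 1" by (rule mult_left_mono[OF H(5) B.cnorm_nonneg[OF b]])
      finally show ?thesis by simp
    qed
    have iR: "(i s, V s) \<in> R" if "s \<in> P" for s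
      unfolding R_def using that iP Vc unfolding rel_def by auto
    show "carrier B \<subseteq> D" if D: "cstar_subalgebra D B" "Domain R \<subseteq> D" for D
      unfolding gB[symmetric] by (rule cstar_generated_least[OF D(1)]) (use D(2) iR in blast)
    fix \<phi> assume \<phi>: "cstar_hom B A \<phi>" "\<And>b a. (b, a) \<in> R \<Longrightarrow> \<phi> b = a"
    show thesis by (rule that[OF \<phi>(1) \<phi>(2)[OF iR]])
  qed
qed

end

text \<open>\<open>join_in\<close> is a definite description, so uniqueness of the least upper
  bound, which comes from \<open>cone_proper\<close>, must precede any statement about
  \<open>u\<close>.\<close>

lemma (in ordered_pair) join_right_in_cone:
  assumes ql: "quasi_lattice G P (right_le G P)" and s: "s \<in> P" and t: "t \<in> P"
    and j: "join_in (right_le G P) P s t = Some u"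
  shows "u \<in> P"
proof -
  have ex: "\<exists>u. upper_bound_in (right_le G P) P {s, t} u" and u: "u = (THE u. lub_in (right_le G P) P {s, t} u)"
    using j by (auto simp: join_in_def split: if_splits)
  have "finite {s, t}" "{s, t} \<subseteq> carrier G" using s t cone_carrier by auto
  then obtain v where v: "lub_in (right_le G P) P {s, t} v" using ql ex unfolding quasi_lattice_def by blast
  have "w = v" if w: "lub_in (right_le G P) P {s, t} w" for w
  proof -
    have P: "v \<in> P" "w \<in> P" using v w unfolding lub_in_def upper_bound_in_def by blast+
    then have c: "v \<in> carrier G" "w \<in> carrier G" using cone_carrier by auto
    have "v \<otimes> inv w \<in> P" "w \<otimes> inv v \<in> P"
      using v w unfolding lub_in_def right_le_def by blast+
    moreover have "v \<otimes> inv w = inv (w \<otimes> inv v)" using c by (simp add: inv_mult_group)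
    ultimately have "v \<otimes> inv w \<in> P \<inter> m_inv G ` P" by blast
    then have "v \<otimes> inv w = \<one>" using cone_proper by blast
    then have "v \<otimes> inv w \<otimes> w = w" using c by simp
    then show ?thesis using c by (simp add: m_assoc)
  qed
  then have "u = v" unfolding u using v by blast
  then show ?thesis using v unfolding lub_in_def upper_bound_in_def by blast
qed

text \<open>\<open>\<phi> u\<close> fixes every product \<open>\<phi> a \<otimes> b\<close> from the
  left, and these span a dense subspace by nondegeneracy. The rule on the other side follows by
  adjoints.\<close>

lemma nondegenerate_hom_unit:
  assumes A: "u \<in> carrier A" "\<And>a. a \<in> carrier A \<Longrightarrow> u \<otimes>\<^bsub>A\<^esub> a = a" "star A u = u"
    and B: "cstar_algebra B" and nd: "nondegenerate_hom A B \<phi>" and b: "b \<in> carrier B"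
  shows "\<phi> u \<otimes>\<^bsub>B\<^esub> b = b" "b \<otimes>\<^bsub>B\<^esub> \<phi> u = b"
proof -
  interpret cstar_algebra B by (rule B)
  interpret nm: normed_module B "cnorm B" by (rule cstar_normed_module[OF B])
  have hom: "cstar_hom A B \<phi>" using nd unfolding nondegenerate_hom_def by blast
  note h = cstar_homD[OF hom]
  let ?S = "{\<phi> a \<otimes>\<^bsub>B\<^esub> b |a b. a \<in> carrier A \<and> b \<in> carrier B}"
  let ?L = "{b \<in> carrier B. \<phi> u \<otimes>\<^bsub>B\<^esub> b = b}"
  have uc: "\<phi> u \<in> carrier B" by (rule h(1)[OF A(1)])
  have "closed_span B (cnorm B) ?S \<subseteq> ?L"
  proof (rule nm.closed_span_least)
    show "submodule ?L complex_ring B"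
      unfolding nm.submodule_iff
    proof (intro conjI ballI allI)
      have "\<phi> u \<otimes>\<^bsub>B\<^esub> \<zero>\<^bsub>B\<^esub> = \<zero>\<^bsub>B\<^esub>"
        using smult_mult_r[OF uc M.zero_closed, of 0] uc mult_closed by simp
      then show "\<zero>\<^bsub>B\<^esub> \<in> ?L" by simp
      fix x assume x: "x \<in> ?L"
      then show "c \<odot>\<^bsub>B\<^esub> x \<in> ?L" for c using uc by (simp add: smult_mult_r)
      show "x \<oplus>\<^bsub>B\<^esub> y \<in> ?L" if "y \<in> ?L" for y using x that uc by (simp add: mult_distr_r)
    qed blast
    show "closedin (norm_topology B (cnorm B)) ?L"
      unfolding nm.closedin_iff
    proof (intro conjI ballI impI)
      fix x assume x: "x \<in> carrier B" "\<forall>e>0. \<exists>s\<in>?L. cnorm B (x \<oplus>\<^bsub>B\<^esub> (- 1) \<odot>\<^bsub>B\<^esub> s) < e"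
      have "\<phi> u \<otimes>\<^bsub>B\<^esub> x = x" by (rule left_fixed_closed[OF uc x(1)]) (use x(2) in blast)
      then show "x \<in> ?L" using x(1) by simp
    qed blast
    show "?S \<subseteq> ?L"
    proof
      fix x assume "x \<in> ?S"
      then obtain a b where ab: "a \<in> carrier A" "b \<in> carrier B" "x = \<phi> a \<otimes>\<^bsub>B\<^esub> b" by blast
      have "\<phi> u \<otimes>\<^bsub>B\<^esub> (\<phi> a \<otimes>\<^bsub>B\<^esub> b) = \<phi> (u \<otimes>\<^bsub>A\<^esub> a) \<otimes>\<^bsub>B\<^esub> b"
        using ab h(1) uc by (simp add: h(4) A(1) mult_assoc)
      then show "x \<in> ?L" using ab h(1) A(2) mult_closed by simp
    qed
  qed
  then have left: "\<phi> u \<otimes>\<^bsub>B\<^esub> b = b" if "b \<in> carrier B" for b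
    using nd that unfolding nondegenerate_hom_def by blast
  show "\<phi> u \<otimes>\<^bsub>B\<^esub> b = b" by (rule left[OF b])
  have "star B (\<phi> u \<otimes>\<^bsub>B\<^esub> star B b) = star B (star B b)" by (simp add: left star_closed b)
  moreover have "star B (\<phi> u) = \<phi> u" using h(5)[OF A(1)] A(3) by simp
  ultimately show "b \<otimes>\<^bsub>B\<^esub> \<phi> u = b" using b uc by (simp add: star_mult star_star star_closed)
qed

section \<open>The canonical map of the crossed product and its universal property\<close>

theorem proposition9p6:
  fixes G :: "('g, 'm) monoid_scheme" and P :: "'g set" and \<omega> :: "'g \<Rightarrow> 'g \<Rightarrow> complex"
    and B :: "'b cstar" and i\<^sub>B :: "('g \<Rightarrow> complex) \<Rightarrow> 'b" and i\<^sub>P :: "'g \<Rightarrow> 'b"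
  assumes qlo: "quasi_lattice_ordered G P"
    and opp_qlo: "opp_quasi_lattice_ordered G P"
    and mult: "multiplier G P \<omega>"
    and universe: "(UNIV :: real set) \<lesssim> (UNIV :: 'h set)"
    and cp: "nica_toeplitz_crossed_product TYPE('h) G P \<omega> B i\<^sub>B i\<^sub>P"
  shows "bicovariant_rep G P \<omega> B i\<^sub>P \<and>
    cstar_generated B (i\<^sub>P ` P) = carrier B \<and>
    (\<forall>(A :: 'a cstar) V. cstar_algebra A \<and> bicovariant_rep G P \<omega> A V \<longrightarrow>
       (\<exists>Vstar. cstar_hom B A Vstar \<and> (\<forall>s\<in>P. Vstar (i\<^sub>P s) = V s)))"
proof -
  have ql: "quasi_lattice G P (left_le G P)" using qlo unfolding quasi_lattice_ordered_def by blast
  have qr: "quasi_lattice G P (right_le G P)" using opp_qlo unfolding opp_quasi_lattice_ordered_def by blast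
  interpret ordered_pair G P using qlo unfolding quasi_lattice_ordered_def by blast
  interpret BP: unital_cstar_algebra "BP G P" by (rule BP_unital_cstar_algebra[OF ql])
  have Bc: "cstar_algebra B" and nd: "nondegenerate_hom (BP G P) B i\<^sub>B" and iP: "i\<^sub>P \<in> P \<rightarrow> carrier B"
    and cov: "\<And>(H :: 'h inner_space) \<sigma>. hilbert_space H \<Longrightarrow> nondegenerate_rep B H \<sigma> \<Longrightarrow>
        nica_toeplitz_covariant G P \<omega> H (\<sigma> \<circ> i\<^sub>B) (\<sigma> \<circ> i\<^sub>P)"
    and univ: "\<And>(H :: 'h inner_space) \<pi> V. hilbert_space H \<Longrightarrow> nica_toeplitz_covariant G P \<omega> H \<pi> V \<Longrightarrow>
        \<exists>\<rho>. cstar_hom B (bounded_ops H) \<rho> \<and> (\<forall>a\<in>carrier (BP G P). \<rho> (i\<^sub>B a) = \<pi> a) \<and> (\<forall>s\<in>P. \<rho> (i\<^sub>P s) = V s)"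
    and gen: "cstar_generated B {i\<^sub>B a \<otimes>\<^bsub>B\<^esub> i\<^sub>P s |a s. a \<in> carrier (BP G P) \<and> s \<in> P} = carrier B"
    using cp unfolding nica_toeplitz_crossed_product_def by blast+
  interpret B: cstar_algebra B by (rule Bc)
  have hom: "cstar_hom (BP G P) B i\<^sub>B" using nd unfolding nondegenerate_hom_def by blast
  note hB = cstar_homD[OF hom]
  have ic: "i\<^sub>P s \<in> carrier B" if "s \<in> P" for s using iP that by blast
  define e where "e = i\<^sub>B (chi G P \<one>\<^bsub>G\<^esub>)"
  have chi1: "chi G P \<one>\<^bsub>G\<^esub> \<in> carrier (BP G P)" by (rule chi_in_BP[OF one_in_cone])
  have ec: "e \<in> carrier B" unfolding e_def by (rule hB(1)[OF chi1])
  have unit: "e \<otimes>\<^bsub>B\<^esub> b = b" "b \<otimes>\<^bsub>B\<^esub> e = b" if "b \<in> carrier B" for b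
    unfolding e_def
    by (rule nondegenerate_hom_unit[OF chi1 _ _ Bc nd that]; use BP.one_left BP.star_one in simp)+
  \<comment> \<open>The field \<open>one\<close> of \<open>B\<close> may hold any value;
    \<open>B1\<close> stores the actual unit \<open>e\<close> there and agrees with \<open>B\<close>
    otherwise.\<close>
  define B1 where "B1 = B\<lparr>one := e\<rparr>"
  have B1c: "carrier B1 = carrier B" by (simp add: B1_def)
  have B1: "unital_cstar_algebra B1"
    unfolding unital_cstar_algebra_iff unital_cstar_def B1_def using cstar_algebra_update_one[OF Bc] ec unit by simp
  have homB1: "cstar_hom A B1 = cstar_hom A B" for A :: "('z, 'y) cstar_scheme" by (rule ext) (simp add: cstar_hom_def B1_def)
  have homB1': "cstar_hom B1 L = cstar_hom B L" for L :: "('z, 'y) cstar_scheme" by (rule ext) (simp add: cstar_hom_def B1_def)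
  have ndB1: "nondegenerate_rep B1 H \<sigma> = nondegenerate_rep B H \<sigma>" for H :: "'h inner_space" and \<sigma>
    unfolding nondegenerate_rep_def homB1' by (simp add: B1_def)
  have genB1: "cstar_generated B1 S = cstar_generated B S" for S unfolding B1_def by (rule cstar_generated_update_one[OF Bc])
  have gen_all: "cstar_generated B S = carrier B"
    if S: "S \<subseteq> carrier B" "i\<^sub>P ` P \<subseteq> cstar_generated B S" "\<And>t. t \<in> P \<Longrightarrow> i\<^sub>B (chi G P t) \<in> cstar_generated B S" for S
  proof
    let ?D = "cstar_generated B S"
    have D: "cstar_subalgebra ?D B" by (rule cstar_generated_subalgebra[OF Bc S(1)])
    then show "?D \<subseteq> carrier B" unfolding cstar_subalgebra_iff[OF Bc] by blast
    have D1: "cstar_subalgebra ?D B1" unfolding B1_def cstar_subalgebra_update_one[OF Bc] by (rule D)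
    have hom1: "cstar_hom (BP G P) B1 i\<^sub>B" by (simp add: homB1 hom)
    have "i\<^sub>B f \<in> ?D" if "f \<in> carrier (BP G P)" for f
      by (rule BP_hom_in_subalgebra[OF ql B1 hom1 D1 _ that]) (rule S(3))
    moreover have "x \<otimes>\<^bsub>B\<^esub> y \<in> ?D" if "x \<in> ?D" "y \<in> ?D" for x y
      using D that unfolding cstar_subalgebra_def by blast
    ultimately have "{i\<^sub>B a \<otimes>\<^bsub>B\<^esub> i\<^sub>P s |a s. a \<in> carrier (BP G P) \<and> s \<in> P} \<subseteq> ?D" using S(2) by blast
    then show "carrier B \<subseteq> ?D" unfolding gen[symmetric] by (rule cstar_generated_least[OF D])
  qed
  define S where "S = i\<^sub>P ` P \<union> (\<lambda>t. i\<^sub>B (chi G P t)) ` P"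
  have S: "countable S" "S \<subseteq> carrier B1"
    using countable_cone ic hB(1)[OF chi_in_BP] unfolding S_def B1c by auto
  have SB: "cstar_generated B1 S = carrier B1"
    unfolding genB1 B1c
  proof (rule gen_all)
    show "S \<subseteq> carrier B" using S(2) B1c by simp
    from cstar_generated_subalgebra(2)[OF Bc this]
    show "i\<^sub>P ` P \<subseteq> cstar_generated B S" "\<And>t. t \<in> P \<Longrightarrow> i\<^sub>B (chi G P t) \<in> cstar_generated B S"
      unfolding S_def by auto
  qed
  \<comment> \<open>Any identity that holds in all covariant pairs arising from representations of
    \<open>B\<close> holds in \<open>B\<close>: \<open>S\<close> is countable, so nondegenerate
    representations on the universe separate points.\<close>
  have sep: "x = y"
    if xy: "x \<in> carrier B" "y \<in> carrier B"
      and eq: "\<And>(H :: 'h inner_space) \<sigma>. hilbert_space H \<Longrightarrow> cstar_hom B (bounded_ops H) \<sigma> \<Longrightarrow>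
        nica_toeplitz_covariant G P \<omega> H (\<sigma> \<circ> i\<^sub>B) (\<sigma> \<circ> i\<^sub>P) \<Longrightarrow> \<sigma> x = \<sigma> y" for x y
  proof (rule representations_separate[OF B1 S SB universe])
    show "x \<in> carrier B1" "y \<in> carrier B1" using xy B1c by auto
    fix H :: "'h inner_space" and \<sigma>
    assume H: "hilbert_space H" "nondegenerate_rep B1 H \<sigma>" "cstar_hom B1 (bounded_ops H) \<sigma>"
    show "\<sigma> x = \<sigma> y" by (rule eq) (use H cov in \<open>simp_all add: ndB1 homB1'\<close>)
  qed
  have rj: "u \<in> P" if "s \<in> P" "t \<in> P" "join_in (right_le G P) P s t = Some u" for s t u
    by (rule join_right_in_cone[OF qr that])
  have pi: "i\<^sub>P s \<otimes>\<^bsub>B\<^esub> star B (i\<^sub>P s) \<otimes>\<^bsub>B\<^esub> i\<^sub>P s = i\<^sub>P s" if s: "s \<in> P" for s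
  proof (rule sep)
    show "i\<^sub>P s \<otimes>\<^bsub>B\<^esub> star B (i\<^sub>P s) \<otimes>\<^bsub>B\<^esub> i\<^sub>P s \<in> carrier B" "i\<^sub>P s \<in> carrier B" using ic[OF s] by (simp_all add: B.mult_closed B.star_closed)
    fix H :: "'h inner_space" and \<sigma>
    assume hs: "cstar_hom B (bounded_ops H) \<sigma>" and nc: "nica_toeplitz_covariant G P \<omega> H (\<sigma> \<circ> i\<^sub>B) (\<sigma> \<circ> i\<^sub>P)"
    show "\<sigma> (i\<^sub>P s \<otimes>\<^bsub>B\<^esub> star B (i\<^sub>P s) \<otimes>\<^bsub>B\<^esub> i\<^sub>P s) = \<sigma> (i\<^sub>P s)"
      using nc s ic[OF s]
      by (simp add: cstar_homD[OF hs] B.mult_closed B.star_closed nica_toeplitz_covariant_def Let_def partial_isometric_rep_def partial_isometry_def)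
  qed
  have pm: "i\<^sub>P s \<otimes>\<^bsub>B\<^esub> i\<^sub>P t = \<omega> s t \<odot>\<^bsub>B\<^esub> i\<^sub>P (s \<otimes>\<^bsub>G\<^esub> t)" if s: "s \<in> P" and t: "t \<in> P" for s t
  proof (rule sep)
    note c = ic[OF s] ic[OF t] ic[OF mult_in_cone[OF s t]]
    show "i\<^sub>P s \<otimes>\<^bsub>B\<^esub> i\<^sub>P t \<in> carrier B" "\<omega> s t \<odot>\<^bsub>B\<^esub> i\<^sub>P (s \<otimes>\<^bsub>G\<^esub> t) \<in> carrier B"
      using c B.smult_closed[of "\<omega> s t"] by (simp_all add: B.mult_closed)
    fix H :: "'h inner_space" and \<sigma>
    assume hs: "cstar_hom B (bounded_ops H) \<sigma>" and nc: "nica_toeplitz_covariant G P \<omega> H (\<sigma> \<circ> i\<^sub>B) (\<sigma> \<circ> i\<^sub>P)"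
    show "\<sigma> (i\<^sub>P s \<otimes>\<^bsub>B\<^esub> i\<^sub>P t) = \<sigma> (\<omega> s t \<odot>\<^bsub>B\<^esub> i\<^sub>P (s \<otimes>\<^bsub>G\<^esub> t))"
      using nc s t c by (simp add: cstar_homD[OF hs] nica_toeplitz_covariant_def Let_def partial_isometric_rep_def)
  qed
  have tau: "i\<^sub>B (tau G P s f) = i\<^sub>P s \<otimes>\<^bsub>B\<^esub> i\<^sub>B f \<otimes>\<^bsub>B\<^esub> star B (i\<^sub>P s)" if s: "s \<in> P" and f: "f \<in> carrier (BP G P)" for s f
  proof (rule sep)
    note c = ic[OF s] hB(1)[OF f] hB(1)[OF tau_BP[OF ql s f]]
    show "i\<^sub>B (tau G P s f) \<in> carrier B" "i\<^sub>P s \<otimes>\<^bsub>B\<^esub> i\<^sub>B f \<otimes>\<^bsub>B\<^esub> star B (i\<^sub>P s) \<in> carrier B"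
      using c by (simp_all add: B.mult_closed B.star_closed)
    fix H :: "'h inner_space" and \<sigma>
    assume hs: "cstar_hom B (bounded_ops H) \<sigma>" and nc: "nica_toeplitz_covariant G P \<omega> H (\<sigma> \<circ> i\<^sub>B) (\<sigma> \<circ> i\<^sub>P)"
    show "\<sigma> (i\<^sub>B (tau G P s f)) = \<sigma> (i\<^sub>P s \<otimes>\<^bsub>B\<^esub> i\<^sub>B f \<otimes>\<^bsub>B\<^esub> star B (i\<^sub>P s))"
      using nc s f c by (simp add: cstar_homD[OF hs] B.mult_closed B.star_closed nica_toeplitz_covariant_def Let_def)
  qed
  have rc: "star B (i\<^sub>P s) \<otimes>\<^bsub>B\<^esub> i\<^sub>P s \<otimes>\<^bsub>B\<^esub> star B (i\<^sub>P t) \<otimes>\<^bsub>B\<^esub> i\<^sub>P t =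
      (case join_in (right_le G P) P s t of Some u \<Rightarrow> star B (i\<^sub>P u) \<otimes>\<^bsub>B\<^esub> i\<^sub>P u | None \<Rightarrow> \<zero>\<^bsub>B\<^esub>)" if s: "s \<in> P" and t: "t \<in> P" for s t
  proof (rule sep)
    note c = ic[OF s] ic[OF t]
    show "star B (i\<^sub>P s) \<otimes>\<^bsub>B\<^esub> i\<^sub>P s \<otimes>\<^bsub>B\<^esub> star B (i\<^sub>P t) \<otimes>\<^bsub>B\<^esub> i\<^sub>P t \<in> carrier B" using c by (simp add: B.mult_closed B.star_closed)
    show "(case join_in (right_le G P) P s t of Some u \<Rightarrow> star B (i\<^sub>P u) \<otimes>\<^bsub>B\<^esub> i\<^sub>P u | None \<Rightarrow> \<zero>\<^bsub>B\<^esub>) \<in> carrier B"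
      using rj[OF s t] ic by (auto simp: B.mult_closed B.star_closed split: option.split)
    fix H :: "'h inner_space" and \<sigma>
    assume H: "hilbert_space H" and hs: "cstar_hom B (bounded_ops H) \<sigma>" and nc: "nica_toeplitz_covariant G P \<omega> H (\<sigma> \<circ> i\<^sub>B) (\<sigma> \<circ> i\<^sub>P)"
    have "\<sigma> (0 \<odot>\<^bsub>B\<^esub> e) = \<zero>\<^bsub>bounded_ops H\<^esub>"
      using bounded_ops_zero[OF cstar_homD(1)[OF hs ec] H] by (simp add: cstar_homD(3)[OF hs ec])
    moreover have "0 \<odot>\<^bsub>B\<^esub> e = \<zero>\<^bsub>B\<^esub>" using B.smult_l_null[OF ec] by simp
    ultimately have z: "\<sigma> \<zero>\<^bsub>B\<^esub> = \<zero>\<^bsub>bounded_ops H\<^esub>" by simp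
    have "right_covariant G P (bounded_ops H) (\<sigma> \<circ> i\<^sub>P)" using nc unfolding nica_toeplitz_covariant_def Let_def by blast
    then show "\<sigma> (star B (i\<^sub>P s) \<otimes>\<^bsub>B\<^esub> i\<^sub>P s \<otimes>\<^bsub>B\<^esub> star B (i\<^sub>P t) \<otimes>\<^bsub>B\<^esub> i\<^sub>P t) =
        \<sigma> (case join_in (right_le G P) P s t of Some u \<Rightarrow> star B (i\<^sub>P u) \<otimes>\<^bsub>B\<^esub> i\<^sub>P u | None \<Rightarrow> \<zero>\<^bsub>B\<^esub>)"
      using s t c rj[OF s t] ic unfolding right_covariant_def
      by (auto simp: cstar_homD[OF hs] B.mult_closed B.star_closed z split: option.splits)
  qed
  \<comment> \<open>Covariance at the unit: translation by \<open>s\<close> takes the characteristic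
    function of \<open>P\<close> to that of \<open>sP\<close>, and \<open>i\<^sub>B\<close> sends
    the former to the unit \<open>e\<close>.\<close>
  have range: "i\<^sub>B (chi G P s) = i\<^sub>P s \<otimes>\<^bsub>B\<^esub> star B (i\<^sub>P s)" if s: "s \<in> P" for s
  proof -
    have "tau G P s (chi G P \<one>\<^bsub>G\<^esub>) = chi G P s" using tau_chi[OF s one_in_cone] cone_carrier[OF s] by simp
    then show ?thesis using tau[OF s chi1] unit(2)[OF ic[OF s]] by (simp add: e_def)
  qed
  have lc: "i\<^sub>P s \<otimes>\<^bsub>B\<^esub> star B (i\<^sub>P s) \<otimes>\<^bsub>B\<^esub> i\<^sub>P t \<otimes>\<^bsub>B\<^esub> star B (i\<^sub>P t) =
      (case join_in (left_le G P) P s t of Some u \<Rightarrow> i\<^sub>P u \<otimes>\<^bsub>B\<^esub> star B (i\<^sub>P u) | None \<Rightarrow> \<zero>\<^bsub>B\<^esub>)" if s: "s \<in> P" and t: "t \<in> P" for s t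
  proof -
    have "i\<^sub>B (0 \<odot>\<^bsub>BP G P\<^esub> chi G P \<one>\<^bsub>G\<^esub>) = 0 \<odot>\<^bsub>B\<^esub> e" unfolding e_def by (rule hB(3)[OF chi1])
    then have z: "i\<^sub>B (\<lambda>x. 0) = \<zero>\<^bsub>B\<^esub>" using B.smult_l_null[OF ec] by simp
    have "i\<^sub>P s \<otimes>\<^bsub>B\<^esub> star B (i\<^sub>P s) \<otimes>\<^bsub>B\<^esub> i\<^sub>P t \<otimes>\<^bsub>B\<^esub> star B (i\<^sub>P t) = i\<^sub>B (chi G P s) \<otimes>\<^bsub>B\<^esub> i\<^sub>B (chi G P t)"
      using ic[OF s] ic[OF t] by (simp add: range s t B.mult_assoc B.mult_closed B.star_closed)
    also have "\<dots> = i\<^sub>B (\<lambda>x. chi G P s x * chi G P t x)" using hB(4)[OF chi_in_BP[OF s] chi_in_BP[OF t]] by simp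
    finally show ?thesis
      unfolding chi_mult[OF ql s t] using join_left(1)[OF ql s t] range z by (auto split: option.split)
  qed
  have bicov: "bicovariant_rep G P \<omega> B i\<^sub>P"
    unfolding bicovariant_rep_def partial_isometric_rep_def partial_isometry_def left_covariant_def right_covariant_def
    by (intro conjI ballI ic pi pm lc rc)
  have iPB: "i\<^sub>P ` P \<subseteq> carrier B" using ic by blast
  have gP: "cstar_generated B (i\<^sub>P ` P) = carrier B"
  proof (rule gen_all[OF iPB])
    note D = cstar_generated_subalgebra[OF Bc iPB]
    show "i\<^sub>P ` P \<subseteq> cstar_generated B (i\<^sub>P ` P)" by (rule D(2))
    fix t assume t: "t \<in> P"
    then have "i\<^sub>P t \<in> cstar_generated B (i\<^sub>P ` P)" using D(2) by blast
    then show "i\<^sub>B (chi G P t) \<in> cstar_generated B (i\<^sub>P ` P)"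
      unfolding range[OF t] using D(1) unfolding cstar_subalgebra_def by blast
  qed
  have lift: "\<exists>Vstar. cstar_hom B A Vstar \<and> (\<forall>s\<in>P. Vstar (i\<^sub>P s) = V s)"
    if A: "cstar_algebra A" and V: "bicovariant_rep G P \<omega> A V" for A :: "'a cstar" and V
  proof -
    interpret A: cstar_algebra A by (rule A)
    have Vc: "V s \<in> carrier A" and Vp: "V s \<otimes>\<^bsub>A\<^esub> star A (V s) \<otimes>\<^bsub>A\<^esub> V s = V s" if "s \<in> P" for s
      using V that unfolding bicovariant_rep_def partial_isometric_rep_def partial_isometry_def by blast+
    have Vm: "V s \<otimes>\<^bsub>A\<^esub> V t = \<omega> s t \<odot>\<^bsub>A\<^esub> V (s \<otimes>\<^bsub>G\<^esub> t)" if "s \<in> P" "t \<in> P" for s t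
      using V that unfolding bicovariant_rep_def partial_isometric_rep_def by blast
    \<comment> \<open>\<open>V \<one>\<close> is idempotent since the multiplier is normalised,
      hence a projection by \<open>idempotent_sa\<close>, and it fixes every \<open>V s\<close>. As
      \<open>A\<close> may be non-unital or have a larger unit, the lift is carried out in the
      algebra \<open>A1\<close> generated by \<open>V\<close>, with unit \<open>p\<close>.\<close>
    define p where "p = V \<one>\<^bsub>G\<^esub>"
    have pc: "p \<in> carrier A" unfolding p_def by (rule Vc[OF one_in_cone])
    have pV: "p \<otimes>\<^bsub>A\<^esub> V s = V s" "V s \<otimes>\<^bsub>A\<^esub> p = V s" if "s \<in> P" for s
      using Vm[OF one_in_cone that] Vm[OF that one_in_cone] multiplier_one[OF mult that] cone_carrier[OF that]
        A.smult_one[OF Vc[OF that]] by (simp_all add: p_def)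
    have sp: "star A p = p"
      by (rule A.idempotent_sa[OF pc]) (use pV(1)[OF one_in_cone] Vp[OF one_in_cone] in \<open>simp_all add: p_def\<close>)
    have VA: "V ` P \<subseteq> carrier A" using Vc by blast
    define D where "D = cstar_generated A (V ` P)"
    have D: "cstar_subalgebra D A" "V ` P \<subseteq> D" unfolding D_def by (rule cstar_generated_subalgebra[OF A VA])+
    have DA: "D \<subseteq> carrier A" using D(1) unfolding cstar_subalgebra_iff[OF A] by blast+
    have "V ` P \<subseteq> {x \<in> carrier A. p \<otimes>\<^bsub>A\<^esub> x = x \<and> p \<otimes>\<^bsub>A\<^esub> star A x = star A x}"
    proof (clarsimp simp: Vc pV)
      fix s assume s: "s \<in> P"
      show "p \<otimes>\<^bsub>A\<^esub> star A (V s) = star A (V s)" using A.star_mult[OF Vc[OF s] pc] by (simp add: pV s sp)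
    qed
    from cstar_generated_least[OF A.unit_subalgebra[OF pc] this]
    have left: "p \<otimes>\<^bsub>A\<^esub> x = x" "p \<otimes>\<^bsub>A\<^esub> star A x = star A x" if "x \<in> D" for x using that unfolding D_def by blast+
    have right: "x \<otimes>\<^bsub>A\<^esub> p = x" if x: "x \<in> D" for x
    proof -
      have xc: "x \<in> carrier A" using x DA by blast
      have "star A (p \<otimes>\<^bsub>A\<^esub> star A x) = x" using left(2)[OF x] xc by (simp add: A.star_star)
      then show ?thesis using xc pc by (simp add: A.star_mult A.star_star A.star_closed sp)
    qed
    define A0 where "A0 = A\<lparr>carrier := D\<rparr>"
    have A0: "cstar_algebra A0" unfolding A0_def by (rule cstar_subalgebra_cstar_algebra[OF A D(1)])
    define A1 where "A1 = A0\<lparr>one := p\<rparr>"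
    have pD: "p \<in> D" using D(2) one_in_cone unfolding p_def by blast
    have A1: "unital_cstar_algebra A1"
      unfolding unital_cstar_algebra_iff unital_cstar_def using cstar_algebra_update_one[OF A0] left(1) right pD
      by (simp add: A1_def) (simp add: A0_def)
    have ops: "carrier A1 = D" "x \<otimes>\<^bsub>A1\<^esub> y = x \<otimes>\<^bsub>A\<^esub> y" "x \<oplus>\<^bsub>A1\<^esub> y = x \<oplus>\<^bsub>A\<^esub> y" "c \<odot>\<^bsub>A1\<^esub> x = c \<odot>\<^bsub>A\<^esub> x" "star A1 x = star A x"
      "cnorm A1 x = cnorm A x" "\<zero>\<^bsub>A1\<^esub> = \<zero>\<^bsub>A\<^esub>" "\<one>\<^bsub>A1\<^esub> = p" for x y c by (simp_all add: A1_def A0_def)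
    have bV: "bicovariant_rep G P \<omega> A1 V"
      using V D(2) unfolding bicovariant_rep_def partial_isometric_rep_def partial_isometry_def left_covariant_def right_covariant_def ops by blast
    have gA: "cstar_generated A1 (V ` P) = carrier A1"
    proof
      have A1c: "cstar_algebra A1" using A1 unfolding unital_cstar_algebra_def by blast
      show "cstar_generated A1 (V ` P) \<subseteq> carrier A1"
        using cstar_generated_subalgebra(1)[OF A1c, of "V ` P"] D(2) unfolding cstar_subalgebra_iff[OF A1c] ops by blast
      have "D \<subseteq> D'" if D': "cstar_subalgebra D' A1" "V ` P \<subseteq> D'" for D'
      proof -
        note d = D'(1)[unfolded cstar_subalgebra_iff[OF A1c] ops]
        \<comment> \<open>A subset closed in \<open>D\<close> is closed in \<open>A\<close>, because
          \<open>D\<close> is closed; so generating inside \<open>A1\<close> gives the same algebra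
          as generating inside \<open>A\<close>.\<close>
        have "cstar_subalgebra D' A"
          unfolding cstar_subalgebra_iff[OF A]
        proof (intro conjI)
          show "D' \<subseteq> carrier A" using d DA by blast
          show "\<forall>x\<in>carrier A. (\<forall>e>0. \<exists>s\<in>D'. cnorm A (x \<oplus>\<^bsub>A\<^esub> (- 1) \<odot>\<^bsub>A\<^esub> s) < e) \<longrightarrow> x \<in> D'"
          proof (intro ballI impI)
            fix x assume x: "x \<in> carrier A" "\<forall>e>0. \<exists>s\<in>D'. cnorm A (x \<oplus>\<^bsub>A\<^esub> (- 1) \<odot>\<^bsub>A\<^esub> s) < e"
            have "D' \<subseteq> D" using d by blast
            then have "\<forall>e>0. \<exists>s\<in>D. cnorm A (x \<oplus>\<^bsub>A\<^esub> (- 1) \<odot>\<^bsub>A\<^esub> s) < e" using x(2) by (meson subsetD)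
            then have "x \<in> D" using D(1) x(1) unfolding cstar_subalgebra_iff[OF A] by blast
            then show "x \<in> D'" using d x(2) by blast
          qed
        qed (use d in blast)+
        then show ?thesis unfolding D_def using D'(2) by (rule cstar_generated_least)
      qed
      then show "carrier A1 \<subseteq> cstar_generated A1 (V ` P)" unfolding ops cstar_generated_def by blast
    qed
    have univ': "\<exists>\<rho>. cstar_hom B1 (bounded_ops H) \<rho> \<and> (\<forall>s\<in>P. \<rho> (i\<^sub>P s) = W s)"
      if "hilbert_space H" "nica_toeplitz_covariant G P \<omega> H \<pi> W" for H :: "'h inner_space" and \<pi> W
      unfolding homB1' using univ[OF that] by blast
    show ?thesis
    proof (rule lift_unital[OF ql mult universe A1 bV _ gA B1 _ _ univ' rj])
      show "V \<one>\<^bsub>G\<^esub> = \<one>\<^bsub>A1\<^esub>" by (simp add: ops p_def)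
      show "i\<^sub>P ` P \<subseteq> carrier B1" using iPB B1c by simp
      show "cstar_generated B1 (i\<^sub>P ` P) = carrier B1" using gP genB1 B1c by simp
      fix \<phi> assume \<phi>: "cstar_hom B1 A1 \<phi>" "\<And>s. s \<in> P \<Longrightarrow> \<phi> (i\<^sub>P s) = V s"
      have "cstar_hom B A \<phi>"
        using \<phi>(1) DA unfolding homB1' unfolding cstar_hom_def ops by blast
      then show ?thesis using \<phi>(2) by blast
    qed
  qed
  show ?thesis using bicov gP lift by blast
qed

end
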